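(* Let $d\geq 3$ and let $f\in L^{2d/(d+2)}(\mathbb{R}^d)$ be non-negative. Then $\mathcal{F}[f]\geq 0$, and $\mathcal{F}[f]=0$ if and only if $f$ is a multiple of $h(x/s-x_0)$ for some $s>0$ and some $x_0\in\mathbb{R}^d$, where $$h(x)=\left(\frac{1}{1+|x|^2}\right)^{(d+2)/2}.$$
   Context: $\|f\|_p=\left(\int_{\mathbb{R}^d}|f|^p\,dx\right)^{1/p}$ is the $L^p$ norm with respect to Lebesgue measure. For $d\ge 3$ and $f\in L^{2d/(d+2)}(\mathbb{R}^d)$, the HLS functional is $$\mathcal{F}[f]:=C_S\|f\|_{2d/(d+2)}^2-\int_{\mathbb{R}^d}f(x)\left[(-\Delta)^{-1}f\right](x)\,dx,\qquad C_S:=\frac{4}{d(d-2)}|S^d|^{-2/d},$$ where $|S^k|$ is the surface area of the $k$-dimensional unit sphere in $\mathbb{R}^{k+1}$ and $$\int_{\mathbb{R}^d}f(x)\left[(-\Delta)^{-1}f\right](x)\,dx=\frac{1}{(d-2)|S^{d-1}|}\int_{\mathbb{R}^d}\int_{\mathbb{R}^d}\frac{f(x)f(y)}{|x-y|^{d-2}}\,dx\,dy.$$ *)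

theory Defs
  imports "HOL-Analysis.Analysis"
begin

text \<open>
  Surface area is taken as the Minkowski content of codimension one: the volume of the
  \<open>\<epsilon>\<close>-neighbourhood divided by its thickness \<open>2\<epsilon>\<close>, in the limit \<open>\<epsilon> \<rightarrow> 0\<close>. On the unit sphere this
  gives the usual value, see \<open>surface_area_unit_sphere\<close> below.
\<close>

definition surface_area :: "'a::euclidean_space set \<Rightarrow> real" where
  "surface_area S =
     Lim (at_right 0) (\<lambda>\<epsilon>. measure lebesgue (\<Union>x\<in>S. ball x \<epsilon>) / (2 * \<epsilon>))"

lemma neighbourhood_unit_sphere:
  assumes "0 < \<epsilon>" "\<epsilon> < 1"
  shows "(\<Union>x\<in>sphere (0::'a::euclidean_space) 1. ball x \<epsilon>) = ball 0 (1 + \<epsilon>) - cball 0 (1 - \<epsilon>)"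
proof (intro equalityI subsetI)
  fix y :: 'a
  assume "y \<in> (\<Union>x\<in>sphere 0 1. ball x \<epsilon>)"
  then obtain x where "norm x = 1" "norm (x - y) < \<epsilon>"
    by (auto simp: dist_norm)
  then have "\<bar>norm x - norm y\<bar> < \<epsilon>"
    using norm_triangle_ineq3[of x y] by linarith
  with \<open>norm x = 1\<close> show "y \<in> ball 0 (1 + \<epsilon>) - cball 0 (1 - \<epsilon>)"
    by (auto simp: abs_less_iff)
next
  fix y :: 'a
  assume y: "y \<in> ball 0 (1 + \<epsilon>) - cball 0 (1 - \<epsilon>)"
  then have *: "y \<noteq> 0" "\<bar>1 - norm y\<bar> < \<epsilon>"
    using assms by (auto simp: abs_less_iff)
  have "y /\<^sub>R norm y - y = (1 - norm y) *\<^sub>R (y /\<^sub>R norm y)"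
    using * by (simp add: algebra_simps)
  then have "norm (y /\<^sub>R norm y - y) = \<bar>1 - norm y\<bar> * norm (y /\<^sub>R norm y)"
    by (simp only: norm_scaleR)
  also have "\<dots> = \<bar>1 - norm y\<bar>"
    using * by (simp add: field_simps)
  finally have "norm (y /\<^sub>R norm y - y) = \<bar>1 - norm y\<bar>" .
  with * have "y /\<^sub>R norm y \<in> sphere 0 1" "y \<in> ball (y /\<^sub>R norm y) \<epsilon>"
    by (auto simp: dist_norm)
  then show "y \<in> (\<Union>x\<in>sphere 0 1. ball x \<epsilon>)"
    by blast
qed

lemma surface_area_unit_sphere:
  "surface_area (sphere (0::'a::euclidean_space) 1)
     = real DIM('a) * unit_ball_vol (real DIM('a))"
proof -
  define n where "n = DIM('a)"
  define c where "c = unit_ball_vol (real n)"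
  define g where "g = (\<lambda>\<epsilon>::real. c * ((1 + \<epsilon>) ^ n - (1 - \<epsilon>) ^ n) / 2)"
  have eq: "measure lebesgue (\<Union>x\<in>sphere (0::'a) 1. ball x \<epsilon>) / (2 * \<epsilon>) = (g \<epsilon> - g 0) / \<epsilon>"
    if "0 < \<epsilon>" "\<epsilon> < 1" for \<epsilon>
  proof -
    have "measure lebesgue (ball (0::'a) (1 + \<epsilon>) - cball 0 (1 - \<epsilon>))
        = measure lebesgue (ball (0::'a) (1 + \<epsilon>)) - measure lebesgue (cball (0::'a) (1 - \<epsilon>))"
      using that by (intro measurable_measure_Diff) auto
    also have "\<dots> = c * (1 + \<epsilon>) ^ n - c * (1 - \<epsilon>) ^ n"
      using that by (simp add: content_ball content_cball c_def n_def)
    finally show ?thesis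
      using that by (simp add: neighbourhood_unit_sphere g_def field_simps)
  qed
  have "(g has_field_derivative (real n * c)) (at 0 within {0<..})"
    unfolding g_def by (auto intro!: derivative_eq_intros simp: field_simps)
  then have "((\<lambda>\<epsilon>. (g \<epsilon> - g 0) / \<epsilon>) \<longlongrightarrow> real n * c) (at_right 0)"
    by (simp add: has_field_derivative_iff)
  moreover have "\<forall>\<^sub>F \<epsilon> in at_right 0.
      measure lebesgue (\<Union>x\<in>sphere (0::'a) 1. ball x \<epsilon>) / (2 * \<epsilon>) = (g \<epsilon> - g 0) / \<epsilon>"
    using eventually_at_right_real[of 0 1] by (auto elim!: eventually_mono intro: eq)
  ultimately have "((\<lambda>\<epsilon>. measure lebesgue (\<Union>x\<in>sphere (0::'a) 1. ball x \<epsilon>) / (2 * \<epsilon>))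
      \<longlongrightarrow> real n * c) (at_right 0)"
    by (simp add: filterlim_cong)
  then show ?thesis
    unfolding surface_area_def n_def c_def by (intro tendsto_Lim) auto
qed

definition Lp_norm :: "real \<Rightarrow> ('a::euclidean_space \<Rightarrow> real) \<Rightarrow> real" where
  "Lp_norm p f = (LINT x|lebesgue. \<bar>f x\<bar> powr p) powr (1 / p)"

text \<open>Elements are functions; equality and sign conditions are to be read almost everywhere.\<close>

definition Lp_space :: "real \<Rightarrow> ('a::euclidean_space \<Rightarrow> real) set" where
  "Lp_space p = {f \<in> borel_measurable lebesgue. integrable lebesgue (\<lambda>x. \<bar>f x\<bar> powr p)}"

text \<open>\<open>(real^'n) \<times> real\<close> with its Euclidean norm serves as the space of dimension \<open>d + 1\<close>, \<open>d = CARD('n)\<close>.\<close>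

definition HLS_const :: "'n::finite itself \<Rightarrow> real" where
  "HLS_const _ = 4 / (real CARD('n) * (real CARD('n) - 2))
     * surface_area (sphere (0 :: (real^'n) \<times> real) 1) powr (- 2 / real CARD('n))"

text \<open>The value at \<open>x = y\<close>, where division by zero gives \<open>0\<close>, concerns a null set only.\<close>

definition HLS_integrand :: "(real^'n \<Rightarrow> real) \<Rightarrow> real^'n \<Rightarrow> real^'n \<Rightarrow> real" where
  "HLS_integrand f x y = f x * f y / norm (x - y) ^ (CARD('n) - 2)"

text \<open>The quadratic form of \<open>(-\<Delta>)\<^sup>-\<^sup>1\<close>.\<close>

definition HLS_energy :: "(real^'n \<Rightarrow> real) \<Rightarrow> real" where
  "HLS_energy f =
     1 / ((real CARD('n) - 2) * surface_area (sphere (0 :: real^'n) 1))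
       * (LINT y|lebesgue. (LINT x|lebesgue. HLS_integrand f x y))"

definition HLS_functional :: "(real^'n \<Rightarrow> real) \<Rightarrow> real" where
  "HLS_functional f =
     HLS_const TYPE('n) * (Lp_norm (2 * real CARD('n) / (real CARD('n) + 2)) f)\<^sup>2 - HLS_energy f"

definition HLS_optimizer :: "real^'n \<Rightarrow> real" where
  "HLS_optimizer x = (1 / (1 + (norm x)\<^sup>2)) powr ((real CARD('n) + 2) / 2)"

end

theory Submission imports Defs "HOL-Real_Asymp.Real_Asymp" begin

text \<open>
  Let \<open>M\<close> be the supremum of the energy of nonnegative normalized functions and \<open>u\<close> the Newton potential of
  a near-maximizer \<open>f\<close> of energy one. A translation and a dilation place the conformal centre of mass of
  \<open>u\<^sup>q\<close>, \<open>q = 2d/(d-2)\<close>, at the origin of the ball bounded by \<open>S\<^sup>d\<close>. Applying the Sobolev inequality with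
  constant \<open>M\<close> (the dual form of the inequality) to \<open>(1 \<plusminus> \<epsilon> \<omega>) u\<close>, where \<open>\<omega>\<close> runs through the \<open>d + 1\<close>
  coordinates of the inverse stereographic projection, the first-order terms cancel and the sum of the
  second-order terms bounds \<open>\<integral> u\<^sup>2 \<xi>\<^sup>2\<close> from below, \<open>\<xi>\<close> being the conformal factor (the argument of Frank and
  Lieb). The operator \<open>f \<mapsto> \<xi>\<^sup>2 u\<close> has, up to a constant, norm one in the energy, with a simple top eigenvalue
  and a spectral gap that follows from a pointwise lower bound of the Newton kernel. So \<open>f\<close> nearly lies in the
  top eigenspace, and its pairing with the standard bubble is nearly extremal. Hoelder's inequality for this
  pairing yields the sharp constant and, when there is no error term, its equality case yields the optimizers.
\<close>

section \<open>The Newton kernel\<close>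


text \<open>The existence of a maximizer is not known beforehand, so no Euler-Lagrange equation is
  available and every step has to be an inequality with an error. For a function within the factor 1
  - \<delta> of the supremum and variations of size \<epsilon> this error is of order \<epsilon> +
  \<delta> / \<epsilon>^2. The choice \<delta> = \<epsilon>^3 gives the constant, \<delta> = 0 the
  equality case; compactness and rearrangement are avoided.

  The two bounds on S, the weighted integral of u^2, meet exactly. The squared coordinates sum to 1
  and their squared gradients to d times the squared conformal factor, so the second variation
  compares q - 1 with 1 + (d / c) S, where c is the constant of the fundamental solution. As q - 2 =
  4 / (d - 2), S is nearly at least 4 c / (d (d - 2)), which is also the top eigenvalue.

  The potential of a general f is too rough for integration by parts. The Sobolev inequality is
  therefore proved for smoothed potentials, in a form where all gradients fall on the smooth
  multiplier and which survives the passage to the limit.\<close>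

lemma distr_norm_lborel:
  "distr lborel borel (norm :: 'a::euclidean_space \<Rightarrow> real) =
     density lborel (\<lambda>r. ennreal (real DIM('a) * unit_ball_vol (real DIM('a)) * r ^ (DIM('a) - 1)) * indicator {0..} r)"
    (is "?M = ?N")
proof (rule measure_eqI_generator_eq[where E = "range (\<lambda>a::real. {..a})" and \<Omega> = UNIV and A = "\<lambda>n. {..real n}"])
  show "Int_stable (range (\<lambda>a::real. {..a}))"
    by (auto simp: Int_stable_def)
  show "sets ?M = sigma_sets UNIV (range (\<lambda>a::real. {..a}))"
    by (simp add: borel_eq_atMost[where 'a=real])
  show "sets ?N = sigma_sets UNIV (range (\<lambda>a::real. {..a}))"
    by (simp add: borel_eq_atMost[where 'a=real])
  show "(\<Union>i. {..real i}) = UNIV"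
    using real_arch_simple by (auto)
  \<comment> \<open>Both measures are compared on half-lines. The mass of a half-line is the volume
    of the ball of radius \<open>max a 0\<close>, and the density on the right is the derivative of
    that volume in the radius.\<close>
  have M: "emeasure ?M {..a} = ennreal (unit_ball_vol (real DIM('a)) * (max a 0) ^ DIM('a))" for a
  proof -
    have "norm -` {..a} \<inter> space lborel = cball (0::'a) a" by (auto simp: dist_norm)
    then have "emeasure ?M {..a} = emeasure lborel (cball (0::'a) a)"
      by (subst emeasure_distr) auto
    also have "\<dots> = ennreal (unit_ball_vol (real DIM('a)) * (max a 0) ^ DIM('a))"
    proof (cases "a \<ge> 0")
      case True then show ?thesis by (subst emeasure_cball) (auto simp: max_def)
    next
      case False then show ?thesis by (simp add: max_def)
    qed
    finally show ?thesis .
  qed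
  have N: "emeasure ?N {..a} = ennreal (unit_ball_vol (real DIM('a)) * (max a 0) ^ DIM('a))" for a
  proof -
    have "emeasure ?N {..a} = (\<integral>\<^sup>+r. ennreal (real DIM('a) * unit_ball_vol (real DIM('a)) * r ^ (DIM('a) - 1)) * indicator {0..} r * indicator {..a} r \<partial>lborel)"
      by (subst emeasure_density) auto
    also have "\<dots> = (\<integral>\<^sup>+r. ennreal (real DIM('a) * unit_ball_vol (real DIM('a)) * r ^ (DIM('a) - 1)) * indicator {0..max a 0} r \<partial>lborel)"
      by (intro nn_integral_cong_AE AE_I[of _ _ "{0}"]) (auto simp: indicator_def max_def split: if_splits)
    also have "\<dots> = ennreal (unit_ball_vol (real DIM('a)) * (max a 0) ^ DIM('a) - unit_ball_vol (real DIM('a)) * 0 ^ DIM('a))"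
      by (rule nn_integral_FTC_Icc) (auto intro!: derivative_eq_intros)
    finally show ?thesis by simp
  qed
  show "emeasure ?M X = emeasure ?N X" if "X \<in> range (\<lambda>a::real. {..a})" for X
    using that M N by auto
  show "emeasure ?M {..real i} \<noteq> \<infinity>" for i by (simp add: M)
qed auto

lemma nn_integral_norm:
  assumes [measurable]: "g \<in> borel_measurable borel"
  shows "(\<integral>\<^sup>+(x::'a::euclidean_space). g (norm x) \<partial>lborel) =
    (\<integral>\<^sup>+r. ennreal (real DIM('a) * unit_ball_vol (real DIM('a)) * r ^ (DIM('a) - 1)) * indicator {0..} r * g r \<partial>lborel)"
proof -
  have "(\<integral>\<^sup>+(x::'a). g (norm x) \<partial>lborel) = (\<integral>\<^sup>+r. g r \<partial>distr lborel borel (norm :: 'a \<Rightarrow> real))"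
    by (subst nn_integral_distr) auto
  then show ?thesis unfolding distr_norm_lborel by (subst (asm) nn_integral_density) auto
qed

text \<open>With this exponent the radial integrand has the elementary primitive \<open>F\<close>,
  which tends to the volume of the unit ball. The value fixes the total mass of \<open>rho\<close>
  and with it the constant of the fundamental solution.\<close>

lemma nn_integral_bubble:
  "(\<integral>\<^sup>+(x::'a::euclidean_space). ennreal ((1 + (norm x)\<^sup>2) powr (- (real DIM('a) + 2) / 2)) \<partial>lborel)
     = ennreal (unit_ball_vol (real DIM('a)))"
proof -
  define d where "d = DIM('a)"
  define w where "w = unit_ball_vol (real d)"
  have d: "d \<ge> 1" by (simp add: d_def Suc_leI)
  have w: "w > 0" by (simp add: w_def)
  define F where "F = (\<lambda>r::real. w * (r ^ d * (1 + r\<^sup>2) powr (- real d / 2)))"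
  have pos: "1 + r\<^sup>2 > 0" for r :: real by (simp add: add_pos_nonneg)
  have der: "(F has_real_derivative (real d * w * r ^ (d - 1)) * (1 + r\<^sup>2) powr (- (real d + 2) / 2)) (at r)" for r
  proof -
    have 1: "(1 + r\<^sup>2) powr (- real d / 2) = (1 + r\<^sup>2) powr (- (real d + 2) / 2) * (1 + r\<^sup>2)"
      using pos[of r] powr_add[of "1 + r\<^sup>2" "- (real d + 2) / 2" 1] by (simp add: field_simps)
    have 2: "- real d / 2 - 1 = - (real d + 2) / 2" by (simp add: field_simps)
    obtain k where k: "d = Suc k" using d by (cases d) auto
    have alg: "w * (real d * r ^ (d - 1) * (A * (1 + r\<^sup>2)) + r ^ d * ((- real d / 2) * A * (2 * r)))
        = (real d * w * r ^ (d - 1)) * A" for A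
      unfolding k by (simp add: field_simps power2_eq_square)
    have "(F has_real_derivative w * (real d * r ^ (d - 1) * (1 + r\<^sup>2) powr (- real d / 2)
        + r ^ d * ((- real d / 2) * (1 + r\<^sup>2) powr (- real d / 2 - 1) * (2 * r)))) (at r)"
      unfolding F_def using pos[of r]
      by (auto intro!: derivative_eq_intros simp: field_simps)
    moreover have "w * (real d * r ^ (d - 1) * (1 + r\<^sup>2) powr (- real d / 2)
        + r ^ d * ((- real d / 2) * (1 + r\<^sup>2) powr (- real d / 2 - 1) * (2 * r)))
        = (real d * w * r ^ (d - 1)) * (1 + r\<^sup>2) powr (- (real d + 2) / 2)"
      unfolding 2 1 by (rule alg)
    ultimately show ?thesis by (simp only:)
  qed
  have lim: "(F \<longlongrightarrow> w) at_top"
  proof -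
    have "((\<lambda>r::real. w * ((r\<^sup>2 / (1 + r\<^sup>2)) powr (real d / 2))) \<longlongrightarrow> w * (1 powr (real d / 2))) at_top"
      by (intro tendsto_intros) (real_asymp | simp)+
    moreover have "eventually (\<lambda>r. w * ((r\<^sup>2 / (1 + r\<^sup>2)) powr (real d / 2)) = F r) at_top"
      using eventually_gt_at_top[of 0]
    proof eventually_elim
      case (elim r)
      have "(r\<^sup>2) powr (real d / 2) = r ^ d"
        using elim by (simp add: powr_powr flip: powr_numeral powr_realpow)
      then show ?case using elim pos[of r]
        by (simp add: F_def powr_divide powr_minus_divide)
    qed
    ultimately show ?thesis by (simp add: filterlim_cong)
  qed
  have "(\<integral>\<^sup>+(x::'a). ennreal ((1 + (norm x)\<^sup>2) powr (- (real d + 2) / 2)) \<partial>lborel)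
     = (\<integral>\<^sup>+r. ennreal ((real d * w * r ^ (d - 1)) * (1 + r\<^sup>2) powr (- (real d + 2) / 2)) * indicator {0..} r \<partial>lborel)"
    using nn_integral_norm[where 'a='a, of "\<lambda>r. ennreal ((1 + r\<^sup>2) powr (- (real d + 2) / 2))"]
    by (auto simp: w_def d_def ennreal_mult' ennreal_mult'' mult_ac indicator_def intro!: nn_integral_cong)
  also have "\<dots> = ennreal (w - F 0)"
    using der lim w by (intro nn_integral_FTC_atLeast) auto
  also have "F 0 = 0" using d by (simp add: F_def)
  finally show ?thesis by (simp only: w_def d_def diff_zero)
qed

lemma nn_integral_norm_real:
  assumes [measurable]: "g \<in> borel_measurable borel" and "\<And>r. 0 \<le> r \<Longrightarrow> 0 \<le> g r"
  shows "(\<integral>\<^sup>+(x::'a::euclidean_space). ennreal (g (norm x)) \<partial>lborel) =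
    (\<integral>\<^sup>+r. ennreal (real DIM('a) * unit_ball_vol (real DIM('a)) * r ^ (DIM('a) - 1) * g r) * indicator {0..} r \<partial>lborel)"
proof (subst nn_integral_norm[of "\<lambda>r. ennreal (g r)"])
  show "(\<integral>\<^sup>+r. ennreal (real DIM('a) * unit_ball_vol (real DIM('a)) * r ^ (DIM('a) - 1)) * indicator {0..} r * ennreal (g r) \<partial>lborel)
    = (\<integral>\<^sup>+r. ennreal (real DIM('a) * unit_ball_vol (real DIM('a)) * r ^ (DIM('a) - 1) * g r) * indicator {0..} r \<partial>lborel)"
    using assms(2) by (intro nn_integral_cong) (simp add: indicator_def ennreal_mult'')
qed simp

text \<open>The fundamental solution of the Laplacian without its constant, which is kept apart in
  \<open>newt_c\<close>. Real exponents allow powers to be combined freely; at the origin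
  \<open>powr\<close> gives the value 0.\<close>

definition newton :: "'a::euclidean_space \<Rightarrow> real" where
  "newton z = norm z powr (2 - real DIM('a))"

lemma newton_nonneg [simp]: "newton z \<ge> 0" by (simp add: newton_def)
lemma newton_measurable [measurable]: "newton \<in> borel_measurable borel"
  unfolding newton_def[abs_def] by measurable
lemma newton_minus [simp]: "newton (- z) = newton z" by (simp add: newton_def)
lemma newton_commute: "newton (x - y) = newton (y - x)" by (simp add: newton_def norm_minus_commute)

lemma nn_integral_newton_ball:
  assumes "R > 0"
  shows "(\<integral>\<^sup>+(x::'a::euclidean_space). ennreal (newton x) * indicator {x. norm x < R} x \<partial>lborel)
    = ennreal (real DIM('a) * unit_ball_vol (real DIM('a)) / 2 * R\<^sup>2)"
proof -
  define d where "d = DIM('a)"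
  define w where "w = unit_ball_vol (real d)"
  have d: "d \<ge> 1" by (simp add: d_def Suc_leI)
  have w: "w > 0" by (simp add: w_def)
  have "(\<integral>\<^sup>+(x::'a). ennreal (newton x) * indicator {x. norm x < R} x \<partial>lborel)
     = (\<integral>\<^sup>+(x::'a). ennreal ((norm x powr (2 - real d)) * indicator {..<R} (norm x)) \<partial>lborel)"
    by (intro nn_integral_cong) (auto simp: indicator_def newton_def d_def)
  also have "\<dots> = (\<integral>\<^sup>+r. ennreal (real d * w * r ^ (d - 1) * (r powr (2 - real d) * indicator {..<R} r)) * indicator {0..} r \<partial>lborel)"
    unfolding d_def w_def by (intro nn_integral_norm_real) auto
  also have "\<dots> = (\<integral>\<^sup>+r. ennreal (real d * w * r) * indicator {0..R} r \<partial>lborel)"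
  \<comment> \<open>The end point \<open>R\<close> belongs to only one of the two indicators;
    leaving out 0 as well permits rewriting the powers.\<close>
  proof (intro nn_integral_cong_AE AE_I[of _ _ "{0, R}"])
    have "ennreal (real d * w * r ^ (d - 1) * (r powr (2 - real d) * indicator {..<R} r)) * indicator {0..} r
      = ennreal (real d * w * r) * indicator {0..R} r" if "r \<noteq> 0" "r \<noteq> R" for r
    proof (cases "0 < r \<and> r < R")
      case True
      have e: "r ^ (d - 1) = r powr (real d - 1)"
        using powr_realpow[of r "d - 1"] True d by (simp add: of_nat_diff)
      have "r ^ (d - 1) * r powr (2 - real d) = r"
        unfolding e using True by (simp flip: powr_add)
      then show ?thesis using True by (simp add: mult_ac)
    next
      case False then show ?thesis using that by (auto simp: indicator_def)
    qed
    then show "{r \<in> space lborel. ennreal (real d * w * r ^ (d - 1) * (r powr (2 - real d) * indicator {..<R} r)) * indicator {0..} r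
      \<noteq> ennreal (real d * w * r) * indicator {0..R} r} \<subseteq> {0, R}" by auto
    show "emeasure lborel {0, R} = 0" by (intro emeasure_lborel_countable) auto
  qed auto
  also have "\<dots> = ennreal (real d * w / 2 * R\<^sup>2 - real d * w / 2 * 0\<^sup>2)"
    by (rule nn_integral_FTC_Icc) (use assms w in \<open>auto intro!: derivative_eq_intros\<close>)
  finally show ?thesis by (simp add: d_def w_def)
qed

lemma nn_integral_powr_norm_ge:
  assumes "R > 0" and "k > real DIM('a)"
  shows "(\<integral>\<^sup>+(x::'a::euclidean_space). ennreal (norm x powr (-k)) * indicator {x. R \<le> norm x} x \<partial>lborel)
    = ennreal (real DIM('a) * unit_ball_vol (real DIM('a)) / (k - real DIM('a)) * R powr (real DIM('a) - k))"
proof -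
  define d where "d = DIM('a)"
  define w where "w = unit_ball_vol (real d)"
  have d: "d \<ge> 1" by (simp add: d_def Suc_leI)
  have w: "w > 0" by (simp add: w_def)
  have "(\<integral>\<^sup>+(x::'a). ennreal (norm x powr (-k)) * indicator {x. R \<le> norm x} x \<partial>lborel)
     = (\<integral>\<^sup>+(x::'a). ennreal ((norm x powr (-k)) * indicator {R..} (norm x)) \<partial>lborel)"
    by (intro nn_integral_cong) (auto simp: indicator_def)
  also have "\<dots> = (\<integral>\<^sup>+r. ennreal (real d * w * r ^ (d - 1) * (r powr (-k) * indicator {R..} r)) * indicator {0..} r \<partial>lborel)"
    unfolding d_def w_def by (intro nn_integral_norm_real) auto
  also have "\<dots> = (\<integral>\<^sup>+r. ennreal (real d * w * (r powr (real d - 1 - k))) * indicator {R..} r \<partial>lborel)"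
  proof (intro nn_integral_cong)
    fix r :: real
    show "ennreal (real d * w * r ^ (d - 1) * (r powr (-k) * indicator {R..} r)) * indicator {0..} r
      = ennreal (real d * w * (r powr (real d - 1 - k))) * indicator {R..} r"
    proof (cases "R \<le> r")
      case True
      then have "r > 0" using assms by simp
      have e: "r ^ (d - 1) = r powr (real d - 1)"
        using powr_realpow[of r "d - 1"] \<open>r > 0\<close> d by (simp add: of_nat_diff)
      have "r powr (real d - 1 - k) = r ^ (d - 1) * r powr (- k)"
        unfolding e by (simp flip: powr_add)
      then show ?thesis using True \<open>r > 0\<close> by (simp add: mult_ac)
    next
      case False then show ?thesis by (auto simp: indicator_def)
    qed
  qed
  also have "\<dots> = ennreal (0 - real d * w / (real d - k) * R powr (real d - k))"
  proof (rule nn_integral_FTC_atLeast)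
    have nz: "real d - k \<noteq> 0" using assms by (simp add: d_def)
    show "((\<lambda>r. real d * w / (real d - k) * r powr (real d - k)) has_real_derivative real d * w * r powr (real d - 1 - k)) (at r)"
      if "R \<le> r" for r
    proof -
      have "r > 0" using that assms by simp
      then have "((\<lambda>r. real d * w / (real d - k) * r powr (real d - k)) has_real_derivative
          real d * w / (real d - k) * ((real d - k) * r powr (real d - k - 1))) (at r)"
        by (intro DERIV_cmult has_real_derivative_powr)
      moreover have "real d * w / (real d - k) * ((real d - k) * r powr (real d - k - 1)) = real d * w * r powr (real d - 1 - k)"
        using nz by (simp add: diff_diff_eq add.commute)
      ultimately show ?thesis by (simp only:)
    qed
    have "((\<lambda>r::real. r powr (real d - k)) \<longlongrightarrow> 0) at_top"
      using assms by (intro tendsto_neg_powr filterlim_ident) (auto simp: d_def)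
    from tendsto_mult[OF tendsto_const this, of "real d * w / (real d - k)"]
    show "((\<lambda>r. real d * w / (real d - k) * r powr (real d - k)) \<longlongrightarrow> 0) at_top" by simp
    show "0 \<le> real d * w * r powr (real d - 1 - k)" for r using w by simp
    show "(\<lambda>r. real d * w * r powr (real d - 1 - k)) \<in> borel_measurable borel" by measurable
  qed
  also have "0 - real d * w / (real d - k) * R powr (real d - k) = real d * w / (k - real d) * R powr (real d - k)"
    using minus_divide_right[of "real d * w * R powr (real d - k)" "k - real d"] by simp
  finally show ?thesis by (simp only: d_def w_def)
qed

text \<open>The Japanese bracket: comparable to 1 + |x|, but smooth and at least 1, so that decay
  rates can be stated on all of space as powers of it.\<close>

definition jb :: "'a::euclidean_space \<Rightarrow> real" where
  "jb x = sqrt (1 + (norm x)\<^sup>2)"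

lemma jb_ge_1: "jb x \<ge> 1" by (simp add: jb_def)
lemma jb_pos [simp]: "jb x > 0" using jb_ge_1[of x] by linarith
lemma jb_nonneg [simp]: "jb x \<ge> 0" using jb_pos[of x] by linarith
lemma norm_le_jb: "norm x \<le> jb x" by (simp add: jb_def real_le_rsqrt)
lemma jb_le: "jb x \<le> 1 + norm x"
  unfolding jb_def by (rule real_le_lsqrt) (auto simp: power2_eq_square algebra_simps)
lemma jb_measurable [measurable]: "jb \<in> borel_measurable borel"
  unfolding jb_def[abs_def] by measurable
lemma jb_powr: "(1 + (norm x)\<^sup>2) powr k = jb x powr (2 * k)"
proof -
  have "jb x = (1 + (norm x)\<^sup>2) powr (1/2)" by (simp add: jb_def powr_half_sqrt)
  then show ?thesis by (simp only: powr_powr) simp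
qed

lemma jb_powr_integrable:
  assumes "k > real DIM('a)"
  shows "integrable lborel (\<lambda>x::'a::euclidean_space. jb x powr (-k))"
proof (rule integrableI_bounded)
  show "(\<lambda>x::'a. jb x powr (-k)) \<in> borel_measurable lborel"
    unfolding jb_def by measurable
  have "(\<integral>\<^sup>+(x::'a). ennreal (norm (jb x powr (-k))) \<partial>lborel) \<le>
    (\<integral>\<^sup>+(x::'a). indicator {x. norm x < 1} x + ennreal (norm x powr (-k)) * indicator {x. 1 \<le> norm x} x \<partial>lborel)"
  proof (intro nn_integral_mono)
    fix x :: 'a
    have "jb x powr (-k) \<le> 1 powr (-k)" 
      using assms by (intro powr_mono2') (auto simp: jb_ge_1)
    moreover have "jb x powr (-k) \<le> norm x powr (-k)" if "norm x \<ge> 1"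
      using assms that norm_le_jb[of x] by (intro powr_mono2') auto
    ultimately show "ennreal (norm (jb x powr (-k))) \<le> indicator {x. norm x < 1} x + ennreal (norm x powr (-k)) * indicator {x. 1 \<le> norm x} x"
      by (auto simp: indicator_def)
  qed
  also have "\<dots> = emeasure lborel {x::'a. norm x < 1} + (\<integral>\<^sup>+(x::'a). ennreal (norm x powr (-k)) * indicator {x. 1 \<le> norm x} x \<partial>lborel)"
    by (subst nn_integral_add) auto
  also have "{x::'a. norm x < 1} = ball 0 1" by (auto simp: dist_norm)
  also have "emeasure lborel (ball 0 1 :: 'a set) + (\<integral>\<^sup>+(x::'a). ennreal (norm x powr (-k)) * indicator {x. 1 \<le> norm x} x \<partial>lborel) < \<infinity>"
    using nn_integral_powr_norm_ge[where 'a='a, of 1 k] assms emeasure_bounded_finite[of "ball (0::'a) 1"]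
    by simp
  finally show "(\<integral>\<^sup>+(x::'a). ennreal (norm (jb x powr (-k))) \<partial>lborel) < \<infinity>" .
qed


section \<open>The area of the sphere from Gamma and Beta integrals\<close>

lemma Gamma_real_legendre_duplication:
  assumes "(x::real) > 0"
  shows "Gamma x * Gamma (x + 1/2) = 2 powr (1 - 2 * x) * sqrt pi * Gamma (2 * x)"
proof -
  have 1: "complex_of_real x \<notin> \<int>\<^sub>\<le>\<^sub>0" and 2: "complex_of_real x + 1/2 \<notin> \<int>\<^sub>\<le>\<^sub>0"
  proof -
    show "complex_of_real x \<notin> \<int>\<^sub>\<le>\<^sub>0"
      using assms by (auto elim!: nonpos_Ints_cases simp: complex_eq_iff)
    show "complex_of_real x + 1/2 \<notin> \<int>\<^sub>\<le>\<^sub>0"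
      using assms by (auto elim!: nonpos_Ints_cases simp: complex_eq_iff)
  qed
  have "complex_of_real (Gamma x * Gamma (x + 1/2)) = Gamma (of_real x) * Gamma (of_real x + 1/2)"
    by (simp flip: Gamma_complex_of_real)
  also have "\<dots> = exp ((1 - 2 * of_real x) * of_real (ln 2)) * of_real (sqrt pi) * Gamma (2 * of_real x)"
    by (rule Gamma_legendre_duplication[OF 1 2])
  also have "\<dots> = complex_of_real (exp ((1 - 2 * x) * ln 2) * sqrt pi * Gamma (2 * x))"
    by (simp flip: Gamma_complex_of_real exp_of_real)
  finally show ?thesis
    unfolding of_real_eq_iff by (simp add: powr_def)
qed

text \<open>The integrand is the Jacobian of the inverse stereographic projection, so the value is
  the area of the unit sphere in one dimension more. The radial integral is turned by t = r^2 / (1 +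
  r^2) into a symmetric Beta integral, which the duplication formula matches with the ball
  volume.\<close>

lemma nn_integral_sphere:
  "(\<integral>\<^sup>+(x::'a::euclidean_space). ennreal ((2 / (1 + (norm x)\<^sup>2)) ^ DIM('a)) \<partial>lborel)
     = ennreal ((real DIM('a) + 1) * unit_ball_vol (real DIM('a) + 1))"
proof -
  define d where "d = DIM('a)"
  define w where "w = unit_ball_vol (real d)"
  have d: "d \<ge> 1" by (simp add: d_def Suc_leI)
  have w: "w > 0" by (simp add: w_def)
  have pos: "1 + r\<^sup>2 > 0" for r :: real by (simp add: add_pos_nonneg)
  define h where "h = (\<lambda>r::real. 2 * r ^ (d - 1) / (1 + r\<^sup>2) ^ d)"
  define b where "b = (\<lambda>t::real. t powr (real d / 2 - 1) * (1 - t) powr (real d / 2 - 1))"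
  define g where "g = (\<lambda>r::real. r\<^sup>2 / (1 + r\<^sup>2))"
  have [measurable]: "h \<in> borel_measurable borel" "b \<in> borel_measurable borel"
    unfolding h_def b_def by measurable
  have g1: "1 - g r = 1 / (1 + r\<^sup>2)" for r
    unfolding g_def using pos[of r] by (simp add: field_simps)
  \<comment> \<open>The substitution is made on [0, n]; both sides then increase with n to the
    integrals over [0, \<infinity>) and [0, 1).\<close>
  have fin: "(\<integral>\<^sup>+t. ennreal (b t) * indicator {g 0..g (real n)} t \<partial>lborel) = (\<integral>\<^sup>+r. ennreal (h r) * indicator {0..real n} r \<partial>lborel)" for n
  proof -
    have "(\<integral>\<^sup>+t. ennreal (b t * indicator {g 0..g (real n)} t) \<partial>lborel) = (\<integral>\<^sup>+r. ennreal (b (g r) * (2 * r / (1 + r\<^sup>2)\<^sup>2) * indicator {0..real n} r) \<partial>lborel)"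
    proof (rule nn_integral_substitution)
      show "(g has_real_derivative 2 * r / (1 + r\<^sup>2)\<^sup>2) (at r)" for r
        unfolding g_def using pos[of r]
        by (auto intro!: derivative_eq_intros simp: field_simps power2_eq_square)
      show "continuous_on {0..real n} (\<lambda>r. 2 * r / (1 + r\<^sup>2)\<^sup>2)"
        using pos by (intro continuous_intros) (simp add: less_imp_neq[symmetric])
    qed (auto simp: set_borel_measurable_def)
    also have "\<dots> = (\<integral>\<^sup>+r. ennreal (h r) * indicator {0..real n} r \<partial>lborel)"
    proof (intro nn_integral_cong_AE AE_I[of _ _ "{0}"])
      have "b (g r) * (2 * r / (1 + r\<^sup>2)\<^sup>2) = h r" if "r > 0" for r
      proof -
        have "g r powr (real d / 2 - 1) * (1 - g r) powr (real d / 2 - 1) = (r / (1 + r\<^sup>2)) powr (real d - 2)"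
        proof -
          have "g r * (1 - g r) = (r / (1 + r\<^sup>2)) powr 2"
            using that pos[of r] unfolding g1 by (simp add: g_def power2_eq_square)
          then have "(g r * (1 - g r)) powr (real d / 2 - 1) = (r / (1 + r\<^sup>2)) powr (2 * (real d / 2 - 1))"
            by (simp only: powr_powr)
          moreover have "g r \<ge> 0" "1 - g r \<ge> 0" using pos[of r] unfolding g1 by (simp_all add: g_def)
          moreover have "2 * (real d / 2 - 1) = real d - 2" by simp
          ultimately show ?thesis using powr_mult[of "g r" "1 - g r" "real d / 2 - 1"] by (simp only:)
        qed
        also have "\<dots> = (r / (1 + r\<^sup>2)) ^ d / (r / (1 + r\<^sup>2))\<^sup>2"
          using that pos[of r] by (simp add: powr_diff powr_realpow)
        finally have 1: "b (g r) = (r / (1 + r\<^sup>2)) ^ d / (r / (1 + r\<^sup>2))\<^sup>2" by (simp add: b_def)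
        obtain k where k: "d = Suc k" using d by (cases d) auto
        have "(r / q) ^ Suc k / (r / q)\<^sup>2 * (2 * r / q\<^sup>2) = 2 * r ^ (Suc k - 1) / q ^ Suc k" if "q > 0" for q
          using that \<open>r > 0\<close> by (simp add: field_simps power2_eq_square power_divide)
        from this[OF pos] show ?thesis unfolding 1 h_def k .
      qed
      then show "{r \<in> space lborel. ennreal (b (g r) * (2 * r / (1 + r\<^sup>2)\<^sup>2) * indicator {0..real n} r) \<noteq> ennreal (h r) * indicator {0..real n} r} \<subseteq> {0}"
        by (auto simp: indicator_def order_le_less)
    qed auto
    finally show ?thesis by (simp add: nn_integral_set_ennreal)
  qed
  have L1: "(\<lambda>n. \<integral>\<^sup>+r. ennreal (h r) * indicator {0..real n} r \<partial>lborel) \<longlonglongrightarrow> (\<integral>\<^sup>+r. ennreal (h r) * indicator {0..} r \<partial>lborel)"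
  proof -
    have "(\<lambda>n. emeasure (density lborel h) {0..real n}) \<longlonglongrightarrow> emeasure (density lborel h) (\<Union>n. {0..real n})"
      by (rule Lim_emeasure_incseq) (auto simp: incseq_def)
    moreover have "(\<Union>n. {0..real n}) = {0..}" using real_arch_simple by auto
    ultimately show ?thesis by (simp add: emeasure_density)
  qed
  have L2: "(\<lambda>n. \<integral>\<^sup>+t. ennreal (b t) * indicator {g 0..g (real n)} t \<partial>lborel) \<longlonglongrightarrow> (\<integral>\<^sup>+t. ennreal (b t) * indicator {0..<1} t \<partial>lborel)"
  proof -
    have mono: "g x \<le> g y" if "0 \<le> x" "x \<le> y" for x y
    proof -
      have "1 / (1 + y\<^sup>2) \<le> 1 / (1 + x\<^sup>2)" using that pos[of x] pos[of y] by (simp add: frac_le)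
      then show ?thesis using g1[of x] g1[of y] by linarith
    qed
    have "(\<lambda>n. emeasure (density lborel b) {0..g (real n)}) \<longlonglongrightarrow> emeasure (density lborel b) (\<Union>n. {0..g (real n)})"
      by (rule Lim_emeasure_incseq) (auto simp: incseq_def intro: order_trans[OF _ mono])
    moreover have "(\<Union>n. {0..g (real n)}) = {0..<1}"
    proof -
      have "g (real n) < 1" for n using g1[of "real n"] pos[of "real n"] by (smt (verit) divide_pos_pos)
      moreover have "\<exists>n. t \<le> g (real n)" if "t < 1" for t
      proof -
        have "((\<lambda>n. g (real n)) \<longlonglongrightarrow> 1)" unfolding g_def by real_asymp
        then have "eventually (\<lambda>n. t < g (real n)) sequentially" using that by (rule order_tendstoD)
        then show ?thesis by (meson eventually_sequentially less_imp_le order_refl)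
      qed
      ultimately show ?thesis by (auto, metis le_less_trans)
    qed
    ultimately show ?thesis by (simp add: emeasure_density g_def)
  qed
  have "(\<integral>\<^sup>+r. ennreal (h r) * indicator {0..} r \<partial>lborel) = (\<integral>\<^sup>+t. ennreal (b t) * indicator {0..<1} t \<partial>lborel)"
    using L1 L2 unfolding fin by (rule LIMSEQ_unique)
  also have "\<dots> = (\<integral>\<^sup>+t. ennreal (b t) * indicator {0..1} t \<partial>lborel)"
    by (intro nn_integral_cong_AE AE_I[of _ _ "{1}"]) (auto simp: indicator_def)
  also have "\<dots> = ennreal (Beta (real d / 2) (real d / 2))"
  proof -
    have "((\<lambda>t. t powr (real d / 2 - 1) * (1 - t) powr (real d / 2 - 1)) has_integral Beta (real d / 2) (real d / 2)) {0..1}"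
      using d by (intro has_integral_Beta_real) auto
    then have "(b has_integral Beta (real d / 2) (real d / 2)) {0..1}" unfolding b_def .
    from nn_integral_has_integral_lebesgue[OF _ this] show ?thesis
      by (subst nn_integral_set_ennreal) (simp add: b_def mult.commute)
  qed
  finally have A: "(\<integral>\<^sup>+r. ennreal (h r) * indicator {0..} r \<partial>lborel) = ennreal (Beta (real d / 2) (real d / 2))" .
  have "(\<integral>\<^sup>+(x::'a). ennreal ((2 / (1 + (norm x)\<^sup>2)) ^ d) \<partial>lborel)
     = (\<integral>\<^sup>+r. ennreal (real d * w * r ^ (d - 1) * ((2 / (1 + r\<^sup>2)) ^ d)) * indicator {0..} r \<partial>lborel)"
    unfolding d_def w_def by (intro nn_integral_norm_real) (auto simp: add_nonneg_nonneg)
  also have "\<dots> = (\<integral>\<^sup>+r. ennreal (real d * w * 2 ^ d / 2) * (ennreal (h r) * indicator {0..} r) \<partial>lborel)"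
  proof (intro nn_integral_cong)
    fix r :: real
    have e: "real d * w * r ^ (d - 1) * ((2 / (1 + r\<^sup>2)) ^ d) = real d * w * 2 ^ d / 2 * h r"
      by (simp add: h_def power_divide)
    show "ennreal (real d * w * r ^ (d - 1) * ((2 / (1 + r\<^sup>2)) ^ d)) * indicator {0..} r = ennreal (real d * w * 2 ^ d / 2) * (ennreal (h r) * indicator {0..} r)"
      unfolding e using w by (subst ennreal_mult') (auto simp: mult.assoc)
  qed
  also have "\<dots> = ennreal (real d * w * 2 ^ d / 2) * ennreal (Beta (real d / 2) (real d / 2))"
    by (subst nn_integral_cmult) (auto simp: A)
  also have "\<dots> = ennreal (real d * w * 2 ^ d / 2 * Beta (real d / 2) (real d / 2))"
    using w by (intro ennreal_mult'[symmetric]) auto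
  also have "real d * w * 2 ^ d / 2 * Beta (real d / 2) (real d / 2) = (real d + 1) * unit_ball_vol (real d + 1)"
  proof -
    have G: "Gamma (real d / 2) > 0" "Gamma (real d) > 0" "Gamma ((real d + 1) / 2) > 0" using d by (auto intro!: Gamma_real_pos)
    \<comment> \<open>Trades the value at (d + 1)/2, which belongs to the sphere, for the values at
      d/2 and d that make up the Beta function.\<close>
    have dup: "Gamma (real d / 2) * Gamma ((real d + 1) / 2) = 2 powr (1 - real d) * sqrt pi * Gamma (real d)"
      using Gamma_real_legendre_duplication[of "real d / 2"] d by (simp add: add_divide_distrib)
    have 1: "Gamma (real d / 2 + 1) = real d / 2 * Gamma (real d / 2)"
      using d by (intro Gamma_plus1) auto
    have 2: "Gamma ((real d + 1) / 2 + 1) = (real d + 1) / 2 * Gamma ((real d + 1) / 2)"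
      by (intro Gamma_plus1) (auto elim!: nonpos_Ints_cases)
    have w': "real d * w = 2 * pi powr (real d / 2) / Gamma (real d / 2)"
      unfolding w_def unit_ball_vol_def 1 using d G by (simp add: field_simps)
    have s': "(real d + 1) * unit_ball_vol (real d + 1) = 2 * pi powr ((real d + 1) / 2) / Gamma ((real d + 1) / 2)"
    proof -
      have "x * (P / (x / 2 * Q)) = 2 * P / Q" if "x > 0" for x P Q :: real using that by simp
      then show ?thesis unfolding unit_ball_vol_def 2 by simp
    qed
    have p: "pi powr ((real d + 1) / 2) = pi powr (real d / 2) * sqrt pi"
      by (simp add: add_divide_distrib powr_add powr_half_sqrt)
    have q: "2 powr (1 - real d) = 2 / 2 ^ d"
      by (simp add: powr_diff powr_realpow)
    have "Gamma ((real d + 1) / 2) * (Gamma (real d / 2)) = 2 / 2 ^ d * sqrt pi * Gamma (real d)"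
      using dup q by (simp add: mult.commute)
    then have e: "sqrt pi / Gamma ((real d + 1) / 2) = 2 ^ d / 2 * Gamma (real d / 2) / Gamma (real d)"
    proof -
      have "s / c = D / 2 * a / b" if "c * a = 2 / D * s * b" "c > 0" "b > 0" "D > 0" for a b c s D :: real
        using that by (simp add: field_simps)
      from this[OF _ G(3,2)] show ?thesis using \<open>Gamma ((real d + 1) / 2) * (Gamma (real d / 2)) = 2 / 2 ^ d * sqrt pi * Gamma (real d)\<close> by simp
    qed
    have "(real d + 1) * unit_ball_vol (real d + 1) = 2 * pi powr (real d / 2) * (sqrt pi / Gamma ((real d + 1) / 2))"
      unfolding s' p by simp
    also have "\<dots> = 2 * pi powr (real d / 2) * (2 ^ d / 2 * Gamma (real d / 2) / Gamma (real d))"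
      unfolding e ..
    also have "\<dots> = real d * w * 2 ^ d / 2 * Beta (real d / 2) (real d / 2)"
      unfolding w' Beta_def using G by (simp add: field_simps power2_eq_square)
    finally show ?thesis by simp
  qed
  finally show ?thesis by (simp add: d_def)
qed

section \<open>Hoelder's inequality with equality case\<close>


lemma nn_integral_affine:
  fixes g :: "'a::euclidean_space \<Rightarrow> ennreal"
  assumes [measurable]: "g \<in> borel_measurable borel" and c: "c \<noteq> 0"
  shows "(\<integral>\<^sup>+x. g x \<partial>lborel) = ennreal (\<bar>c\<bar> ^ DIM('a)) * (\<integral>\<^sup>+x. g (t + c *\<^sub>R x) \<partial>lborel)"
  by (subst lborel_affine[OF c, of t])
     (simp add: nn_integral_density nn_integral_distr nn_integral_cmult)

lemma integral_affine:
  fixes g :: "'a::euclidean_space \<Rightarrow> real"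
  assumes [measurable]: "g \<in> borel_measurable borel" and c: "c \<noteq> 0"
  shows "(\<integral>x. g x \<partial>lborel) = \<bar>c\<bar> ^ DIM('a) * (\<integral>x. g (t + c *\<^sub>R x) \<partial>lborel)"
  by (subst lborel_affine[OF c, of t])
     (simp add: integral_density integral_distr)

lemma integrable_affine_iff:
  fixes g :: "'a::euclidean_space \<Rightarrow> real"
  assumes [measurable]: "g \<in> borel_measurable borel" and c: "c \<noteq> 0"
  shows "integrable lborel g \<longleftrightarrow> integrable lborel (\<lambda>x. g (t + c *\<^sub>R x))"
  using c by (subst lborel_affine[OF c, of t]) (simp add: integrable_density integrable_distr_eq)

lemma nn_integral_shift_minus:
  fixes g :: "'a::euclidean_space \<Rightarrow> ennreal"
  assumes [measurable]: "g \<in> borel_measurable borel"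
  shows "(\<integral>\<^sup>+y. g (x - y) \<partial>lborel) = (\<integral>\<^sup>+y. g y \<partial>lborel)"
  using nn_integral_affine[OF assms, of "-1" x] by simp

lemma integral_shift_minus:
  fixes g :: "'a::euclidean_space \<Rightarrow> real"
  assumes [measurable]: "g \<in> borel_measurable borel"
  shows "(\<integral>y. g (x - y) \<partial>lborel) = (\<integral>y. g y \<partial>lborel)"
  using integral_affine[OF assms, of "-1" x] by simp

lemma integrable_shift_minus:
  fixes g :: "'a::euclidean_space \<Rightarrow> real"
  assumes [measurable]: "g \<in> borel_measurable borel"
  shows "integrable lborel (\<lambda>y. g (x - y)) \<longleftrightarrow> integrable lborel g"
  using integrable_affine_iff[OF assms, of "-1" x] by simp

section \<open>Equality in Young's and Hoelder's inequalities\<close>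

text \<open>Strict concavity of the logarithm. Put m = a b. The weighted sum of ln (X/m) and ln
  (Y/m) vanishes in any case, that of X/m - 1 and Y/m - 1 by the assumed equality. As ln t \<le> t -
  1, the two sums agree term by term, and the tangent touches the logarithm only at t = 1.\<close>

lemma Youngs_equality:
  fixes a b p q :: real
  assumes "p > 1" "q > 1" "1/p + 1/q = 1" "a \<ge> 0" "b \<ge> 0"
    and eq: "a * b = a powr p / p + b powr q / q"
  shows "a powr p = b powr q"
proof (cases "a = 0 \<or> b = 0")
  case True
  then show ?thesis using assms by auto
next
  case False
  then have ab: "a > 0" "b > 0" using assms by auto
  define X Y where "X = a powr p" and "Y = b powr q"
  have XY: "X > 0" "Y > 0" using ab by (auto simp: X_def Y_def)
  define m where "m = a * b"
  have m: "m > 0" "m = X / p + Y / q" using mult_pos_pos[OF ab] eq unfolding m_def X_def Y_def by blast+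
  have "(1/p) * ln (X/m) + (1/q) * ln (Y/m) = ln a + ln b - (1/p + 1/q) * ln m"
  proof -
    have "ln (X/m) = p * ln a - ln m" "ln (Y/m) = q * ln b - ln m"
      using XY m(1) ab by (simp_all add: ln_div ln_powr X_def Y_def)
    moreover have "(1/p) * (p * u - w) + (1/q) * (q * v - w) = u + v - (1/p + 1/q) * w" for u v w
      using assms(1,2) by (simp add: algebra_simps add_divide_distrib diff_divide_distrib)
    ultimately show ?thesis by (simp only:)
  qed
  also have "\<dots> = 0" unfolding assms(3) m_def using ab ln_mult[of a b] by simp
  finally have 1: "(1/p) * ln (X/m) + (1/q) * ln (Y/m) = 0" .
  have "(1/p) * (X/m - 1) + (1/q) * (Y/m - 1) = (X/p + Y/q) / m - (1/p + 1/q)"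
    by (simp add: algebra_simps add_divide_distrib diff_divide_distrib)
  also have "\<dots> = 0" using m(1) assms(3) unfolding m(2)[symmetric] by simp
  finally have 2: "(1/p) * (X/m - 1) + (1/q) * (Y/m - 1) = 0" .
  have le: "ln (X/m) \<le> X/m - 1" "ln (Y/m) \<le> Y/m - 1" using XY m by (auto intro!: ln_le_minus_one)
  have p: "1/p > 0" and q: "1/q > 0" using assms by auto
  have "(1/p) * ln (X/m) \<le> (1/p) * (X/m - 1)" "(1/q) * ln (Y/m) \<le> (1/q) * (Y/m - 1)"
    using le p q by (auto intro!: divide_right_mono)
  then have "(1/p) * ln (X/m) = (1/p) * (X/m - 1)" "(1/q) * ln (Y/m) = (1/q) * (Y/m - 1)"
    using 1 2 by linarith+
  then have "ln (X/m) = X/m - 1" "ln (Y/m) = Y/m - 1" using p q by auto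
  then have "X/m = 1" "Y/m = 1" using XY m(1) ln_eq_minus_one[of "X/m"] ln_eq_minus_one[of "Y/m"] by (simp_all only: divide_pos_pos)
  then show ?thesis using m(1) by (simp add: X_def Y_def)
qed

text \<open>All parts are read off the pointwise Young deficit \<open>D\<close>: it is nonnegative,
  its integral is 1 minus the normalized pairing, and where it vanishes the normalized powers
  coincide.\<close>

lemma Holder_integral:
  fixes f g :: "'b \<Rightarrow> real"
  assumes pq: "p > 1" "q > 1" "1/p + 1/q = 1"
    and [measurable]: "f \<in> borel_measurable M" "g \<in> borel_measurable M"
    and f: "integrable M (\<lambda>x. \<bar>f x\<bar> powr p)" and g: "integrable M (\<lambda>x. \<bar>g x\<bar> powr q)"
  shows "integrable M (\<lambda>x. f x * g x)"
    and "(\<integral>x. f x * g x \<partial>M) \<le> (\<integral>x. \<bar>f x\<bar> powr p \<partial>M) powr (1/p) * (\<integral>x. \<bar>g x\<bar> powr q \<partial>M) powr (1/q)"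
    and "(\<integral>x. f x * g x \<partial>M) = (\<integral>x. \<bar>f x\<bar> powr p \<partial>M) powr (1/p) * (\<integral>x. \<bar>g x\<bar> powr q \<partial>M) powr (1/q) \<Longrightarrow>
      (\<integral>x. \<bar>f x\<bar> powr p \<partial>M) > 0 \<Longrightarrow> (\<integral>x. \<bar>g x\<bar> powr q \<partial>M) > 0 \<Longrightarrow>
      AE x in M. \<bar>f x\<bar> powr p / (\<integral>x. \<bar>f x\<bar> powr p \<partial>M) = \<bar>g x\<bar> powr q / (\<integral>x. \<bar>g x\<bar> powr q \<partial>M)"
proof -
  define A B where "A = (\<integral>x. \<bar>f x\<bar> powr p \<partial>M)" and "B = (\<integral>x. \<bar>g x\<bar> powr q \<partial>M)"
  have AB: "A \<ge> 0" "B \<ge> 0" unfolding A_def B_def by (auto intro: integral_nonneg_AE)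
  show I: "integrable M (\<lambda>x. f x * g x)"
  proof (rule Bochner_Integration.integrable_bound)
    show "integrable M (\<lambda>x. \<bar>f x\<bar> powr p / p + \<bar>g x\<bar> powr q / q)"
      using f g by simp
    show "AE x in M. norm (f x * g x) \<le> norm (\<bar>f x\<bar> powr p / p + \<bar>g x\<bar> powr q / q)"
    proof (intro AE_I2)
      fix x
      have "\<bar>f x\<bar> * \<bar>g x\<bar> \<le> \<bar>f x\<bar> powr p / p + \<bar>g x\<bar> powr q / q"
        by (rule Youngs_inequality) (use pq in auto)
      then show "norm (f x * g x) \<le> norm (\<bar>f x\<bar> powr p / p + \<bar>g x\<bar> powr q / q)"
        by (simp add: abs_mult)
    qed
  qed simp
  have key: "(\<integral>x. f x * g x \<partial>M) \<le> A powr (1/p) * B powr (1/q) \<and>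
    ((\<integral>x. f x * g x \<partial>M) = A powr (1/p) * B powr (1/q) \<longrightarrow> (AE x in M. \<bar>f x\<bar> powr p / A = \<bar>g x\<bar> powr q / B))"
    if "A > 0" "B > 0"
  proof -
    define a b where "a = A powr (1/p)" and "b = B powr (1/q)"
    have ab: "a > 0" "b > 0" using that by (auto simp: a_def b_def)
    have pw: "(\<bar>f x\<bar> / a) powr p = \<bar>f x\<bar> powr p / A" "(\<bar>g x\<bar> / b) powr q = \<bar>g x\<bar> powr q / B" for x
      using that pq by (auto simp: a_def b_def powr_divide powr_powr)
    define D where "D = (\<lambda>x. (\<bar>f x\<bar> powr p / A) / p + (\<bar>g x\<bar> powr q / B) / q - f x * g x / (a * b))"
    have Dge: "D x \<ge> 0" and D0: "D x = 0 \<Longrightarrow> \<bar>f x\<bar> powr p / A = \<bar>g x\<bar> powr q / B" for x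
    proof -
      have Y: "\<bar>f x\<bar> / a * (\<bar>g x\<bar> / b) \<le> (\<bar>f x\<bar> / a) powr p / p + (\<bar>g x\<bar> / b) powr q / q"
        by (rule Youngs_inequality) (use pq ab in auto)
      have F: "f x * g x / (a * b) \<le> \<bar>f x\<bar> / a * (\<bar>g x\<bar> / b)"
        using ab by (simp add: divide_right_mono flip: abs_mult)
      show "D x \<ge> 0" using Y F unfolding D_def pw by linarith
      assume "D x = 0"
      then have "\<bar>f x\<bar> / a * (\<bar>g x\<bar> / b) = (\<bar>f x\<bar> / a) powr p / p + (\<bar>g x\<bar> / b) powr q / q"
        using Y F unfolding D_def pw by linarith
      from Youngs_equality[OF pq _ _ this] ab show "\<bar>f x\<bar> powr p / A = \<bar>g x\<bar> powr q / B"
        unfolding pw by simp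
    qed
    have DI: "integrable M D" unfolding D_def using f g I by simp
    have "(\<integral>x. D x \<partial>M) = (A / A) / p + (B / B) / q - (\<integral>x. f x * g x \<partial>M) / (a * b)"
      unfolding D_def using f g I by (simp add: A_def B_def)
    also have "\<dots> = 1 - (\<integral>x. f x * g x \<partial>M) / (a * b)" using that pq by simp
    finally have D: "(\<integral>x. D x \<partial>M) = 1 - (\<integral>x. f x * g x \<partial>M) / (a * b)" .
    have "(\<integral>x. D x \<partial>M) \<ge> 0" using Dge by (intro integral_nonneg_AE) auto
    then have 1: "(\<integral>x. f x * g x \<partial>M) \<le> a * b" unfolding D using ab by (simp add: pos_divide_le_eq)
    moreover have "AE x in M. \<bar>f x\<bar> powr p / A = \<bar>g x\<bar> powr q / B" if "(\<integral>x. f x * g x \<partial>M) = a * b"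
    proof -
      have "(\<integral>x. D x \<partial>M) = 0" unfolding D that using ab by simp
      then have "AE x in M. D x = 0" using integral_nonneg_eq_0_iff_AE[OF DI] Dge by simp
      then show ?thesis using D0 by (auto elim: eventually_mono)
    qed
    ultimately show ?thesis unfolding a_def b_def by blast
  qed
  show "(\<integral>x. f x * g x \<partial>M) \<le> (\<integral>x. \<bar>f x\<bar> powr p \<partial>M) powr (1/p) * (\<integral>x. \<bar>g x\<bar> powr q \<partial>M) powr (1/q)"
  proof (cases "A > 0 \<and> B > 0")
    case True then show ?thesis using key by (simp add: A_def B_def)
  next
    case False
    then have "A = 0 \<or> B = 0" using AB by linarith
    then have "AE x in M. f x * g x = 0"
    proof
      assume "A = 0"
      then have "AE x in M. \<bar>f x\<bar> powr p = 0"
        unfolding A_def using integral_nonneg_eq_0_iff_AE[OF f] by simp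
      then show ?thesis by (auto elim!: eventually_mono)
    next
      assume "B = 0"
      then have "AE x in M. \<bar>g x\<bar> powr q = 0"
        unfolding B_def using integral_nonneg_eq_0_iff_AE[OF g] by simp
      then show ?thesis by (auto elim!: eventually_mono)
    qed
    then have "(\<integral>x. f x * g x \<partial>M) = (\<integral>x. 0 \<partial>M)" by (intro integral_cong_AE) auto
    then show ?thesis by simp
  qed
  show "AE x in M. \<bar>f x\<bar> powr p / (\<integral>x. \<bar>f x\<bar> powr p \<partial>M) = \<bar>g x\<bar> powr q / (\<integral>x. \<bar>g x\<bar> powr q \<partial>M)"
    if "(\<integral>x. f x * g x \<partial>M) = (\<integral>x. \<bar>f x\<bar> powr p \<partial>M) powr (1/p) * (\<integral>x. \<bar>g x\<bar> powr q \<partial>M) powr (1/q)"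
      "(\<integral>x. \<bar>f x\<bar> powr p \<partial>M) > 0" "(\<integral>x. \<bar>g x\<bar> powr q \<partial>M) > 0"
    using key that by (simp add: A_def B_def)
qed

section \<open>The energy form\<close>


text \<open>\<open>hp\<close> is the exponent of the Hardy-Littlewood-Sobolev inequality and
  \<open>hq\<close> its conjugate, the Sobolev exponent; the type argument carries the
  dimension.\<close>

definition hp :: "'a::euclidean_space itself \<Rightarrow> real" where
  "hp _ = 2 * real DIM('a) / (real DIM('a) + 2)"

definition hq :: "'a::euclidean_space itself \<Rightarrow> real" where
  "hq _ = 2 * real DIM('a) / (real DIM('a) - 2)"

text \<open>The bound of \<open>hq\<close> by 6, reached in dimension 3, is what later permits
  numerical constants in the Taylor estimates that do not depend on the dimension.\<close>

lemma hp_hq: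
  assumes "DIM('a::euclidean_space) \<ge> 3"
  shows "1 < hp TYPE('a)" "2 < hq TYPE('a)" "1 / hp TYPE('a) + 1 / hq TYPE('a) = 1"
    "hp TYPE('a) * (hq TYPE('a) - 1) = hq TYPE('a)"
    "(hp TYPE('a) - 1) * hq TYPE('a) = hp TYPE('a)"
    "(2 - real DIM('a)) * hq TYPE('a) = - 2 * real DIM('a)"
    "hp TYPE('a) - 1 = (real DIM('a) - 2) / (real DIM('a) + 2)"
    "hq TYPE('a) - 2 = 4 / (real DIM('a) - 2)"
    "hq TYPE('a) \<le> 6" "hq TYPE('a) > 1" "hp TYPE('a) < 2"
proof -
  have d: "real DIM('a) \<ge> 3" using assms by simp
  have nz: "real DIM('a) - 2 > 0" "real DIM('a) + 2 > 0" "real DIM('a) > 0" using d by auto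
  show "1 < hp TYPE('a)" "2 < hq TYPE('a)" "hq TYPE('a) > 1" "hp TYPE('a) < 2" "hq TYPE('a) \<le> 6"
    "hp TYPE('a) - 1 = (real DIM('a) - 2) / (real DIM('a) + 2)"
    "hq TYPE('a) - 2 = 4 / (real DIM('a) - 2)"
    "(2 - real DIM('a)) * hq TYPE('a) = - 2 * real DIM('a)"
    using d nz by (simp_all add: hp_def hq_def field_simps)
  show *: "1 / hp TYPE('a) + 1 / hq TYPE('a) = 1"
    using d nz by (simp add: hp_def hq_def add_divide_distrib[symmetric])
  have "hp TYPE('a) > 0" "hq TYPE('a) > 0" using d nz by (simp_all add: hp_def hq_def)
  then have "hq TYPE('a) + hp TYPE('a) = hp TYPE('a) * hq TYPE('a)" using * by (simp add: field_simps)
  then show "hp TYPE('a) * (hq TYPE('a) - 1) = hq TYPE('a)"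
    "(hp TYPE('a) - 1) * hq TYPE('a) = hp TYPE('a)" by (simp_all add: algebra_simps)
qed

text \<open>Borel instead of Lebesgue measurability keeps translations, products and parameter
  integrals measurable. A Lebesgue measurable function is replaced by a Borel version at the very
  end.\<close>

definition Lhp :: "('a::euclidean_space \<Rightarrow> real) set" where
  "Lhp = {f \<in> borel_measurable borel. integrable lborel (\<lambda>x. \<bar>f x\<bar> powr hp TYPE('a))}"

lemma LhpD:
  fixes f :: "'a::euclidean_space \<Rightarrow> real"
  assumes "f \<in> Lhp"
  shows "f \<in> borel_measurable borel" "integrable lborel (\<lambda>x. \<bar>f x\<bar> powr hp TYPE('a))"
  using assms by (auto simp: Lhp_def)

lemma Lhp_bound:
  fixes f g :: "'a::euclidean_space \<Rightarrow> real"
  assumes "f \<in> Lhp" and [measurable]: "g \<in> borel_measurable borel"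
    and "AE x in lborel. \<bar>g x\<bar> \<le> \<bar>f x\<bar>"
  shows "g \<in> Lhp"
proof -
  have [measurable]: "f \<in> borel_measurable borel" using assms(1) by (rule LhpD)
  have "integrable lborel (\<lambda>x. \<bar>g x\<bar> powr hp TYPE('a))"
    using LhpD(2)[OF assms(1)]
  proof (rule Bochner_Integration.integrable_bound)
    show "AE x in lborel. norm (\<bar>g x\<bar> powr hp TYPE('a)) \<le> norm (\<bar>f x\<bar> powr hp TYPE('a))"
      using assms(3) by eventually_elim (auto intro!: powr_mono2 simp: hp_def)
  qed simp
  then show ?thesis by (simp add: Lhp_def)
qed

lemma Lhp_abs: "f \<in> Lhp \<Longrightarrow> (\<lambda>x. \<bar>f x\<bar>) \<in> Lhp"
  by (rule Lhp_bound) (auto dest: LhpD)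

lemma Lhp_scale:
  fixes f :: "'a::euclidean_space \<Rightarrow> real"
  assumes "f \<in> Lhp" shows "(\<lambda>x. c * f x) \<in> Lhp"
  using LhpD[OF assms] by (auto simp: Lhp_def abs_mult powr_mult)

lemma Lhp_add:
  fixes f g :: "'a::euclidean_space \<Rightarrow> real"
  assumes f: "f \<in> Lhp" and g: "g \<in> Lhp"
  shows "(\<lambda>x. f x + g x) \<in> Lhp"
proof -
  define p where "p = hp TYPE('a)"
  have p: "p \<ge> 0" by (simp add: p_def hp_def)
  have [measurable]: "f \<in> borel_measurable borel" "g \<in> borel_measurable borel" using f g by (auto dest: LhpD)
  have "integrable lborel (\<lambda>x. \<bar>f x + g x\<bar> powr p)"
  proof (rule Bochner_Integration.integrable_bound)
    show "integrable lborel (\<lambda>x. 2 powr p * (\<bar>f x\<bar> powr p + \<bar>g x\<bar> powr p))"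
      using LhpD(2)[OF f] LhpD(2)[OF g] by (simp add: p_def)
    show "AE x in lborel. norm (\<bar>f x + g x\<bar> powr p) \<le> norm (2 powr p * (\<bar>f x\<bar> powr p + \<bar>g x\<bar> powr p))"
    proof (intro AE_I2)
      fix x
      have "\<bar>f x + g x\<bar> powr p \<le> (2 * max \<bar>f x\<bar> \<bar>g x\<bar>) powr p"
        using p by (intro powr_mono2) auto
      also have "\<dots> = 2 powr p * (max \<bar>f x\<bar> \<bar>g x\<bar>) powr p" by (simp add: powr_mult)
      also have "\<dots> \<le> 2 powr p * (\<bar>f x\<bar> powr p + \<bar>g x\<bar> powr p)"
        by (intro mult_left_mono) (auto simp: max_def)
      finally show "norm (\<bar>f x + g x\<bar> powr p) \<le> norm (2 powr p * (\<bar>f x\<bar> powr p + \<bar>g x\<bar> powr p))" by simp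
    qed
  qed simp
  then show ?thesis by (simp add: Lhp_def p_def)
qed

section \<open>A bound of the energy with a rough constant\<close>

text \<open>Only points y with f y at most a = f x count. Near x the bound f y \<le> a is combined
  with the local integrability of the kernel, far from x Young's inequality is used. The radius
  \<open>R\<close> is the one at which both contributions are multiples of \<open>a powr p\<close>,
  which is integrable in x.\<close>

lemma hls_weak_inner:
  fixes f :: "'a::euclidean_space \<Rightarrow> real"
  assumes d: "DIM('a) \<ge> 3" and [measurable]: "f \<in> borel_measurable borel"
    and f0: "\<And>x. f x \<ge> 0" and f1: "(\<integral>\<^sup>+x. ennreal (f x powr hp TYPE('a)) \<partial>lborel) \<le> 1"
  shows "(\<integral>\<^sup>+y. ennreal (f x * newton (x - y) * f y) * indicator {y. f y \<le> f x} y \<partial>lborel)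
    \<le> ennreal ((real DIM('a) * unit_ball_vol (real DIM('a)) / 2 + 1 + unit_ball_vol (real DIM('a))) * f x powr hp TYPE('a))"
proof (cases "f x = 0")
  case True then show ?thesis by simp
next
  case False
  define p q where "p = hp TYPE('a)" and "q = hq TYPE('a)"
  define D where "D = real DIM('a)"
  note pq = hp_hq[OF d, folded p_def q_def D_def]
  define w where "w = unit_ball_vol D"
  have D: "D \<ge> 3" using d by (simp add: D_def)
  have w: "w > 0" using D by (simp add: w_def)
  define a where "a = f x"
  have a: "a > 0" using False f0[of x] by (simp add: a_def)
  define R where "R = a powr (- 2 / (D + 2))"
  have R: "R > 0" using a by (simp add: R_def)
  have pt: "ennreal (f x * newton (x - y) * f y) * indicator {y. f y \<le> f x} y
    \<le> ennreal (a * a) * (ennreal (newton (x - y)) * indicator {x. norm x < R} (x - y))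
      + (ennreal (a powr p) * ennreal (f y powr p)
      + ennreal (norm (x - y) powr (- (2 * D))) * indicator {x. R \<le> norm x} (x - y))" for y
  proof (cases "f y \<le> a")
    case le: True
    show ?thesis
    proof (cases "norm (x - y) < R")
      case True
      have "a * newton (x - y) * f y \<le> (a * a) * newton (x - y)"
        using le a mult_right_mono[OF le, of "a * newton (x - y)"] by (simp add: mult_ac)
      then have "ennreal (f x * newton (x - y) * f y) \<le> ennreal (a * a) * ennreal (newton (x - y))"
        using a by (subst ennreal_mult'[symmetric]) (auto simp: a_def[symmetric] intro!: ennreal_leI)
      then show ?thesis using True le by (simp add: a_def add_increasing2)
    next
      case False
      \<comment> \<open>The two weights multiply to 1. They are chosen so that, after Young's
        inequality and multiplication by a, the coefficient of \<open>f y powr p\<close> is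
        \<open>a powr p\<close> and that of the kernel power is 1.\<close>
      have "f y * newton (x - y) = (a powr ((p - 1) / p) * f y) * (a powr (- 1 / q) * newton (x - y))"
      proof -
        have "(p - 1) / p + - 1 / q = 0" using pq(3) pq(1) by (simp add: diff_divide_distrib)
        then have "a powr ((p - 1) / p) * a powr (- 1 / q) = 1" using a by (metis powr_add powr_zero_eq_one less_irrefl)
        then show ?thesis by (simp add: algebra_simps)
      qed
      also have "\<dots> \<le> (a powr ((p - 1) / p) * f y) powr p / p + (a powr (- 1 / q) * newton (x - y)) powr q / q"
        by (rule Youngs_inequality) (use pq f0 in auto)
      also have "\<dots> \<le> (a powr ((p - 1) / p) * f y) powr p + (a powr (- 1 / q) * newton (x - y)) powr q"
      proof -
        have "t / r \<le> t" if "t \<ge> 0" "r > 1" for t r :: real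
          using that mult_left_mono[of 1 r t] by (simp add: pos_divide_le_eq)
        then show ?thesis using pq(1,10) by (intro add_mono) simp_all
      qed
      also have "\<dots> = a powr (p - 1) * f y powr p + a powr (-1) * norm (x - y) powr (- (2 * D))"
        using pq a f0[of y] by (simp add: powr_mult powr_powr newton_def D_def)
      finally have "a * (f y * newton (x - y)) \<le> a * (a powr (p - 1) * f y powr p + a powr (-1) * norm (x - y) powr (- (2 * D)))"
        using a by (intro mult_left_mono) auto
      also have "\<dots> = a powr p * f y powr p + norm (x - y) powr (- (2 * D))"
        using a by (simp add: algebra_simps powr_diff powr_minus)
      finally have "ennreal (f x * newton (x - y) * f y) \<le> ennreal (a powr p * f y powr p + norm (x - y) powr (- (2 * D)))"
        by (intro ennreal_leI) (simp add: a_def mult_ac)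
      also have "\<dots> = ennreal (a powr p) * ennreal (f y powr p) + ennreal (norm (x - y) powr (- (2 * D)))"
        by (simp add: ennreal_plus ennreal_mult')
      finally show ?thesis using False le by (simp add: a_def)
    qed
  next
    case False then show ?thesis by (simp add: a_def)
  qed
  have I1: "(\<integral>\<^sup>+y. ennreal (newton (x - y)) * indicator {x. norm x < R} (x - y) \<partial>lborel) = ennreal (D * w / 2 * R\<^sup>2)"
    using nn_integral_newton_ball[where 'a='a, OF R] 
    by (subst nn_integral_shift_minus[where g="\<lambda>z. ennreal (newton z) * indicator {x. norm x < R} z"]) (auto simp: D_def w_def)
  have I2: "(\<integral>\<^sup>+y. ennreal (norm (x - y) powr (- (2 * D))) * indicator {x. R \<le> norm x} (x - y) \<partial>lborel) = ennreal (w * R powr (- D))"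
    using nn_integral_powr_norm_ge[where 'a='a, OF R, of "2 * D"] D
    by (subst nn_integral_shift_minus[where g="\<lambda>z. ennreal (norm z powr (- (2 * D))) * indicator {x. R \<le> norm x} z"]) (auto simp: D_def w_def)
  have "(\<integral>\<^sup>+y. ennreal (f x * newton (x - y) * f y) * indicator {y. f y \<le> f x} y \<partial>lborel)
    \<le> (\<integral>\<^sup>+y. ennreal (a * a) * (ennreal (newton (x - y)) * indicator {x. norm x < R} (x - y))
      + (ennreal (a powr p) * ennreal (f y powr p)
      + ennreal (norm (x - y) powr (- (2 * D))) * indicator {x. R \<le> norm x} (x - y)) \<partial>lborel)"
    by (intro nn_integral_mono pt)
  also have "\<dots> = ennreal (a * a) * ennreal (D * w / 2 * R\<^sup>2) + (ennreal (a powr p) * (\<integral>\<^sup>+y. ennreal (f y powr p) \<partial>lborel)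
      + ennreal (w * R powr (- D)))"
    by (simp add: nn_integral_add nn_integral_cmult I1 I2)
  also have "\<dots> \<le> ennreal (a * a) * ennreal (D * w / 2 * R\<^sup>2) + (ennreal (a powr p) * 1 + ennreal (w * R powr (- D)))"
    using f1 by (intro add_mono mult_mono order_refl) (auto simp: p_def)
  also have "\<dots> = ennreal (a * a * (D * w / 2 * R\<^sup>2) + (a powr p + w * R powr (- D)))"
  proof -
    have "ennreal X * ennreal Y + (ennreal Z * 1 + ennreal W) = ennreal (X * Y + (Z + W))"
      if "X \<ge> 0" "Y \<ge> 0" "Z \<ge> 0" "W \<ge> 0" for X Y Z W
      using that by (simp add: ennreal_plus ennreal_mult)
    then show ?thesis using a w D by (simp only: mult_nonneg_nonneg less_imp_le powr_ge_zero zero_le_power2 divide_nonneg_pos)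
  qed
  also have "a * a * (D * w / 2 * R\<^sup>2) + (a powr p + w * R powr (- D)) = (D * w / 2 + 1 + w) * a powr p"
  proof -
    have 1: "R powr (- D) = a powr p" 
      unfolding R_def p_def hp_def D_def by (simp add: powr_powr)
    have "R\<^sup>2 = a powr (- 2 / (D + 2) + - 2 / (D + 2))" unfolding R_def power2_eq_square powr_add ..
    moreover have "a * a = a powr 2" using a by (simp add: power2_eq_square)
    ultimately have "a * a * R\<^sup>2 = a powr (2 + (- 2 / (D + 2) + - 2 / (D + 2)))" by (simp only: powr_add)
    also have "2 + (- 2 / (D + 2) + - 2 / (D + 2)) = p"
    proof -
      have "- 2 / (D + 2) + - 2 / (D + 2) = - 4 / (D + 2)" by (simp flip: add_divide_distrib)
      then show ?thesis using D unfolding p_def hp_def D_def[symmetric] by (simp add: field_simps)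
    qed
    finally have 2: "a * a * R\<^sup>2 = a powr p" .
    have "a * a * (D * w / 2 * R\<^sup>2) = D * w / 2 * (a * a * R\<^sup>2)" by simp
    then show ?thesis unfolding 1 2 by (simp add: algebra_simps)
  qed
  finally show ?thesis by (simp add: a_def p_def w_def D_def)
qed

definition hls_C :: "'a::euclidean_space itself \<Rightarrow> real" where
  "hls_C _ = 2 * (real DIM('a) * unit_ball_vol (real DIM('a)) / 2 + 1 + unit_ball_vol (real DIM('a)))"

lemma hls_C_pos: "hls_C TYPE('a::euclidean_space) > 0"
  by (simp add: hls_C_def add_pos_pos add_nonneg_pos)

text \<open>By symmetry of the kernel every pair of points is counted in the region f y \<le> f x or
  in its mirror image, whence the factor 2 in \<open>hls_C\<close>. The bound makes the supremum
  \<open>hls_M\<close> finite.\<close>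

lemma hls_weak_nn:
  fixes f :: "'a::euclidean_space \<Rightarrow> real"
  assumes d: "DIM('a) \<ge> 3" and [measurable]: "f \<in> borel_measurable borel"
    and f0: "\<And>x. f x \<ge> 0" and f1: "(\<integral>\<^sup>+x. ennreal (f x powr hp TYPE('a)) \<partial>lborel) \<le> 1"
  shows "(\<integral>\<^sup>+x. \<integral>\<^sup>+y. ennreal (f x * newton (x - y) * f y) \<partial>lborel \<partial>lborel) \<le> ennreal (hls_C TYPE('a))"
proof -
  define C where "C = (real DIM('a) * unit_ball_vol (real DIM('a)) / 2 + 1 + unit_ball_vol (real DIM('a)))"
  have C: "C > 0" by (simp add: C_def add_pos_pos add_nonneg_pos)
  have A: "(\<integral>\<^sup>+x. \<integral>\<^sup>+y. ennreal (f x * newton (x - y) * f y) * indicator {y. f y \<le> f x} y \<partial>lborel \<partial>lborel) \<le> ennreal C"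
  proof -
    have "(\<integral>\<^sup>+x. \<integral>\<^sup>+y. ennreal (f x * newton (x - y) * f y) * indicator {y. f y \<le> f x} y \<partial>lborel \<partial>lborel)
      \<le> (\<integral>\<^sup>+x. ennreal C * ennreal (f x powr hp TYPE('a)) \<partial>lborel)"
      using hls_weak_inner[OF assms(1-4)] C by (intro nn_integral_mono) (simp add: C_def ennreal_mult')
    also have "\<dots> = ennreal C * (\<integral>\<^sup>+x. ennreal (f x powr hp TYPE('a)) \<partial>lborel)" by (simp add: nn_integral_cmult)
    also have "\<dots> \<le> ennreal C * 1" by (intro mult_mono f1) auto
    finally show ?thesis by simp
  qed
  have "(\<integral>\<^sup>+x. \<integral>\<^sup>+y. ennreal (f x * newton (x - y) * f y) \<partial>lborel \<partial>lborel)
    \<le> (\<integral>\<^sup>+x. \<integral>\<^sup>+y. ennreal (f x * newton (x - y) * f y) * indicator {y. f y \<le> f x} y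
      + ennreal (f y * newton (y - x) * f x) * indicator {x. f x \<le> f y} x \<partial>lborel \<partial>lborel)"
    by (intro nn_integral_mono) (auto simp: indicator_def newton_commute mult_ac)
  also have "\<dots> = (\<integral>\<^sup>+x. \<integral>\<^sup>+y. ennreal (f x * newton (x - y) * f y) * indicator {y. f y \<le> f x} y \<partial>lborel \<partial>lborel)
      + (\<integral>\<^sup>+x. \<integral>\<^sup>+y. ennreal (f y * newton (y - x) * f x) * indicator {x. f x \<le> f y} x \<partial>lborel \<partial>lborel)"
    by (simp add: nn_integral_add)
  also have "(\<integral>\<^sup>+x. \<integral>\<^sup>+y. ennreal (f y * newton (y - x) * f x) * indicator {x. f x \<le> f y} x \<partial>lborel \<partial>lborel)
     = (\<integral>\<^sup>+y. \<integral>\<^sup>+x. ennreal (f y * newton (y - x) * f x) * indicator {x. f x \<le> f y} x \<partial>lborel \<partial>lborel)"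
    by (rule lborel_pair.Fubini') simp
  also have "(\<integral>\<^sup>+x. \<integral>\<^sup>+y. ennreal (f x * newton (x - y) * f y) * indicator {y. f y \<le> f x} y \<partial>lborel \<partial>lborel) +
    (\<integral>\<^sup>+y. \<integral>\<^sup>+x. ennreal (f y * newton (y - x) * f x) * indicator {x. f x \<le> f y} x \<partial>lborel \<partial>lborel) \<le> ennreal C + ennreal C"
    by (intro add_mono A)
  also have "\<dots> = ennreal (hls_C TYPE('a))" using C by (simp add: hls_C_def C_def flip: ennreal_plus)
  finally show ?thesis .
qed


text \<open>An integral over the product measure: absolute convergence is then a single statement,
  from which both iterated forms follow.\<close>

definition hls :: "('a::euclidean_space \<Rightarrow> real) \<Rightarrow> ('a \<Rightarrow> real) \<Rightarrow> real" where
  "hls f g = (LINT z|(lborel \<Otimes>\<^sub>M lborel). f (fst z) * newton (fst z - snd z) * g (snd z))"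

definition pot :: "('a::euclidean_space \<Rightarrow> real) \<Rightarrow> 'a \<Rightarrow> real" where
  "pot f x = (LINT y|lborel. newton (x - y) * f y)"

lemma pot_measurable [measurable]:
  assumes [measurable]: "f \<in> borel_measurable borel"
  shows "pot f \<in> borel_measurable borel"
  unfolding pot_def[abs_def] by measurable

lemma pot_nonneg: "(\<And>x. f x \<ge> 0) \<Longrightarrow> pot f x \<ge> 0"
  unfolding pot_def by (intro integral_nonneg_AE) auto

text \<open>Both arguments are dominated by |f| + |g|, so the bound for one nonnegative function
  suffices after scaling.\<close>

lemma hls_integrable:
  fixes f g :: "'a::euclidean_space \<Rightarrow> real"
  assumes d: "DIM('a) \<ge> 3" and f: "f \<in> Lhp" and g: "g \<in> Lhp"
  shows "integrable (lborel \<Otimes>\<^sub>M lborel) (\<lambda>z. f (fst z) * newton (fst z - snd z) * g (snd z))"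
proof -
  define p where "p = hp TYPE('a)"
  note pq = hp_hq[OF d, folded p_def]
  have [measurable]: "f \<in> borel_measurable borel" "g \<in> borel_measurable borel" using f g by (auto dest: LhpD)
  define h where "h = (\<lambda>x. \<bar>f x\<bar> + \<bar>g x\<bar>)"
  have [measurable]: "h \<in> borel_measurable borel" unfolding h_def by measurable
  have h: "h \<in> Lhp" unfolding h_def by (intro Lhp_add Lhp_abs f g)
  have h0: "h x \<ge> 0" for x by (simp add: h_def)
  define N where "N = (\<integral>x. h x powr p \<partial>lborel)"
  have hI: "integrable lborel (\<lambda>x. h x powr p)" using LhpD(2)[OF h] h0 by (simp add: p_def)
  have N: "N \<ge> 0" unfolding N_def by (intro integral_nonneg_AE) auto
  \<comment> \<open>Adding 1 to \<open>N\<close> avoids a separate case for \<open>N = 0\<close>;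
    the rough bound asks only for a norm of at most 1.\<close>
  define l where "l = (N + 1) powr (- 1 / p)"
  have l: "l > 0" using N by (simp add: l_def)
  have lp: "l powr p = 1 / (N + 1)" using N pq(1) unfolding l_def powr_powr by (simp add: powr_minus_divide)
  have "(\<integral>\<^sup>+x. ennreal ((l * h x) powr p) \<partial>lborel) = (\<integral>\<^sup>+x. ennreal (l powr p * h x powr p) \<partial>lborel)"
    using l h0 by (simp add: powr_mult)
  also have "\<dots> = ennreal (l powr p * N)"
    unfolding N_def using hI by (subst nn_integral_eq_integral) auto
  also have "\<dots> \<le> 1" using N unfolding lp by simp
  finally have "(\<integral>\<^sup>+x. ennreal ((l * h x) powr p) \<partial>lborel) \<le> 1" .
  then have W: "(\<integral>\<^sup>+x. \<integral>\<^sup>+y. ennreal (l * h x * newton (x - y) * (l * h y)) \<partial>lborel \<partial>lborel) \<le> ennreal (hls_C TYPE('a))"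
    using l h0 by (intro hls_weak_nn[OF d]) (auto simp: p_def)
  have "integrable (lborel \<Otimes>\<^sub>M lborel) (\<lambda>z. l * h (fst z) * newton (fst z - snd z) * (l * h (snd z)))"
  proof (rule integrableI_bounded)
    have "(\<integral>\<^sup>+z. ennreal (norm (l * h (fst z) * newton (fst z - snd z) * (l * h (snd z)))) \<partial>(lborel \<Otimes>\<^sub>M lborel))
      = (\<integral>\<^sup>+x. \<integral>\<^sup>+y. ennreal (l * h x * newton (x - y) * (l * h y)) \<partial>lborel \<partial>lborel)"
      using l h0 by (subst lborel.nn_integral_fst[symmetric]) (auto simp: abs_mult)
    also have "\<dots> < \<infinity>" using W by (rule le_less_trans) simp
    finally show "(\<integral>\<^sup>+z. ennreal (norm (l * h (fst z) * newton (fst z - snd z) * (l * h (snd z)))) \<partial>(lborel \<Otimes>\<^sub>M lborel)) < \<infinity>" .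
  qed simp
  then have I: "integrable (lborel \<Otimes>\<^sub>M lborel) (\<lambda>z. 1 / (l * l) * (l * h (fst z) * newton (fst z - snd z) * (l * h (snd z))))"
    by (rule integrable_mult_right)
  show ?thesis
  proof (rule Bochner_Integration.integrable_bound[OF I])
    show "AE z in lborel \<Otimes>\<^sub>M lborel. norm (f (fst z) * newton (fst z - snd z) * g (snd z))
      \<le> norm (1 / (l * l) * (l * h (fst z) * newton (fst z - snd z) * (l * h (snd z))))"
    proof (intro AE_I2)
      fix z :: "'a \<times> 'a"
      have "1 / (l * l) * (l * h (fst z) * newton (fst z - snd z) * (l * h (snd z))) = h (fst z) * newton (fst z - snd z) * h (snd z)"
        using l by simp
      moreover have "norm (f (fst z) * newton (fst z - snd z) * g (snd z)) \<le> h (fst z) * newton (fst z - snd z) * h (snd z)"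
        unfolding norm_mult by (intro mult_mono mult_nonneg_nonneg) (auto simp: h_def)
      ultimately show "norm (f (fst z) * newton (fst z - snd z) * g (snd z))
      \<le> norm (1 / (l * l) * (l * h (fst z) * newton (fst z - snd z) * (l * h (snd z))))" by simp
    qed
  qed simp
qed

lemma hls_add_left:
  fixes f g h :: "'a::euclidean_space \<Rightarrow> real"
  assumes "DIM('a) \<ge> 3" "f \<in> Lhp" "g \<in> Lhp" "h \<in> Lhp"
  shows "hls (\<lambda>x. f x + g x) h = hls f h + hls g h"
  unfolding hls_def
  using hls_integrable[OF assms(1,2,4)] hls_integrable[OF assms(1,3,4)]
  by (subst Bochner_Integration.integral_add[symmetric]) (auto simp: algebra_simps)

lemma hls_scale_left: "hls (\<lambda>x. c * f x) h = c * hls f h"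
  unfolding hls_def by (subst integral_mult_right_zero[symmetric]) (simp add: mult_ac)

lemma hls_commute:
  fixes f g :: "'a::euclidean_space \<Rightarrow> real"
  assumes [measurable]: "f \<in> borel_measurable borel" "g \<in> borel_measurable borel"
  shows "hls f g = hls g f"
proof -
  have "hls g f = (LINT (x, y)|(lborel \<Otimes>\<^sub>M lborel). g y * newton (y - x) * f x)"
    unfolding hls_def 
    by (subst lborel_pair.integral_product_swap[symmetric]) (auto simp: case_prod_beta)
  also have "\<dots> = hls f g"
    unfolding hls_def by (simp add: case_prod_beta' newton_commute[of "snd _"] mult_ac)
  finally show ?thesis by simp
qed

lemma hls_pot:
  fixes f g :: "'a::euclidean_space \<Rightarrow> real"
  assumes "DIM('a) \<ge> 3" "f \<in> Lhp" "g \<in> Lhp"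
  shows "integrable lborel (\<lambda>x. f x * pot g x)" "hls f g = (\<integral>x. f x * pot g x \<partial>lborel)"
proof -
  note I = hls_integrable[OF assms]
  have e: "(\<lambda>x. \<integral>y. f x * newton (x - y) * g y \<partial>lborel) = (\<lambda>x. f x * pot g x)"
    unfolding pot_def by (simp add: mult.assoc)
  show "integrable lborel (\<lambda>x. f x * pot g x)"
    using lborel_pair.integrable_fst'[OF I] by (simp add: e)
  show "hls f g = (\<integral>x. f x * pot g x \<partial>lborel)"
    unfolding hls_def using lborel_pair.integral_fst'[OF I] by (simp add: e)
qed

lemma jb_powr_Lhp:
  assumes "k * hp TYPE('a) > real DIM('a)"
  shows "(\<lambda>x::'a::euclidean_space. jb x powr (-k)) \<in> Lhp"
  using jb_powr_integrable[OF assms] by (simp add: Lhp_def powr_powr)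

text \<open>In the energy of f with a strictly positive member of \<open>Lhp\<close> almost every
  section is integrable by Fubini, and the positive factor can be divided out.\<close>

lemma AE_integrable_newton:
  fixes f :: "'a::euclidean_space \<Rightarrow> real"
  assumes d: "DIM('a) \<ge> 3" and f: "f \<in> Lhp"
  shows "AE x in lborel. integrable lborel (\<lambda>y. newton (x - y) * f y)"
proof -
  have "(\<lambda>x::'a. jb x powr (- (real DIM('a) + 2))) \<in> Lhp"
    by (rule jb_powr_Lhp) (simp add: hp_def)
  from lborel_pair.AE_integrable_fst'[OF hls_integrable[OF d this f]]
  show ?thesis
  proof eventually_elim
    case (elim x)
    then have "integrable lborel (\<lambda>y. jb x powr (- (real DIM('a) + 2)) * (newton (x - y) * f y))"
      by (simp add: mult.assoc)
    moreover have "jb x powr (- (real DIM('a) + 2)) \<noteq> 0" by (simp add: less_imp_neq[OF jb_pos, symmetric])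
    ultimately show ?case by (metis integrable_mult_left_iff mult.commute)
  qed
qed

section \<open>Positive definiteness of the energy\<close>

lemma gaussian_finite:
  "(\<integral>\<^sup>+(z::'a::euclidean_space). ennreal (exp (- (2 * (norm z)\<^sup>2))) \<partial>lborel) < \<infinity>"
proof -
  define n where "n = DIM('a)"
  have n: "n > 0" by (simp add: n_def)
  \<comment> \<open>From (1 + 2u/n)^n \<le> exp (2u) with u = |z|^2: the Gaussian lies below an
    integrable power of \<open>jb\<close>.\<close>
  have "exp (- (2 * (norm z)\<^sup>2)) \<le> real n ^ n * jb z powr (- (2 * real n))" for z :: 'a
  proof -
    define u where "u = (norm z)\<^sup>2"
    have u: "u \<ge> 0" by (simp add: u_def)
    have j: "jb z powr (- (2 * real n)) = 1 / (1 + u) ^ n"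
      using jb_powr[of z "- real n", folded u_def] powr_realpow[of "1 + u" n] u by (simp add: powr_minus_divide)
    have "(1 + u) \<le> real n * (1 + 2 * u / real n)" using n u by (simp add: algebra_simps) 
    then have "(1 + u) ^ n \<le> (real n * (1 + 2 * u / real n)) ^ n" using u by (intro power_mono) auto
    also have "\<dots> \<le> real n ^ n * exp (2 * u)"
      using exp_ge_one_plus_x_over_n_power_n[of n "2 * u"] n u by (simp add: power_mult_distrib)
    finally show ?thesis unfolding j u_def[symmetric] using u by (simp add: exp_minus field_simps)
  qed
  then have "(\<integral>\<^sup>+(z::'a). ennreal (exp (- (2 * (norm z)\<^sup>2))) \<partial>lborel) \<le> (\<integral>\<^sup>+(z::'a). ennreal (real n ^ n * jb z powr (- (2 * real n))) \<partial>lborel)"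
    by (intro nn_integral_mono ennreal_leI)
  also have "\<dots> < \<infinity>"
    using jb_powr_integrable[where 'a='a, of "2 * real n"] n
    by (subst nn_integral_eq_integral) (auto simp: n_def)
  finally show ?thesis .
qed

text \<open>Positive definiteness comes from writing the Newton kernel as a superposition of Gaussians, each of
  which is a composition of two Gaussians.\<close>

lemma newton_gaussian:
  fixes x y :: "'a::euclidean_space"
  assumes d: "DIM('a) \<ge> 3"
  defines "\<phi> \<equiv> (\<lambda>w (x::'a). exp (- (fst w * (norm (x - snd w))\<^sup>2)))"
  obtains C where "C > 0" "\<And>x y :: 'a. x \<noteq> y \<Longrightarrow>
     (\<integral>\<^sup>+w. ennreal (indicator {0<..} (fst w) * fst w powr (real DIM('a) - 2) * (\<phi> w x * \<phi> w y)) \<partial>(lborel \<Otimes>\<^sub>M lborel))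
      = ennreal (C * newton (x - y))"
proof -
  define D where "D = real DIM('a)"
  have D: "D \<ge> 3" using d by (simp add: D_def)
  define G where "G = (\<integral>\<^sup>+(z::'a). ennreal (exp (- (2 * (norm z)\<^sup>2))) \<partial>lborel)"
  have G: "G < \<infinity>" unfolding G_def by (rule gaussian_finite)
  have Gpos: "G \<noteq> 0"
  proof
    assume "G = 0"
    then have "AE z::'a in lborel. ennreal (exp (- (2 * (norm z)\<^sup>2))) = 0"
      unfolding G_def by (subst (asm) nn_integral_0_iff_AE) auto
    then have "AE z::'a in lborel. False" by eventually_elim simp
    then show False by (simp add: eventually_False ae_filter_eq_bot_iff)
  qed
  obtain c where c0: "c \<ge> 0" "G = ennreal c" using G by (cases G) auto
  have c: "G = ennreal c" "c > 0" using c0 Gpos by (auto simp: order_le_less)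
  \<comment> \<open>Two Gaussians of the same width multiply to a Gaussian about the midpoint times
    exp (-t |x - y|^2 / 2), by the parallelogram identity. Integrating over the common centre scales
    like t^(-D/2).\<close>
  have inner: "(\<integral>\<^sup>+z. ennreal (\<phi> (t, z) x * \<phi> (t, z) y) \<partial>lborel) = ennreal (c * t powr (- D / 2) * exp (- (t * (norm (x - y))\<^sup>2 / 2)))"
    if t: "t > 0" for t and x y :: 'a
  proof -
    define m where "m = (1/2) *\<^sub>R (x + y)"
    have id: "(norm (x - z))\<^sup>2 + (norm (y - z))\<^sup>2 = 2 * (norm (z - m))\<^sup>2 + (norm (x - y))\<^sup>2 / 2" for z
      unfolding m_def power2_norm_eq_inner by (simp add: inner_simps inner_commute algebra_simps) (simp add: field_simps)
    have "(\<integral>\<^sup>+z. ennreal (\<phi> (t, z) x * \<phi> (t, z) y) \<partial>lborel)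
       = (\<integral>\<^sup>+z. ennreal (exp (- (t * (norm (x - y))\<^sup>2 / 2)) * exp (- (2 * t * (norm (z - m))\<^sup>2))) \<partial>lborel)"
    proof (intro nn_integral_cong arg_cong[where f=ennreal])
      fix z
      have "- (t * (norm (x - z))\<^sup>2) + - (t * (norm (y - z))\<^sup>2) = - (t * ((norm (x - z))\<^sup>2 + (norm (y - z))\<^sup>2))"
        by (simp add: algebra_simps)
      also have "\<dots> = - (t * (norm (x - y))\<^sup>2 / 2) + - (2 * t * (norm (z - m))\<^sup>2)"
        unfolding id by (simp add: algebra_simps)
      finally show "\<phi> (t, z) x * \<phi> (t, z) y = exp (- (t * (norm (x - y))\<^sup>2 / 2)) * exp (- (2 * t * (norm (z - m))\<^sup>2))"
        unfolding \<phi>_def by (simp only: fst_conv snd_conv exp_add[symmetric])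
    qed
    also have "\<dots> = ennreal (exp (- (t * (norm (x - y))\<^sup>2 / 2))) * (\<integral>\<^sup>+z. ennreal (exp (- (2 * t * (norm (z - m))\<^sup>2))) \<partial>lborel)"
      by (subst nn_integral_cmult[symmetric]) (auto simp: ennreal_mult')
    also have "(\<integral>\<^sup>+z. ennreal (exp (- (2 * t * (norm (z - m))\<^sup>2))) \<partial>lborel)
        = ennreal (\<bar>t powr (-1/2)\<bar> ^ DIM('a)) * (\<integral>\<^sup>+z. ennreal (exp (- (2 * t * (norm (m + t powr (-1/2) *\<^sub>R z - m))\<^sup>2))) \<partial>lborel)"
      using t by (intro nn_integral_affine) auto
    also have "(\<integral>\<^sup>+z. ennreal (exp (- (2 * t * (norm (m + t powr (-1/2) *\<^sub>R z - m))\<^sup>2))) \<partial>lborel) = G"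
    proof -
      have "t * (t powr (-1/2))\<^sup>2 = 1"
      proof -
        have "(t powr (-1/2))\<^sup>2 = t powr (-1/2 + -1/2)" unfolding powr_add power2_eq_square ..
        then show ?thesis using t by (simp add: powr_minus)
      qed
      then have "2 * t * (norm (m + t powr (-1/2) *\<^sub>R z - m))\<^sup>2 = 2 * (norm z)\<^sup>2" for z
        by (simp add: power_mult_distrib)
      then show ?thesis unfolding G_def by (simp only:)
    qed
    also have "\<bar>t powr (-1/2)\<bar> ^ DIM('a) = t powr (- D / 2)"
      using t by (simp add: powr_realpow[symmetric] powr_powr D_def)
    finally show ?thesis unfolding c(1) using c(2) t by (simp add: ennreal_mult' mult_ac)
  qed
  \<comment> \<open>The weight t^(D-2) against the factor t^(-D/2) of the inner integral leaves
    t^(D/2-2). This is a Gamma integral with the positive argument D/2 - 1, and its scaling in |x -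
    y| is that of the Newton kernel.\<close>
  define C where "C = c * (2 powr (D / 2 - 1) * Gamma (D / 2 - 1))"
  have GG: "Gamma (D / 2 - 1) > 0" using D by (intro Gamma_real_pos) auto
  have "C > 0" using c(2) GG by (simp add: C_def)
  moreover have "(\<integral>\<^sup>+w. ennreal (indicator {0<..} (fst w) * fst w powr (real DIM('a) - 2) * (\<phi> w x * \<phi> w y)) \<partial>(lborel \<Otimes>\<^sub>M lborel))
      = ennreal (C * newton (x - y))" if xy: "x \<noteq> y" for x y :: 'a
  proof -
    define r where "r = norm (x - y)"
    have r: "r > 0" using xy by (simp add: r_def)
    have [measurable]: "(\<lambda>w. \<phi> w x) \<in> borel_measurable (lborel \<Otimes>\<^sub>M lborel)" for x unfolding \<phi>_def by measurable
    have "(\<integral>\<^sup>+w. ennreal (indicator {0<..} (fst w) * fst w powr (real DIM('a) - 2) * (\<phi> w x * \<phi> w y)) \<partial>(lborel \<Otimes>\<^sub>M lborel))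
      = (\<integral>\<^sup>+t. \<integral>\<^sup>+z. ennreal (indicator {0<..} t * t powr (D - 2) * (\<phi> (t, z) x * \<phi> (t, z) y)) \<partial>lborel \<partial>lborel)"
      by (subst lborel.nn_integral_fst[symmetric]) (auto simp: D_def)
    also have "\<dots> = (\<integral>\<^sup>+t. ennreal (c * (t powr (D / 2 - 2) * exp (- (t * r\<^sup>2 / 2)))) * indicator {0..} t \<partial>lborel)"
    proof (intro nn_integral_cong)
      fix t :: real
      show "(\<integral>\<^sup>+z. ennreal (indicator {0<..} t * t powr (D - 2) * (\<phi> (t, z) x * \<phi> (t, z) y)) \<partial>lborel)
         = ennreal (c * (t powr (D / 2 - 2) * exp (- (t * r\<^sup>2 / 2)))) * indicator {0..} t"
      proof (cases "t > 0")
        case True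
        have m: "(\<lambda>z. ennreal (\<phi> (t, z) x * \<phi> (t, z) y)) \<in> borel_measurable lborel" unfolding \<phi>_def fst_conv snd_conv by measurable
        have p: "t powr (D - 2) * t powr (- D / 2) = t powr (D / 2 - 2)"
          unfolding powr_add[symmetric] by simp
        have "(\<integral>\<^sup>+z. ennreal (indicator {0<..} t * t powr (D - 2) * (\<phi> (t, z) x * \<phi> (t, z) y)) \<partial>lborel)
          = ennreal (t powr (D - 2)) * (\<integral>\<^sup>+z. ennreal (\<phi> (t, z) x * \<phi> (t, z) y) \<partial>lborel)"
          using True by (subst nn_integral_cmult[OF m, symmetric]) (simp add: ennreal_mult')
        also have "\<dots> = ennreal (t powr (D - 2) * (c * t powr (- D / 2) * exp (- (t * r\<^sup>2 / 2))))"
          unfolding inner[OF True] r_def by (rule ennreal_mult'[symmetric]) simp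
        also have "t powr (D - 2) * (c * t powr (- D / 2) * exp (- (t * r\<^sup>2 / 2))) = c * (t powr (D / 2 - 2) * exp (- (t * r\<^sup>2 / 2)))"
          unfolding p[symmetric] by (simp add: mult_ac)
        finally show ?thesis using True by simp
      next
        case False then show ?thesis by (cases "t = 0") auto
      qed
    qed
    also have "\<dots> = ennreal \<bar>2 / r\<^sup>2\<bar> * (\<integral>\<^sup>+t. ennreal (c * ((0 + 2 / r\<^sup>2 * t) powr (D / 2 - 2) * exp (- ((0 + 2 / r\<^sup>2 * t) * r\<^sup>2 / 2)))) * indicator {0..} (0 + 2 / r\<^sup>2 * t) \<partial>lborel)"
      using r by (intro nn_integral_real_affine) auto
    also have "(\<integral>\<^sup>+t. ennreal (c * ((0 + 2 / r\<^sup>2 * t) powr (D / 2 - 2) * exp (- ((0 + 2 / r\<^sup>2 * t) * r\<^sup>2 / 2)))) * indicator {0..} (0 + 2 / r\<^sup>2 * t) \<partial>lborel)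
      = (\<integral>\<^sup>+t. ennreal (c * (2 / r\<^sup>2) powr (D / 2 - 2)) * (ennreal (t powr (D / 2 - 1 - 1) / exp t * indicator {0..} t)) \<partial>lborel)"
    proof (intro nn_integral_cong)
      fix t :: real
      show "ennreal (c * ((0 + 2 / r\<^sup>2 * t) powr (D / 2 - 2) * exp (- ((0 + 2 / r\<^sup>2 * t) * r\<^sup>2 / 2)))) * indicator {0..} (0 + 2 / r\<^sup>2 * t)
        = ennreal (c * (2 / r\<^sup>2) powr (D / 2 - 2)) * (ennreal (t powr (D / 2 - 1 - 1) / exp t * indicator {0..} t))"
      proof (cases "t \<ge> 0")
        case True
        have "(0 + 2 / r\<^sup>2 * t) powr (D / 2 - 2) = (2 / r\<^sup>2) powr (D / 2 - 2) * t powr (D / 2 - 2)"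
          using True r by (simp add: powr_mult[symmetric])
        moreover have "exp (- ((0 + 2 / r\<^sup>2 * t) * r\<^sup>2 / 2)) = 1 / exp t" using r by (simp add: exp_minus inverse_eq_divide)
        ultimately have "c * ((0 + 2 / r\<^sup>2 * t) powr (D / 2 - 2) * exp (- ((0 + 2 / r\<^sup>2 * t) * r\<^sup>2 / 2)))
           = c * (2 / r\<^sup>2) powr (D / 2 - 2) * (t powr (D / 2 - 1 - 1) / exp t)" by simp
        then show ?thesis using True r c(2) by (simp only:) (simp add: ennreal_mult[symmetric])
      next
        case False then show ?thesis using r by (auto simp: indicator_def zero_le_divide_iff zero_le_mult_iff)
      qed
    qed
    also have "\<dots> = ennreal (c * (2 / r\<^sup>2) powr (D / 2 - 2)) * ennreal (Gamma (D / 2 - 1))"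
    proof (subst nn_integral_cmult)
      have "((\<lambda>t. t powr (D / 2 - 1 - 1) / exp t) has_integral Gamma (D / 2 - 1)) {0..}"
        using D by (intro Gamma_integral_real) auto
      from nn_integral_has_integral_lebesgue[OF _ this]
      show "ennreal (c * (2 / r\<^sup>2) powr (D / 2 - 2)) * (\<integral>\<^sup>+t. ennreal (t powr (D / 2 - 1 - 1) / exp t * indicator {0..} t) \<partial>lborel)
        = ennreal (c * (2 / r\<^sup>2) powr (D / 2 - 2)) * ennreal (Gamma (D / 2 - 1))"
        by (simp add: mult.commute)
    qed auto
    also have "ennreal \<bar>2 / r\<^sup>2\<bar> * \<dots> = ennreal (2 / r\<^sup>2 * (c * (2 / r\<^sup>2) powr (D / 2 - 2) * Gamma (D / 2 - 1)))"
    proof -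
      have "ennreal \<bar>X\<bar> * (ennreal Y * ennreal Z) = ennreal (X * (Y * Z))" if "X \<ge> 0" "Y \<ge> 0" "Z \<ge> 0" for X Y Z
        using that by (simp add: ennreal_mult)
      then show ?thesis using c(2) GG by simp
    qed
    also have "2 / r\<^sup>2 * (c * (2 / r\<^sup>2) powr (D / 2 - 2) * Gamma (D / 2 - 1)) = C * newton (x - y)"
    proof -
      have "2 / r\<^sup>2 * (2 / r\<^sup>2) powr (D / 2 - 2) = (2 / r\<^sup>2) powr (1 + (D / 2 - 2))"
        using r unfolding powr_add by simp
      also have "\<dots> = 2 powr (D / 2 - 1) * (r powr 2) powr (- (D / 2 - 1))"
      proof -
        have "1 + (D / 2 - 2) = D / 2 - 1" by simp
        moreover have "r\<^sup>2 = r powr 2" using r by simp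
        ultimately show ?thesis using powr_minus_divide[of "r powr 2" "D / 2 - 1"] powr_divide[of 2 "r powr 2" "D / 2 - 1"]
          by (simp only: powr_ge_zero) simp
      qed
      also have "(r powr 2) powr (- (D / 2 - 1)) = newton (x - y)"
        unfolding newton_def r_def D_def by (simp only: powr_powr) (simp add: algebra_simps)
      finally show ?thesis unfolding C_def by (simp add: mult_ac)
    qed
    finally show ?thesis .
  qed
  ultimately show thesis by (rule that)
qed


lemma AE_lborel_pair_neq: "AE z in (lborel :: 'a::euclidean_space measure) \<Otimes>\<^sub>M lborel. fst z \<noteq> snd z"
proof (rule lborel_pair.AE_pair_measure)
  show "AE x in lborel. AE y in lborel. fst (x::'a, y) \<noteq> snd (x, y)"
  proof (rule AE_I2)
    fix x :: 'a
    show "AE y in lborel. fst (x, y) \<noteq> snd (x, y)"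
      using AE_lborel_singleton[of x] by eventually_elim auto
  qed
qed measurable

text \<open>Inserting the Gaussian representation and exchanging integrals yields a weighted
  integral of squares of the pairings of f with Gaussians. The exchange is justified by the same
  representation for |f|, whose energy is finite.\<close>

lemma hls_nonneg_self:
  fixes f :: "'a::euclidean_space \<Rightarrow> real"
  assumes d: "DIM('a) \<ge> 3" and f: "f \<in> Lhp"
  shows "hls f f \<ge> 0"
proof -
  have [measurable]: "f \<in> borel_measurable borel" using f by (rule LhpD)
  define \<phi> where "\<phi> = (\<lambda>(w::real \<times> 'a) (x::'a). exp (- (fst w * (norm (x - snd w))\<^sup>2)))"
  define \<tau> where "\<tau> = (\<lambda>w::real \<times> 'a. indicator {0<..} (fst w) * fst w powr (real DIM('a) - 2))"
  obtain C where C: "C > 0" and rep: "\<And>x y :: 'a. x \<noteq> y \<Longrightarrow>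
     (\<integral>\<^sup>+w. ennreal (\<tau> w * (\<phi> w x * \<phi> w y)) \<partial>(lborel \<Otimes>\<^sub>M lborel)) = ennreal (C * newton (x - y))"
    by (rule newton_gaussian[OF d], rule that) (simp_all add: \<phi>_def \<tau>_def)
  have [measurable]: "(\<lambda>(z, w). \<phi> w (fst z)) \<in> borel_measurable ((lborel \<Otimes>\<^sub>M lborel) \<Otimes>\<^sub>M (lborel \<Otimes>\<^sub>M lborel))"
    "(\<lambda>(z, w). \<phi> w (snd z)) \<in> borel_measurable ((lborel \<Otimes>\<^sub>M lborel) \<Otimes>\<^sub>M (lborel \<Otimes>\<^sub>M lborel))"
    "\<tau> \<in> borel_measurable (lborel \<Otimes>\<^sub>M lborel)"
    unfolding \<phi>_def \<tau>_def by measurable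
  have \<tau>0: "\<tau> w \<ge> 0" for w by (simp add: \<tau>_def)
  have \<phi>0: "\<phi> w x \<ge> 0" for w x by (simp add: \<phi>_def)
  define F where "F = (\<lambda>(z :: 'a \<times> 'a, w). (f (fst z) * f (snd z)) * (\<tau> w * (\<phi> w (fst z) * \<phi> w (snd z))))"
  have [measurable]: "F \<in> borel_measurable ((lborel \<Otimes>\<^sub>M lborel) \<Otimes>\<^sub>M (lborel \<Otimes>\<^sub>M lborel))"
    unfolding F_def by measurable
  interpret P: pair_sigma_finite "(lborel :: 'a measure) \<Otimes>\<^sub>M (lborel :: 'a measure)" "(lborel :: real measure) \<Otimes>\<^sub>M (lborel :: 'a measure)" ..
  have sec: "(\<lambda>w. \<tau> w * (\<phi> w x * \<phi> w y)) \<in> borel_measurable (lborel \<Otimes>\<^sub>M lborel)" for x y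
    unfolding \<tau>_def \<phi>_def by measurable
  have Iw: "integrable (lborel \<Otimes>\<^sub>M lborel) (\<lambda>w. \<tau> w * (\<phi> w x * \<phi> w y))"
    "(\<integral>w. \<tau> w * (\<phi> w x * \<phi> w y) \<partial>(lborel \<Otimes>\<^sub>M lborel)) = C * newton (x - y)" if "x \<noteq> y" for x y
  proof -
    show "integrable (lborel \<Otimes>\<^sub>M lborel) (\<lambda>w. \<tau> w * (\<phi> w x * \<phi> w y))"
      using rep[OF that] \<tau>0 \<phi>0 sec by (intro integrableI_bounded) (auto simp: abs_mult)
    show "(\<integral>w. \<tau> w * (\<phi> w x * \<phi> w y) \<partial>(lborel \<Otimes>\<^sub>M lborel)) = C * newton (x - y)"
      using rep[OF that] \<tau>0 \<phi>0 C sec by (subst integral_eq_nn_integral) (auto intro!: AE_I2)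
  qed
  note I2 = hls_integrable[OF d f f]
  have FI: "integrable ((lborel \<Otimes>\<^sub>M lborel) \<Otimes>\<^sub>M (lborel \<Otimes>\<^sub>M lborel)) F"
  proof (rule P.Fubini_integrable)
    show "AE z in lborel \<Otimes>\<^sub>M lborel. integrable (lborel \<Otimes>\<^sub>M lborel) (\<lambda>w. F (z, w))"
      using AE_lborel_pair_neq by eventually_elim (auto simp: F_def intro!: integrable_mult_right Iw)
    have "integrable (lborel \<Otimes>\<^sub>M lborel) (\<lambda>z. C * \<bar>f (fst z) * newton (fst z - snd z) * f (snd z)\<bar>)"
      using I2 by simp
    then show "integrable (lborel \<Otimes>\<^sub>M lborel) (\<lambda>z. LINT w|(lborel \<Otimes>\<^sub>M lborel). norm (F (z, w)))"
    proof (rule integrable_cong_AE_imp)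
      show "AE z in lborel \<Otimes>\<^sub>M lborel. C * \<bar>f (fst z) * newton (fst z - snd z) * f (snd z)\<bar> = (LINT w|(lborel \<Otimes>\<^sub>M lborel). norm (F (z, w)))"
        using AE_lborel_pair_neq
      proof eventually_elim
        case (elim z)
        have "(LINT w|(lborel \<Otimes>\<^sub>M lborel). norm (F (z, w))) = (LINT w|(lborel \<Otimes>\<^sub>M lborel). \<bar>f (fst z) * f (snd z)\<bar> * (\<tau> w * (\<phi> w (fst z) * \<phi> w (snd z))))"
          using \<tau>0 \<phi>0 by (simp add: F_def abs_mult)
        also have "\<dots> = \<bar>f (fst z) * f (snd z)\<bar> * (C * newton (fst z - snd z))"
          using Iw(2)[OF elim] by simp
        finally show ?case using C by (simp add: abs_mult mult_ac)
      qed
    qed simp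
  qed simp
  have FI': "integrable ((lborel \<Otimes>\<^sub>M lborel) \<Otimes>\<^sub>M (lborel \<Otimes>\<^sub>M lborel)) (\<lambda>(z, w). F (z, w))"
    using FI by simp
  have "C * hls f f = (\<integral>z. \<integral>w. F (z, w) \<partial>(lborel \<Otimes>\<^sub>M lborel) \<partial>(lborel \<Otimes>\<^sub>M lborel))"
  proof -
    have "C * hls f f = (\<integral>z. C * (f (fst z) * newton (fst z - snd z) * f (snd z)) \<partial>(lborel \<Otimes>\<^sub>M lborel))"
      unfolding hls_def by simp
    also have "\<dots> = (\<integral>z. \<integral>w. F (z, w) \<partial>(lborel \<Otimes>\<^sub>M lborel) \<partial>(lborel \<Otimes>\<^sub>M lborel))"
    proof (rule integral_cong_AE)
      show "AE z in lborel \<Otimes>\<^sub>M lborel. C * (f (fst z) * newton (fst z - snd z) * f (snd z)) = (\<integral>w. F (z, w) \<partial>(lborel \<Otimes>\<^sub>M lborel))"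
        using AE_lborel_pair_neq
      proof eventually_elim
        case (elim z)
        have "(\<integral>w. F (z, w) \<partial>(lborel \<Otimes>\<^sub>M lborel)) = f (fst z) * f (snd z) * (C * newton (fst z - snd z))"
          unfolding F_def prod.case by (simp only: integral_mult_right_zero Iw(2)[OF elim])
        then show ?case by (simp add: mult_ac)
      qed
    qed simp_all
    finally show ?thesis .
  qed
  also have "\<dots> = (\<integral>w. \<integral>z. F (z, w) \<partial>(lborel \<Otimes>\<^sub>M lborel) \<partial>(lborel \<Otimes>\<^sub>M lborel))"
    by (rule P.Fubini_integral[symmetric]) (use FI in \<open>simp add: case_prod_beta'\<close>)
  also have "\<dots> \<ge> 0"
  proof (rule integral_nonneg_AE)
    show "AE w in lborel \<Otimes>\<^sub>M lborel. 0 \<le> (\<integral>z. F (z, w) \<partial>(lborel \<Otimes>\<^sub>M lborel))"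
      using P.AE_integrable_snd[OF FI']
    proof eventually_elim
      case (elim w)
      have "(\<integral>z. F (z, w) \<partial>(lborel \<Otimes>\<^sub>M lborel)) = (\<integral>x. \<integral>y. F ((x, y), w) \<partial>lborel \<partial>lborel)"
        by (rule lborel_pair.integral_fst'[symmetric]) (use elim in simp)
      also have "\<dots> = (\<integral>x. \<integral>y. \<tau> w * (f x * \<phi> w x) * (f y * \<phi> w y) \<partial>lborel \<partial>lborel)"
        by (simp add: F_def mult_ac)
      also have "\<dots> = \<tau> w * (\<integral>x. f x * \<phi> w x \<partial>lborel) * (\<integral>y. f y * \<phi> w y \<partial>lborel)"
        by (simp only: integral_mult_right_zero integral_mult_left_zero)
      finally show ?case using \<tau>0[of w] by (simp add: mult.assoc)
    qed
  qed
  finally show ?thesis using C by (simp add: zero_le_mult_iff)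
qed

lemma hls_Cauchy_Schwarz:
  fixes f g :: "'a::euclidean_space \<Rightarrow> real"
  assumes d: "DIM('a) \<ge> 3" and f: "f \<in> Lhp" and g: "g \<in> Lhp"
  shows "(hls f g)\<^sup>2 \<le> hls f f * hls g g"
proof -
  define A B C where "A = hls f f" and "B = hls f g" and "C = hls g g"
  have fg: "f \<in> borel_measurable borel" "g \<in> borel_measurable borel" using f g by (auto dest: LhpD)
  have q: "0 \<le> A + 2 * t * B + t\<^sup>2 * C" for t
  proof -
    have tg: "(\<lambda>x. t * g x) \<in> Lhp" by (intro Lhp_scale g)
    have ftg: "(\<lambda>x. f x + t * g x) \<in> Lhp" by (intro Lhp_add f tg)
    have m: "(\<lambda>x. t * g x) \<in> borel_measurable borel" "(\<lambda>x. f x + t * g x) \<in> borel_measurable borel"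
      using tg ftg by (auto dest: LhpD)
    have 1: "hls (\<lambda>x. f x + t * g x) h = hls f h + t * hls g h" if "h \<in> Lhp" for h
      using hls_add_left[OF d f tg that] hls_scale_left[of t g h] by simp
    have "hls (\<lambda>x. f x + t * g x) (\<lambda>x. f x + t * g x)
      = hls f (\<lambda>x. f x + t * g x) + t * hls g (\<lambda>x. f x + t * g x)"
      by (rule 1[OF ftg])
    also have "\<dots> = hls (\<lambda>x. f x + t * g x) f + t * hls (\<lambda>x. f x + t * g x) g"
      using hls_commute[OF fg(1) m(2)] hls_commute[OF fg(2) m(2)] by simp
    also have "\<dots> = A + 2 * t * B + t\<^sup>2 * C"
      unfolding 1[OF f] 1[OF g] A_def B_def C_def hls_commute[OF fg(2,1)]
      by (simp add: algebra_simps power2_eq_square)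
    finally show ?thesis using hls_nonneg_self[OF d ftg] by simp
  qed
  have C0: "C \<ge> 0" using hls_nonneg_self[OF d g] by (simp add: C_def)
  show ?thesis unfolding A_def[symmetric] B_def[symmetric] C_def[symmetric]
  proof (cases "C = 0")
    case True
    \<comment> \<open>With \<open>C = 0\<close> the quadratic is affine in t, and a nonzero slope
      would give it the value -1 at the chosen t.\<close>
    have "B = 0"
    proof (rule ccontr)
      assume "B \<noteq> 0"
      then have "A + 2 * (- (A + 1) / (2 * B)) * B = -1" by (simp add: field_simps)
      then show False using q[of "- (A + 1) / (2 * B)"] True by simp
    qed
    then show "B\<^sup>2 \<le> A * C" using True by simp
  next
    case False
    then have "C > 0" using C0 by simp
    have "A + 2 * (- B / C) * B + (- B / C)\<^sup>2 * C = A - B\<^sup>2 / C"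
      using False by (simp add: field_simps power2_eq_square)
    then have "B\<^sup>2 / C \<le> A" using q[of "- B / C"] by simp
    then show "B\<^sup>2 \<le> A * C" using \<open>C > 0\<close> by (simp add: field_simps)
  qed
qed

section \<open>The best constant\<close>

definition hls_M :: "'a::euclidean_space itself \<Rightarrow> real" where
  "hls_M _ = Sup {hls f f | f :: 'a \<Rightarrow> real. f \<in> Lhp \<and> (\<forall>x. 0 \<le> f x) \<and> (\<integral>x. f x powr hp TYPE('a) \<partial>lborel) = 1}"

lemma hls_cong_AE:
  fixes f g :: "'a::euclidean_space \<Rightarrow> real"
  assumes d: "DIM('a) \<ge> 3" and f: "f \<in> Lhp" and g: "g \<in> Lhp" and eq: "AE x in lborel. f x = g x"
  shows "hls f f = hls g g"
proof -
  have m: "f \<in> borel_measurable borel" "g \<in> borel_measurable borel" using f g by (auto dest: LhpD)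
  note [measurable] = m
  have 1: "hls f h = hls g h" if "h \<in> Lhp" for h
  proof -
    have [measurable]: "h \<in> borel_measurable borel" using that by (rule LhpD)
    show ?thesis unfolding hls_pot(2)[OF d f that] hls_pot(2)[OF d g that]
      using eq by (intro integral_cong_AE) (auto elim!: eventually_mono)
  qed
  show ?thesis using 1[OF f] 1[OF g] hls_commute[OF m] by simp
qed

lemma hls_bdd:
  assumes d: "DIM('a::euclidean_space) \<ge> 3"
  shows "bdd_above {hls f f | f :: 'a \<Rightarrow> real. f \<in> Lhp \<and> (\<forall>x. 0 \<le> f x) \<and> (\<integral>x. f x powr hp TYPE('a) \<partial>lborel) = 1}"
proof (rule bdd_aboveI, safe)
  fix f :: "'a \<Rightarrow> real"
  assume f: "f \<in> Lhp" and f0: "\<forall>x. 0 \<le> f x" and f1: "(\<integral>x. f x powr hp TYPE('a) \<partial>lborel) = 1"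
  have [measurable]: "f \<in> borel_measurable borel" using f by (rule LhpD)
  have "integrable lborel (\<lambda>x. f x powr hp TYPE('a))" using LhpD(2)[OF f] f0 by simp
  then have "(\<integral>\<^sup>+x. ennreal (f x powr hp TYPE('a)) \<partial>lborel) = 1"
    by (subst nn_integral_eq_integral) (auto simp: f1)
  then have W: "(\<integral>\<^sup>+x. \<integral>\<^sup>+y. ennreal (f x * newton (x - y) * f y) \<partial>lborel \<partial>lborel) \<le> ennreal (hls_C TYPE('a))"
    using f0 by (intro hls_weak_nn[OF d]) auto
  have "ennreal (hls f f) = (\<integral>\<^sup>+z. ennreal (f (fst z) * newton (fst z - snd z) * f (snd z)) \<partial>(lborel \<Otimes>\<^sub>M lborel))"
    unfolding hls_def using f0 by (intro nn_integral_eq_integral[symmetric] hls_integrable[OF d f f] AE_I2) auto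
  also have "\<dots> = (\<integral>\<^sup>+x. \<integral>\<^sup>+y. ennreal (f x * newton (x - y) * f y) \<partial>lborel \<partial>lborel)"
    by (subst lborel.nn_integral_fst[symmetric]) auto
  also note W
  finally show "hls f f \<le> hls_C TYPE('a)"
    using hls_C_pos[where 'a='a] by (simp add: ennreal_le_iff2)
qed

text \<open>Homogeneity. If the norm is 0, then f vanishes almost everywhere and so does its
  energy.\<close>

lemma hls_le_M:
  fixes f :: "'a::euclidean_space \<Rightarrow> real"
  assumes d: "DIM('a) \<ge> 3" and f: "f \<in> Lhp" and f0: "\<And>x. 0 \<le> f x"
  shows "hls f f \<le> hls_M TYPE('a) * (\<integral>x. f x powr hp TYPE('a) \<partial>lborel) powr (2 / hp TYPE('a))"
proof -
  define p where "p = hp TYPE('a)"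
  note pq = hp_hq[OF d, folded p_def]
  define N where "N = (\<integral>x. f x powr p \<partial>lborel)"
  have [measurable]: "f \<in> borel_measurable borel" using f by (rule LhpD)
  have fI: "integrable lborel (\<lambda>x. f x powr p)" using LhpD(2)[OF f] f0 by (simp add: p_def)
  have N0: "N \<ge> 0" unfolding N_def by (intro integral_nonneg_AE) auto
  show ?thesis unfolding p_def[symmetric] N_def[symmetric]
  proof (cases "N = 0")
    case True
    then have "AE x in lborel. f x powr p = 0"
      unfolding N_def using integral_nonneg_eq_0_iff_AE[OF fI] by simp
    then have "AE x in lborel. f x = 0" by eventually_elim simp
    moreover have "(\<lambda>x. 0) \<in> Lhp" by (simp add: Lhp_def)
    ultimately have "hls f f = hls (\<lambda>x::'a. 0) (\<lambda>x. 0)" by (intro hls_cong_AE[OF d f]) auto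
    then show "hls f f \<le> hls_M TYPE('a) * N powr (2 / p)" using True by (simp add: hls_def)
  next
    case False
    then have N: "N > 0" using N0 by simp
    define l where "l = N powr (- 1 / p)"
    have l: "l > 0" using N by (simp add: l_def)
    have lp: "l powr p = 1 / N" using N pq(1) unfolding l_def powr_powr by (simp add: powr_minus_divide)
    have "(\<integral>x. (l * f x) powr p \<partial>lborel) = 1"
      using l f0 N by (simp add: powr_mult lp N_def[symmetric])
    moreover have "(\<lambda>x. l * f x) \<in> Lhp" by (rule Lhp_scale[OF f])
    ultimately have "hls (\<lambda>x. l * f x) (\<lambda>x. l * f x) \<le> hls_M TYPE('a)"
      unfolding hls_M_def using l f0 by (intro cSup_upper hls_bdd[OF d]) (auto simp: p_def)
    also have "hls (\<lambda>x. l * f x) (\<lambda>x. l * f x) = l\<^sup>2 * hls f f"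
      unfolding hls_def power2_eq_square by (subst integral_mult_right_zero[symmetric]) (simp add: mult_ac)
    finally have "hls f f \<le> hls_M TYPE('a) * (1 / l\<^sup>2)" using l by (simp add: field_simps)
    also have "1 / l\<^sup>2 = N powr (2 / p)"
    proof -
      have "l\<^sup>2 = N powr (- (2 / p))" unfolding l_def power2_eq_square by (simp flip: powr_add)
      then show ?thesis by (simp add: powr_minus_divide)
    qed
    finally show "hls f f \<le> hls_M TYPE('a) * N powr (2 / p)" .
  qed
qed

section \<open>Symbol classes and bubbles\<close>


lemma jb_neq_0 [simp]: "jb x \<noteq> 0" using jb_pos[of x] by linarith

text \<open>A symbol calculus along one direction i: \<open>v\<close> decays at the rate k and its
  derivative one power faster. The derivative is carried as an argument, so the rules for sums and
  products compute it, and the decay recorded along with it decides whether boundary terms at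
  infinity vanish.\<close>

definition sb :: "'a::euclidean_space \<Rightarrow> real \<Rightarrow> ('a \<Rightarrow> real) \<Rightarrow> ('a \<Rightarrow> real) \<Rightarrow> bool" where
  "sb i k v v' \<longleftrightarrow> continuous_on UNIV v \<and> continuous_on UNIV v' \<and>
     (\<forall>x. ((\<lambda>t. v (x + t *\<^sub>R i)) has_real_derivative v' x) (at 0)) \<and>
     (\<exists>C. \<forall>x. \<bar>v x\<bar> \<le> C * jb x powr (- k) \<and> \<bar>v' x\<bar> \<le> C * jb x powr (- k - 1))"

lemma sbI:
  assumes "continuous_on UNIV v" "continuous_on UNIV v'"
    "\<And>x. ((\<lambda>t. v (x + t *\<^sub>R i)) has_real_derivative v' x) (at 0)"
    "\<And>x. \<bar>v x\<bar> \<le> C * jb x powr (- k)" "\<And>x. \<bar>v' x\<bar> \<le> C' * jb x powr (- k - 1)"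
  shows "sb i k v v'"
proof -
  have "\<bar>v x\<bar> \<le> max C C' * jb x powr (- k) \<and> \<bar>v' x\<bar> \<le> max C C' * jb x powr (- k - 1)" for x
  proof
    show "\<bar>v x\<bar> \<le> max C C' * jb x powr (- k)"
      by (rule order_trans[OF assms(4)]) (intro mult_right_mono, auto)
    show "\<bar>v' x\<bar> \<le> max C C' * jb x powr (- k - 1)"
      by (rule order_trans[OF assms(5)]) (intro mult_right_mono, auto)
  qed
  then show ?thesis unfolding sb_def by (intro conjI exI[of _ "max C C'"] allI assms(1-3))  auto
qed

lemma sbD:
  assumes "sb i k v v'"
  shows "continuous_on UNIV v" "continuous_on UNIV v'" "v \<in> borel_measurable borel" "v' \<in> borel_measurable borel"
    "((\<lambda>t. v (x + t *\<^sub>R i)) has_real_derivative v' x) (at 0)"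
  using assms borel_measurable_continuous_onI[of v] borel_measurable_continuous_onI[of v'] unfolding sb_def by simp_all

lemma sb_bound:
  assumes "sb i k v v'"
  obtains C where "C \<ge> 0" "\<And>x. \<bar>v x\<bar> \<le> C * jb x powr (- k)" "\<And>x. \<bar>v' x\<bar> \<le> C * jb x powr (- k - 1)"
proof -
  obtain C where C: "\<bar>v x\<bar> \<le> C * jb x powr (- k)" "\<bar>v' x\<bar> \<le> C * jb x powr (- k - 1)" for x
    using assms unfolding sb_def by blast
  have "C \<ge> 0" using order_trans[OF abs_ge_zero C(1)[of 0]] by (simp add: jb_def)
  then show ?thesis using C that by blast
qed

lemma sb_mult:
  assumes "sb i k v v'" "sb i l w w'"
  shows "sb i (k + l) (\<lambda>x. v x * w x) (\<lambda>x. v' x * w x + v x * w' x)"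
proof -
  obtain C where C: "C \<ge> 0" "\<And>x. \<bar>v x\<bar> \<le> C * jb x powr (- k)" "\<And>x. \<bar>v' x\<bar> \<le> C * jb x powr (- k - 1)"
    using sb_bound[OF assms(1)] by metis
  obtain B where B: "B \<ge> 0" "\<And>x. \<bar>w x\<bar> \<le> B * jb x powr (- l)" "\<And>x. \<bar>w' x\<bar> \<le> B * jb x powr (- l - 1)"
    using sb_bound[OF assms(2)] by metis
  show ?thesis
  proof (rule sbI)
    show "continuous_on UNIV (\<lambda>x. v x * w x)" "continuous_on UNIV (\<lambda>x. v' x * w x + v x * w' x)"
      using sbD(1,2)[OF assms(1)] sbD(1,2)[OF assms(2)] by (auto intro!: continuous_intros)
    show "((\<lambda>t. v (x + t *\<^sub>R i) * w (x + t *\<^sub>R i)) has_real_derivative v' x * w x + v x * w' x) (at 0)" for x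
      using DERIV_mult[OF sbD(5)[OF assms(1)] sbD(5)[OF assms(2)], of x x] by (simp add: algebra_simps)
    fix x
    have "\<bar>v x * w x\<bar> \<le> (C * jb x powr (- k)) * (B * jb x powr (- l))"
      unfolding abs_mult using B C by (intro mult_mono) auto
    also have "\<dots> = C * B * jb x powr (- (k + l))" by (simp add: powr_add[symmetric] mult_ac add.commute)
    finally show "\<bar>v x * w x\<bar> \<le> C * B * jb x powr (- (k + l))" .
    have "\<bar>v' x * w x + v x * w' x\<bar> \<le> \<bar>v' x * w x\<bar> + \<bar>v x * w' x\<bar>" by simp
    also have "\<dots> \<le> (C * jb x powr (- k - 1)) * (B * jb x powr (- l)) + (C * jb x powr (- k)) * (B * jb x powr (- l - 1))"
      unfolding abs_mult using B C by (intro add_mono mult_mono) auto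
    also have "\<dots> = C * B * (jb x powr (- k - 1) * jb x powr (- l)) + C * B * (jb x powr (- k) * jb x powr (- l - 1))"
      by (simp add: mult_ac)
    also have "\<dots> = (2 * C * B) * jb x powr (- (k + l) - 1)"
      unfolding powr_add[symmetric] by (simp add: algebra_simps)
    finally show "\<bar>v' x * w x + v x * w' x\<bar> \<le> (2 * C * B) * jb x powr (- (k + l) - 1)" .
  qed
qed

lemma sb_add:
  assumes "sb i k v v'" "sb i k w w'"
  shows "sb i k (\<lambda>x. v x + w x) (\<lambda>x. v' x + w' x)"
proof -
  obtain C where C: "C \<ge> 0" "\<And>x. \<bar>v x\<bar> \<le> C * jb x powr (- k)" "\<And>x. \<bar>v' x\<bar> \<le> C * jb x powr (- k - 1)"
    using sb_bound[OF assms(1)] by metis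
  obtain B where B: "B \<ge> 0" "\<And>x. \<bar>w x\<bar> \<le> B * jb x powr (- k)" "\<And>x. \<bar>w' x\<bar> \<le> B * jb x powr (- k - 1)"
    using sb_bound[OF assms(2)] by metis
  show ?thesis
  proof (rule sbI)
    show "continuous_on UNIV (\<lambda>x. v x + w x)" "continuous_on UNIV (\<lambda>x. v' x + w' x)"
      using sbD(1,2)[OF assms(1)] sbD(1,2)[OF assms(2)] by (auto intro!: continuous_intros)
    show "((\<lambda>t. v (x + t *\<^sub>R i) + w (x + t *\<^sub>R i)) has_real_derivative v' x + w' x) (at 0)" for x
      by (rule DERIV_add[OF sbD(5)[OF assms(1)] sbD(5)[OF assms(2)]])
    show "\<bar>v x + w x\<bar> \<le> (C + B) * jb x powr (- k)" for x
      using C(2)[of x] B(2)[of x] by (simp add: distrib_right)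
    show "\<bar>v' x + w' x\<bar> \<le> (C + B) * jb x powr (- k - 1)" for x
      using C(3)[of x] B(3)[of x] by (simp add: distrib_right)
  qed
qed

lemma sb_scale:
  assumes "sb i k v v'"
  shows "sb i k (\<lambda>x. c * v x) (\<lambda>x. c * v' x)"
proof -
  obtain C where C: "C \<ge> 0" "\<And>x. \<bar>v x\<bar> \<le> C * jb x powr (- k)" "\<And>x. \<bar>v' x\<bar> \<le> C * jb x powr (- k - 1)"
    using sb_bound[OF assms(1)] by metis
  show ?thesis
  proof (rule sbI)
    show "continuous_on UNIV (\<lambda>x. c * v x)" "continuous_on UNIV (\<lambda>x. c * v' x)"
      using sbD(1,2)[OF assms(1)] by (auto intro!: continuous_intros)
    show "((\<lambda>t. c * v (x + t *\<^sub>R i)) has_real_derivative c * v' x) (at 0)" for x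
      by (rule DERIV_cmult[OF sbD(5)[OF assms]])
    show "\<bar>c * v x\<bar> \<le> (\<bar>c\<bar> * C) * jb x powr (- k)" for x
      using C(2)[of x] by (simp add: abs_mult mult.assoc mult_left_mono)
    show "\<bar>c * v' x\<bar> \<le> (\<bar>c\<bar> * C) * jb x powr (- k - 1)" for x
      using C(3)[of x] by (simp add: abs_mult mult.assoc mult_left_mono)
  qed
qed

lemma sb_mono:
  assumes "sb i k v v'" "l \<le> k"
  shows "sb i l v v'"
proof -
  obtain C where C: "C \<ge> 0" "\<And>x. \<bar>v x\<bar> \<le> C * jb x powr (- k)" "\<And>x. \<bar>v' x\<bar> \<le> C * jb x powr (- k - 1)"
    using sb_bound[OF assms(1)] by metis
  have p: "jb x powr a \<le> jb x powr b" if "a \<le> b" for x :: 'a and a b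
    using that jb_ge_1[of x] by (intro powr_mono) auto
  show ?thesis
  proof (rule sbI[OF sbD(1,2,5)[OF assms(1)]])
    show "\<bar>v x\<bar> \<le> C * jb x powr (- l)" for x
      using C(2)[of x] mult_left_mono[OF p C(1), of "- k" "- l" x] assms(2) by linarith
    show "\<bar>v' x\<bar> \<le> C * jb x powr (- l - 1)" for x
      using C(3)[of x] mult_left_mono[OF p C(1), of "- k - 1" "- l - 1" x] assms(2) by linarith
  qed
qed

lemma sb_const: "sb i 0 (\<lambda>x. c) (\<lambda>x. 0)"
  by (rule sbI[where C = "\<bar>c\<bar>" and C' = 0]) (auto intro!: derivative_eq_intros continuous_intros)

lemma sb_coord:
  assumes "norm i = 1"
  shows "sb i (-1) (\<lambda>x. (x - a) \<bullet> j) (\<lambda>x. i \<bullet> j)"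
proof (rule sbI)
  show "((\<lambda>t. (x + t *\<^sub>R i - a) \<bullet> j) has_real_derivative i \<bullet> j) (at 0)" for x
    by (simp add: inner_simps) (auto intro!: derivative_eq_intros)
  show "\<bar>(x - a) \<bullet> j\<bar> \<le> (1 + norm a) * norm j * jb x powr (- (- 1))" for x
  proof -
    have "\<bar>(x - a) \<bullet> j\<bar> \<le> norm (x - a) * norm j" by (rule Cauchy_Schwarz_ineq2)
    also have "norm (x - a) \<le> norm x + norm a" by (rule norm_triangle_ineq4)
    also have "norm x + norm a \<le> jb x + norm a * jb x"
      using norm_le_jb[of x] mult_left_mono[OF jb_ge_1[of x], of "norm a"] by simp
    finally show ?thesis by (simp add: algebra_simps mult_right_mono)
  qed
  show "\<bar>i \<bullet> j\<bar> \<le> norm j * jb x powr (- (- 1) - 1)" for x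
    using Cauchy_Schwarz_ineq2[of i j] assms by (simp add: less_imp_neq[OF jb_pos, symmetric])
qed (auto intro!: continuous_intros)

lemma jb_shift_bound:
  fixes a :: "'a::euclidean_space"
  assumes "s > 0"
  obtains C where "C > 0" "\<And>x. (jb x)\<^sup>2 \<le> C * (s\<^sup>2 + (norm (x - a))\<^sup>2)"
proof
  let ?C = "(1 + 2 * (norm a)\<^sup>2) / s\<^sup>2 + 2"
  show "?C > 0" using assms by (simp add: add_nonneg_pos)
  fix x
  have "(norm x)\<^sup>2 \<le> (norm (x - a) + norm a)\<^sup>2"
    using norm_triangle_ineq[of "x - a" a] by (intro power_mono) auto
  also have "\<dots> \<le> 2 * (norm (x - a))\<^sup>2 + 2 * (norm a)\<^sup>2"
    using sum_squares_bound[of "norm (x - a)" "norm a"] by (simp add: power2_sum)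
  finally have 1: "(jb x)\<^sup>2 \<le> 1 + 2 * (norm a)\<^sup>2 + 2 * (norm (x - a))\<^sup>2" by (simp add: jb_def)
  have 2: "?C * (s\<^sup>2 + (norm (x - a))\<^sup>2) = (1 + 2 * (norm a)\<^sup>2) + 2 * (norm (x - a))\<^sup>2
     + (2 * s\<^sup>2 + (1 + 2 * (norm a)\<^sup>2) / s\<^sup>2 * (norm (x - a))\<^sup>2)"
    using assms by (simp add: field_simps)
  have "0 \<le> 2 * s\<^sup>2 + (1 + 2 * (norm a)\<^sup>2) / s\<^sup>2 * (norm (x - a))\<^sup>2" by simp
  then show "(jb x)\<^sup>2 \<le> ?C * (s\<^sup>2 + (norm (x - a))\<^sup>2)" using 1 2 by linarith
qed

lemma bubble_le_jb:
  fixes a :: "'a::euclidean_space"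
  assumes "C > 0" "(jb x)\<^sup>2 \<le> C * (s\<^sup>2 + (norm (x - a))\<^sup>2)" "b \<ge> 0" "s > 0"
  shows "(s\<^sup>2 + (norm (x - a))\<^sup>2) powr (- b / 2) \<le> C powr (b / 2) * jb x powr (- b)"
proof -
  have pos: "s\<^sup>2 + (norm (x - a))\<^sup>2 > 0" using assms by (simp add: add_pos_nonneg)
  have "(s\<^sup>2 + (norm (x - a))\<^sup>2) powr (- b / 2) \<le> ((jb x)\<^sup>2 / C) powr (- b / 2)"
    using assms pos jb_pos[of x] by (intro powr_mono2') (auto simp: field_simps)
  also have "\<dots> = C powr (b / 2) * ((jb x)\<^sup>2) powr (- b / 2)"
    using assms jb_pos[of x] by (simp add: powr_divide powr_minus_divide)
  also have "((jb x)\<^sup>2) powr (- b / 2) = (jb x powr 2) powr (- b / 2)" by simp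
  also have "\<dots> = jb x powr (- b)" by (simp only: powr_powr) simp
  finally show ?thesis .
qed

lemma sb_bubble:
  fixes a :: "'a::euclidean_space"
  assumes i: "norm i = 1" and s: "s > 0" and b: "b \<ge> 0"
  shows "sb i b (\<lambda>x. (s\<^sup>2 + (norm (x - a))\<^sup>2) powr (- b / 2))
    (\<lambda>x. - b * ((x - a) \<bullet> i) * (s\<^sup>2 + (norm (x - a))\<^sup>2) powr (- (b + 2) / 2))"
proof -
  have pos: "s\<^sup>2 + (norm y)\<^sup>2 > 0" for y :: 'a using s by (simp add: add_pos_nonneg)
  obtain C where C: "C > 0" "\<And>x. (jb x)\<^sup>2 \<le> C * (s\<^sup>2 + (norm (x - a))\<^sup>2)"
    using jb_shift_bound[OF s] by metis
  show ?thesis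
  proof (rule sbI)
    show "continuous_on UNIV (\<lambda>x. (s\<^sup>2 + (norm (x - a))\<^sup>2) powr (- b / 2))"
      using s by (intro continuous_intros) auto
    show "continuous_on UNIV (\<lambda>x. - b * ((x - a) \<bullet> i) * (s\<^sup>2 + (norm (x - a))\<^sup>2) powr (- (b + 2) / 2))"
      using s by (intro continuous_intros) auto
    fix x
    have e: "(norm (x + t *\<^sub>R i - a))\<^sup>2 = (norm (x - a))\<^sup>2 + 2 * t * ((x - a) \<bullet> i) + t\<^sup>2" for t
    proof -
      have "i \<bullet> i = 1" using i by (simp add: norm_eq_1)
      then show ?thesis unfolding power2_norm_eq_inner
        by (simp add: inner_simps inner_commute algebra_simps power2_eq_square)
    qed
    have "((\<lambda>t. (s\<^sup>2 + ((norm (x - a))\<^sup>2 + 2 * t * ((x - a) \<bullet> i) + t\<^sup>2)) powr (- b / 2)) has_real_derivative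
       (- b / 2) * (s\<^sup>2 + (norm (x - a))\<^sup>2) powr (- b / 2 - 1) * (2 * ((x - a) \<bullet> i))) (at 0)"
      using pos[of "x - a"] by (auto intro!: derivative_eq_intros)
    moreover have "(- b / 2) * (s\<^sup>2 + (norm (x - a))\<^sup>2) powr (- b / 2 - 1) * (2 * ((x - a) \<bullet> i))
       = - b * ((x - a) \<bullet> i) * (s\<^sup>2 + (norm (x - a))\<^sup>2) powr (- (b + 2) / 2)"
    proof -
      have e2: "- b / 2 - 1 = - (b + 2) / 2" by (simp add: field_simps)
      show ?thesis unfolding e2 by simp
    qed
    ultimately show "((\<lambda>t. (s\<^sup>2 + (norm (x + t *\<^sub>R i - a))\<^sup>2) powr (- b / 2)) has_real_derivative
       - b * ((x - a) \<bullet> i) * (s\<^sup>2 + (norm (x - a))\<^sup>2) powr (- (b + 2) / 2)) (at 0)"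
      unfolding e by (simp only:)
    show "\<bar>(s\<^sup>2 + (norm (x - a))\<^sup>2) powr (- b / 2)\<bar> \<le> C powr (b / 2) * jb x powr (- b)"
      using bubble_le_jb[OF C(1) C(2)[of x] b s] by simp
    have "\<bar>(x - a) \<bullet> i\<bar> \<le> norm (x - a)" using Cauchy_Schwarz_ineq2[of "x - a" i] i by simp
    also have "\<dots> \<le> (s\<^sup>2 + (norm (x - a))\<^sup>2) powr (1 / 2)"
      using pos[of "x - a"] by (simp add: powr_half_sqrt real_le_rsqrt)
    finally have "\<bar>(x - a) \<bullet> i\<bar> * (s\<^sup>2 + (norm (x - a))\<^sup>2) powr (- (b + 2) / 2)
       \<le> (s\<^sup>2 + (norm (x - a))\<^sup>2) powr (1 / 2) * (s\<^sup>2 + (norm (x - a))\<^sup>2) powr (- (b + 2) / 2)"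
      by (intro mult_right_mono) auto
    also have "\<dots> = (s\<^sup>2 + (norm (x - a))\<^sup>2) powr (- (b + 1) / 2)"
      unfolding powr_add[symmetric] by (simp add: field_simps)
    also have "\<dots> \<le> C powr ((b + 1) / 2) * jb x powr (- (b + 1))"
      using b by (intro bubble_le_jb[OF C(1) C(2)[of x] _ s]) simp
    finally have "b * (\<bar>(x - a) \<bullet> i\<bar> * (s\<^sup>2 + (norm (x - a))\<^sup>2) powr (- (b + 2) / 2)) \<le> b * (C powr ((b + 1) / 2) * jb x powr (- (b + 1)))"
      using b by (intro mult_left_mono)
    moreover have "- (b + 1) = - b - 1" by simp
    ultimately show "\<bar>- b * ((x - a) \<bullet> i) * (s\<^sup>2 + (norm (x - a))\<^sup>2) powr (- (b + 2) / 2)\<bar> \<le> (b * C powr ((b + 1) / 2)) * jb x powr (- b - 1)"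
      using b by (simp only: abs_mult abs_minus_cancel) (simp add: mult.assoc)
  qed
qed

section \<open>Integration by parts on the whole space\<close>

text \<open>Difference quotients of an integrable function have integral 0 by translation
  invariance. The mean value theorem bounds them by a multiple of
  \<open>jb x powr (- (k + 1))\<close>, uniformly in the step, so the limit may be taken under the
  integral.\<close>

lemma integral_sb_aux:
  fixes v :: "'a::euclidean_space \<Rightarrow> real"
  assumes i: "norm i = 1" and v: "sb i k v v'" and k: "k > real DIM('a)"
  shows "integrable lborel v'" "(\<integral>x. v' x \<partial>lborel) = 0"
proof -
  note [measurable] = sbD(3,4)[OF v]
  obtain C where C: "C \<ge> 0" "\<And>x. \<bar>v x\<bar> \<le> C * jb x powr (- k)" "\<And>x. \<bar>v' x\<bar> \<le> C * jb x powr (- k - 1)"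
    using sb_bound[OF v] by metis
  have k0: "k > 0" using k of_nat_0_le_iff[of "DIM('a)", where 'a=real] by linarith
  have Iv: "integrable lborel v"
    by (rule Bochner_Integration.integrable_bound[OF integrable_mult_right[OF jb_powr_integrable[OF k], of C]])
      (use C in \<open>auto intro!: AE_I2 order_trans[OF C(2) abs_ge_self]\<close>)
  define h where "h = (\<lambda>n::nat. 1 / (real n + 1))"
  have h: "h n > 0" "h n \<le> 1" for n by (auto simp: h_def)
  define g where "g = (\<lambda>n x. (v (x + h n *\<^sub>R i) - v x) / h n)"
  have lim: "(\<lambda>n. g n x) \<longlonglongrightarrow> v' x" for x
  proof -
    have "((\<lambda>t. (v (x + t *\<^sub>R i) - v x) / t) \<longlongrightarrow> v' x) (at 0)"
      using sbD(5)[OF v, of x] by (simp add: has_field_derivative_iff)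
    moreover have "filterlim h (at 0) sequentially"
      unfolding filterlim_at using h by (auto simp: h_def less_imp_neq[symmetric] intro!: always_eventually) real_asymp
    ultimately show ?thesis unfolding g_def by (rule filterlim_compose)
  qed
  \<comment> \<open>A shift of length at most 1 changes \<open>jb\<close> at most by the factor
    2.\<close>
  have jbs: "jb x powr (- l) \<le> 2 powr l * jb y powr (- l)" if "norm (x - y) \<le> 1" "l \<ge> 0" for x y :: 'a and l
  proof -
    have "norm y \<le> norm x + 1" using that(1) norm_triangle_ineq2[of y x] by (simp add: norm_minus_commute)
    then have "(norm y)\<^sup>2 \<le> (norm x + 1)\<^sup>2" by (intro power_mono) auto
    also have "\<dots> \<le> 2 * (norm x)\<^sup>2 + 2" using sum_squares_bound[of "norm x" 1] by (simp add: power2_sum)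
    finally have "1 + (norm y)\<^sup>2 \<le> 4 * (1 + (norm x)\<^sup>2)" by (simp add: algebra_simps) (smt (verit) zero_le_power2)
    then have "jb y \<le> sqrt (4 * (1 + (norm x)\<^sup>2))" unfolding jb_def by (rule real_sqrt_le_mono)
    also have "\<dots> = 2 * jb x" unfolding jb_def real_sqrt_mult by simp
    finally have "jb y / 2 \<le> jb x" by simp
    then have "jb x powr (- l) \<le> (jb y / 2) powr (- l)" using that(2) jb_pos[of y] by (intro powr_mono2') auto
    also have "\<dots> = 2 powr l * jb y powr (- l)" using jb_pos[of y] by (simp add: powr_divide powr_minus_divide)
    finally show ?thesis .
  qed
  have bd: "\<bar>g n x\<bar> \<le> C * 2 powr (k + 1) * jb x powr (- (k + 1))" for n x
  proof -
    have D: "((\<lambda>t. v (x + t *\<^sub>R i)) has_real_derivative v' (x + t *\<^sub>R i)) (at t)" for t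
    proof -
      have "((\<lambda>r. v (x + t *\<^sub>R i + r *\<^sub>R i)) has_real_derivative v' (x + t *\<^sub>R i)) (at 0)"
        by (rule sbD(5)[OF v])
      then have "((\<lambda>r. v (x + (r + t) *\<^sub>R i)) has_real_derivative v' (x + t *\<^sub>R i)) (at 0)"
        by (simp add: scaleR_add_left add.assoc add.commute add.left_commute)
      then show ?thesis using DERIV_shift[of "\<lambda>t. v (x + t *\<^sub>R i)" "v' (x + t *\<^sub>R i)" 0 t] by simp
    qed
    obtain t where t: "0 < t" "t < h n" "v (x + h n *\<^sub>R i) - v (x + 0 *\<^sub>R i) = (h n - 0) * v' (x + t *\<^sub>R i)"
      using MVT2[OF h(1)[of n], of "\<lambda>t. v (x + t *\<^sub>R i)" "\<lambda>t. v' (x + t *\<^sub>R i)"] D by auto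
    then have "g n x = v' (x + t *\<^sub>R i)" using h(1)[of n] by (simp add: g_def)
    also have "\<bar>\<dots>\<bar> \<le> C * jb (x + t *\<^sub>R i) powr (- (k + 1))" using C(3)[of "x + t *\<^sub>R i"] by simp
    also have "\<dots> \<le> C * (2 powr (k + 1) * jb x powr (- (k + 1)))"
      using t h(2)[of n] i k0 by (intro mult_left_mono jbs C(1)) auto
    finally show ?thesis by (simp add: mult.assoc)
  qed
  have dom: "integrable lborel (\<lambda>x::'a. C * 2 powr (k + 1) * jb x powr (- (k + 1)))"
    using k by (intro integrable_mult_right jb_powr_integrable) simp
  have [measurable]: "g n \<in> borel_measurable borel" for n unfolding g_def by measurable
  show "integrable lborel v'"
    by (rule integrable_dominated_convergence[OF _ _ dom, of v' g]) (use lim bd in auto)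
  have "(\<lambda>n. \<integral>x. g n x \<partial>lborel) \<longlonglongrightarrow> (\<integral>x. v' x \<partial>lborel)"
    by (rule integral_dominated_convergence[OF _ _ dom]) (use lim bd in auto)
  moreover have "(\<integral>x. g n x \<partial>lborel) = 0" for n
  proof -
    have e: "(\<lambda>x. v (x + h n *\<^sub>R i)) = (\<lambda>x. v (h n *\<^sub>R i + 1 *\<^sub>R x))" by (simp add: add.commute)
    have "integrable lborel (\<lambda>x. v (x + h n *\<^sub>R i))"
      unfolding e using Iv integrable_affine_iff[of v 1 "h n *\<^sub>R i"] by simp
    moreover have "(\<integral>x. v (x + h n *\<^sub>R i) \<partial>lborel) = (\<integral>x. v x \<partial>lborel)"
      unfolding e using integral_affine[of v 1 "h n *\<^sub>R i"] by simp
    ultimately show ?thesis unfolding g_def using Iv by simp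
  qed
  ultimately show "(\<integral>x. v' x \<partial>lborel) = 0" by (simp add: LIMSEQ_const_iff)
qed

text \<open>For rates between d - 1 and d the function itself may fail to be integrable although its
  derivative is. The cutoffs N^2 / (N^2 + |x|^2) are symbols of rate 2, which brings the product
  into reach of \<open>integral_sb_aux\<close>; their derivatives tend to 0 and are bounded by 2 /
  \<open>jb\<close> uniformly in N.\<close>

lemma integral_sb:
  fixes v :: "'a::euclidean_space \<Rightarrow> real"
  assumes i: "norm i = 1" and v: "sb i k v v'" and k: "k > real DIM('a) - 1"
  shows "integrable lborel v'" "(\<integral>x. v' x \<partial>lborel) = 0"
proof -
  note [measurable] = sbD(3,4)[OF v]
  obtain C where C: "C \<ge> 0" "\<And>x. \<bar>v x\<bar> \<le> C * jb x powr (- k)" "\<And>x. \<bar>v' x\<bar> \<le> C * jb x powr (- k - 1)"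
    using sb_bound[OF v] by metis
  have I: "integrable lborel (\<lambda>x::'a. jb x powr (- (k + 1)))" using k by (intro jb_powr_integrable) simp
  show Iv': "integrable lborel v'"
    by (rule Bochner_Integration.integrable_bound[OF integrable_mult_right[OF I, of C]])
      (use C(3) in \<open>auto intro!: AE_I2 order_trans[OF C(3) abs_ge_self]\<close>)
  define c :: "nat \<Rightarrow> 'a \<Rightarrow> real" where "c = (\<lambda>n x. (real (Suc n))\<^sup>2 * ((real (Suc n))\<^sup>2 + (norm (x - 0))\<^sup>2) powr (- 2 / 2))"
  define c' :: "nat \<Rightarrow> 'a \<Rightarrow> real" where "c' = (\<lambda>n x. (real (Suc n))\<^sup>2 * (- 2 * ((x - 0) \<bullet> i) * ((real (Suc n))\<^sup>2 + (norm (x - 0))\<^sup>2) powr (- (2 + 2) / 2)))"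
  have sbc: "sb i 2 (c n) (c' n)" for n unfolding c_def c'_def
    by (intro sb_scale sb_bubble i) auto
  note [measurable] = sbD(3,4)[OF sbc]
  have pos: "(real (Suc n))\<^sup>2 + (norm x)\<^sup>2 > 0" for n and x :: 'a by (simp add: add_pos_nonneg)
  have c: "c n x = (real (Suc n))\<^sup>2 / ((real (Suc n))\<^sup>2 + (norm x)\<^sup>2)" for n x
    using pos[of n x] by (simp add: c_def powr_minus_divide)
  have c': "c' n x = - (2 * (real (Suc n))\<^sup>2 * (x \<bullet> i)) / ((real (Suc n))\<^sup>2 + (norm x)\<^sup>2)\<^sup>2" for n x
    using pos[of n x] by (simp add: c'_def powr_minus_divide mult_ac)
  have c1: "0 \<le> c n x" "c n x \<le> 1" for n x
    using pos[of n x] unfolding c by (auto simp: divide_le_eq)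
  have c'1: "\<bar>c' n x\<bar> \<le> 2 * jb x powr (- 1)" for n x
  proof -
    have xi: "\<bar>x \<bullet> i\<bar> \<le> jb x" using Cauchy_Schwarz_ineq2[of x i] i norm_le_jb[of x] by simp
    have j2: "(jb x)\<^sup>2 \<le> (real (Suc n))\<^sup>2 + (norm x)\<^sup>2" by (simp add: jb_def)
    have "\<bar>c' n x\<bar> = 2 * c n x * \<bar>x \<bullet> i\<bar> / ((real (Suc n))\<^sup>2 + (norm x)\<^sup>2)"
      using pos[of n x] unfolding c c' by (simp add: abs_mult power2_eq_square[of "_ + _"])
    also have "\<dots> \<le> 2 * 1 * jb x / (jb x)\<^sup>2"
      using j2 c1[of n x] xi pos[of n x] by (intro frac_le mult_mono) auto
    also have "\<dots> = 2 * jb x powr (- 1)" using jb_pos[of x] by (simp add: power2_eq_square powr_minus_divide)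
    finally show ?thesis .
  qed
  have zero: "(\<integral>x. v' x * c n x + v x * c' n x \<partial>lborel) = 0" for n
    by (rule integral_sb_aux(2)[OF i sb_mult[OF v sbc]]) (use k in simp)
  have "(\<lambda>n. \<integral>x. v' x * c n x + v x * c' n x \<partial>lborel) \<longlonglongrightarrow> (\<integral>x. v' x \<partial>lborel)"
  proof (rule integral_dominated_convergence)
    show "integrable lborel (\<lambda>x::'a. 3 * C * jb x powr (- (k + 1)))" by (intro integrable_mult_right I)
    show "AE x in lborel. (\<lambda>n. v' x * c n x + v x * c' n x) \<longlonglongrightarrow> v' x"
    proof (rule AE_I2)
      fix x
      have "(\<lambda>n. c n x) \<longlonglongrightarrow> 1" unfolding c by real_asymp
      moreover have "(\<lambda>n. c' n x) \<longlonglongrightarrow> 0" unfolding c' by real_asymp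
      ultimately have "(\<lambda>n. v' x * c n x + v x * c' n x) \<longlonglongrightarrow> v' x * 1 + v x * 0" by (intro tendsto_intros)
      then show "(\<lambda>n. v' x * c n x + v x * c' n x) \<longlonglongrightarrow> v' x" by simp
    qed
    show "AE x in lborel. norm (v' x * c n x + v x * c' n x) \<le> 3 * C * jb x powr (- (k + 1))" for n
    proof (rule AE_I2)
      fix x
      have "norm (v' x * c n x + v x * c' n x) \<le> \<bar>v' x\<bar> * \<bar>c n x\<bar> + \<bar>v x\<bar> * \<bar>c' n x\<bar>"
        by (simp add: abs_mult[symmetric])
      also have "\<dots> \<le> (C * jb x powr (- k - 1)) * 1 + (C * jb x powr (- k)) * (2 * jb x powr (- 1))"
        using C c1[of n x] c'1[of n x] by (intro add_mono mult_mono) auto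
      also have "(C * jb x powr (- k)) * (2 * jb x powr (- 1)) = 2 * C * (jb x powr (- k) * jb x powr (- 1))" by simp
      also have "(C * jb x powr (- k - 1)) * 1 + 2 * C * (jb x powr (- k) * jb x powr (- 1)) = 3 * C * jb x powr (- (k + 1))"
      proof -
        have "- k + - 1 = - k - 1" "- (k + 1) = - k - 1" by auto
        then show ?thesis unfolding powr_add[symmetric] by (simp only:)
      qed
      finally show "norm (v' x * c n x + v x * c' n x) \<le> 3 * C * jb x powr (- (k + 1))" .
    qed
  qed auto
  then show "(\<integral>x. v' x \<partial>lborel) = 0" unfolding zero by (simp add: LIMSEQ_const_iff)
qed


section \<open>Bubbles as smoothed Newton kernels\<close>

text \<open>The factor c for which -\<Delta> |x|^(2-d) is c times the Dirac mass: d - 2 times the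
  area of the unit sphere.\<close>

definition newt_c :: "'a::euclidean_space itself \<Rightarrow> real" where
  "newt_c _ = real DIM('a) * (real DIM('a) - 2) * unit_ball_vol (real DIM('a))"

lemma newt_c_pos: "DIM('a::euclidean_space) \<ge> 3 \<Longrightarrow> newt_c TYPE('a) > 0"
  by (simp add: newt_c_def)

text \<open>The Newton kernel with |z|^2 replaced by s^2 + |z|^2. \<open>bub1\<close> and
  \<open>bub2\<close> are its first and second derivatives along i, and \<open>rho\<close>, minus
  its Laplacian, is a positive bump that concentrates at the origin as s tends to 0.\<close>

definition bub :: "real \<Rightarrow> 'a::euclidean_space \<Rightarrow> real" where
  "bub s z = (s\<^sup>2 + (norm z)\<^sup>2) powr (- (real DIM('a) - 2) / 2)"

definition bub1 :: "'a \<Rightarrow> real \<Rightarrow> 'a::euclidean_space \<Rightarrow> real" where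
  "bub1 i s z = - (real DIM('a) - 2) * (z \<bullet> i) * (s\<^sup>2 + (norm z)\<^sup>2) powr (- real DIM('a) / 2)"

definition bub2 :: "'a \<Rightarrow> real \<Rightarrow> 'a::euclidean_space \<Rightarrow> real" where
  "bub2 i s z = - (real DIM('a) - 2) * ((s\<^sup>2 + (norm z)\<^sup>2) powr (- real DIM('a) / 2)
     - real DIM('a) * (z \<bullet> i)\<^sup>2 * (s\<^sup>2 + (norm z)\<^sup>2) powr (- (real DIM('a) + 2) / 2))"

definition rho :: "real \<Rightarrow> 'a::euclidean_space \<Rightarrow> real" where
  "rho s z = real DIM('a) * (real DIM('a) - 2) * s\<^sup>2 * (s\<^sup>2 + (norm z)\<^sup>2) powr (- (real DIM('a) + 2) / 2)"

lemma bub_measurable [measurable]: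
  "bub s \<in> borel_measurable borel" "bub1 i s \<in> borel_measurable borel" "bub2 i s \<in> borel_measurable borel"
  "rho s \<in> borel_measurable borel"
  unfolding bub_def[abs_def] bub1_def[abs_def] bub2_def[abs_def] rho_def[abs_def] by measurable

lemma bub_nonneg [simp]: "bub s z \<ge> 0" by (simp add: bub_def)
lemma rho_nonneg [simp]: "DIM('a::euclidean_space) \<ge> 3 \<Longrightarrow> rho s (z::'a) \<ge> 0" by (simp add: rho_def)

lemma bub_minus [simp]: "bub s (- z) = bub s z" "rho s (- z) = rho s z"
  by (simp_all add: bub_def rho_def)

lemma sb_bub:
  fixes a i :: "'a::euclidean_space"
  assumes d: "DIM('a) \<ge> 3" and i: "i \<in> Basis" and s: "s > 0"
  shows "sb i (real DIM('a) - 2) (\<lambda>x. bub s (x - a)) (\<lambda>x. bub1 i s (x - a))"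
    "sb i (real DIM('a) - 1) (\<lambda>x. bub1 i s (x - a)) (\<lambda>x. bub2 i s (x - a))"
proof -
  define D where "D = real DIM('a)"
  have D: "D \<ge> 3" using d by (simp add: D_def)
  have ni: "norm i = 1" "i \<bullet> i = 1" using i by auto
  have "sb i (D - 2) (\<lambda>x. (s\<^sup>2 + (norm (x - a))\<^sup>2) powr (- (D - 2) / 2))
    (\<lambda>x. - (D - 2) * ((x - a) \<bullet> i) * (s\<^sup>2 + (norm (x - a))\<^sup>2) powr (- ((D - 2) + 2) / 2))"
    using D by (intro sb_bubble ni s) simp
  then show "sb i (real DIM('a) - 2) (\<lambda>x. bub s (x - a)) (\<lambda>x. bub1 i s (x - a))"
    unfolding bub_def bub1_def D_def by simp
  have "sb i (- 1 + D) (\<lambda>x. ((x - a) \<bullet> i) * (s\<^sup>2 + (norm (x - a))\<^sup>2) powr (- D / 2))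
    (\<lambda>x. (i \<bullet> i) * (s\<^sup>2 + (norm (x - a))\<^sup>2) powr (- D / 2) + ((x - a) \<bullet> i) * (- D * ((x - a) \<bullet> i) * (s\<^sup>2 + (norm (x - a))\<^sup>2) powr (- (D + 2) / 2)))"
    using D by (intro sb_mult sb_bubble sb_coord ni s) simp
  from sb_scale[OF this, of "- (D - 2)"]
  show "sb i (real DIM('a) - 1) (\<lambda>x. bub1 i s (x - a)) (\<lambda>x. bub2 i s (x - a))"
    unfolding bub1_def bub2_def D_def[symmetric] ni by (simp add: algebra_simps power2_eq_square)
qed

lemma sum_bub2:
  fixes z :: "'a::euclidean_space"
  assumes "s > 0"
  shows "(\<Sum>i\<in>Basis. bub2 i s z) = - rho s z"
proof -
  define D where "D = real DIM('a)"
  define q where "q = s\<^sup>2 + (norm z)\<^sup>2"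
  have q: "q > 0" using assms by (simp add: q_def add_pos_nonneg)
  have S: "(\<Sum>i\<in>Basis. (z \<bullet> i)\<^sup>2) = (norm z)\<^sup>2"
    unfolding power2_norm_eq_inner by (subst (2) euclidean_inner) (simp add: power2_eq_square)
  have p: "q powr (- D / 2) = q * q powr (- (D + 2) / 2)"
  proof -
    have "- D / 2 = 1 + - (D + 2) / 2" by (simp add: field_simps)
    then show ?thesis using q by (simp only: powr_add) simp
  qed
  have "(\<Sum>i\<in>Basis. bub2 i s z) = - (D - 2) * (D * q powr (- D / 2) - D * (\<Sum>i\<in>Basis. (z \<bullet> i)\<^sup>2) * q powr (- (D + 2) / 2))"
    unfolding bub2_def D_def[symmetric] q_def[symmetric]
    by (simp add: sum_distrib_left[symmetric] sum_subtractf sum_distrib_right[symmetric] D_def)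
  also have "\<dots> = - (D - 2) * D * q powr (- (D + 2) / 2) * (q - (norm z)\<^sup>2)"
    unfolding S p by (simp add: algebra_simps)
  also have "\<dots> = - rho s z"
    unfolding rho_def D_def[symmetric] q_def[symmetric] by (simp add: q_def algebra_simps)
  finally show ?thesis .
qed

text \<open>Near x the kernel is locally integrable. Far from x it decays like
  \<open>jb y powr (- (D - 2))\<close>, and the total rate 2D - 2 exceeds the dimension.\<close>

lemma newton_jb_integrable:
  fixes x :: "'a::euclidean_space"
  assumes d: "DIM('a) \<ge> 3"
  shows "integrable lborel (\<lambda>y. newton (x - y) * jb y powr (- real DIM('a)))"
proof -
  define D where "D = real DIM('a)"
  have D: "D \<ge> 3" using d by (simp add: D_def)
  have "integrable lborel (\<lambda>z::'a. newton z * indicator {z. norm z < 1} z)"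
  proof (rule integrableI_bounded)
    have "(\<integral>\<^sup>+(z::'a). ennreal (norm (newton z * indicator {z. norm z < 1} z)) \<partial>lborel)
      = (\<integral>\<^sup>+(z::'a). ennreal (newton z) * indicator {z. norm z < 1} z \<partial>lborel)"
      by (intro nn_integral_cong) (auto simp: indicator_def)
    then show "(\<integral>\<^sup>+(z::'a). ennreal (norm (newton z * indicator {z. norm z < 1} z)) \<partial>lborel) < \<infinity>"
      using nn_integral_newton_ball[where 'a='a, of 1] by simp
  qed simp
  then have I1: "integrable lborel (\<lambda>y. newton (x - y) * indicator {z. norm z < 1} (x - y))"
    by (subst integrable_shift_minus[of "\<lambda>z. newton z * indicator {z. norm z < 1} z"]) simp_all
  have I2: "integrable lborel (\<lambda>y::'a. (2 + norm x) powr (D - 2) * jb y powr (- (2 * D - 2)))"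
    using D by (intro integrable_mult_right jb_powr_integrable) (simp add: D_def)
  show ?thesis unfolding D_def[symmetric]
  proof (rule Bochner_Integration.integrable_bound[OF Bochner_Integration.integrable_add[OF I1 I2]])
    show "AE y in lborel. norm (newton (x - y) * jb y powr (- D)) \<le> norm (newton (x - y) * indicator {z. norm z < 1} (x - y) + (2 + norm x) powr (D - 2) * jb y powr (- (2 * D - 2)))"
    proof (rule AE_I2)
      fix y :: 'a
      have j1: "jb y powr (- D) \<le> 1"
        using powr_mono2'[of "- D" 1 "jb y"] jb_ge_1[of y] D by simp
      have "newton (x - y) * jb y powr (- D) \<le> newton (x - y) * indicator {z. norm z < 1} (x - y) + (2 + norm x) powr (D - 2) * jb y powr (- (2 * D - 2))"
      proof (cases "norm (x - y) < 1")
        case True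
        have "newton (x - y) * jb y powr (- D) \<le> newton (x - y) * 1" using j1 by (intro mult_left_mono) auto
        then show ?thesis using True by (simp add: add_increasing2)
      next
        case False
        have "jb y \<le> 1 + norm y" by (rule jb_le)
        also have "norm y \<le> norm x + norm (x - y)" using norm_triangle_ineq2[of y x] by (simp add: norm_minus_commute)
        also have "1 + (norm x + norm (x - y)) \<le> (2 + norm x) * norm (x - y)"
          using False mult_left_mono[of 1 "norm (x - y)" "1 + norm x"] by (simp add: algebra_simps)
        finally have "jb y / (2 + norm x) \<le> norm (x - y)" by (simp add: divide_le_eq mult.commute add_pos_nonneg)
        then have "norm (x - y) powr (- (D - 2)) \<le> (jb y / (2 + norm x)) powr (- (D - 2))"
          using D by (intro powr_mono2') (auto simp: add_pos_nonneg)
        also have "\<dots> = (2 + norm x) powr (D - 2) * jb y powr (- (D - 2))"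
        proof -
          have "(jb y / (2 + norm x)) powr (- (D - 2)) = jb y powr (- (D - 2)) / (2 + norm x) powr (- (D - 2))"
            by (rule powr_divide)
          also have "(2 + norm x) powr (- (D - 2)) = 1 / (2 + norm x) powr (D - 2)" by (rule powr_minus_divide)
          finally show ?thesis by simp
        qed
        finally have "newton (x - y) \<le> (2 + norm x) powr (D - 2) * jb y powr (- (D - 2))"
          by (simp add: newton_def D_def)
        then have "newton (x - y) * jb y powr (- D) \<le> (2 + norm x) powr (D - 2) * jb y powr (- (D - 2)) * jb y powr (- D)"
          by (intro mult_right_mono) auto
        also have "\<dots> = (2 + norm x) powr (D - 2) * jb y powr (- (2 * D - 2))"
          unfolding mult.assoc powr_add[symmetric] by (simp add: algebra_simps)
        finally show ?thesis using False by simp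
      qed
      then show "norm (newton (x - y) * jb y powr (- D)) \<le> norm (newton (x - y) * indicator {z. norm z < 1} (x - y) + (2 + norm x) powr (D - 2) * jb y powr (- (2 * D - 2)))"
        by (simp add: abs_mult)
    qed
  qed simp
qed

lemma rho_integral:
  assumes d: "DIM('a::euclidean_space) \<ge> 3"
  shows "integrable lborel (rho 1 :: 'a \<Rightarrow> real)" "(\<integral>z. rho 1 (z::'a) \<partial>lborel) = newt_c TYPE('a)"
proof -
  define D where "D = real DIM('a)"
  have D: "D \<ge> 3" using d by (simp add: D_def)
  have I: "integrable lborel (\<lambda>x::'a. (1 + (norm x)\<^sup>2) powr (- (D + 2) / 2))"
    using nn_integral_bubble[where 'a='a] by (intro integrableI_bounded) (auto simp: D_def)
  have "(\<integral>(x::'a). (1 + (norm x)\<^sup>2) powr (- (D + 2) / 2) \<partial>lborel) = unit_ball_vol D"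
    using nn_integral_bubble[where 'a='a] D by (subst integral_eq_nn_integral) (auto simp: D_def)
  then show "(\<integral>z. rho 1 (z::'a) \<partial>lborel) = newt_c TYPE('a)"
    unfolding rho_def newt_c_def D_def by simp
  show "integrable lborel (rho 1 :: 'a \<Rightarrow> real)"
    unfolding rho_def[abs_def] using I by (simp add: D_def)
qed

lemma rho_scale:
  fixes z :: "'a::euclidean_space"
  assumes t: "t > 0"
  shows "t ^ DIM('a) * rho t (t *\<^sub>R z) = rho 1 z"
proof -
  define D where "D = real DIM('a)"
  have pos: "1 + (norm z)\<^sup>2 > 0" by (simp add: add_pos_nonneg)
  have "(t\<^sup>2 + (norm (t *\<^sub>R z))\<^sup>2) = t powr 2 * (1 + (norm z)\<^sup>2)"
    using t by (simp add: power_mult_distrib algebra_simps)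
  then have "(t\<^sup>2 + (norm (t *\<^sub>R z))\<^sup>2) powr (- (D + 2) / 2) = (t powr 2) powr (- (D + 2) / 2) * (1 + (norm z)\<^sup>2) powr (- (D + 2) / 2)"
    using pos by (simp add: powr_mult)
  also have "(t powr 2) powr (- (D + 2) / 2) = t powr (- (D + 2))"
  proof -
    have "2 * (- (D + 2) / 2) = - (D + 2)" by simp
    then show ?thesis by (simp only: powr_powr)
  qed
  finally have e: "(t\<^sup>2 + (norm (t *\<^sub>R z))\<^sup>2) powr (- (D + 2) / 2) = t powr (- (D + 2)) * (1 + (norm z)\<^sup>2) powr (- (D + 2) / 2)" .
  have "t ^ DIM('a) * t\<^sup>2 * t powr (- (D + 2)) = t powr D * t powr 2 * t powr (- (D + 2))"
    using t by (simp add: D_def powr_realpow)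
  also have "\<dots> = 1" using t unfolding powr_add[symmetric] by simp
  finally have "t ^ DIM('a) * t\<^sup>2 * t powr (- (D + 2)) = 1" .
  then show ?thesis unfolding rho_def D_def[symmetric] e
    by (simp add: mult_ac)
qed

lemma integral_rho_shift:
  fixes v :: "'a::euclidean_space \<Rightarrow> real"
  assumes [measurable]: "v \<in> borel_measurable borel" and t: "t > 0"
  shows "(\<integral>y. v y * rho t (y - x) \<partial>lborel) = (\<integral>z. v (x + t *\<^sub>R z) * rho 1 z \<partial>lborel)"
proof -
  have "(\<integral>y. v y * rho t (y - x) \<partial>lborel) = \<bar>t\<bar> ^ DIM('a) * (\<integral>z. v (x + t *\<^sub>R z) * rho t (x + t *\<^sub>R z - x) \<partial>lborel)"
    using t by (intro integral_affine) auto
  also have "\<dots> = (\<integral>z. t ^ DIM('a) * (v (x + t *\<^sub>R z) * rho t (t *\<^sub>R z)) \<partial>lborel)"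
    using t by simp
  also have "\<dots> = (\<integral>z. v (x + t *\<^sub>R z) * rho 1 z \<partial>lborel)"
    unfolding rho_scale[OF t, symmetric] by (simp add: mult_ac)
  finally show ?thesis .
qed

lemma bub_le_newton:
  fixes z :: "'a::euclidean_space"
  assumes "DIM('a) \<ge> 3" "z \<noteq> 0"
  shows "bub s z \<le> newton z"
proof -
  have "bub s z \<le> ((norm z)\<^sup>2) powr (- (real DIM('a) - 2) / 2)"
    unfolding bub_def using assms by (intro powr_mono2') auto
  also have "\<dots> = (norm z powr 2) powr (- (real DIM('a) - 2) / 2)" by simp
  also have "\<dots> = newton z"
  proof -
    have "2 * (- (real DIM('a) - 2) / 2) = 2 - real DIM('a)" by simp
    then show ?thesis unfolding newton_def by (simp only: powr_powr)
  qed
  finally show ?thesis .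
qed

lemma bub_tendsto_newton:
  fixes z :: "'a::euclidean_space"
  assumes "z \<noteq> 0" and t: "t \<longlonglongrightarrow> 0"
  shows "(\<lambda>n. bub (t n) z) \<longlonglongrightarrow> newton z"
proof -
  have "(\<lambda>n. ((t n)\<^sup>2 + (norm z)\<^sup>2) powr (- (real DIM('a) - 2) / 2)) \<longlonglongrightarrow> (0\<^sup>2 + (norm z)\<^sup>2) powr (- (real DIM('a) - 2) / 2)"
    using assms by (intro tendsto_intros) auto
  also have "(0\<^sup>2 + (norm z)\<^sup>2) powr (- (real DIM('a) - 2) / 2) = (norm z powr 2) powr (- (real DIM('a) - 2) / 2)" by simp
  also have "\<dots> = newton z"
  proof -
    have "2 * (- (real DIM('a) - 2) / 2) = 2 - real DIM('a)" by simp
    then show ?thesis unfolding newton_def by (simp only: powr_powr)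
  qed
  finally show ?thesis unfolding bub_def .
qed

text \<open>Green's formula is used with the smooth kernel \<open>bub\<close> instead of the
  singular one, so no ball has to be cut out. As the parameter tends to 0, the bubbles converge to
  the Newton kernel, which also dominates them, and \<open>rho\<close> acts as an approximate
  identity of mass \<open>newt_c\<close>.\<close>

lemma newton_representation:
  fixes v :: "'a::euclidean_space \<Rightarrow> real"
  assumes d: "DIM('a) \<ge> 3"
    and v1: "\<And>i. i \<in> Basis \<Longrightarrow> sb i (real DIM('a) - 2) v (v1 i)"
    and v2: "\<And>i. i \<in> Basis \<Longrightarrow> sb i (real DIM('a) - 1) (v1 i) (v2 i)"
  defines "L \<equiv> (\<lambda>x. \<Sum>i\<in>Basis. v2 i x)"
  shows "L \<in> borel_measurable borel"
    "\<exists>C. \<forall>x. \<bar>L x\<bar> \<le> C * jb x powr (- real DIM('a))"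
    "integrable lborel (\<lambda>y. newton (x - y) * L y)"
    "(\<integral>y. newton (x - y) * - L y \<partial>lborel) = newt_c TYPE('a) * v x"
proof -
  define D where "D = real DIM('a)"
  have D: "D \<ge> 3" using d by (simp add: D_def)
  have m2 [measurable]: "v2 i \<in> borel_measurable borel" if "i \<in> Basis" for i using sbD(4)[OF v2[OF that]] .
  show Lm [measurable]: "L \<in> borel_measurable borel" unfolding L_def by measurable
  obtain b0 :: 'a where b0: "b0 \<in> Basis" using nonempty_Basis by blast
  have [measurable]: "v \<in> borel_measurable borel" and vc: "continuous_on UNIV v" using sbD[OF v1[OF b0]] by auto
  show "\<exists>C. \<forall>x. \<bar>L x\<bar> \<le> C * jb x powr (- real DIM('a))"
  proof -
    have "\<forall>i\<in>Basis. \<exists>C. \<forall>x. \<bar>v2 i x\<bar> \<le> C * jb x powr (- D)"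
    proof
      fix i :: 'a assume i: "i \<in> Basis"
      show "\<exists>C. \<forall>x. \<bar>v2 i x\<bar> \<le> C * jb x powr (- D)"
        by (rule sb_bound[OF v2[OF i]]) (auto simp: D_def)
    qed
    then obtain C where C: "\<And>i x. i \<in> Basis \<Longrightarrow> \<bar>v2 i x\<bar> \<le> C i * jb x powr (- D)" by metis
    have "\<bar>L x\<bar> \<le> (\<Sum>i\<in>Basis. C i) * jb x powr (- D)" for x
    proof -
      have "\<bar>L x\<bar> \<le> (\<Sum>i\<in>Basis. \<bar>v2 i x\<bar>)" unfolding L_def by (rule sum_abs)
      also have "\<dots> \<le> (\<Sum>i\<in>Basis. C i * jb x powr (- D))" by (intro sum_mono C)
      finally show ?thesis by (simp add: sum_distrib_right)
    qed
    then show ?thesis unfolding D_def by blast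
  qed
  then obtain CL where CL: "\<And>x. \<bar>L x\<bar> \<le> CL * jb x powr (- D)" unfolding D_def by blast
  show nI: "integrable lborel (\<lambda>y. newton (x - y) * L y)"
  proof (rule Bochner_Integration.integrable_bound[OF integrable_mult_right[OF newton_jb_integrable[OF d, of x], of CL]])
    show "AE y in lborel. norm (newton (x - y) * L y) \<le> norm (CL * (newton (x - y) * jb y powr (- real DIM('a))))"
    proof (rule AE_I2)
      fix y
      have "norm (newton (x - y) * L y) \<le> newton (x - y) * (CL * jb y powr (- D))"
        using CL[of y] by (simp add: abs_mult mult_left_mono)
      also have "\<dots> \<le> norm (CL * (newton (x - y) * jb y powr (- D)))"
        by (simp add: mult_ac)
      finally show "norm (newton (x - y) * L y) \<le> norm (CL * (newton (x - y) * jb y powr (- real DIM('a))))"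
        by (simp add: D_def)
    qed
  qed simp
  obtain Cv where Cv: "Cv \<ge> 0" "\<And>x. \<bar>v x\<bar> \<le> Cv * jb x powr (- (D - 2))"
    using sb_bound[OF v1[OF b0]] unfolding D_def by metis
  have vb: "\<bar>v y\<bar> \<le> Cv" for y
  proof -
    have "jb y powr (- (D - 2)) \<le> 1 powr (- (D - 2))" using D jb_ge_1 by (intro powr_mono2') auto
    then show ?thesis using Cv(2)[of y] mult_left_mono[OF _ Cv(1), of "jb y powr (- (D - 2))" 1] by simp
  qed
  define t where "t = (\<lambda>n. 1 / real (Suc n))"
  have t: "t n > 0" for n by (simp add: t_def)
  have t0: "t \<longlonglongrightarrow> 0" unfolding t_def using LIMSEQ_inverse_real_of_nat by (simp add: inverse_eq_divide)
  have bv: "integrable lborel (\<lambda>y. v y * rho (t n) (y - x))" for n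
  proof -
    have "integrable lborel (\<lambda>z. v (x + t n *\<^sub>R z) * rho 1 z)"
      by (rule Bochner_Integration.integrable_bound[OF integrable_mult_right[OF rho_integral(1)[OF d], of Cv]])
        (use vb Cv(1) d in \<open>auto intro!: AE_I2 mult_right_mono simp: abs_mult\<close>)
    then have "integrable lborel (\<lambda>z. v (x + t n *\<^sub>R z) * (t n ^ DIM('a) * rho (t n) (x + t n *\<^sub>R z - x)))"
      unfolding rho_scale[OF t[of n], symmetric] by simp
    then have "integrable lborel (\<lambda>z. t n ^ DIM('a) * (v (x + t n *\<^sub>R z) * rho (t n) (x + t n *\<^sub>R z - x)))"
      by (simp only: mult.left_commute)
    from integrable_mult_right[OF this, of "1 / t n ^ DIM('a)"]
    have "integrable lborel (\<lambda>z. v (x + t n *\<^sub>R z) * rho (t n) (x + t n *\<^sub>R z - x))"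
      using t[of n] by simp
    then show ?thesis using t[of n]
      by (subst integrable_affine_iff[of "\<lambda>y. v y * rho (t n) (y - x)" "t n" x]) auto
  qed
  have green: "(\<integral>y. bub (t n) (y - x) * L y \<partial>lborel) = - (\<integral>y. v y * rho (t n) (y - x) \<partial>lborel)"
    "integrable lborel (\<lambda>y. bub (t n) (y - x) * L y)" for n
  proof -
    \<comment> \<open>The integrand is the derivative along i of the expression with the values bub
      v1 - v bub1, a symbol of rate 2D - 3, which exceeds the threshold D - 1 of
      \<open>integral_sb\<close>.\<close>
    have i: "integrable lborel (\<lambda>y. bub (t n) (y - x) * v2 i y - v y * bub2 i (t n) (y - x))"
      "(\<integral>y. bub (t n) (y - x) * v2 i y - v y * bub2 i (t n) (y - x) \<partial>lborel) = 0" if i: "i \<in> Basis" for i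
    proof -
      have "sb i ((D - 2) + (D - 1)) (\<lambda>y. bub (t n) (y - x) * v1 i y) (\<lambda>y. bub1 i (t n) (y - x) * v1 i y + bub (t n) (y - x) * v2 i y)"
        unfolding D_def by (intro sb_mult sb_bub d i t v2)
      moreover have "sb i ((D - 2) + (D - 1)) (\<lambda>y. v y * bub1 i (t n) (y - x)) (\<lambda>y. v1 i y * bub1 i (t n) (y - x) + v y * bub2 i (t n) (y - x))"
        unfolding D_def by (intro sb_mult sb_bub d i t v1)
      ultimately have S: "sb i ((D - 2) + (D - 1)) (\<lambda>y. bub (t n) (y - x) * v1 i y + (-1) * (v y * bub1 i (t n) (y - x)))
        (\<lambda>y. (bub1 i (t n) (y - x) * v1 i y + bub (t n) (y - x) * v2 i y) + (-1) * (v1 i y * bub1 i (t n) (y - x) + v y * bub2 i (t n) (y - x)))"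
        by (intro sb_add sb_scale)
      have e: "(\<lambda>y. (bub1 i (t n) (y - x) * v1 i y + bub (t n) (y - x) * v2 i y) + (-1) * (v1 i y * bub1 i (t n) (y - x) + v y * bub2 i (t n) (y - x)))
        = (\<lambda>y. bub (t n) (y - x) * v2 i y - v y * bub2 i (t n) (y - x))" by (simp add: algebra_simps)
      have k: "(D - 2) + (D - 1) > real DIM('a) - 1" using D by (simp add: D_def)
      show "integrable lborel (\<lambda>y. bub (t n) (y - x) * v2 i y - v y * bub2 i (t n) (y - x))"
        "(\<integral>y. bub (t n) (y - x) * v2 i y - v y * bub2 i (t n) (y - x) \<partial>lborel) = 0"
        using integral_sb[OF _ S k] i unfolding e by auto
    qed
    have e: "(\<Sum>i\<in>Basis. bub (t n) (y - x) * v2 i y - v y * bub2 i (t n) (y - x)) = bub (t n) (y - x) * L y + v y * rho (t n) (y - x)" for y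
      using sum_bub2[OF t[of n], of "y - x"] by (simp add: sum_subtractf sum_distrib_left[symmetric] L_def)
    have I: "integrable lborel (\<lambda>y. bub (t n) (y - x) * L y + v y * rho (t n) (y - x))"
      unfolding e[symmetric] by (intro Bochner_Integration.integrable_sum i)
    have "(\<integral>y. bub (t n) (y - x) * L y + v y * rho (t n) (y - x) \<partial>lborel) = 0"
      unfolding e[symmetric] by (subst Bochner_Integration.integral_sum) (auto simp: i)
    moreover show I2: "integrable lborel (\<lambda>y. bub (t n) (y - x) * L y)"
      using Bochner_Integration.integrable_diff[OF I bv[of n]] by simp
    ultimately show "(\<integral>y. bub (t n) (y - x) * L y \<partial>lborel) = - (\<integral>y. v y * rho (t n) (y - x) \<partial>lborel)"
      using bv[of n] by (simp add: add_eq_0_iff2)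
  qed
  have lim1: "(\<lambda>n. \<integral>y. bub (t n) (y - x) * L y \<partial>lborel) \<longlonglongrightarrow> (\<integral>y. newton (x - y) * L y \<partial>lborel)"
  proof (rule integral_dominated_convergence[where w = "\<lambda>y. \<bar>newton (x - y) * L y\<bar>"])
    show "integrable lborel (\<lambda>y. \<bar>newton (x - y) * L y\<bar>)" using nI by simp
    show "AE y in lborel. (\<lambda>n. bub (t n) (y - x) * L y) \<longlonglongrightarrow> newton (x - y) * L y"
      using AE_lborel_singleton[of x]
    proof eventually_elim
      case (elim y)
      have "(\<lambda>n. bub (t n) (y - x)) \<longlonglongrightarrow> newton (x - y)"
        using bub_tendsto_newton[OF _ t0, of "y - x"] elim by (simp add: newton_commute)
      then show ?case by (intro tendsto_intros)
    qed
    show "AE y in lborel. norm (bub (t n) (y - x) * L y) \<le> \<bar>newton (x - y) * L y\<bar>" for n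
      using AE_lborel_singleton[of x]
    proof eventually_elim
      case (elim y)
      have "bub (t n) (y - x) \<le> newton (x - y)"
        using bub_le_newton[OF d, of "y - x"] elim by (simp add: newton_commute)
      then show ?case by (simp add: abs_mult mult_right_mono)
    qed
  qed auto
  have lim2: "(\<lambda>n. \<integral>y. v y * rho (t n) (y - x) \<partial>lborel) \<longlonglongrightarrow> newt_c TYPE('a) * v x"
  proof -
    have "(\<lambda>n. \<integral>z. v (x + t n *\<^sub>R z) * rho 1 z \<partial>lborel) \<longlonglongrightarrow> (\<integral>(z::'a). v x * rho 1 z \<partial>lborel)"
    proof (rule integral_dominated_convergence[where w = "\<lambda>z. Cv * rho 1 z"])
      show "integrable lborel (\<lambda>z::'a. Cv * rho 1 z)" using rho_integral(1)[OF d] by simp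
      show "AE z in lborel. (\<lambda>n. v (x + t n *\<^sub>R z) * rho 1 z) \<longlonglongrightarrow> v x * rho 1 z"
      proof (rule AE_I2)
        fix z
        have "(\<lambda>n. x + t n *\<^sub>R z) \<longlonglongrightarrow> x + 0 *\<^sub>R z" by (intro tendsto_intros t0)
        then have "(\<lambda>n. v (x + t n *\<^sub>R z)) \<longlonglongrightarrow> v x"
          using vc by (auto simp: continuous_on_eq_continuous_at intro: isCont_tendsto_compose)
        then show "(\<lambda>n. v (x + t n *\<^sub>R z) * rho 1 z) \<longlonglongrightarrow> v x * rho 1 z" by (intro tendsto_intros)
      qed
      show "AE z in lborel. norm (v (x + t n *\<^sub>R z) * rho 1 z) \<le> Cv * rho 1 z" for n
        using vb d by (auto intro!: AE_I2 mult_right_mono simp: abs_mult)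
    qed auto
    then show ?thesis unfolding integral_rho_shift[OF \<open>v \<in> borel_measurable borel\<close> t]
      using rho_integral(2)[OF d] by (simp add: mult.commute)
  qed
  have "(\<lambda>n. \<integral>y. bub (t n) (y - x) * L y \<partial>lborel) \<longlonglongrightarrow> - (newt_c TYPE('a) * v x)"
    unfolding green by (intro tendsto_minus lim2)
  then have "(\<integral>y. newton (x - y) * L y \<partial>lborel) = - (newt_c TYPE('a) * v x)"
    using lim1 LIMSEQ_unique by blast
  then show "(\<integral>y. newton (x - y) * - L y \<partial>lborel) = newt_c TYPE('a) * v x" by simp
qed


section \<open>Superpositions of bubbles\<close>

text \<open>Differentiation under the integral, where the mean value theorem turns the bound on
  \<open>F'\<close> into one on the difference quotients. The decay is asked only where
  \<open>g\<close> does not vanish, since translates of a bubble share a decay constant only for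
  centres in a bounded set.\<close>

lemma sb_superpos:
  fixes F F' :: "'a::euclidean_space \<Rightarrow> 'a \<Rightarrow> real" and g :: "'a \<Rightarrow> real"
  assumes i: "norm i = 1"
    and sb: "\<And>a. sb i k (F a) (F' a)"
    and [measurable]: "\<And>x. (\<lambda>a. F a x) \<in> borel_measurable borel" "\<And>x. (\<lambda>a. F' a x) \<in> borel_measurable borel"
    and g: "integrable lborel g" and [measurable]: "g \<in> borel_measurable borel"
    and k: "k \<ge> 0"
    and bd: "\<And>a x. g a \<noteq> 0 \<Longrightarrow> \<bar>F a x\<bar> \<le> C * jb x powr (- k)" "\<And>a x. g a \<noteq> 0 \<Longrightarrow> \<bar>F' a x\<bar> \<le> C * jb x powr (- k - 1)"
  shows "sb i k (\<lambda>x. \<integral>a. g a * F a x \<partial>lborel) (\<lambda>x. \<integral>a. g a * F' a x \<partial>lborel)"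
proof -
  have j1: "jb x powr (- l) \<le> 1" if "l \<ge> 0" for x :: 'a and l
    using powr_mono2'[of "- l" 1 "jb x"] jb_ge_1[of x] that by simp
  define C0 where "C0 = max C 0"
  have bd0: "\<bar>F a x\<bar> \<le> C0" "\<bar>F' a x\<bar> \<le> C0" if "g a \<noteq> 0" for a x
  proof -
    have "C * jb x powr (- k) \<le> C0 * 1" using j1[OF k, of x] by (intro mult_mono) (auto simp: C0_def)
    then show "\<bar>F a x\<bar> \<le> C0" using bd(1)[OF that, of x] by simp
    have "- (k + 1) = - k - 1" by simp
    then have "C * jb x powr (- k - 1) \<le> C0 * 1" using j1[of "k + 1" x] k by (intro mult_mono) (auto simp: C0_def)
    then show "\<bar>F' a x\<bar> \<le> C0" using bd(2)[OF that, of x] by simp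
  qed
  have gb: "\<bar>g a * F a x\<bar> \<le> \<bar>g a\<bar> * C0" "\<bar>g a * F' a x\<bar> \<le> \<bar>g a\<bar> * C0" for a x
    using bd0[of a x] by (cases "g a = 0"; simp add: abs_mult mult_left_mono)+
  have dom: "integrable lborel (\<lambda>a. \<bar>g a\<bar> * C0)" using g by simp
  have I: "integrable lborel (\<lambda>a. g a * F a x)" "integrable lborel (\<lambda>a. g a * F' a x)" for x
    by (rule Bochner_Integration.integrable_bound[OF dom]; use gb in \<open>auto intro!: AE_I2 order_trans[OF gb(1) abs_ge_self] order_trans[OF gb(2) abs_ge_self]\<close>)+
  have mult_left_mono': "\<bar>g a\<bar> * u \<le> \<bar>g a\<bar> * v" if "g a \<noteq> 0 \<Longrightarrow> u \<le> v" for a u v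
    using that by (cases "g a = 0") (auto intro!: mult_left_mono)
  have cont: "continuous_on UNIV (\<lambda>x. \<integral>a. g a * H a x \<partial>lborel)"
    if [measurable]: "\<And>x. (\<lambda>a. H a x) \<in> borel_measurable borel" and c: "\<And>a. continuous_on UNIV (H a)"
      and b: "\<And>a x. \<bar>g a * H a x\<bar> \<le> \<bar>g a\<bar> * C0" for H :: "'a \<Rightarrow> 'a \<Rightarrow> real"
  proof (rule continuous_on_sequentiallyI)
    fix X :: "nat \<Rightarrow> 'a" and x assume X: "X \<longlonglongrightarrow> x"
    show "(\<lambda>n. \<integral>a. g a * H a (X n) \<partial>lborel) \<longlonglongrightarrow> (\<integral>a. g a * H a x \<partial>lborel)"
    proof (rule integral_dominated_convergence[OF _ _ dom])
      show "AE a in lborel. (\<lambda>n. g a * H a (X n)) \<longlonglongrightarrow> g a * H a x"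
      proof (rule AE_I2)
        fix a
        have "isCont (H a) x" using c[of a] by (simp add: continuous_on_eq_continuous_at)
        then show "(\<lambda>n. g a * H a (X n)) \<longlonglongrightarrow> g a * H a x" by (intro tendsto_intros isCont_tendsto_compose[OF _ X])
      qed
    qed (use b in auto)
  qed
  have D: "((\<lambda>t. F a (x + t *\<^sub>R i)) has_real_derivative F' a (x + t *\<^sub>R i)) (at t)" for a x t
  proof -
    have "((\<lambda>r. F a (x + t *\<^sub>R i + r *\<^sub>R i)) has_real_derivative F' a (x + t *\<^sub>R i)) (at 0)"
      by (rule sbD(5)[OF sb])
    then have "((\<lambda>r. F a (x + (r + t) *\<^sub>R i)) has_real_derivative F' a (x + t *\<^sub>R i)) (at 0)"
      by (simp add: scaleR_add_left add.assoc add.commute add.left_commute)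
    then show ?thesis using DERIV_shift[of "\<lambda>t. F a (x + t *\<^sub>R i)" "F' a (x + t *\<^sub>R i)" 0 t] by simp
  qed
  have quot: "\<bar>g a * ((F a (x + t *\<^sub>R i) - F a x) / t)\<bar> \<le> \<bar>g a\<bar> * C0" if "t \<noteq> 0" for a x t
  proof (cases "g a = 0")
    case False
    have "\<exists>z. F a (x + t *\<^sub>R i) - F a (x + 0 *\<^sub>R i) = (t - 0) * F' a (x + z *\<^sub>R i)"
    proof (cases "t > 0")
      case True
      then show ?thesis using MVT2[of 0 t "\<lambda>t. F a (x + t *\<^sub>R i)" "\<lambda>t. F' a (x + t *\<^sub>R i)"] D by blast
    next
      case neg: False
      then have "t < 0" using that by simp
      then obtain z where "F a (x + 0 *\<^sub>R i) - F a (x + t *\<^sub>R i) = (0 - t) * F' a (x + z *\<^sub>R i)"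
        using MVT2[of t 0 "\<lambda>t. F a (x + t *\<^sub>R i)" "\<lambda>t. F' a (x + t *\<^sub>R i)"] D by blast
      then show ?thesis by (intro exI[of _ z]) (simp add: algebra_simps)
    qed
    then obtain z where "F a (x + t *\<^sub>R i) - F a x = t * F' a (x + z *\<^sub>R i)" by auto
    then have "(F a (x + t *\<^sub>R i) - F a x) / t = F' a (x + z *\<^sub>R i)" using that by simp
    then show ?thesis using gb(2)[of a "x + z *\<^sub>R i"] by simp
  qed simp
  show ?thesis
  proof (rule sbI)
    show "continuous_on UNIV (\<lambda>x. \<integral>a. g a * F a x \<partial>lborel)" "continuous_on UNIV (\<lambda>x. \<integral>a. g a * F' a x \<partial>lborel)"
      using sbD(1,2)[OF sb] gb by (auto intro!: cont)
    fix x
    show "((\<lambda>t. \<integral>a. g a * F a (x + t *\<^sub>R i) \<partial>lborel) has_real_derivative (\<integral>a. g a * F' a x \<partial>lborel)) (at 0)"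
      unfolding has_field_derivative_iff tendsto_at_iff_sequentially
    proof (intro allI impI)
      fix X :: "nat \<Rightarrow> real" assume X: "\<forall>n. X n \<in> UNIV - {0}" "X \<longlonglongrightarrow> 0"
      have X0: "X n \<noteq> 0" for n using X by auto
      have e: "((\<integral>a. g a * F a (x + X n *\<^sub>R i) \<partial>lborel) - (\<integral>a. g a * F a (x + 0 *\<^sub>R i) \<partial>lborel)) / X n
        = (\<integral>a. g a * ((F a (x + X n *\<^sub>R i) - F a x) / X n) \<partial>lborel)" for n
      proof -
        have "(\<integral>a. g a * ((F a (x + X n *\<^sub>R i) - F a x) / X n) \<partial>lborel) = (\<integral>a. (g a * F a (x + X n *\<^sub>R i) - g a * F a x) / X n \<partial>lborel)"
          by (simp only: right_diff_distrib times_divide_eq_right)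
        also have "\<dots> = (\<integral>a. g a * F a (x + X n *\<^sub>R i) - g a * F a x \<partial>lborel) / X n"
          by (rule integral_divide_zero)
        also have "(\<integral>a. g a * F a (x + X n *\<^sub>R i) - g a * F a x \<partial>lborel) = (\<integral>a. g a * F a (x + X n *\<^sub>R i) \<partial>lborel) - (\<integral>a. g a * F a x \<partial>lborel)"
          by (intro Bochner_Integration.integral_diff I)
        finally have fin: "(\<integral>a. g a * ((F a (x + X n *\<^sub>R i) - F a x) / X n) \<partial>lborel)
          = ((\<integral>a. g a * F a (x + X n *\<^sub>R i) \<partial>lborel) - (\<integral>a. g a * F a x \<partial>lborel)) / X n" .
        show ?thesis unfolding fin by (simp only: add_0_left scaleR_zero_left add_0_right)
      qed
      have "(\<lambda>n. \<integral>a. g a * ((F a (x + X n *\<^sub>R i) - F a x) / X n) \<partial>lborel) \<longlonglongrightarrow> (\<integral>a. g a * F' a x \<partial>lborel)"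
      proof (rule integral_dominated_convergence[OF _ _ dom])
        show "AE a in lborel. (\<lambda>n. g a * ((F a (x + X n *\<^sub>R i) - F a x) / X n)) \<longlonglongrightarrow> g a * F' a x"
        proof (rule AE_I2)
          fix a
          have "((\<lambda>t. (F a (x + t *\<^sub>R i) - F a x) / t) \<longlongrightarrow> F' a x) (at 0)"
            using sbD(5)[OF sb, of a x] by (simp add: has_field_derivative_iff)
          then have "(\<lambda>n. (F a (x + X n *\<^sub>R i) - F a x) / X n) \<longlonglongrightarrow> F' a x"
            using X unfolding tendsto_at_iff_sequentially by (auto simp: comp_def)
          then show "(\<lambda>n. g a * ((F a (x + X n *\<^sub>R i) - F a x) / X n)) \<longlonglongrightarrow> g a * F' a x" by (intro tendsto_intros)
        qed
      qed (use quot[OF X0] in auto)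
      then show "((\<lambda>t. ((\<integral>a. g a * F a (x + t *\<^sub>R i) \<partial>lborel) - (\<integral>a. g a * F a (x + 0 *\<^sub>R i) \<partial>lborel)) / (t - 0)) \<circ> X) \<longlonglongrightarrow> (\<integral>a. g a * F' a x \<partial>lborel)"
        unfolding comp_def diff_zero e .
    qed
    have I3: "integrable lborel (\<lambda>a. \<bar>g a\<bar> * c)" for c using g by simp
    have "\<bar>\<integral>a. g a * F a x \<partial>lborel\<bar> \<le> (\<integral>a. \<bar>g a\<bar> * (C * jb x powr (- k)) \<partial>lborel)"
      by (rule order_trans[OF integral_abs_bound integral_mono[OF integrable_abs[OF I(1)] I3]])
         (use bd(1)[of _ x] in \<open>auto simp: abs_mult intro!: mult_left_mono'\<close>)
    then show "\<bar>\<integral>a. g a * F a x \<partial>lborel\<bar> \<le> ((\<integral>a. \<bar>g a\<bar> \<partial>lborel) * C) * jb x powr (- k)" by (simp add: mult_ac)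
    have "\<bar>\<integral>a. g a * F' a x \<partial>lborel\<bar> \<le> (\<integral>a. \<bar>g a\<bar> * (C * jb x powr (- k - 1)) \<partial>lborel)"
      by (rule order_trans[OF integral_abs_bound integral_mono[OF integrable_abs[OF I(2)] I3]])
         (use bd(2)[of _ x] in \<open>auto simp: abs_mult intro!: mult_left_mono'\<close>)
    then show "\<bar>\<integral>a. g a * F' a x \<partial>lborel\<bar> \<le> ((\<integral>a. \<bar>g a\<bar> \<partial>lborel) * C) * jb x powr (- k - 1)" by (simp add: mult_ac)
  qed
qed

lemma bub_bounds_uniform:
  assumes d: "DIM('a::euclidean_space) \<ge> 3" and s: "s > 0"
  obtains C where "\<And>a x. norm (a::'a) \<le> R \<Longrightarrow> \<bar>bub s (x - a)\<bar> \<le> C * jb x powr (- (real DIM('a) - 2))"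
    "\<And>a x i. norm (a::'a) \<le> R \<Longrightarrow> i \<in> Basis \<Longrightarrow> \<bar>bub1 i s (x - a)\<bar> \<le> C * jb x powr (- (real DIM('a) - 1))"
    "\<And>a x i. norm (a::'a) \<le> R \<Longrightarrow> i \<in> Basis \<Longrightarrow> \<bar>bub2 i s (x - a)\<bar> \<le> C * jb x powr (- real DIM('a))"
proof -
  define D where "D = real DIM('a)"
  have D: "D \<ge> 3" using d by (simp add: D_def)
  \<comment> \<open>The constant of \<open>jb_shift_bound\<close> with the norm of the centre
    replaced by its bound \<open>R\<close>.\<close>
  define K where "K = (1 + 2 * R\<^sup>2) / s\<^sup>2 + 2"
  have K: "K > 0" "K \<ge> 1" using s by (simp_all add: K_def add_nonneg_pos)
  have jq: "(jb x)\<^sup>2 \<le> K * (s\<^sup>2 + (norm (x - a))\<^sup>2)" if "norm a \<le> R" for a x :: 'a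
  proof -
    have "(norm x)\<^sup>2 \<le> (norm (x - a) + norm a)\<^sup>2"
      using norm_triangle_ineq[of "x - a" a] by (intro power_mono) auto
    also have "\<dots> \<le> 2 * (norm (x - a))\<^sup>2 + 2 * (norm a)\<^sup>2"
      using sum_squares_bound[of "norm (x - a)" "norm a"] by (simp add: power2_sum)
    also have "(norm a)\<^sup>2 \<le> R\<^sup>2" using that by (intro power_mono) auto
    finally have 1: "(jb x)\<^sup>2 \<le> 1 + 2 * R\<^sup>2 + 2 * (norm (x - a))\<^sup>2" by (simp add: jb_def)
    have 2: "K * (s\<^sup>2 + (norm (x - a))\<^sup>2) = (1 + 2 * R\<^sup>2) + 2 * (norm (x - a))\<^sup>2
       + (2 * s\<^sup>2 + (1 + 2 * R\<^sup>2) / s\<^sup>2 * (norm (x - a))\<^sup>2)"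
      using s by (simp add: field_simps K_def)
    have "0 \<le> 2 * s\<^sup>2 + (1 + 2 * R\<^sup>2) / s\<^sup>2 * (norm (x - a))\<^sup>2" by simp
    then show ?thesis using 1 2 by linarith
  qed
  define q where "q = (\<lambda>z::'a. s\<^sup>2 + (norm z)\<^sup>2)"
  have q: "q z > 0" for z using s by (simp add: q_def add_pos_nonneg)
  have nq: "\<bar>z \<bullet> i\<bar> \<le> q z powr (1 / 2)" if "i \<in> Basis" for z i
  proof -
    have "\<bar>z \<bullet> i\<bar> \<le> norm z" using Basis_le_norm[OF that] .
    also have "\<dots> \<le> q z powr (1 / 2)" using q[of z] by (simp add: powr_half_sqrt real_le_rsqrt q_def)
    finally show ?thesis .
  qed
  \<comment> \<open>One constant for all three bounds: \<open>1 + D\<close> counts the two terms of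
    \<open>bub2\<close>, and the largest power of \<open>K\<close> serves because \<open>K\<close>
    is at least 1.\<close>
  define C where "C = (D - 2) * (1 + D) * K powr (D / 2)"
  have C: "K powr ((D - 2) / 2) \<le> C" "(D - 2) * K powr ((D - 1) / 2) \<le> C"
  proof -
    have k: "K powr ((D - 2) / 2) \<le> K powr (D / 2)" "K powr ((D - 1) / 2) \<le> K powr (D / 2)"
      using K by (auto intro!: powr_mono)
    have 1: "1 \<le> (D - 2) * (1 + D)" using D mult_mono[of 1 "D - 2" 1 "1 + D"] by simp
    have 2: "D - 2 \<le> (D - 2) * (1 + D)" using D mult_left_mono[of 1 "1 + D" "D - 2"] by simp
    have "1 * K powr ((D - 2) / 2) \<le> C"
      unfolding C_def by (rule mult_mono[OF 1 k(1)]) (use D in auto)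
    then show "K powr ((D - 2) / 2) \<le> C" by simp
    show "(D - 2) * K powr ((D - 1) / 2) \<le> C"
      unfolding C_def by (rule mult_mono[OF 2 k(2)]) (use D in auto)
  qed
  have B: "q (x - a) powr (- b / 2) \<le> K powr (b / 2) * jb x powr (- b)" if "norm a \<le> R" "b \<ge> 0" for a x b
    unfolding q_def using bubble_le_jb[OF K(1) jq[OF that(1)] that(2) s] .
  show ?thesis
  proof (rule that[of C])
    fix a x :: 'a assume a: "norm a \<le> R"
    have "\<bar>bub s (x - a)\<bar> \<le> K powr ((D - 2) / 2) * jb x powr (- (D - 2))"
      using B[OF a, of "D - 2" x] D by (simp add: bub_def D_def q_def)
    also have "\<dots> \<le> C * jb x powr (- (D - 2))" by (intro mult_right_mono C) auto
    finally show "\<bar>bub s (x - a)\<bar> \<le> C * jb x powr (- (real DIM('a) - 2))" unfolding D_def .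
  next
    fix a x i :: 'a assume a: "norm a \<le> R" and i: "i \<in> Basis"
    define z where "z = x - a"
    have "\<bar>bub1 i s z\<bar> = (D - 2) * (\<bar>z \<bullet> i\<bar> * q z powr (- D / 2))"
      using D by (simp add: bub1_def abs_mult D_def q_def)
    also have "\<dots> \<le> (D - 2) * (q z powr (1 / 2) * q z powr (- D / 2))"
      using D nq[OF i, of z] by (intro mult_left_mono mult_right_mono) auto
    also have "q z powr (1 / 2) * q z powr (- D / 2) = q z powr (- (D - 1) / 2)"
      unfolding powr_add[symmetric] by (simp add: field_simps)
    also have "(D - 2) * \<dots> \<le> (D - 2) * (K powr ((D - 1) / 2) * jb x powr (- (D - 1)))"
      unfolding z_def using D by (intro mult_left_mono B a) auto
    also have "\<dots> \<le> C * jb x powr (- (D - 1))" unfolding mult.assoc[symmetric] by (intro mult_right_mono C) auto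
    finally show "\<bar>bub1 i s (x - a)\<bar> \<le> C * jb x powr (- (real DIM('a) - 1))" unfolding D_def z_def .
    have "\<bar>bub2 i s z\<bar> = (D - 2) * \<bar>q z powr (- D / 2) - D * (z \<bullet> i)\<^sup>2 * q z powr (- (D + 2) / 2)\<bar>"
      using D unfolding bub2_def abs_mult D_def[symmetric] q_def by simp
    also have "\<bar>q z powr (- D / 2) - D * (z \<bullet> i)\<^sup>2 * q z powr (- (D + 2) / 2)\<bar> \<le> (1 + D) * q z powr (- D / 2)"
    proof -
      have "(z \<bullet> i)\<^sup>2 * q z powr (- (D + 2) / 2) \<le> q z * q z powr (- (D + 2) / 2)"
      proof (intro mult_right_mono)
        have "(z \<bullet> i)\<^sup>2 \<le> (norm z)\<^sup>2" using power_mono[OF Basis_le_norm[OF i, of z], of 2] by simp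
        then show "(z \<bullet> i)\<^sup>2 \<le> q z" by (simp add: q_def add_increasing)
      qed auto
      also have "q z * q z powr (- (D + 2) / 2) = q z powr (1 + - (D + 2) / 2)" using q[of z] unfolding powr_add by simp
      also have "1 + - (D + 2) / 2 = - D / 2" by (simp add: field_simps)
      finally have "D * ((z \<bullet> i)\<^sup>2 * q z powr (- (D + 2) / 2)) \<le> D * q z powr (- D / 2)" using D by (intro mult_left_mono) auto
      moreover have "0 \<le> D * ((z \<bullet> i)\<^sup>2 * q z powr (- (D + 2) / 2))" using D by auto
      moreover have "0 \<le> q z powr (- D / 2)" by simp
      ultimately have "\<bar>q z powr (- D / 2) - D * ((z \<bullet> i)\<^sup>2 * q z powr (- (D + 2) / 2))\<bar> \<le> q z powr (- D / 2) + D * q z powr (- D / 2)"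
        by linarith
      then show ?thesis by (simp add: algebra_simps)
    qed
    also have "(1 + D) * q z powr (- D / 2) \<le> (1 + D) * (K powr (D / 2) * jb x powr (- D))"
      unfolding z_def using D by (intro mult_left_mono B a) auto
    finally show "\<bar>bub2 i s (x - a)\<bar> \<le> C * jb x powr (- real DIM('a))"
      using D unfolding z_def C_def D_def by (simp add: mult_left_mono mult.assoc)
  qed
qed

section \<open>The localized Sobolev inequality\<close>


text \<open>Only pure second derivatives are recorded, since they enter through the Laplacian. The
  Lipschitz bound is there for moving the multiplier across a mollifier.\<close>

definition multiplier :: "('a::euclidean_space \<Rightarrow> real) \<Rightarrow> ('a \<Rightarrow> 'a \<Rightarrow> real) \<Rightarrow> ('a \<Rightarrow> 'a \<Rightarrow> real) \<Rightarrow> bool" where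
  "multiplier m m1 m2 \<longleftrightarrow> (\<forall>i\<in>Basis. sb i 0 m (m1 i) \<and> sb i 1 (m1 i) (m2 i)) \<and> (\<forall>x. 0 \<le> m x) \<and>
     (\<exists>L. \<forall>x y. \<bar>m x - m y\<bar> \<le> L * norm (x - y))"

definition grad2 :: "('a::euclidean_space \<Rightarrow> 'a \<Rightarrow> real) \<Rightarrow> 'a \<Rightarrow> real" where
  "grad2 m1 x = (\<Sum>i\<in>Basis. (m1 i x)\<^sup>2)"

lemma grad2_nonneg [simp]: "grad2 m1 x \<ge> 0" by (simp add: grad2_def sum_nonneg)

lemma multiplierD:
  assumes "multiplier m m1 m2"
  shows "i \<in> Basis \<Longrightarrow> sb i 0 m (m1 i)" "i \<in> Basis \<Longrightarrow> sb i 1 (m1 i) (m2 i)" "0 \<le> m x"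
    "m \<in> borel_measurable borel" "grad2 m1 \<in> borel_measurable borel" "\<exists>C. \<forall>x. m x \<le> C"
proof -
  show "i \<in> Basis \<Longrightarrow> sb i 0 m (m1 i)" "i \<in> Basis \<Longrightarrow> sb i 1 (m1 i) (m2 i)" "0 \<le> m x"
    using assms by (auto simp: multiplier_def)
  obtain b :: 'a where b: "b \<in> Basis" using nonempty_Basis by blast
  have sb: "sb b 0 m (m1 b)" using assms b by (auto simp: multiplier_def)
  show "m \<in> borel_measurable borel" by (rule sbD(3)[OF sb])
  have [measurable]: "m1 i \<in> borel_measurable borel" if "i \<in> Basis" for i
    using assms that by (auto simp: multiplier_def dest: sbD)
  show "grad2 m1 \<in> borel_measurable borel" unfolding grad2_def[abs_def] by measurable
  obtain C where "\<And>x. \<bar>m x\<bar> \<le> C * jb x powr (- 0)" using sb_bound[OF sb] by metis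
  then have "m x \<le> C" for x using abs_ge_self[of "m x"] by (metis order_trans powr_zero_eq_one jb_neq_0 minus_zero mult.right_neutral)
  then show "\<exists>C. \<forall>x. m x \<le> C" by blast
qed

lemma hls_M_nonneg:
  assumes d: "DIM('a::euclidean_space) \<ge> 3"
  shows "hls_M TYPE('a) \<ge> 0"
proof -
  define f where "f = (\<lambda>x::'a. jb x powr (- (real DIM('a) + 2)))"
  have f: "f \<in> Lhp" unfolding f_def by (rule jb_powr_Lhp) (simp add: hp_def)
  have f0: "f x > 0" for x by (simp add: f_def)
  define N where "N = (\<integral>x. f x powr hp TYPE('a) \<partial>lborel)"
  have I: "integrable lborel (\<lambda>x. f x powr hp TYPE('a))" using LhpD(2)[OF f] f0 by (simp add: less_imp_le)
  have "N \<noteq> 0"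
  proof
    assume "N = 0"
    then have "AE x in lborel. f x powr hp TYPE('a) = 0"
      unfolding N_def using integral_nonneg_eq_0_iff_AE[OF I] by simp
    then have "AE x::'a in lborel. False" by eventually_elim (use f0 in \<open>auto simp: less_imp_neq[symmetric]\<close>)
    then show False by (simp add: eventually_False ae_filter_eq_bot_iff)
  qed
  then have "N > 0" unfolding N_def by (smt (verit) integral_nonneg_AE AE_I2 powr_ge_zero)
  have "0 \<le> hls f f" by (rule hls_nonneg_self[OF d f])
  also have "\<dots> \<le> hls_M TYPE('a) * N powr (2 / hp TYPE('a))"
    unfolding N_def using f0 by (intro hls_le_M[OF d f]) (simp add: less_imp_le)
  finally show ?thesis using \<open>N > 0\<close> by (simp add: zero_le_mult_iff)
qed

text \<open>The Sobolev inequality for the potential \<open>m u\<close>, with the constant of the dual inequality: the energy of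
  \<open>m u\<close> splits into \<open>\<integral> m\<^sup>2 u (- \<Delta> u)\<close> and \<open>\<integral> u\<^sup>2 |\<nabla> m|\<^sup>2\<close>.\<close>

lemma localized_Sobolev_smooth:
  fixes g :: "'a::euclidean_space \<Rightarrow> real"
  assumes d: "DIM('a) \<ge> 3" and m: "multiplier m m1 m2" and s: "s > 0"
    and gm [measurable]: "g \<in> borel_measurable borel" and g0: "\<And>x. 0 \<le> g x" and gI: "integrable lborel g"
    and gR: "\<And>x. norm x > R \<Longrightarrow> g x = 0"
  defines "u \<equiv> (\<lambda>x. \<integral>a. g a * bub s (x - a) \<partial>lborel)"
    and "r \<equiv> (\<lambda>x. \<integral>a. g a * rho s (x - a) \<partial>lborel)"
  shows "integrable lborel (\<lambda>x. (m x * u x) powr hq TYPE('a))"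
    "newt_c TYPE('a) * (\<integral>x. (m x * u x) powr hq TYPE('a) \<partial>lborel) powr (2 / hq TYPE('a))
      \<le> hls_M TYPE('a) * (\<integral>x. (m x)\<^sup>2 * r x * u x + (u x)\<^sup>2 * grad2 m1 x \<partial>lborel)"
    "integrable lborel (\<lambda>x. (m x)\<^sup>2 * r x * u x + (u x)\<^sup>2 * grad2 m1 x)"
    "\<exists>C. \<forall>x. u x \<le> C * jb x powr (- (real DIM('a) - 2))"
proof -
  define D where "D = real DIM('a)"
  define c where "c = newt_c TYPE('a)"
  define p q where "p = hp TYPE('a)" and "q = hq TYPE('a)"
  note pq = hp_hq[OF d, folded p_def q_def]
  have D: "D \<ge> 3" using d by (simp add: D_def)
  have c: "c > 0" unfolding c_def by (rule newt_c_pos[OF d])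
  note mD = multiplierD[OF m]
  note [measurable] = mD(4,5)
  define u1 where "u1 = (\<lambda>i x. \<integral>a. g a * bub1 i s (x - a) \<partial>lborel)"
  define u2 where "u2 = (\<lambda>i x. \<integral>a. g a * bub2 i s (x - a) \<partial>lborel)"
  obtain C where "\<And>a x. norm (a::'a) \<le> R \<Longrightarrow> \<bar>bub s (x - a)\<bar> \<le> C * jb x powr (- (real DIM('a) - 2))"
    "\<And>a x i. norm (a::'a) \<le> R \<Longrightarrow> i \<in> Basis \<Longrightarrow> \<bar>bub1 i s (x - a)\<bar> \<le> C * jb x powr (- (real DIM('a) - 1))"
    "\<And>a x i. norm (a::'a) \<le> R \<Longrightarrow> i \<in> Basis \<Longrightarrow> \<bar>bub2 i s (x - a)\<bar> \<le> C * jb x powr (- real DIM('a))"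
    by (rule bub_bounds_uniform[OF d s, of R]) (rule that, assumption+)
  note C = this[folded D_def]
  have gR': "norm x \<le> R" if "g x \<noteq> 0" for x using gR[of x] that by force
  have e1: "- (D - 2) - 1 = - (D - 1)" "- (D - 1) - 1 = - D" by auto
  have sbu: "sb i (D - 2) u (u1 i)" if i: "i \<in> Basis" for i
    unfolding u_def u1_def
  proof (rule sb_superpos[where C = C])
    show "sb i (D - 2) (\<lambda>x. bub s (x - a)) (\<lambda>x. bub1 i s (x - a))" for a
      unfolding D_def by (rule sb_bub(1)[OF d i s])
  qed (use i D C gR' gI gm in \<open>auto simp: e1\<close>)
  have sbu1: "sb i (D - 1) (u1 i) (u2 i)" if i: "i \<in> Basis" for i
    unfolding u1_def u2_def
  proof (rule sb_superpos[where C = C])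
    show "sb i (D - 1) (\<lambda>x. bub1 i s (x - a)) (\<lambda>x. bub2 i s (x - a))" for a
      unfolding D_def by (rule sb_bub(2)[OF d i s])
  qed (use i D C gR' gI gm in \<open>auto simp: e1\<close>)
  obtain b :: 'a where b: "b \<in> Basis" using nonempty_Basis by blast
  have um [measurable]: "u \<in> borel_measurable borel" by (rule sbD(3)[OF sbu[OF b]])
  have sbv: "sb i (D - 2) (\<lambda>x. m x * u x) (\<lambda>x. m1 i x * u x + m x * u1 i x)" if i: "i \<in> Basis" for i
    using sb_mult[OF mD(1)[OF i] sbu[OF i]] by simp
  define v2 where "v2 = (\<lambda>i x. (m2 i x * u x + m1 i x * u1 i x) + (m1 i x * u1 i x + m x * u2 i x))"
  have sbv1: "sb i (D - 1) (\<lambda>x. m1 i x * u x + m x * u1 i x) (v2 i)" if i: "i \<in> Basis" for i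
  proof -
    have e: "1 + (D - 2) = D - 1" "0 + (D - 1) = D - 1" by auto
    show ?thesis unfolding v2_def
      using sb_add[OF sb_mult[OF mD(2)[OF i] sbu[OF i], unfolded e] sb_mult[OF mD(1)[OF i] sbu1[OF i], unfolded e]] .
  qed
  define L where "L = (\<lambda>x. \<Sum>i\<in>Basis. v2 i x)"
  note rep = newton_representation[OF d, of "\<lambda>x. m x * u x" "\<lambda>i x. m1 i x * u x + m x * u1 i x" v2, folded D_def, OF sbv sbv1, folded L_def c_def]
  have Lm [measurable]: "L \<in> borel_measurable borel" by (rule rep(1))
  \<comment> \<open>Minus the Laplacian of m u. By the representation formula its potential is
    \<open>c\<close> times m u, so a Sobolev inequality for m u becomes a statement about the energy
    of \<open>G\<close>.\<close>
  define G where "G = (\<lambda>x. - L x)"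
  have Gm [measurable]: "G \<in> borel_measurable borel" unfolding G_def by measurable
  obtain CL where CL: "\<And>x. \<bar>L x\<bar> \<le> CL * jb x powr (- D)" using rep(2) unfolding L_def by auto
  have "(\<lambda>x::'a. CL * jb x powr (- D)) \<in> Lhp"
    using pq(1) D by (intro Lhp_scale jb_powr_Lhp) (simp add: D_def p_def)
  then have G: "G \<in> Lhp"
    by (rule Lhp_bound) (use CL in \<open>auto simp: G_def intro: order_trans[OF CL abs_ge_self]\<close>)
  have potG: "pot G x = c * (m x * u x)" for x
    unfolding pot_def G_def L_def by (rule rep(4))
  have bubI: "integrable lborel (\<lambda>a. g a * bub2 i s (x - a))" if i: "i \<in> Basis" for i x
  proof (rule Bochner_Integration.integrable_bound[OF integrable_mult_left[OF gI, of "C * jb x powr (- D)"]])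
    show "AE a in lborel. norm (g a * bub2 i s (x - a)) \<le> norm (g a * (C * jb x powr (- D)))"
    proof (rule AE_I2)
      fix a
      show "norm (g a * bub2 i s (x - a)) \<le> norm (g a * (C * jb x powr (- D)))"
      proof (cases "g a = 0")
        case False
        have "\<bar>bub2 i s (x - a)\<bar> \<le> \<bar>C * jb x powr (- D)\<bar>" using C(3)[OF gR'[OF False] i, of x] by linarith
        then show ?thesis unfolding real_norm_def abs_mult[of "g a"] by (intro mult_left_mono) auto
      qed simp
    qed
  qed simp
  have sum_u2: "(\<Sum>i\<in>Basis. u2 i x) = - r x" for x
  proof -
    have "(\<Sum>i\<in>Basis. u2 i x) = (\<integral>a. (\<Sum>i\<in>Basis. g a * bub2 i s (x - a)) \<partial>lborel)"
      unfolding u2_def by (rule Bochner_Integration.integral_sum[symmetric]) (rule bubI)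
    also have "\<dots> = (\<integral>a. - (g a * rho s (x - a)) \<partial>lborel)"
      by (simp only: sum_distrib_left[symmetric] sum_bub2[OF s] mult_minus_right)
    finally show ?thesis by (simp add: r_def)
  qed
  \<comment> \<open>The components of the field m u^2 \<nabla>m. Its divergence has integral 0 and
    is exactly the difference between the integrand \<open>E\<close> and -(m u) \<Delta>(m u); the
    mixed terms with \<nabla>m and \<nabla>u cancel.\<close>
  have X: "sb i ((D - 2) + (1 + (D - 2))) (\<lambda>x. (m x * u x) * (m1 i x * u x))
      (\<lambda>x. (m1 i x * u x + m x * u1 i x) * (m1 i x * u x) + (m x * u x) * (m2 i x * u x + m1 i x * u1 i x))" if i: "i \<in> Basis" for i
    by (intro sb_mult[OF sbv[OF i] sb_mult[OF mD(2)[OF i] sbu[OF i]]])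
  define X' where "X' = (\<lambda>i x. (m1 i x * u x + m x * u1 i x) * (m1 i x * u x) + (m x * u x) * (m2 i x * u x + m1 i x * u1 i x))"
  have XI: "integrable lborel (X' i)" "(\<integral>x. X' i x \<partial>lborel) = 0" if i: "i \<in> Basis" for i
    using integral_sb[OF _ X[OF i]] i D unfolding X'_def by (auto simp: D_def)
  define E where "E = (\<lambda>x. (m x)\<^sup>2 * r x * u x + (u x)\<^sup>2 * grad2 m1 x)"
  have ptw: "G x * (m x * u x) = E x - (\<Sum>i\<in>Basis. X' i x)" for x
  proof -
    have "(\<Sum>i\<in>Basis. X' i x) = (\<Sum>i\<in>Basis. v2 i x * (m x * u x) + (u x)\<^sup>2 * (m1 i x)\<^sup>2 - (m x)\<^sup>2 * u x * u2 i x)"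
      by (rule sum.cong) (simp_all add: X'_def v2_def algebra_simps power2_eq_square)
    also have "\<dots> = L x * (m x * u x) + (u x)\<^sup>2 * grad2 m1 x + (m x)\<^sup>2 * u x * r x"
    proof -
      have rx: "r x = - (\<Sum>i\<in>Basis. u2 i x)" using sum_u2[of x] by simp
      have "(m x)\<^sup>2 * u x * r x = - (\<Sum>i\<in>Basis. (m x)\<^sup>2 * u x * u2 i x)"
        unfolding rx by (simp add: sum_distrib_left)
      then show ?thesis
        by (simp add: sum.distrib sum_subtractf L_def grad2_def sum_distrib_left sum_distrib_right)
    qed
    finally show ?thesis by (simp add: G_def E_def algebra_simps)
  qed
  have GI: "integrable lborel (\<lambda>x. G x * (m x * u x))"
    using hls_pot(1)[OF d G G] c unfolding potG by (simp add: mult.left_commute)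
  have "integrable lborel (\<lambda>x. G x * (m x * u x) + (\<Sum>i\<in>Basis. X' i x))"
    by (intro Bochner_Integration.integrable_add Bochner_Integration.integrable_sum GI XI)
  then have EI: "integrable lborel E" unfolding ptw by simp
  then show "integrable lborel (\<lambda>x. (m x)\<^sup>2 * r x * u x + (u x)\<^sup>2 * grad2 m1 x)" unfolding E_def .
  have GE: "(\<integral>x. G x * (m x * u x) \<partial>lborel) = (\<integral>x. E x \<partial>lborel)"
    unfolding ptw using EI XI by (simp add: Bochner_Integration.integral_sum)
  have hG: "hls G G = c * (\<integral>x. E x \<partial>lborel)"
    unfolding hls_pot(2)[OF d G G] potG GE[symmetric] by (simp add: mult.left_commute)
  have u0: "u x \<ge> 0" for x unfolding u_def using g0 by (intro integral_nonneg_AE) auto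
  obtain Cu where Cu: "\<And>x. \<bar>u x\<bar> \<le> Cu * jb x powr (- (D - 2))" using sb_bound[OF sbu[OF b]] by metis
  then show "\<exists>C. \<forall>x. u x \<le> C * jb x powr (- (real DIM('a) - 2))"
    unfolding D_def by (metis abs_ge_self order_trans)
  obtain Cm where Cm: "\<And>x. \<bar>m x * u x\<bar> \<le> Cm * jb x powr (- (D - 2))" using sb_bound[OF sbv[OF b]] by metis
  have mu0: "m x * u x \<ge> 0" for x using mD(3) u0 by simp
  have SI: "integrable lborel (\<lambda>x. (m x * u x) powr q)"
  proof -
    have Cm0: "Cm \<ge> 0" using order_trans[OF abs_ge_zero Cm[of 0]] by (simp add: jb_def)
    have I: "integrable lborel (\<lambda>x::'a. Cm powr q * jb x powr (- (2 * D)))"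
      using D by (intro integrable_mult_right jb_powr_integrable) (simp add: D_def)
    show ?thesis
    proof (rule Bochner_Integration.integrable_bound[OF I])
      show "AE x in lborel. norm ((m x * u x) powr q) \<le> norm (Cm powr q * jb x powr (- (2 * D)))"
      proof (rule AE_I2)
        fix x
        have "(m x * u x) powr q \<le> (Cm * jb x powr (- (D - 2))) powr q"
          using mu0[of x] Cm[of x] pq by (intro powr_mono2) auto
        also have "\<dots> = Cm powr q * jb x powr (- (D - 2) * q)" using Cm0 by (simp add: powr_mult powr_powr)
        also have "- (D - 2) * q = - (2 * D)" using pq(6) by (simp add: D_def algebra_simps)
        finally show "norm ((m x * u x) powr q) \<le> norm (Cm powr q * jb x powr (- (2 * D)))" by simp
      qed
    qed simp
  qed
  then show "integrable lborel (\<lambda>x. (m x * u x) powr hq TYPE('a))" unfolding q_def .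
  define S where "S = (\<integral>x. (m x * u x) powr q \<partial>lborel)"
  have S0: "S \<ge> 0" unfolding S_def by (intro integral_nonneg_AE) auto
  \<comment> \<open>The dual density: its p-th power and its product with m u are both (m u)^q.
    Cauchy-Schwarz in the energy for \<open>k\<close> and \<open>G\<close>, with the energy of
    \<open>k\<close> bounded through \<open>hls_M\<close>, is the whole duality argument.\<close>
  define k where "k = (\<lambda>x. (m x * u x) powr (q - 1))"
  have [measurable]: "k \<in> borel_measurable borel" unfolding k_def by measurable
  have kp: "k x powr p = (m x * u x) powr q" for x unfolding k_def using pq(4) by (simp add: powr_powr mult.commute)
  have k0: "k x \<ge> 0" for x by (simp add: k_def)
  have k: "k \<in> Lhp" using SI k0 kp by (simp add: Lhp_def p_def[symmetric])
  have km: "k x * (m x * u x) = (m x * u x) powr q" for x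
    unfolding k_def using mu0[of x] pq(2) powr_add[of "m x * u x" "q - 1" 1] by (cases "m x * u x = 0") auto
  have hkG: "hls k G = c * S"
  proof -
    have "hls k G = (\<integral>x. c * (k x * (m x * u x)) \<partial>lborel)"
      unfolding hls_pot(2)[OF d k G] potG by (simp add: mult.left_commute)
    then show ?thesis unfolding km S_def by simp
  qed
  have hkk: "hls k k \<le> hls_M TYPE('a) * S powr (2 / p)"
    using hls_le_M[OF d k k0] unfolding p_def[symmetric] kp S_def .
  define M where "M = hls_M TYPE('a)"
  define T where "T = (\<integral>x. E x \<partial>lborel)"
  have hG0: "0 \<le> c * T" using hls_nonneg_self[OF d G] unfolding hG T_def .
  then have T0: "T \<ge> 0" using c by (simp add: zero_le_mult_iff)
  have "(c * S)\<^sup>2 \<le> hls k k * hls G G"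
    using hls_Cauchy_Schwarz[OF d k G] unfolding hkG .
  also have "\<dots> \<le> (M * S powr (2 / p)) * (c * T)"
    unfolding hG T_def[symmetric] M_def by (intro mult_right_mono hkk hG0)
  finally have main: "(c * S)\<^sup>2 \<le> (M * S powr (2 / p)) * (c * T)" .
  have "c * S powr (2 / q) \<le> M * T"
  proof (cases "S = 0")
    case True then show ?thesis using hls_M_nonneg[OF d] T0 by (simp add: M_def)
  next
    case False
    then have S: "S > 0" using S0 by simp
    have "2 / q = 2 - 2 / p" using pq(3) by (simp add: field_simps)
    then have "S powr (2 / q) = S\<^sup>2 / S powr (2 / p)" using S by (simp add: powr_diff)
    moreover have "c * S\<^sup>2 \<le> M * T * S powr (2 / p)"
    proof -
      have "c * (c * S\<^sup>2) \<le> c * (M * T * S powr (2 / p))"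
        using main by (simp add: power2_eq_square mult_ac)
      then show ?thesis using c by simp
    qed
    moreover have "c * S\<^sup>2 / S powr (2 / p) \<le> M * T" using calculation(2) S by (simp add: pos_divide_le_eq)
    ultimately show ?thesis by simp
  qed
  then show "newt_c TYPE('a) * (\<integral>x. (m x * u x) powr hq TYPE('a) \<partial>lborel) powr (2 / hq TYPE('a))
      \<le> hls_M TYPE('a) * (\<integral>x. (m x)\<^sup>2 * r x * u x + (u x)\<^sup>2 * grad2 m1 x \<partial>lborel)"
    unfolding c_def q_def S_def M_def T_def E_def .
qed


section \<open>From smooth to bounded densities\<close>

lemma AE_norm_mono:
  fixes f g :: "'b \<Rightarrow> real"
  assumes "\<And>x. 0 \<le> f x" "\<And>x. f x \<le> g x"
  shows "AE x in M. norm (f x) \<le> norm (g x)" "AE x in M. \<bar>f x\<bar> \<le> \<bar>g x\<bar>"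
proof -
  have "\<bar>f x\<bar> \<le> \<bar>g x\<bar>" for x using assms[of x] by linarith
  then show "AE x in M. norm (f x) \<le> norm (g x)" "AE x in M. \<bar>f x\<bar> \<le> \<bar>g x\<bar>" by auto
qed

lemma newton_far:
  fixes x y :: "'a::euclidean_space"
  assumes d: "DIM('a) \<ge> 3" and far: "norm (x - y) \<ge> 1"
  shows "newton (x - y) \<le> (2 + norm x) powr (real DIM('a) - 2) * jb y powr (- (real DIM('a) - 2))"
proof -
  define D where "D = real DIM('a)"
  have D: "D \<ge> 3" using d by (simp add: D_def)
  have "jb y \<le> 1 + norm y" by (rule jb_le)
  also have "norm y \<le> norm x + norm (x - y)" using norm_triangle_ineq2[of y x] by (simp add: norm_minus_commute)
  also have "1 + (norm x + norm (x - y)) \<le> (2 + norm x) * norm (x - y)"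
    using far mult_left_mono[of 1 "norm (x - y)" "1 + norm x"] by (simp add: algebra_simps)
  finally have "jb y / (2 + norm x) \<le> norm (x - y)" by (simp add: divide_le_eq mult.commute add_pos_nonneg)
  then have "norm (x - y) powr (- (D - 2)) \<le> (jb y / (2 + norm x)) powr (- (D - 2))"
    using D by (intro powr_mono2') (auto simp: add_pos_nonneg)
  also have "\<dots> = (2 + norm x) powr (D - 2) * jb y powr (- (D - 2))"
  proof -
    have "(jb y / (2 + norm x)) powr (- (D - 2)) = jb y powr (- (D - 2)) / (2 + norm x) powr (- (D - 2))"
      by (rule powr_divide)
    also have "(2 + norm x) powr (- (D - 2)) = 1 / (2 + norm x) powr (D - 2)" by (rule powr_minus_divide)
    finally show ?thesis by simp
  qed
  finally show ?thesis by (simp add: newton_def D_def)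
qed

text \<open>At distance at least 1 from a point of the support the kernel itself has the required
  decay. At smaller distance the factor \<open>(2 + R) powr (D - 2) * jb x powr (- (D - 2))\<close>
  is at least 1 and may be inserted, so the single majorant \<open>H\<close> covers both
  cases.\<close>

lemma pot_bounded_support:
  fixes g :: "'a::euclidean_space \<Rightarrow> real"
  assumes d: "DIM('a) \<ge> 3" and [measurable]: "g \<in> borel_measurable borel"
    and g0: "\<And>x. 0 \<le> g x" and gB: "\<And>x. g x \<le> B" and gR: "\<And>x. norm x > R \<Longrightarrow> g x = 0" and R: "R \<ge> 0"
  shows "integrable lborel g" "\<And>x. integrable lborel (\<lambda>y. newton (x - y) * g y)"
    "\<exists>C. \<forall>x. pot g x \<le> C * jb x powr (- (real DIM('a) - 2))"
proof -
  define D where "D = real DIM('a)"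
  have D: "D \<ge> 3" using d by (simp add: D_def)
  have B: "B \<ge> 0" using g0[of 0] gB[of 0] by simp
  show gI: "integrable lborel g"
  proof (rule Bochner_Integration.integrable_bound)
    show "integrable lborel (\<lambda>x::'a. B * indicator (cball 0 R) x)"
      using emeasure_bounded_finite[of "cball (0::'a) R"] by simp
    show "AE x in lborel. norm (g x) \<le> norm (B * indicator (cball 0 R) x)"
      using g0 gB gR B by (intro AE_I2) (auto simp: indicator_def not_le)
  qed simp
  have "integrable lborel (\<lambda>z::'a. newton z * indicator {z. norm z < 1} z)"
  proof (rule integrableI_bounded)
    have "(\<integral>\<^sup>+(z::'a). ennreal (norm (newton z * indicator {z. norm z < 1} z)) \<partial>lborel)
      = (\<integral>\<^sup>+(z::'a). ennreal (newton z) * indicator {z. norm z < 1} z \<partial>lborel)"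
      by (intro nn_integral_cong) (auto simp: indicator_def)
    then show "(\<integral>\<^sup>+(z::'a). ennreal (norm (newton z * indicator {z. norm z < 1} z)) \<partial>lborel) < \<infinity>"
      using nn_integral_newton_ball[where 'a='a, of 1] by simp
  qed simp
  then have I1: "integrable lborel (\<lambda>y. newton (x - y) * indicator {z. norm z < 1} (x - y))" for x :: 'a
    by (subst integrable_shift_minus[of "\<lambda>z. newton z * indicator {z. norm z < 1} z"]) simp_all
  define C1 where "C1 = (\<integral>(z::'a). newton z * indicator {z. norm z < 1} z \<partial>lborel)"
  have I1v: "(\<integral>y. newton (x - y) * indicator {z. norm z < 1} (x - y) \<partial>lborel) = C1" for x :: 'a
    unfolding C1_def by (rule integral_shift_minus[of "\<lambda>z. newton z * indicator {z. norm z < 1} z"]) simp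
  define H where "H = (\<lambda>x y. ((2 + R) powr (D - 2) * jb x powr (- (D - 2))) * (B * (newton (x - y) * indicator {z::'a. norm z < 1} (x - y)) + g y))"
  have HI: "integrable lborel (H x)" for x
    unfolding H_def by (intro integrable_mult_right Bochner_Integration.integrable_add I1 gI)
  have Hv: "(\<integral>y. H x y \<partial>lborel) = ((2 + R) powr (D - 2) * jb x powr (- (D - 2))) * (B * C1 + (\<integral>y. g y \<partial>lborel))" for x
    unfolding H_def using I1[of x] gI by (simp add: I1v)
  have bd: "newton (x - y) * g y \<le> H x y" for x y
  proof (cases "g y = 0")
    case True then show ?thesis unfolding H_def using B by simp
  next
    case False
    then have yR: "norm y \<le> R" using gR[of y] by force
    show ?thesis
    proof (cases "norm (x - y) < 1")
      case True
      have "norm x \<le> norm y + norm (x - y)" using norm_triangle_ineq[of y "x - y"] by simp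
      then have "jb x \<le> 2 + R" using jb_le[of x] yR True by linarith
      then have "(2 + R) powr (- (D - 2)) \<le> jb x powr (- (D - 2))" using D by (intro powr_mono2') auto
      then have "(2 + R) powr (D - 2) * (2 + R) powr (- (D - 2)) \<le> (2 + R) powr (D - 2) * jb x powr (- (D - 2))"
        by (intro mult_left_mono) auto
      moreover have "(2 + R) powr (D - 2) * (2 + R) powr (- (D - 2)) = 1" using R unfolding powr_add[symmetric] by simp
      ultimately have 1: "1 \<le> (2 + R) powr (D - 2) * jb x powr (- (D - 2))" by simp
      have "newton (x - y) * g y \<le> newton (x - y) * B" using gB by (intro mult_left_mono) auto
      also have "\<dots> \<le> B * newton (x - y) + g y" using g0[of y] by simp
      also have "\<dots> \<le> H x y" unfolding H_def using True B g0[of y] mult_right_mono[OF 1, of "B * newton (x - y) + g y"] by simp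
      finally show ?thesis .
    next
      case far: False
      have "newton (x - y) \<le> (2 + norm y) powr (D - 2) * jb x powr (- (D - 2))"
        using newton_far[OF d, of y x] far unfolding D_def by (simp add: newton_commute norm_minus_commute)
      also have "\<dots> \<le> (2 + R) powr (D - 2) * jb x powr (- (D - 2))"
        using yR D by (intro mult_right_mono powr_mono2) auto
      finally show ?thesis unfolding H_def using far g0[of y] by (simp add: mult_right_mono)
    qed
  qed
  show nI: "integrable lborel (\<lambda>y. newton (x - y) * g y)" for x
    by (rule Bochner_Integration.integrable_bound[OF HI[of x]])
       (use bd g0 in \<open>auto intro!: AE_I2 intro: order_trans[OF bd abs_ge_self]\<close>)
  have "pot g x \<le> ((2 + R) powr (D - 2) * (B * C1 + (\<integral>y. g y \<partial>lborel))) * jb x powr (- (D - 2))" for x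
  proof -
    have "pot g x \<le> (\<integral>y. H x y \<partial>lborel)" unfolding pot_def by (intro integral_mono nI HI bd)
    then show ?thesis unfolding Hv by (simp add: mult_ac)
  qed
  then show "\<exists>C. \<forall>x. pot g x \<le> C * jb x powr (- (real DIM('a) - 2))" unfolding D_def by blast
qed

lemma rho_le_jb:
  assumes d: "DIM('a::euclidean_space) \<ge> 3" and t: "t > 0"
  obtains C where "\<And>z::'a. rho t z \<le> C * jb z powr (- (real DIM('a) + 2))"
proof -
  define D where "D = real DIM('a)"
  obtain K where K: "K > 0" "\<And>x::'a. (jb x)\<^sup>2 \<le> K * (t\<^sup>2 + (norm (x - 0))\<^sup>2)"
    using jb_shift_bound[OF t, of "0::'a"] by metis
  have "rho t z \<le> (D * (D - 2) * t\<^sup>2 * K powr ((D + 2) / 2)) * jb z powr (- (D + 2))" for z :: 'a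
  proof -
    have "rho t z = D * (D - 2) * t\<^sup>2 * (t\<^sup>2 + (norm (z - 0))\<^sup>2) powr (- (D + 2) / 2)"
      by (simp add: rho_def D_def)
    also have "\<dots> \<le> D * (D - 2) * t\<^sup>2 * (K powr ((D + 2) / 2) * jb z powr (- (D + 2)))"
      using d by (intro mult_left_mono bubble_le_jb[OF K(1) K(2) _ t]) (auto simp: D_def)
    finally show ?thesis by (simp add: mult.assoc)
  qed
  then show ?thesis using that unfolding D_def by blast
qed

text \<open>The first moment is proportional to t; it measures the error of moving a Lipschitz
  factor across the mollifier. Membership in \<open>Lhp\<close> lets translates of
  \<open>rho\<close> enter the bilinear form.\<close>

lemma rho_integrable:
  assumes d: "DIM('a::euclidean_space) \<ge> 3" and t: "t > 0"
  shows "integrable lborel (\<lambda>x::'a. rho t (x - a))" "integrable lborel (\<lambda>x::'a. norm (x - a) * rho t (x - a))"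
    "(\<integral>x. norm (x - a) * rho t (x - a) \<partial>lborel) = t * (\<integral>(z::'a). norm z * rho 1 z \<partial>lborel)"
    "(\<lambda>x::'a. rho t (x - a)) \<in> Lhp"
proof -
  define D where "D = real DIM('a)"
  have D: "D \<ge> 3" using d by (simp add: D_def)
  obtain C where C: "\<And>z::'a. rho t z \<le> C * jb z powr (- (D + 2))" using rho_le_jb[OF d t] unfolding D_def by metis
  have r0: "rho t z \<ge> 0" for z :: 'a by (rule rho_nonneg[OF d])
  have J: "integrable lborel (\<lambda>x::'a. C * jb x powr (- k))" if "k > D" for k
    using that by (intro integrable_mult_right jb_powr_integrable) (simp add: D_def)
  have sh: "integrable lborel (\<lambda>x::'a. h (x - a))" if "integrable lborel h" and [measurable]: "h \<in> borel_measurable borel" for h :: "'a \<Rightarrow> real"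
    using that integrable_affine_iff[of h 1 "- a"] by (simp add: add.commute)
  have I1: "integrable lborel (rho t :: 'a \<Rightarrow> real)"
    by (rule Bochner_Integration.integrable_bound[OF J[of "D + 2"] _ AE_norm_mono(1)[OF r0 C]]) auto
  show "integrable lborel (\<lambda>x::'a. rho t (x - a))" by (rule sh[OF I1]) simp
  have "integrable lborel (\<lambda>z::'a. norm z * rho t z)"
  proof (rule Bochner_Integration.integrable_bound[OF J[of "D + 1"]])
    show "AE x::'a in lborel. norm (norm x * rho t x) \<le> norm (C * jb x powr (- (D + 1)))"
    proof (rule AE_I2)
      fix x :: 'a
      have "norm x * rho t x \<le> jb x * (C * jb x powr (- (D + 2)))"
        using C[of x] r0[of x] norm_le_jb[of x] by (intro mult_mono) auto
      also have "\<dots> = C * (jb x powr 1 * jb x powr (- (D + 2)))" by simp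
      also have "jb x powr 1 * jb x powr (- (D + 2)) = jb x powr (- (D + 1))"
      proof -
        have "1 + - (D + 2) = - (D + 1)" by simp
        then show ?thesis unfolding powr_add[symmetric] by (simp only:)
      qed
      finally have 1: "norm x * rho t x \<le> C * jb x powr (- (D + 1))" .
      have 0: "0 \<le> norm x * rho t x" using r0[of x] by simp
      show "norm (norm x * rho t x) \<le> norm (C * jb x powr (- (D + 1)))" unfolding real_norm_def using 0 1 by linarith
    qed
  qed auto
  then show "integrable lborel (\<lambda>x::'a. norm (x - a) * rho t (x - a))" by (rule sh) simp
  show "(\<integral>x. norm (x - a) * rho t (x - a) \<partial>lborel) = t * (\<integral>(z::'a). norm z * rho 1 z \<partial>lborel)"
    using t by (subst integral_rho_shift) (auto simp: mult.assoc)
  have "(\<lambda>x::'a. C * jb x powr (- (D + 2))) \<in> Lhp"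
    by (intro Lhp_scale jb_powr_Lhp) (simp add: hp_def D_def)
  then have L: "rho t \<in> (Lhp :: ('a \<Rightarrow> real) set)"
    by (rule Lhp_bound[OF _ _ AE_norm_mono(2)[OF r0 C]]) simp
  have "integrable lborel (\<lambda>x::'a. \<bar>rho t (x - a)\<bar> powr hp TYPE('a))"
    by (rule sh[OF LhpD(2)[OF L]]) simp
  then show "(\<lambda>x::'a. rho t (x - a)) \<in> Lhp" by (simp add: Lhp_def)
qed

lemma pot_rho:
  fixes a :: "'a::euclidean_space"
  assumes d: "DIM('a) \<ge> 3" and t: "t > 0"
  shows "pot (\<lambda>x. rho t (x - a)) y = newt_c TYPE('a) * bub t (y - a)"
proof -
  have "(\<integral>x. newton (y - x) * - (\<Sum>i\<in>Basis. bub2 i t (x - a)) \<partial>lborel) = newt_c TYPE('a) * bub t (y - a)"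
    by (rule newton_representation(4)[OF d, of "\<lambda>x. bub t (x - a)" "\<lambda>i x. bub1 i t (x - a)" "\<lambda>i x. bub2 i t (x - a)"])
       (auto intro: sb_bub[OF d _ t])
  then show ?thesis unfolding pot_def by (simp add: sum_bub2[OF t])
qed

text \<open>The smooth case is applied with the kernel \<open>bub (t n)\<close>. The potentials
  \<open>u n\<close> stay below \<open>U\<close> and converge to it. The term that needs care is the
  one with \<open>r n\<close>, where the squared multiplier is evaluated at x and has to be moved to
  the centre a of the mollifier.\<close>

lemma localized_Sobolev_bounded:
  fixes g :: "'a::euclidean_space \<Rightarrow> real"
  assumes d: "DIM('a) \<ge> 3" and m: "multiplier m m1 m2"
    and gm [measurable]: "g \<in> borel_measurable borel" and g0: "\<And>x. 0 \<le> g x" and gB: "\<And>x. g x \<le> B"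
    and gR: "\<And>x. norm x > R \<Longrightarrow> g x = 0" and R: "R \<ge> 0"
    and J: "integrable lborel (\<lambda>x. (pot g x)\<^sup>2 * grad2 m1 x)"
  shows "integrable lborel (\<lambda>x. (m x * pot g x) powr hq TYPE('a))"
    "newt_c TYPE('a) * (\<integral>x. (m x * pot g x) powr hq TYPE('a) \<partial>lborel) powr (2 / hq TYPE('a))
      \<le> hls_M TYPE('a) * (newt_c TYPE('a) * (\<integral>x. g x * (m x)\<^sup>2 * pot g x \<partial>lborel) + (\<integral>x. (pot g x)\<^sup>2 * grad2 m1 x \<partial>lborel))"
proof -
  define D where "D = real DIM('a)"
  define c where "c = newt_c TYPE('a)"
  define M where "M = hls_M TYPE('a)"
  define q where "q = hq TYPE('a)"
  note pq = hp_hq[OF d, folded q_def]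
  have D: "D \<ge> 3" using d by (simp add: D_def)
  have c: "c > 0" unfolding c_def by (rule newt_c_pos[OF d])
  have M: "M \<ge> 0" unfolding M_def by (rule hls_M_nonneg[OF d])
  note mD = multiplierD[OF m]
  note [measurable] = mD(4,5)
  define U where "U = pot g"
  have Um [measurable]: "U \<in> borel_measurable borel" unfolding U_def by measurable
  note bs = pot_bounded_support[OF d gm g0 gB gR R]
  note gI = bs(1) and nI = bs(2)
  obtain CU where CU: "\<And>x. U x \<le> CU * jb x powr (- (D - 2))" using bs(3) unfolding U_def D_def by blast
  have U0: "U x \<ge> 0" for x unfolding U_def by (rule pot_nonneg[OF g0])
  have CU0: "CU \<ge> 0" using order_trans[OF U0 CU[of 0]] by (simp add: jb_def)
  have Ub: "U x \<le> CU" for x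
  proof -
    have "jb x powr (- (D - 2)) \<le> 1 powr (- (D - 2))" using D jb_ge_1 by (intro powr_mono2') auto
    then show ?thesis using CU[of x] mult_left_mono[OF _ CU0, of "jb x powr (- (D - 2))" 1] by simp
  qed
  obtain Cm where Cm: "\<And>x. m x \<le> Cm" using mD(6) by blast
  have Cm0: "Cm \<ge> 0" using order_trans[OF mD(3) Cm] .
  obtain L where L: "\<And>x y. \<bar>m x - m y\<bar> \<le> L * norm (x - y)" using m unfolding multiplier_def by blast
  have gL: "g \<in> Lhp"
  proof -
    have B0: "B \<ge> 0" using g0[of 0] gB[of 0] by simp
    have "integrable lborel (\<lambda>x::'a. \<bar>B * indicator (cball 0 R) x\<bar> powr hp TYPE('a))"
    proof -
      have "(\<lambda>x::'a. \<bar>B * indicator (cball 0 R) x\<bar> powr hp TYPE('a)) = (\<lambda>x. \<bar>B\<bar> powr hp TYPE('a) * indicator (cball 0 R) x)"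
        by (auto simp: indicator_def fun_eq_iff)
      then show ?thesis using emeasure_bounded_finite[of "cball (0::'a) R"] by simp
    qed
    moreover have "(\<lambda>x::'a. B * indicator (cball 0 R) x) \<in> borel_measurable borel"
      by (intro borel_measurable_times borel_measurable_const borel_measurable_indicator) simp
    ultimately have "(\<lambda>x::'a. B * indicator (cball 0 R) x) \<in> Lhp" by (simp add: Lhp_def)
    then show ?thesis
      by (rule Lhp_bound) (use g0 gB gR B0 in \<open>auto simp: indicator_def not_le\<close>)
  qed
  define t where "t = (\<lambda>n. 1 / real (Suc n))"
  have t: "t n > 0" for n by (simp add: t_def)
  have t0: "t \<longlonglongrightarrow> 0" unfolding t_def using LIMSEQ_inverse_real_of_nat by (simp add: inverse_eq_divide)
  define u where "u = (\<lambda>n x. \<integral>a. g a * bub (t n) (x - a) \<partial>lborel)"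
  define r where "r = (\<lambda>n x. \<integral>a. g a * rho (t n) (x - a) \<partial>lborel)"
  have um [measurable]: "u n \<in> borel_measurable borel" "r n \<in> borel_measurable borel" for n
    unfolding u_def r_def by measurable
  have domu: "AE a in lborel. norm (g a * bub (t n) (x - a)) \<le> newton (x - a) * g a" for n x
    using AE_lborel_singleton[of x]
  proof eventually_elim
    case (elim a)
    then have "bub (t n) (x - a) \<le> newton (x - a)" by (intro bub_le_newton[OF d]) simp
    then show ?case using g0[of a] by (simp add: abs_mult mult.commute[of _ "g a"] mult_left_mono)
  qed
  have uI: "integrable lborel (\<lambda>a. g a * bub (t n) (x - a))" for n x
    by (rule Bochner_Integration.integrable_bound[OF nI[of x]])
       (use domu[of n x] in \<open>auto elim!: eventually_mono\<close>)
  have u0: "u n x \<ge> 0" for n x unfolding u_def using g0 by (intro integral_nonneg_AE) auto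
  have uU: "u n x \<le> U x" for n x
    unfolding u_def U_def pot_def using domu[of n x] by (intro integral_mono_AE uI nI) (auto elim!: eventually_mono)
  have r0: "r n x \<ge> 0" for n x unfolding r_def using g0 rho_nonneg[OF d] by (intro integral_nonneg_AE) auto
  have ulim: "(\<lambda>n. u n x) \<longlonglongrightarrow> U x" for x
    unfolding u_def U_def pot_def
  proof (rule integral_dominated_convergence[OF _ _ nI[of x] _ domu])
    show "AE a in lborel. (\<lambda>n. g a * bub (t n) (x - a)) \<longlonglongrightarrow> newton (x - a) * g a"
      using AE_lborel_singleton[of x]
    proof eventually_elim
      case (elim a)
      have "(\<lambda>n. g a * bub (t n) (x - a)) \<longlonglongrightarrow> g a * newton (x - a)"
        using elim by (intro tendsto_intros bub_tendsto_newton t0) simp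
      then show ?case by (simp add: mult.commute)
    qed
  qed simp_all
  have mU0: "m x * U x \<ge> 0" for x using mD(3) U0 by simp
  have SI: "integrable lborel (\<lambda>x. (m x * U x) powr q)"
  proof -
    have I: "integrable lborel (\<lambda>x::'a. (Cm * CU) powr q * jb x powr (- (2 * D)))"
      using D by (intro integrable_mult_right jb_powr_integrable) (simp add: D_def)
    show ?thesis
    proof (rule Bochner_Integration.integrable_bound[OF I])
      show "AE x in lborel. norm ((m x * U x) powr q) \<le> norm ((Cm * CU) powr q * jb x powr (- (2 * D)))"
      proof (rule AE_I2)
        fix x
        have "m x * U x \<le> Cm * (CU * jb x powr (- (D - 2)))"
          using mD(3)[of x] U0[of x] Cm CU[of x] Cm0 by (intro mult_mono) auto
        then have "(m x * U x) powr q \<le> ((Cm * CU) * jb x powr (- (D - 2))) powr q"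
          using mU0[of x] pq by (intro powr_mono2) (auto simp: mult.assoc)
        also have "\<dots> = (Cm * CU) powr q * jb x powr (- (D - 2) * q)" by (simp only: powr_mult powr_powr)
        also have "- (D - 2) * q = - (2 * D)" using pq(6) by (simp add: D_def algebra_simps)
        finally show "norm ((m x * U x) powr q) \<le> norm ((Cm * CU) powr q * jb x powr (- (2 * D)))" by simp
      qed
    qed simp
  qed
  then show "integrable lborel (\<lambda>x. (m x * pot g x) powr hq TYPE('a))" unfolding q_def U_def .
  have Slim: "(\<lambda>n. \<integral>x. (m x * u n x) powr q \<partial>lborel) \<longlonglongrightarrow> (\<integral>x. (m x * U x) powr q \<partial>lborel)"
  proof (rule integral_dominated_convergence[OF _ _ SI])
    show "AE x in lborel. (\<lambda>n. (m x * u n x) powr q) \<longlonglongrightarrow> (m x * U x) powr q"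
      using pq mD(3) u0 by (intro AE_I2 tendsto_powr' tendsto_intros ulim) auto
    show "AE x in lborel. norm ((m x * u n x) powr q) \<le> (m x * U x) powr q" for n
      using pq mD(3) u0 uU by (intro AE_I2) (auto intro!: powr_mono2 mult_left_mono)
  qed auto
  define C3 where "C3 = (\<integral>(z::'a). norm z * rho 1 z \<partial>lborel)"
  define A where "A = (\<integral>x. g x * (m x)\<^sup>2 * U x \<partial>lborel)"
  define Bg where "Bg = (\<integral>x. (U x)\<^sup>2 * grad2 m1 x \<partial>lborel)"
  define G where "G = (\<integral>x. g x \<partial>lborel)"
  define C4 where "C4 = 2 * Cm * \<bar>L\<bar> * CU * C3"
  have C3: "C3 \<ge> 0" unfolding C3_def using rho_nonneg[OF d] by (intro integral_nonneg_AE) auto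
  have C4: "C4 \<ge> 0" unfolding C4_def using Cm0 CU0 C3 by simp
  \<comment> \<open>Replacing m x by m a costs, by the Lipschitz bound, the first moment of
    \<open>rho\<close>, which is of order \<open>t n\<close>. What remains is the pairing of
    \<open>rho\<close> with \<open>U\<close>; by symmetry it is the pairing of g with a bubble times
    \<open>c\<close>, hence at most c U a.\<close>
  have inner: "(\<integral>x. (m x)\<^sup>2 * U x * rho (t n) (x - a) \<partial>lborel) \<le> c * (m a)\<^sup>2 * U a + t n * C4"
    "integrable lborel (\<lambda>x. (m x)\<^sup>2 * U x * rho (t n) (x - a))" for n a
  proof -
    note ri = rho_integrable[OF d t[of n]]
    have rho0: "rho (t n) z \<ge> 0" for z :: 'a by (rule rho_nonneg[OF d])
    have UI: "integrable lborel (\<lambda>x. rho (t n) (x - a) * U x)"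
      unfolding U_def by (rule hls_pot(1)[OF d ri(4) gL])
    have "(\<integral>x. rho (t n) (x - a) * U x \<partial>lborel) = hls g (\<lambda>x. rho (t n) (x - a))"
      unfolding U_def hls_pot(2)[OF d ri(4) gL, symmetric] by (rule hls_commute) auto
    also have "\<dots> = c * u n a"
      unfolding hls_pot(2)[OF d gL ri(4)] pot_rho[OF d t] c_def u_def
      using bub_minus(1)[of "t n" "_ - a"] by (simp add: mult.left_commute flip: integral_mult_right_zero)
    also have "\<dots> \<le> c * U a" using c uU by (simp add: mult_left_mono)
    finally have 1: "(\<integral>x. rho (t n) (x - a) * U x \<partial>lborel) \<le> c * U a" .
    have pt: "(m x)\<^sup>2 * U x * rho (t n) (x - a) \<le> (m a)\<^sup>2 * (rho (t n) (x - a) * U x) + (2 * Cm * \<bar>L\<bar> * CU) * (norm (x - a) * rho (t n) (x - a))" for x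
    proof -
      have "(m x)\<^sup>2 - (m a)\<^sup>2 = (m x + m a) * (m x - m a)" by (simp add: power2_eq_square algebra_simps)
      also have "\<dots> \<le> (Cm + Cm) * (\<bar>L\<bar> * norm (x - a))"
      proof -
        have "(m x + m a) * (m x - m a) \<le> (m x + m a) * \<bar>m x - m a\<bar>" using mD(3) by (intro mult_left_mono) auto
        also have "\<dots> \<le> (Cm + Cm) * (\<bar>L\<bar> * norm (x - a))"
        proof (intro mult_mono add_mono Cm)
          show "\<bar>m x - m a\<bar> \<le> \<bar>L\<bar> * norm (x - a)"
            by (rule order_trans[OF L]) (intro mult_right_mono, auto)
        qed (use Cm0 in auto)
        finally show ?thesis .
      qed
      finally have "(m x)\<^sup>2 \<le> (m a)\<^sup>2 + 2 * Cm * \<bar>L\<bar> * norm (x - a)" by simp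
      then have "(m x)\<^sup>2 * (U x * rho (t n) (x - a)) \<le> ((m a)\<^sup>2 + 2 * Cm * \<bar>L\<bar> * norm (x - a)) * (U x * rho (t n) (x - a))"
        using U0 rho0 by (intro mult_right_mono) auto
      also have "\<dots> = (m a)\<^sup>2 * (rho (t n) (x - a) * U x) + (2 * Cm * \<bar>L\<bar> * (norm (x - a) * rho (t n) (x - a))) * U x"
        by (simp add: algebra_simps)
      also have "(2 * Cm * \<bar>L\<bar> * (norm (x - a) * rho (t n) (x - a))) * U x \<le> (2 * Cm * \<bar>L\<bar> * (norm (x - a) * rho (t n) (x - a))) * CU"
        using Cm0 rho0 by (intro mult_left_mono Ub) auto
      finally show ?thesis by (simp add: mult_ac)
    qed
    have RI: "integrable lborel (\<lambda>x. (m a)\<^sup>2 * (rho (t n) (x - a) * U x) + (2 * Cm * \<bar>L\<bar> * CU) * (norm (x - a) * rho (t n) (x - a)))"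
      by (intro Bochner_Integration.integrable_add integrable_mult_right UI ri(2))
    show I: "integrable lborel (\<lambda>x. (m x)\<^sup>2 * U x * rho (t n) (x - a))"
      by (rule Bochner_Integration.integrable_bound[OF RI])
         (use pt U0 rho0 in \<open>auto intro!: AE_I2 intro: order_trans[OF pt abs_ge_self] simp: abs_mult\<close>)
    have "(\<integral>x. (m x)\<^sup>2 * U x * rho (t n) (x - a) \<partial>lborel) \<le> (\<integral>x. (m a)\<^sup>2 * (rho (t n) (x - a) * U x) + (2 * Cm * \<bar>L\<bar> * CU) * (norm (x - a) * rho (t n) (x - a)) \<partial>lborel)"
      by (intro integral_mono I RI pt)
    also have "\<dots> = (m a)\<^sup>2 * (\<integral>x. rho (t n) (x - a) * U x \<partial>lborel) + (2 * Cm * \<bar>L\<bar> * CU) * (t n * C3)"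
      using UI ri(2) unfolding C3_def ri(3)[of a, symmetric] by simp
    also have "\<dots> \<le> (m a)\<^sup>2 * (c * U a) + (2 * Cm * \<bar>L\<bar> * CU) * (t n * C3)"
      using 1 by (intro add_mono mult_left_mono order_refl) auto
    finally show "(\<integral>x. (m x)\<^sup>2 * U x * rho (t n) (x - a) \<partial>lborel) \<le> c * (m a)\<^sup>2 * U a + t n * C4"
      by (simp add: C4_def mult_ac)
  qed
  have gmU: "integrable lborel (\<lambda>x. g x * (m x)\<^sup>2 * U x)"
  proof (rule Bochner_Integration.integrable_bound)
    show "integrable lborel (\<lambda>x. Cm\<^sup>2 * (g x * U x))" unfolding U_def by (intro integrable_mult_right hls_pot(1)[OF d gL gL])
    show "AE x in lborel. norm (g x * (m x)\<^sup>2 * U x) \<le> norm (Cm\<^sup>2 * (g x * U x))"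
    proof (rule AE_I2)
      fix x
      have "(m x)\<^sup>2 * (g x * U x) \<le> Cm\<^sup>2 * (g x * U x)" using g0 U0 mD(3) Cm by (intro mult_right_mono power_mono) auto
      then show "norm (g x * (m x)\<^sup>2 * U x) \<le> norm (Cm\<^sup>2 * (g x * U x))" using g0[of x] U0[of x] by (simp add: abs_mult mult_ac)
    qed
  qed simp
  have step: "c * (\<integral>x. (m x * u n x) powr q \<partial>lborel) powr (2 / q) \<le> M * ((c * A + t n * C4 * G) + Bg)" for n
  proof -
    note S = localized_Sobolev_smooth[OF d m t[of n] gm g0 gI gR]
    have E: "integrable lborel (\<lambda>x. (m x)\<^sup>2 * r n x * u n x + (u n x)\<^sup>2 * grad2 m1 x)"
      unfolding r_def u_def by (rule S(3))
    have E2: "integrable lborel (\<lambda>x. (u n x)\<^sup>2 * grad2 m1 x)" "(\<integral>x. (u n x)\<^sup>2 * grad2 m1 x \<partial>lborel) \<le> Bg"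
    proof -
      have le: "(u n x)\<^sup>2 * grad2 m1 x \<le> (U x)\<^sup>2 * grad2 m1 x" for x
        using u0 uU by (intro mult_right_mono power_mono) auto
      show I: "integrable lborel (\<lambda>x. (u n x)\<^sup>2 * grad2 m1 x)"
        by (rule Bochner_Integration.integrable_bound[OF J]) (use le in \<open>auto simp: U_def abs_mult\<close>)
      show "(\<integral>x. (u n x)\<^sup>2 * grad2 m1 x \<partial>lborel) \<le> Bg"
        unfolding Bg_def using J by (intro integral_mono I le) (simp add: U_def)
    qed
    have E1: "integrable lborel (\<lambda>x. (m x)\<^sup>2 * r n x * u n x)"
      using Bochner_Integration.integrable_diff[OF E E2(1)] by simp
    have "ennreal (\<integral>x. (m x)\<^sup>2 * r n x * u n x \<partial>lborel) = (\<integral>\<^sup>+x. ennreal ((m x)\<^sup>2 * r n x * u n x) \<partial>lborel)"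
      using E1 r0 u0 by (intro nn_integral_eq_integral[symmetric] AE_I2) auto
    also have "\<dots> \<le> (\<integral>\<^sup>+x. \<integral>\<^sup>+a. ennreal (g a * ((m x)\<^sup>2 * U x * rho (t n) (x - a))) \<partial>lborel \<partial>lborel)"
    proof (intro nn_integral_mono)
      fix x
      have rI: "integrable lborel (\<lambda>a. g a * rho (t n) (x - a))"
      proof -
        obtain C where C: "\<And>z::'a. rho (t n) z \<le> C * jb z powr (- (real DIM('a) + 2))" using rho_le_jb[OF d t] by metis
        have "rho (t n) (z::'a) \<le> \<bar>C\<bar>" for z
        proof -
          have "jb z powr (- (real DIM('a) + 2)) \<le> 1 powr (- (real DIM('a) + 2))" using jb_ge_1 by (intro powr_mono2') auto
          then have "C * jb z powr (- (real DIM('a) + 2)) \<le> \<bar>C\<bar> * 1" by (intro mult_mono) auto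
          then show ?thesis using C[of z] by simp
        qed
        then have b: "integrable lborel (\<lambda>a. g a * \<bar>C\<bar>)" "AE a in lborel. norm (g a * rho (t n) (x - a)) \<le> norm (g a * \<bar>C\<bar>)"
          using gI g0 rho_nonneg[OF d] by (auto simp: abs_mult intro!: AE_I2 mult_left_mono)
        show ?thesis by (rule Bochner_Integration.integrable_bound[OF b(1) _ b(2)]) simp
      qed
      have "(m x)\<^sup>2 * r n x * u n x \<le> (m x)\<^sup>2 * U x * r n x"
        using mult_left_mono[OF uU[of n x], of "(m x)\<^sup>2 * r n x"] r0[of n x] by (simp add: mult_ac)
      also have "\<dots> = (\<integral>a. g a * ((m x)\<^sup>2 * U x * rho (t n) (x - a)) \<partial>lborel)"
        unfolding r_def by (simp add: mult.left_commute flip: integral_mult_right_zero)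
      finally have "ennreal ((m x)\<^sup>2 * r n x * u n x) \<le> ennreal (\<integral>a. g a * ((m x)\<^sup>2 * U x * rho (t n) (x - a)) \<partial>lborel)"
        by (rule ennreal_leI)
      also have "\<dots> = (\<integral>\<^sup>+a. ennreal (g a * ((m x)\<^sup>2 * U x * rho (t n) (x - a))) \<partial>lborel)"
      proof (rule nn_integral_eq_integral[symmetric])
        have "integrable lborel (\<lambda>a. ((m x)\<^sup>2 * U x) * (g a * rho (t n) (x - a)))" using rI by simp
        then show "integrable lborel (\<lambda>a. g a * ((m x)\<^sup>2 * U x * rho (t n) (x - a)))" by (simp only: mult.left_commute)
        show "AE a in lborel. 0 \<le> g a * ((m x)\<^sup>2 * U x * rho (t n) (x - a))"
          using g0 U0 rho_nonneg[OF d] by (intro AE_I2) auto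
      qed
      finally show "ennreal ((m x)\<^sup>2 * r n x * u n x) \<le> (\<integral>\<^sup>+a. ennreal (g a * ((m x)\<^sup>2 * U x * rho (t n) (x - a))) \<partial>lborel)" .
    qed
    also have "\<dots> = (\<integral>\<^sup>+a. \<integral>\<^sup>+x. ennreal (g a * ((m x)\<^sup>2 * U x * rho (t n) (x - a))) \<partial>lborel \<partial>lborel)"
      by (rule lborel_pair.Fubini') simp
    also have "\<dots> \<le> (\<integral>\<^sup>+a. ennreal (c * (g a * (m a)\<^sup>2 * U a) + t n * C4 * g a) \<partial>lborel)"
    proof (intro nn_integral_mono)
      fix a
      have "(\<integral>\<^sup>+x. ennreal (g a * ((m x)\<^sup>2 * U x * rho (t n) (x - a))) \<partial>lborel) = ennreal (\<integral>x. g a * ((m x)\<^sup>2 * U x * rho (t n) (x - a)) \<partial>lborel)"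
        using g0 U0 rho_nonneg[OF d] by (intro nn_integral_eq_integral integrable_mult_right inner(2) AE_I2) auto
      also have "\<dots> \<le> ennreal (g a * (c * (m a)\<^sup>2 * U a + t n * C4))"
        using inner(1)[of n a] g0 by (intro ennreal_leI) (simp add: mult_left_mono)
      also have "g a * (c * (m a)\<^sup>2 * U a + t n * C4) = c * (g a * (m a)\<^sup>2 * U a) + t n * C4 * g a" by (simp add: algebra_simps)
      finally show "(\<integral>\<^sup>+x. ennreal (g a * ((m x)\<^sup>2 * U x * rho (t n) (x - a))) \<partial>lborel) \<le> ennreal (c * (g a * (m a)\<^sup>2 * U a) + t n * C4 * g a)" .
    qed
    also have "\<dots> = ennreal (c * A + t n * C4 * G)"
    proof (subst nn_integral_eq_integral)
      show "integrable lborel (\<lambda>a. c * (g a * (m a)\<^sup>2 * U a) + t n * C4 * g a)" using gmU gI by simp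
      show "AE a in lborel. 0 \<le> c * (g a * (m a)\<^sup>2 * U a) + t n * C4 * g a"
        using g0 U0 c C4 t[of n] by (intro AE_I2) auto
      show "ennreal (\<integral>a. c * (g a * (m a)\<^sup>2 * U a) + t n * C4 * g a \<partial>lborel) = ennreal (c * A + t n * C4 * G)"
        using gmU gI by (simp add: A_def G_def)
    qed
    finally have "ennreal (\<integral>x. (m x)\<^sup>2 * r n x * u n x \<partial>lborel) \<le> ennreal (c * A + t n * C4 * G)" .
    moreover have "A \<ge> 0" "G \<ge> 0" unfolding A_def G_def using g0 U0 by (auto intro!: integral_nonneg_AE)
    then have "0 \<le> c * A + t n * C4 * G" using c C4 t[of n] by simp
    ultimately have 1: "(\<integral>x. (m x)\<^sup>2 * r n x * u n x \<partial>lborel) \<le> c * A + t n * C4 * G" by simp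
    have "c * (\<integral>x. (m x * u n x) powr q \<partial>lborel) powr (2 / q) \<le> M * (\<integral>x. (m x)\<^sup>2 * r n x * u n x + (u n x)\<^sup>2 * grad2 m1 x \<partial>lborel)"
      unfolding r_def u_def M_def c_def q_def by (rule S(2))
    also have "\<dots> = M * ((\<integral>x. (m x)\<^sup>2 * r n x * u n x \<partial>lborel) + (\<integral>x. (u n x)\<^sup>2 * grad2 m1 x \<partial>lborel))"
      using E1 E2 by simp
    also have "\<dots> \<le> M * ((c * A + t n * C4 * G) + Bg)"
      using 1 E2(2) M by (intro mult_left_mono add_mono) auto
    finally show ?thesis .
  qed
  have "c * (\<integral>x. (m x * U x) powr q \<partial>lborel) powr (2 / q) \<le> M * ((c * A + 0 * C4 * G) + Bg)"
  proof (rule LIMSEQ_le)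
    show "(\<lambda>n. c * (\<integral>x. (m x * u n x) powr q \<partial>lborel) powr (2 / q)) \<longlonglongrightarrow> c * (\<integral>x. (m x * U x) powr q \<partial>lborel) powr (2 / q)"
      using pq by (intro tendsto_mult tendsto_const tendsto_powr' Slim) (auto intro!: always_eventually integral_nonneg_AE)
    show "(\<lambda>n. M * ((c * A + t n * C4 * G) + Bg)) \<longlonglongrightarrow> M * ((c * A + 0 * C4 * G) + Bg)"
      by (intro tendsto_intros t0)
    show "\<exists>N. \<forall>n\<ge>N. c * (\<integral>x. (m x * u n x) powr q \<partial>lborel) powr (2 / q) \<le> M * ((c * A + t n * C4 * G) + Bg)"
      using step by blast
  qed
  then show "newt_c TYPE('a) * (\<integral>x. (m x * pot g x) powr hq TYPE('a) \<partial>lborel) powr (2 / hq TYPE('a))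
      \<le> hls_M TYPE('a) * (newt_c TYPE('a) * (\<integral>x. g x * (m x)\<^sup>2 * pot g x \<partial>lborel) + (\<integral>x. (pot g x)\<^sup>2 * grad2 m1 x \<partial>lborel))"
    unfolding c_def q_def M_def A_def Bg_def U_def by simp
qed

section \<open>Conformal centering\<close>


text \<open>A first-order condition without derivatives: minimality can be exploited through
  one-sided quadratic bounds of the logarithm instead of differentiating under the integral.\<close>

lemma stationary_quadratic:
  fixes A B :: real
  assumes "\<And>t. \<bar>t\<bar> \<le> 1 / 2 \<Longrightarrow> 0 \<le> t * B + t\<^sup>2 * A"
  shows "B = 0"
proof (rule ccontr)
  assume B: "B \<noteq> 0"
  define K where "K = 2 * \<bar>B\<bar> + \<bar>A\<bar> + 1"
  have K: "K > 0" "\<bar>A\<bar> < K" "2 * \<bar>B\<bar> \<le> K" by (auto simp: K_def)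
  \<comment> \<open>\<open>K\<close> keeps |t| at most 1/2 and exceeds |A|, so that the linear term
    wins.\<close>
  define t where "t = - B / K"
  have "\<bar>t\<bar> \<le> 1 / 2" using K by (simp add: t_def abs_divide)
  then have "0 \<le> t * B + t\<^sup>2 * A" by (rule assms)
  also have "t * B + t\<^sup>2 * A = B\<^sup>2 / K * (A / K - 1)"
    using K by (simp add: t_def field_simps power2_eq_square)
  finally have "0 \<le> B\<^sup>2 / K * (A / K - 1)" .
  moreover have "B\<^sup>2 / K > 0" using B K by simp
  moreover have "A / K - 1 < 0" using K by (simp add: divide_less_eq)
  ultimately show False using mult_pos_neg[of "B\<^sup>2 / K" "A / K - 1"] by linarith
qed

text \<open>The conformal centre of mass of a density is found as the minimum of the averaged logarithmic
  conformal factor, a coercive function on the half-space of pairs \<open>(a, s)\<close>.\<close>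

lemma conformal_centering:
  fixes f :: "'a::euclidean_space \<Rightarrow> real"
  assumes fm [measurable]: "f \<in> borel_measurable borel" and f0: "\<And>x. 0 \<le> f x"
    and fI: "integrable lborel f" and f1: "(\<integral>x. f x \<partial>lborel) = 1"
  obtains a s where "s > 0" "\<And>e. norm e = 1 \<Longrightarrow> (\<integral>y. f y * (((y - a) \<bullet> e) / (s\<^sup>2 + (norm (y - a))\<^sup>2)) \<partial>lborel) = 0"
    "(\<integral>y. f y * ((s\<^sup>2 - (norm (y - a))\<^sup>2) / (s\<^sup>2 + (norm (y - a))\<^sup>2)) \<partial>lborel) = 0"
proof -
  \<comment> \<open>Twice the hyperbolic cosine of the distance between (a, s) and (0, 1) in the
    upper half-space. Accordingly \<open>lf a s y\<close> is the Busemann function of the boundary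
    point y, normalized to vanish at (0, 1).\<close>
  define \<Delta> where "\<Delta> = (\<lambda>(a::'a) (s::real). (1 + s\<^sup>2 + (norm a)\<^sup>2) / s)"
  define lf where "lf = (\<lambda>a s (y::'a). ln ((s\<^sup>2 + (norm (y - a))\<^sup>2) / (s * (1 + (norm y)\<^sup>2))))"
  have [measurable]: "lf a s \<in> borel_measurable borel" for a s unfolding lf_def by measurable
  have pos: "s\<^sup>2 + (norm y)\<^sup>2 > 0" if "s > 0" for s and y :: 'a using that by (simp add: add_pos_nonneg)
  have pos1: "1 + (norm y)\<^sup>2 > 0" for y :: 'a by (simp add: add_pos_nonneg)
  have \<Delta>2: "\<Delta> a s \<ge> 2" if "s > 0" for a s
  proof -
    have "2 * s \<le> 1 + s\<^sup>2" using sum_squares_bound[of 1 s] by simp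
    then have "2 * s \<le> 1 + s\<^sup>2 + (norm a)\<^sup>2" by (simp add: add_increasing2)
    then show ?thesis unfolding \<Delta>_def using that by (simp add: pos_le_divide_eq)
  qed
  have tri: "(norm y)\<^sup>2 \<le> 2 * (norm (y - a))\<^sup>2 + 2 * (norm a)\<^sup>2" "(norm (y - a))\<^sup>2 \<le> 2 * (norm y)\<^sup>2 + 2 * (norm a)\<^sup>2" for y a :: 'a
  proof -
    have "(norm y)\<^sup>2 \<le> (norm (y - a) + norm a)\<^sup>2" using norm_triangle_ineq[of "y - a" a] by (intro power_mono) auto
    also have "\<dots> \<le> 2 * (norm (y - a))\<^sup>2 + 2 * (norm a)\<^sup>2"
      using sum_squares_bound[of "norm (y - a)" "norm a"] by (simp add: power2_sum)
    finally show "(norm y)\<^sup>2 \<le> 2 * (norm (y - a))\<^sup>2 + 2 * (norm a)\<^sup>2" .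
    have "(norm (y - a))\<^sup>2 \<le> (norm y + norm a)\<^sup>2" using norm_triangle_ineq4[of y a] by (intro power_mono) auto
    also have "\<dots> \<le> 2 * (norm y)\<^sup>2 + 2 * (norm a)\<^sup>2"
      using sum_squares_bound[of "norm y" "norm a"] by (simp add: power2_sum)
    finally show "(norm (y - a))\<^sup>2 \<le> 2 * (norm y)\<^sup>2 + 2 * (norm a)\<^sup>2" .
  qed
  \<comment> \<open>A Busemann function grows at most like the distance.\<close>
  have lfb: "- ln (2 * \<Delta> a s) \<le> lf a s y" "lf a s y \<le> ln (2 * \<Delta> a s)" if s: "s > 0" for a s y
  proof -
    let ?r = "(s\<^sup>2 + (norm (y - a))\<^sup>2) / (s * (1 + (norm y)\<^sup>2))"
    have rpos: "?r > 0" using pos[OF s, of "y - a"] pos1[of y] s by simp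
    have Dp: "2 * \<Delta> a s > 0" using \<Delta>2[OF s, of a] by simp
    have "s\<^sup>2 + (norm (y - a))\<^sup>2 \<le> 2 * (1 + s\<^sup>2 + (norm a)\<^sup>2) * (1 + (norm y)\<^sup>2)"
    proof -
      have "s\<^sup>2 + (norm (y - a))\<^sup>2 \<le> s\<^sup>2 + 2 * (norm y)\<^sup>2 + 2 * (norm a)\<^sup>2" using tri(2)[of y a] by simp
      also have "\<dots> \<le> 2 * (1 + s\<^sup>2 + (norm a)\<^sup>2) * (1 + (norm y)\<^sup>2)"
        by (simp add: algebra_simps add_nonneg_nonneg)
      finally show ?thesis .
    qed
    then have "?r \<le> 2 * (1 + s\<^sup>2 + (norm a)\<^sup>2) * (1 + (norm y)\<^sup>2) / (s * (1 + (norm y)\<^sup>2))"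
      using s pos1[of y] by (intro divide_right_mono) auto
    also have "\<dots> = 2 * \<Delta> a s" using s pos1[of y] by (simp add: \<Delta>_def)
    finally show "lf a s y \<le> ln (2 * \<Delta> a s)" unfolding lf_def using rpos Dp by simp
    have "s\<^sup>2 * (1 + (norm y)\<^sup>2) \<le> (s\<^sup>2 + (norm (y - a))\<^sup>2) * (2 * (1 + s\<^sup>2 + (norm a)\<^sup>2))"
    proof -
      have "s\<^sup>2 * (1 + (norm y)\<^sup>2) \<le> s\<^sup>2 * (1 + (2 * (norm (y - a))\<^sup>2 + 2 * (norm a)\<^sup>2))"
        using tri(1)[of y a] by (intro mult_left_mono) auto
      also have "\<dots> \<le> (s\<^sup>2 + (norm (y - a))\<^sup>2) * (2 * (1 + s\<^sup>2 + (norm a)\<^sup>2))"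
        by (simp add: algebra_simps add_nonneg_nonneg)
      finally show ?thesis .
    qed
    then have "1 / (2 * \<Delta> a s) \<le> ?r"
      using s pos1[of y] pos[OF s, of a] Dp unfolding \<Delta>_def
      by (simp add: field_simps power2_eq_square add_pos_nonneg)
    then have "ln (1 / (2 * \<Delta> a s)) \<le> lf a s y" unfolding lf_def using rpos Dp by (subst ln_le_cancel_iff) auto
    then show "- ln (2 * \<Delta> a s) \<le> lf a s y" using Dp by (simp add: ln_div)
  qed
  have lfI: "integrable lborel (\<lambda>y. f y * lf a s y)" if s: "s > 0" for a s
  proof (rule Bochner_Integration.integrable_bound[OF integrable_mult_left[OF fI, of "ln (2 * \<Delta> a s)"]])
    show "AE y in lborel. norm (f y * lf a s y) \<le> norm (f y * ln (2 * \<Delta> a s))"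
    proof (rule AE_I2)
      fix y
      have "\<bar>lf a s y\<bar> \<le> \<bar>ln (2 * \<Delta> a s)\<bar>" using lfb[OF s, of a y] by linarith
      then show "norm (f y * lf a s y) \<le> norm (f y * ln (2 * \<Delta> a s))"
        unfolding real_norm_def abs_mult by (intro mult_left_mono) auto
    qed
  qed simp
  define G where "G = (\<lambda>a s. \<integral>y. f y * lf a s y \<partial>lborel)"
  have cutm: "(\<lambda>y::'a. min (f y) (real n) * indicator (cball 0 (real n)) y) \<in> borel_measurable borel" for n
    by (intro borel_measurable_times borel_measurable_min fm borel_measurable_const borel_measurable_indicator) simp
  \<comment> \<open>Truncation to a bounded density on a ball keeps more than 7/8 of the mass, and a
    ball of small radius r carries at most 1/8 wherever its centre lies. So at least 3/4 of the mass
    is at distance r or more from a, uniformly in a.\<close>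
  obtain n :: nat where n: "(\<integral>y. min (f y) (real n) * indicator (cball 0 (real n)) y \<partial>lborel) > 7 / 8"
  proof -
    have "(\<lambda>n. \<integral>y. min (f y) (real n) * indicator (cball 0 (real n)) y \<partial>lborel) \<longlonglongrightarrow> (\<integral>y. f y \<partial>lborel)"
    proof (rule integral_dominated_convergence[OF _ _ fI])
      show "AE y in lborel. (\<lambda>n. min (f y) (real n) * indicator (cball 0 (real n)) y) \<longlonglongrightarrow> f y"
      proof (rule AE_I2, rule tendsto_eventually)
        fix y :: 'a
        have "eventually (\<lambda>n. real n \<ge> max (f y) (norm y)) sequentially"
          using eventually_ge_at_top[of "nat \<lceil>max (f y) (norm y)\<rceil>"] by eventually_elim linarith
        then show "eventually (\<lambda>n. min (f y) (real n) * indicator (cball 0 (real n)) y = f y) sequentially"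
          by eventually_elim (auto simp: min_def)
      qed
      show "AE y in lborel. norm (min (f y) (real n) * indicator (cball 0 (real n)) y) \<le> f y" for n
        using f0 by (intro AE_I2) (auto simp: indicator_def min_def)
    qed (use cutm in auto)
    then have "eventually (\<lambda>n. (\<integral>y. min (f y) (real n) * indicator (cball 0 (real n)) y \<partial>lborel) > 7 / 8) sequentially"
      unfolding f1 by (rule order_tendstoD) simp
    then show ?thesis using that by (auto simp: eventually_sequentially)
  qed
  define fn where "fn = (\<lambda>y::'a. min (f y) (real n) * indicator (cball 0 (real n)) y)"
  have [measurable]: "fn \<in> borel_measurable borel" unfolding fn_def by (rule cutm)
  have fn: "0 \<le> fn y" "fn y \<le> f y" "fn y \<le> real n" "norm y > real n \<Longrightarrow> fn y = 0" for y
    using f0[of y] by (auto simp: fn_def indicator_def min_def)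
  have fnI: "integrable lborel fn"
    by (rule Bochner_Integration.integrable_bound[OF fI]) (use fn f0 in auto)
  define w where "w = unit_ball_vol (real DIM('a))"
  have w: "w > 0" by (simp add: w_def)
  obtain r where r: "r > 0" "r \<le> 1" "real n * (w * r ^ DIM('a)) \<le> 1 / 8"
  proof -
    define r where "r = 1 / (8 * (real n * w + 1))"
    have p: "real n * w + 1 \<ge> 1" using w by simp
    have r: "r > 0" "r \<le> 1" using p by (auto simp: r_def divide_le_eq)
    have "real n * (w * r ^ DIM('a)) \<le> real n * (w * r)"
      using r w power_decreasing[of 1 "DIM('a)" r] by (intro mult_left_mono) (auto simp: Suc_leI)
    also have "\<dots> \<le> 1 / 8"
      using p unfolding r_def by (simp add: field_simps)
    finally show ?thesis using that r by blast
  qed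
  have mass: "(\<integral>y. fn y * indicator (- ball a r) y \<partial>lborel) \<ge> 3 / 4" for a
  proof -
    have I1: "integrable lborel (\<lambda>y. fn y * indicator (ball a r) y)" "integrable lborel (\<lambda>y. fn y * indicator (- ball a r) y)"
      by (intro integrable_real_mult_indicator fnI; simp)+
    have I2: "integrable lborel (\<lambda>y. real n * indicator (ball a r) y)"
      using emeasure_bounded_finite[of "ball a r"] by simp
    have "(\<integral>y. fn y * indicator (ball a r) y \<partial>lborel) \<le> (\<integral>y. real n * indicator (ball a r) y \<partial>lborel)"
      using fn by (intro integral_mono I1 I2) (auto simp: indicator_def)
    also have "\<dots> = real n * (w * r ^ DIM('a))"
      using r(1) by (simp add: content_ball w_def)
    finally have "(\<integral>y. fn y * indicator (ball a r) y \<partial>lborel) \<le> 1 / 8" using r(3) by simp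
    moreover have "(\<integral>y. fn y \<partial>lborel) = (\<integral>y. fn y * indicator (ball a r) y \<partial>lborel) + (\<integral>y. fn y * indicator (- ball a r) y \<partial>lborel)"
    proof -
      have "(\<integral>y. fn y \<partial>lborel) = (\<integral>y. fn y * indicator (ball a r) y + fn y * indicator (- ball a r) y \<partial>lborel)"
        by (rule Bochner_Integration.integral_cong) (auto simp: indicator_def)
      also have "\<dots> = (\<integral>y. fn y * indicator (ball a r) y \<partial>lborel) + (\<integral>y. fn y * indicator (- ball a r) y \<partial>lborel)"
        by (rule Bochner_Integration.integral_add[OF I1])
      finally show ?thesis .
    qed
    ultimately show ?thesis using n unfolding fn_def by linarith
  qed
  define k where "k = min 1 (1 / ((1 + (real n)\<^sup>2) * ((1 + 2 * (real n)\<^sup>2) / r\<^sup>2 + 2)))"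
  have k: "k > 0" unfolding k_def using r by (auto simp: add_pos_nonneg add_nonneg_pos)
  \<comment> \<open>At the points that carry this mass the logarithm grows at the full rate ln
    \<Delta>, up to the constant ln k.\<close>
  have good: "ln (k * \<Delta> a s) \<le> lf a s y" if s: "s > 0" and y: "norm y \<le> real n" "norm (y - a) \<ge> r" for a s y
  proof -
    define b where "b = (norm (y - a))\<^sup>2"
    define N where "N = (real n)\<^sup>2"
    define T where "T = (1 + 2 * N) / r\<^sup>2 + 2"
    have T: "T > 0" unfolding T_def N_def using r by (simp add: add_nonneg_pos)
    have br: "r\<^sup>2 \<le> b" unfolding b_def using y r by (intro power_mono) auto
    have yN: "(norm y)\<^sup>2 \<le> N" unfolding N_def using y by (intro power_mono) auto
    have "(norm a)\<^sup>2 \<le> 2 * b + 2 * N" using tri(2)[of a y] yN unfolding b_def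
      by (simp add: norm_minus_commute) (metis add.commute add_left_mono mult_left_mono order_trans tri(1) zero_le_numeral norm_minus_commute)
    then have "1 + s\<^sup>2 + (norm a)\<^sup>2 \<le> s\<^sup>2 + (1 + 2 * N) * 1 + 2 * b" by simp
    also have "\<dots> \<le> s\<^sup>2 + (1 + 2 * N) * (b / r\<^sup>2) + 2 * b"
      using br r by (intro add_mono mult_left_mono) (auto simp: N_def)
    also have "\<dots> = s\<^sup>2 + T * b" by (simp add: T_def algebra_simps)
    also have "\<dots> \<le> T * (s\<^sup>2 + b)"
    proof -
      have "1 \<le> T" unfolding T_def N_def by (simp add: add_increasing)
      then have "1 * s\<^sup>2 \<le> T * s\<^sup>2" by (intro mult_right_mono) auto
      then show ?thesis by (simp add: algebra_simps)
    qed
    finally have 1: "1 + s\<^sup>2 + (norm a)\<^sup>2 \<le> T * (s\<^sup>2 + b)" .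
    have kT: "k * ((1 + N) * T) \<le> 1"
    proof -
      have p: "(1 + N) * T > 0" using T by (simp add: N_def add_pos_nonneg)
      have "k \<le> 1 / ((1 + N) * T)" unfolding k_def N_def T_def by simp
      then show ?thesis using p by (simp add: pos_le_divide_eq)
    qed
    have "k * (1 + s\<^sup>2 + (norm a)\<^sup>2) * (1 + (norm y)\<^sup>2) \<le> k * (T * (s\<^sup>2 + b)) * (1 + N)"
      using 1 yN k T by (intro mult_mono mult_left_mono mult_nonneg_nonneg add_mono) (auto simp: b_def)
    also have "\<dots> = (k * ((1 + N) * T)) * (s\<^sup>2 + b)" by (simp add: mult_ac)
    also have "\<dots> \<le> 1 * (s\<^sup>2 + b)" using kT by (intro mult_right_mono) (auto simp: b_def)
    finally have 2: "k * (1 + s\<^sup>2 + (norm a)\<^sup>2) * (1 + (norm y)\<^sup>2) \<le> s\<^sup>2 + b" by simp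
    have "k * \<Delta> a s = k * (1 + s\<^sup>2 + (norm a)\<^sup>2) * (1 + (norm y)\<^sup>2) / (s * (1 + (norm y)\<^sup>2))"
      using s pos1[of y] by (simp add: \<Delta>_def)
    also have "\<dots> \<le> (s\<^sup>2 + b) / (s * (1 + (norm y)\<^sup>2))"
      using 2 s pos1[of y] by (intro divide_right_mono) auto
    finally show ?thesis unfolding lf_def b_def using k \<Delta>2[OF s, of a] pos[OF s, of "y - a"] pos1[of y] s
      by (subst ln_le_cancel_iff) auto
  qed
  \<comment> \<open>Three quarters of the mass contribute at least ln (k \<Delta>), the rest at
    least -ln (2 \<Delta>). Any share above one half makes the total grow; 3/4 gives the coefficient
    1/2.\<close>
  have coercive: "G a s \<ge> ln (\<Delta> a s) / 2 - ln 2 / 4 + 3 / 4 * ln k" if s: "s > 0" and big: "1 \<le> 2 * k * (\<Delta> a s)\<^sup>2" for a s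
  proof -
    define X where "X = ln (2 * \<Delta> a s)"
    define Y where "Y = ln (k * \<Delta> a s)"
    have Dp: "\<Delta> a s > 0" using \<Delta>2[OF s, of a] by simp
    have XY: "X = ln 2 + ln (\<Delta> a s)" "Y = ln k + ln (\<Delta> a s)" using Dp k by (simp_all add: X_def Y_def ln_mult)
    have "X + Y = ln (2 * k * (\<Delta> a s)\<^sup>2)" using Dp k unfolding XY by (simp add: ln_mult power2_eq_square)
    then have XY0: "X + Y \<ge> 0" using big by simp
    have I: "integrable lborel (\<lambda>y. f y * (- X))" "integrable lborel (\<lambda>y. (fn y * indicator (- ball a r) y) * (X + Y))"
      by (intro integrable_mult_left fI integrable_real_mult_indicator fnI; simp)+
    have "(\<integral>y. f y * (- X) + (fn y * indicator (- ball a r) y) * (X + Y) \<partial>lborel) \<le> G a s"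
      unfolding G_def
    proof (intro integral_mono Bochner_Integration.integrable_add I lfI[OF s])
      fix y
      show "f y * (- X) + (fn y * indicator (- ball a r) y) * (X + Y) \<le> f y * lf a s y"
      proof (cases "norm y \<le> real n \<and> norm (y - a) \<ge> r")
        case True
        have Yl: "Y \<le> lf a s y" unfolding Y_def using good[OF s] True by simp
        have "f y * (- X) + (fn y * indicator (- ball a r) y) * (X + Y) \<le> f y * (- X) + f y * (X + Y)"
          using fn[of y] f0[of y] XY0 by (intro add_left_mono mult_right_mono) (auto simp: indicator_def)
        also have "\<dots> = f y * Y" by (simp add: algebra_simps)
        also have "\<dots> \<le> f y * lf a s y" using Yl f0 by (intro mult_left_mono) auto
        finally show ?thesis .
      next
        case False
        then have z: "fn y * indicator (- ball a r) y = 0"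
          using fn(4)[of y] by (auto simp: indicator_def dist_norm norm_minus_commute not_le)
        show ?thesis unfolding z X_def using mult_left_mono[OF lfb(1)[OF s, of a y] f0[of y]] by simp
      qed
    qed
    moreover have "(\<integral>y. f y * (- X) + (fn y * indicator (- ball a r) y) * (X + Y) \<partial>lborel) = - X + (\<integral>y. fn y * indicator (- ball a r) y \<partial>lborel) * (X + Y)"
      using I f1 by (subst Bochner_Integration.integral_add) auto
    moreover have "3 / 4 * (X + Y) \<le> (\<integral>y. fn y * indicator (- ball a r) y \<partial>lborel) * (X + Y)"
      by (intro mult_right_mono mass XY0)
    ultimately have "- X + 3 / 4 * (X + Y) \<le> G a s" by linarith
    then show ?thesis unfolding XY by (simp add: algebra_simps)
  qed
  define G0 where "G0 = G 0 1"
  \<comment> \<open>Beyond \<open>D0\<close> the side condition of \<open>coercive\<close> holds and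
    its lower bound exceeds the value \<open>G0\<close> at (0, 1). A minimum over the compact box
    \<open>KK\<close> is therefore global.\<close>
  define D0 where "D0 = max 3 (max (1 / k) (exp (2 * (G0 + ln 2 / 4 - 3 / 4 * ln k) + 1)))"
  have D0: "D0 \<ge> 3" "D0 \<ge> 1 / k" "D0 \<ge> exp (2 * (G0 + ln 2 / 4 - 3 / 4 * ln k) + 1)" by (auto simp: D0_def)
  have out: "G a s > G0" if s: "s > 0" and D: "\<Delta> a s > D0" for a s
  proof -
    have Dk: "\<Delta> a s > 1 / k" "\<Delta> a s > 3" using D D0 by auto
    then have "1 \<le> k * \<Delta> a s" using k by (simp add: field_simps)
    then have "1 * 1 \<le> (k * \<Delta> a s) * (2 * \<Delta> a s)" using Dk by (intro mult_mono) auto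
    then have "1 \<le> 2 * k * (\<Delta> a s)\<^sup>2" by (simp add: power2_eq_square mult_ac)
    from coercive[OF s this] have c: "G a s \<ge> ln (\<Delta> a s) / 2 - ln 2 / 4 + 3 / 4 * ln k" .
    have "exp (2 * (G0 + ln 2 / 4 - 3 / 4 * ln k) + 1) < \<Delta> a s" using D D0(3) by simp
    then have "ln (exp (2 * (G0 + ln 2 / 4 - 3 / 4 * ln k) + 1)) < ln (\<Delta> a s)" using Dk by (subst ln_less_cancel_iff) auto
    then show ?thesis using c by simp
  qed
  define KK where "KK = cball (0::'a) D0 \<times> {1 / D0..D0}"
  have KK: "compact KK" unfolding KK_def by (intro compact_Times compact_cball) simp
  have ne: "(0, 1) \<in> KK" using D0(1) by (simp add: KK_def divide_le_eq)
  have sK: "s > 0" if "(a, s) \<in> KK" for a s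
  proof -
    have "1 / D0 > 0" using D0(1) by simp
    moreover have "1 / D0 \<le> s" using that unfolding KK_def by auto
    ultimately show ?thesis by linarith
  qed
  have inK: "(a, s) \<in> KK" if s: "s > 0" and D: "\<Delta> a s \<le> D0" for a s
  proof -
    have 1: "1 + s\<^sup>2 + (norm a)\<^sup>2 \<le> D0 * s" using D s unfolding \<Delta>_def by (simp add: pos_divide_le_eq)
    have a0: "(norm a)\<^sup>2 \<ge> 0" "s\<^sup>2 \<ge> 0" by auto
    have "s\<^sup>2 \<le> D0 * s" using 1 a0 by linarith
    then have "s * s \<le> D0 * s" by (simp only: power2_eq_square)
    then have sD: "s \<le> D0" using s by simp
    have "1 \<le> D0 * s" using 1 a0 by linarith
    then have "1 / D0 \<le> s" using D0(1) by (simp add: divide_le_eq mult.commute)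
    moreover have "(norm a)\<^sup>2 \<le> D0\<^sup>2"
    proof -
      have "(norm a)\<^sup>2 \<le> D0 * s" using 1 a0 by linarith
      also have "\<dots> \<le> D0 * D0" using sD D0(1) by (intro mult_left_mono) auto
      finally show ?thesis by (simp add: power2_eq_square)
    qed
    then have "norm a \<le> D0" using D0(1) by (simp add: power2_le_iff_abs_le)
    ultimately show ?thesis using sD by (simp add: KK_def)
  qed
  have cont: "continuous_on KK (\<lambda>z. G (fst z) (snd z))"
  proof (rule continuous_on_sequentiallyI)
    fix X :: "nat \<Rightarrow> 'a \<times> real" and z assume X: "\<forall>n. X n \<in> KK" and z: "z \<in> KK" and lim: "X \<longlonglongrightarrow> z"
    have sX: "snd (X n) > 0" for n using sK[of "fst (X n)" "snd (X n)"] X by simp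
    have sz: "snd z > 0" using sK[of "fst z" "snd z"] z by simp
    define DM where "DM = (1 + D0\<^sup>2 + D0\<^sup>2) * D0"
    have DM: "\<Delta> a s \<le> DM" if "(a, s) \<in> KK" for a s
    proof -
      have s: "s > 0" by (rule sK[OF that])
      have b: "norm a \<le> D0" "s \<le> D0" "1 / D0 \<le> s" using that by (auto simp: KK_def)
      have "1 / s \<le> D0" using b(3) s D0(1) by (simp add: field_simps)
      then have "(1 + s\<^sup>2 + (norm a)\<^sup>2) * (1 / s) \<le> DM"
        unfolding DM_def using b s D0(1) by (intro mult_mono add_mono power_mono) (auto simp: add_nonneg_nonneg)
      then show ?thesis by (simp add: \<Delta>_def)
    qed
    show "(\<lambda>n. G (fst (X n)) (snd (X n))) \<longlonglongrightarrow> G (fst z) (snd z)"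
      unfolding G_def
    proof (rule integral_dominated_convergence[OF _ _ integrable_mult_left[OF fI, of "ln (2 * DM)"]])
      show "AE y in lborel. (\<lambda>n. f y * lf (fst (X n)) (snd (X n)) y) \<longlonglongrightarrow> f y * lf (fst z) (snd z) y"
      proof (rule AE_I2)
        fix y
        have l: "(\<lambda>n. fst (X n)) \<longlonglongrightarrow> fst z" "(\<lambda>n. snd (X n)) \<longlonglongrightarrow> snd z" using lim by (auto intro: tendsto_intros)
        have "(\<lambda>n. ln (((snd (X n))\<^sup>2 + (norm (y - fst (X n)))\<^sup>2) / (snd (X n) * (1 + (norm y)\<^sup>2))))
           \<longlonglongrightarrow> ln (((snd z)\<^sup>2 + (norm (y - fst z))\<^sup>2) / (snd z * (1 + (norm y)\<^sup>2)))"
          using sz pos1[of y] pos[OF sz, of "y - fst z"]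
          by (intro tendsto_intros l) (auto simp: less_imp_neq[symmetric])
        then show "(\<lambda>n. f y * lf (fst (X n)) (snd (X n)) y) \<longlonglongrightarrow> f y * lf (fst z) (snd z) y"
          unfolding lf_def by (rule tendsto_mult[OF tendsto_const])
      qed
      show "AE y in lborel. norm (f y * lf (fst (X n)) (snd (X n)) y) \<le> f y * ln (2 * DM)" for n
      proof (rule AE_I2)
        fix y
        have "ln (2 * \<Delta> (fst (X n)) (snd (X n))) \<le> ln (2 * DM)"
          using DM[of "fst (X n)" "snd (X n)"] X \<Delta>2[OF sX[of n], of "fst (X n)"] by (subst ln_le_cancel_iff) auto
        then have "\<bar>lf (fst (X n)) (snd (X n)) y\<bar> \<le> ln (2 * DM)"
          using lfb[OF sX[of n], of "fst (X n)" y] by linarith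
        then show "norm (f y * lf (fst (X n)) (snd (X n)) y) \<le> f y * ln (2 * DM)"
          using f0[of y] by (simp add: abs_mult mult_left_mono)
      qed
    qed simp_all
  qed
  obtain z where z: "z \<in> KK" "\<And>z'. z' \<in> KK \<Longrightarrow> G (fst z) (snd z) \<le> G (fst z') (snd z')"
    using continuous_attains_inf[OF KK _ cont] ne by (metis empty_iff)
  define a s where "a = fst z" and "s = snd z"
  have s: "s > 0" using sK[of a s] z(1) by (simp add: a_def s_def)
  have min: "G a s \<le> G a' s'" if s': "s' > 0" for a' s'
  proof (cases "\<Delta> a' s' \<le> D0")
    case True then show ?thesis using z(2)[OF inK[OF s' True]] by (simp add: a_def s_def)
  next
    case False
    then have "G0 < G a' s'" using out[OF s'] by simp
    moreover have "G a s \<le> G0" using z(2)[OF ne] by (simp add: a_def s_def G0_def)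
    ultimately show ?thesis by simp
  qed
  define Q where "Q = (\<lambda>y. s\<^sup>2 + (norm (y - a))\<^sup>2)"
  have Q: "Q y > 0" "Q y \<ge> s\<^sup>2" for y using pos[OF s] by (auto simp: Q_def)
  have [measurable]: "Q \<in> borel_measurable borel" unfolding Q_def by measurable
  have bI: "integrable lborel (\<lambda>y. f y * b y)" if [measurable]: "b \<in> borel_measurable borel" and b: "\<And>y. \<bar>b y\<bar> \<le> B" for b and B
  proof (rule Bochner_Integration.integrable_bound[OF integrable_mult_left[OF fI, of B]])
    show "AE y in lborel. norm (f y * b y) \<le> norm (f y * B)"
    proof (rule AE_I2)
      fix y
      have "\<bar>b y\<bar> \<le> \<bar>B\<bar>" using b[of y] by linarith
      then show "norm (f y * b y) \<le> norm (f y * B)" unfolding real_norm_def abs_mult by (intro mult_left_mono) auto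
    qed
  qed simp
  have b1: "\<bar>((y - a) \<bullet> e) / Q y\<bar> \<le> 1 / s" if "norm e = 1" for e y
  proof -
    have "\<bar>(y - a) \<bullet> e\<bar> * s \<le> norm (y - a) * s" using Cauchy_Schwarz_ineq2[of "y - a" e] that s by (intro mult_right_mono) auto
    also have "\<dots> \<le> Q y"
    proof -
      have "0 \<le> norm (y - a) * s" using s by simp
      then show ?thesis unfolding Q_def using sum_squares_bound[of "norm (y - a)" s] by linarith
    qed
    finally show ?thesis using Q(1)[of y] s by (simp add: abs_divide field_simps)
  qed
  have b2: "\<bar>1 / Q y\<bar> \<le> 1 / s\<^sup>2" for y using Q[of y] s by (simp add: frac_le)
  have lnd: "lf a' s' y - lf a s y = ln ((s'\<^sup>2 + (norm (y - a'))\<^sup>2) / Q y) - ln (s' / s)" if s': "s' > 0" for a' s' y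
    using s s' Q(1)[of y] pos1[of y] pos[OF s', of "y - a'"] unfolding lf_def Q_def
    by (simp add: ln_div ln_mult)
  have Gd: "0 \<le> (\<integral>y. f y * (lf a' s' y - lf a s y) \<partial>lborel)" if s': "s' > 0" for a' s'
    using min[OF s', of a'] lfI[OF s', of a'] lfI[OF s, of a] unfolding G_def by (simp add: right_diff_distrib)
  have GI: "integrable lborel (\<lambda>y. f y * (lf a' s' y - lf a s y))" if s': "s' > 0" for a' s'
    using lfI[OF s', of a'] lfI[OF s, of a] by (simp add: right_diff_distrib)
  show ?thesis
  proof (rule that[OF s])
    fix e :: 'a assume e: "norm e = 1"
    have ee: "e \<bullet> e = 1" using e by (simp add: norm_eq_1)
    define B where "B = (\<integral>y. f y * (((y - a) \<bullet> e) / Q y) \<partial>lborel)"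
    define A where "A = (\<integral>y. f y * (1 / Q y) \<partial>lborel)"
    have I1: "integrable lborel (\<lambda>y. f y * (((y - a) \<bullet> e) / Q y))" by (rule bI[OF _ b1[OF e]]) simp
    have I2: "integrable lborel (\<lambda>y. f y * (1 / Q y))" by (rule bI[OF _ b2]) simp
    have "0 \<le> t * (- 2 * B) + t\<^sup>2 * A" for t
    proof -
      \<comment> \<open>By ln x \<le> x - 1 the increment lies below a quadratic in t, whose linear
        coefficient is, up to the factor -2, the integrand that has to vanish on average.\<close>
      have pt: "lf (a + t *\<^sub>R e) s y - lf a s y \<le> (- 2 * t) * (((y - a) \<bullet> e) / Q y) + t\<^sup>2 * (1 / Q y)" for y
      proof -
        have "(norm (y - (a + t *\<^sub>R e)))\<^sup>2 = (norm (y - a))\<^sup>2 - 2 * t * ((y - a) \<bullet> e) + t\<^sup>2"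
          using ee unfolding power2_norm_eq_inner by (simp add: inner_simps inner_commute algebra_simps power2_eq_square)
        then have n: "s\<^sup>2 + (norm (y - (a + t *\<^sub>R e)))\<^sup>2 = Q y + ((- 2 * t) * ((y - a) \<bullet> e) + t\<^sup>2)"
          unfolding Q_def by linarith
        have "(s\<^sup>2 + (norm (y - (a + t *\<^sub>R e)))\<^sup>2) / Q y = 1 + ((- 2 * t) * (((y - a) \<bullet> e) / Q y) + t\<^sup>2 * (1 / Q y))"
          unfolding n using Q(1)[of y] by (simp add: add_divide_distrib diff_divide_distrib)
        moreover have "(s\<^sup>2 + (norm (y - (a + t *\<^sub>R e)))\<^sup>2) / Q y > 0" using pos[OF s] Q(1)[of y] by simp
        ultimately show ?thesis using ln_le_minus_one[of "(s\<^sup>2 + (norm (y - (a + t *\<^sub>R e)))\<^sup>2) / Q y"] lnd[OF s, of "a + t *\<^sub>R e" y] s by simp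
      qed
      have "0 \<le> (\<integral>y. f y * (lf (a + t *\<^sub>R e) s y - lf a s y) \<partial>lborel)" by (rule Gd[OF s])
      also have "\<dots> \<le> (\<integral>y. (- 2 * t) * (f y * (((y - a) \<bullet> e) / Q y)) + t\<^sup>2 * (f y * (1 / Q y)) \<partial>lborel)"
      proof (intro integral_mono GI[OF s] Bochner_Integration.integrable_add integrable_mult_right I1 I2)
        fix y
        show "f y * (lf (a + t *\<^sub>R e) s y - lf a s y) \<le> (- 2 * t) * (f y * (((y - a) \<bullet> e) / Q y)) + t\<^sup>2 * (f y * (1 / Q y))"
          using mult_left_mono[OF pt[of y] f0[of y]] by (simp add: algebra_simps)
      qed
      also have "\<dots> = (- 2 * t) * B + t\<^sup>2 * A"
        unfolding A_def B_def integral_mult_right_zero[symmetric]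
        by (intro Bochner_Integration.integral_add integrable_mult_right I1 I2)
      finally show ?thesis by (simp add: algebra_simps)
    qed
    then have "- 2 * B = 0" by (rule stationary_quadratic)
    then show "(\<integral>y. f y * (((y - a) \<bullet> e) / (s\<^sup>2 + (norm (y - a))\<^sup>2)) \<partial>lborel) = 0" by (simp add: B_def Q_def)
  next
    define B where "B = (\<integral>y. f y * ((s\<^sup>2 - (norm (y - a))\<^sup>2) / Q y) \<partial>lborel)"
    have bb: "\<bar>(s\<^sup>2 - (norm (y - a))\<^sup>2) / Q y\<bar> \<le> 1" for y
      using Q(1)[of y] by (simp add: abs_divide pos_divide_le_eq) (auto simp: Q_def abs_le_iff)
    have I1: "integrable lborel (\<lambda>y. f y * ((s\<^sup>2 - (norm (y - a))\<^sup>2) / Q y))" by (rule bI[OF _ bb]) simp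
    \<comment> \<open>The dilation of s contributes -ln (1 + t), which is at most -t + 2 t^2.
      Together with the t^2 from squaring 1 + t this makes the constant 3.\<close>
    have "0 \<le> t * B + t\<^sup>2 * 3" if t: "\<bar>t\<bar> \<le> 1 / 2" for t
    proof -
      have t1: "1 + t > 0" using t by linarith
      have s': "s * (1 + t) > 0" using s t1 by simp
      have pt: "lf a (s * (1 + t)) y - lf a s y \<le> t * ((s\<^sup>2 - (norm (y - a))\<^sup>2) / Q y) + 3 * t\<^sup>2" for y
      proof -
        have e1: "((s * (1 + t))\<^sup>2 + (norm (y - a))\<^sup>2) / Q y = 1 + (2 * t + t\<^sup>2) * (s\<^sup>2 / Q y)"
        proof -
          have n: "(s * (1 + t))\<^sup>2 + (norm (y - a))\<^sup>2 = Q y + (2 * t + t\<^sup>2) * s\<^sup>2"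
            by (simp add: Q_def power2_eq_square algebra_simps)
          show ?thesis unfolding n using Q(1)[of y] by (simp add: add_divide_distrib)
        qed
        have "((s * (1 + t))\<^sup>2 + (norm (y - a))\<^sup>2) / Q y > 0" using pos[OF s'] Q(1)[of y] by simp
        then have l1: "ln (((s * (1 + t))\<^sup>2 + (norm (y - a))\<^sup>2) / Q y) \<le> (2 * t + t\<^sup>2) * (s\<^sup>2 / Q y)"
          using ln_le_minus_one[of "((s * (1 + t))\<^sup>2 + (norm (y - a))\<^sup>2) / Q y"] e1 by simp
        have l2: "ln (1 + t) \<ge> t - 2 * t\<^sup>2" using abs_ln_one_plus_x_minus_x_bound[OF t] by (simp add: abs_le_iff)
        have "t\<^sup>2 * (s\<^sup>2 / Q y) \<le> t\<^sup>2 * 1" using Q[of y] by (intro mult_left_mono) auto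
        moreover have "t * ((s\<^sup>2 - (norm (y - a))\<^sup>2) / Q y) = 2 * t * (s\<^sup>2 / Q y) - t"
        proof -
          have n: "s\<^sup>2 - (norm (y - a))\<^sup>2 = 2 * s\<^sup>2 - Q y" by (simp add: Q_def)
          have "t * ((2 * s\<^sup>2 - Q y) / Q y) = 2 * t * (s\<^sup>2 / Q y) - t"
            using Q(1)[of y] by (simp add: diff_divide_distrib right_diff_distrib)
          then show ?thesis unfolding n .
        qed
        moreover have "s * (1 + t) / s = 1 + t" using s by simp
        then have "lf a (s * (1 + t)) y - lf a s y = ln (((s * (1 + t))\<^sup>2 + (norm (y - a))\<^sup>2) / Q y) - ln (1 + t)"
          using lnd[OF s', of a y] by (simp only:)
        moreover have "(2 * t + t\<^sup>2) * (s\<^sup>2 / Q y) = 2 * t * (s\<^sup>2 / Q y) + t\<^sup>2 * (s\<^sup>2 / Q y)" by (rule distrib_right)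
        ultimately show ?thesis using l1 l2 by linarith
      qed
      have "0 \<le> (\<integral>y. f y * (lf a (s * (1 + t)) y - lf a s y) \<partial>lborel)" by (rule Gd[OF s'])
      also have "\<dots> \<le> (\<integral>y. t * (f y * ((s\<^sup>2 - (norm (y - a))\<^sup>2) / Q y)) + 3 * t\<^sup>2 * f y \<partial>lborel)"
      proof (intro integral_mono GI[OF s'] Bochner_Integration.integrable_add integrable_mult_right I1 fI)
        fix y
        show "f y * (lf a (s * (1 + t)) y - lf a s y) \<le> t * (f y * ((s\<^sup>2 - (norm (y - a))\<^sup>2) / Q y)) + 3 * t\<^sup>2 * f y"
          using mult_left_mono[OF pt[of y] f0[of y]] by (simp add: algebra_simps)
      qed
      also have "\<dots> = t * B + 3 * t\<^sup>2 * (\<integral>y. f y \<partial>lborel)"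
        unfolding B_def integral_mult_right_zero[symmetric]
        by (intro Bochner_Integration.integral_add integrable_mult_right I1 fI)
      finally show ?thesis unfolding f1 by simp
    qed
    then have "B = 0" by (rule stationary_quadratic)
    then show "(\<integral>y. f y * ((s\<^sup>2 - (norm (y - a))\<^sup>2) / (s\<^sup>2 + (norm (y - a))\<^sup>2)) \<partial>lborel) = 0" by (simp add: B_def Q_def)
  qed
qed


section \<open>From bounded to general densities\<close>

lemma multiplier_one: "multiplier (\<lambda>_. 1) (\<lambda>_ _. 0) (\<lambda>_ _. 0)"
proof -
  have "sb i 1 (\<lambda>x::'a. 0) (\<lambda>x. 0)" for i :: 'a
    by (rule sbI[where C = 0 and C' = 0]) (auto intro!: continuous_intros)
  then show ?thesis unfolding multiplier_def by (auto intro!: sb_const exI[of _ 0])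
qed

text \<open>The truncations \<open>fn n\<close> stay below f, and their potentials converge wherever
  the integral defining \<open>pot f\<close> exists. The right side is monotone in the density. On
  the left the integrability belongs to the claim, so the limit is taken by Fatou's lemma.\<close>

lemma localized_Sobolev:
  fixes f :: "'a::euclidean_space \<Rightarrow> real"
  assumes d: "DIM('a) \<ge> 3" and m: "multiplier m m1 m2" and f: "f \<in> Lhp" and f0: "\<And>x. 0 \<le> f x"
    and J: "integrable lborel (\<lambda>x. (pot f x)\<^sup>2 * grad2 m1 x)"
  shows "integrable lborel (\<lambda>x. (m x * pot f x) powr hq TYPE('a))"
    "newt_c TYPE('a) * (\<integral>x. (m x * pot f x) powr hq TYPE('a) \<partial>lborel) powr (2 / hq TYPE('a))
      \<le> hls_M TYPE('a) * (newt_c TYPE('a) * (\<integral>x. f x * (m x)\<^sup>2 * pot f x \<partial>lborel) + (\<integral>x. (pot f x)\<^sup>2 * grad2 m1 x \<partial>lborel))"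
    "integrable lborel (\<lambda>x. f x * (m x)\<^sup>2 * pot f x)"
proof -
  define c where "c = newt_c TYPE('a)"
  define M where "M = hls_M TYPE('a)"
  define q where "q = hq TYPE('a)"
  note pq = hp_hq[OF d, folded q_def]
  have c: "c > 0" unfolding c_def by (rule newt_c_pos[OF d])
  have M: "M \<ge> 0" unfolding M_def by (rule hls_M_nonneg[OF d])
  note mD = multiplierD[OF m]
  have fm [measurable]: "f \<in> borel_measurable borel" using f by (rule LhpD)
  note [measurable] = mD(4,5)
  obtain Cm where Cm: "\<And>x. m x \<le> Cm" using mD(6) by blast
  define fn where "fn = (\<lambda>n (y::'a). min (f y) (real n) * indicator (cball 0 (real n)) y)"
  have fnm [measurable]: "fn n \<in> borel_measurable borel" for n unfolding fn_def
    by (intro borel_measurable_times borel_measurable_min fm borel_measurable_const borel_measurable_indicator) simp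
  have fn: "0 \<le> fn n y" "fn n y \<le> f y" "fn n y \<le> real n" "norm y > real n \<Longrightarrow> fn n y = 0" for n y
    using f0[of y] by (auto simp: fn_def indicator_def min_def)
  have fnlim: "(\<lambda>n. fn n y) \<longlonglongrightarrow> f y" for y
  proof (rule tendsto_eventually)
    have "eventually (\<lambda>n. real n \<ge> max (f y) (norm y)) sequentially"
      using eventually_ge_at_top[of "nat \<lceil>max (f y) (norm y)\<rceil>"] by eventually_elim linarith
    then show "eventually (\<lambda>n. fn n y = f y) sequentially"
      by eventually_elim (auto simp: min_def fn_def)
  qed
  define U where "U = pot f"
  have [measurable]: "U \<in> borel_measurable borel" unfolding U_def by measurable
  have U0: "U x \<ge> 0" for x unfolding U_def by (rule pot_nonneg[OF f0])
  have Un0: "pot (fn n) x \<ge> 0" for n x by (rule pot_nonneg[OF fn(1)])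
  have le: "pot (fn n) x \<le> U x" and lim: "(\<lambda>n. pot (fn n) x) \<longlonglongrightarrow> U x" if I: "integrable lborel (\<lambda>y. newton (x - y) * f y)" for n x
  proof -
    have b: "AE y in lborel. norm (newton (x - y) * fn n y) \<le> newton (x - y) * f y" for n
      using fn by (intro AE_I2) (simp add: mult_left_mono)
    have In: "integrable lborel (\<lambda>y. newton (x - y) * fn n y)" for n
      by (rule Bochner_Integration.integrable_bound[OF I]) (use fn f0 in \<open>auto intro!: mult_left_mono\<close>)
    show "pot (fn n) x \<le> U x" unfolding U_def pot_def
      using fn by (intro integral_mono In I mult_left_mono) auto
    show "(\<lambda>n. pot (fn n) x) \<longlonglongrightarrow> U x" unfolding U_def pot_def
      by (rule integral_dominated_convergence[OF _ _ I _ b]) (auto intro!: tendsto_intros fnlim)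
  qed
  note AEI = AE_integrable_newton[OF d f]
  have fUI: "integrable lborel (\<lambda>x. f x * (m x)\<^sup>2 * U x)"
  proof (rule Bochner_Integration.integrable_bound)
    show "integrable lborel (\<lambda>x. Cm\<^sup>2 * (f x * U x))" unfolding U_def by (intro integrable_mult_right hls_pot(1)[OF d f f])
    have "f x * (m x)\<^sup>2 * U x \<le> Cm\<^sup>2 * (f x * U x)" for x
    proof -
      have "(m x)\<^sup>2 * (f x * U x) \<le> Cm\<^sup>2 * (f x * U x)" using f0 U0 mD(3) Cm by (intro mult_right_mono power_mono) auto
      then show ?thesis by (simp add: mult_ac)
    qed
    then show "AE x in lborel. norm (f x * (m x)\<^sup>2 * U x) \<le> norm (Cm\<^sup>2 * (f x * U x))"
      using f0 U0 by (intro AE_norm_mono) auto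
  qed simp
  then show "integrable lborel (\<lambda>x. f x * (m x)\<^sup>2 * pot f x)" unfolding U_def .
  define T where "T = c * (\<integral>x. f x * (m x)\<^sup>2 * U x \<partial>lborel) + (\<integral>x. (U x)\<^sup>2 * grad2 m1 x \<partial>lborel)"
  have T0: "T \<ge> 0" unfolding T_def using c f0 U0 by (intro add_nonneg_nonneg mult_nonneg_nonneg integral_nonneg_AE) auto
  \<comment> \<open>The inequality solved for the integral of the q-th power: a bound common to all
    truncations.\<close>
  define K where "K = (M * T / c) powr (q / 2)"
  have step: "integrable lborel (\<lambda>x. (m x * pot (fn n) x) powr q)" "(\<integral>x. (m x * pot (fn n) x) powr q \<partial>lborel) \<le> K" for n
  proof -
    have leJ: "AE x in lborel. norm ((pot (fn n) x)\<^sup>2 * grad2 m1 x) \<le> norm ((U x)\<^sup>2 * grad2 m1 x)"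
      using AEI by eventually_elim (auto simp: abs_mult Un0 U0 intro!: mult_right_mono power_mono le)
    have Jn: "integrable lborel (\<lambda>x. (pot (fn n) x)\<^sup>2 * grad2 m1 x)"
      by (rule Bochner_Integration.integrable_bound[OF J[folded U_def] _ leJ]) simp
    have le1: "AE x in lborel. norm (fn n x * (m x)\<^sup>2 * pot (fn n) x) \<le> norm (f x * (m x)\<^sup>2 * U x)"
      using AEI by eventually_elim (auto simp: abs_mult Un0 U0 fn f0 intro!: mult_mono le)
    have I1: "integrable lborel (\<lambda>x. fn n x * (m x)\<^sup>2 * pot (fn n) x)"
      by (rule Bochner_Integration.integrable_bound[OF fUI _ le1]) simp
    note S = localized_Sobolev_bounded[OF d m fnm fn(1) fn(3) fn(4) of_nat_0_le_iff Jn, folded c_def M_def q_def]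
    show "integrable lborel (\<lambda>x. (m x * pot (fn n) x) powr q)" by (rule S(1))
    define X where "X = (\<integral>x. (m x * pot (fn n) x) powr q \<partial>lborel)"
    have X0: "X \<ge> 0" unfolding X_def by (intro integral_nonneg_AE) auto
    have "(\<integral>x. fn n x * (m x)\<^sup>2 * pot (fn n) x \<partial>lborel) \<le> (\<integral>x. f x * (m x)\<^sup>2 * U x \<partial>lborel)"
      by (rule integral_mono_AE[OF I1 fUI]) (use le1 in eventually_elim, auto simp: abs_mult Un0 U0 fn f0)
    moreover have "(\<integral>x. (pot (fn n) x)\<^sup>2 * grad2 m1 x \<partial>lborel) \<le> (\<integral>x. (U x)\<^sup>2 * grad2 m1 x \<partial>lborel)"
      by (rule integral_mono_AE[OF Jn J[folded U_def]]) (use leJ in eventually_elim, auto simp: abs_mult Un0 U0)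
    ultimately have "c * X powr (2 / q) \<le> M * T"
      unfolding X_def T_def using c by (intro order_trans[OF S(2)] mult_left_mono[OF _ M] add_mono mult_left_mono) auto
    then have "X powr (2 / q) \<le> M * T / c" using c by (simp add: pos_le_divide_eq mult.commute)
    then have "(X powr (2 / q)) powr (q / 2) \<le> K" unfolding K_def using pq by (intro powr_mono2) auto
    then show "X \<le> K" using X0 pq by (simp add: powr_powr)
  qed
  have K0: "K \<ge> 0" by (simp add: K_def)
  have "(\<integral>\<^sup>+x. ennreal ((m x * U x) powr q) \<partial>lborel) = (\<integral>\<^sup>+x. liminf (\<lambda>n. ennreal ((m x * pot (fn n) x) powr q)) \<partial>lborel)"
  proof (rule nn_integral_cong_AE)
    show "AE x in lborel. ennreal ((m x * U x) powr q) = liminf (\<lambda>n. ennreal ((m x * pot (fn n) x) powr q))"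
      using AEI
    proof eventually_elim
      case (elim x)
      have "(\<lambda>n. ennreal ((m x * pot (fn n) x) powr q)) \<longlonglongrightarrow> ennreal ((m x * U x) powr q)"
        using pq mD(3) Un0 by (intro tendsto_ennrealI tendsto_powr' tendsto_mult tendsto_const lim[OF elim]) (auto intro!: always_eventually)
      then show ?case by (metis lim_imp_Liminf trivial_limit_sequentially)
    qed
  qed
  also have "\<dots> \<le> liminf (\<lambda>n. \<integral>\<^sup>+x. ennreal ((m x * pot (fn n) x) powr q) \<partial>lborel)"
    by (rule nn_integral_liminf) simp
  also have "\<dots> \<le> liminf (\<lambda>n. ennreal K)"
  proof (intro Liminf_mono always_eventually allI)
    fix n
    show "(\<integral>\<^sup>+x. ennreal ((m x * pot (fn n) x) powr q) \<partial>lborel) \<le> ennreal K"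
      using step[of n] by (subst nn_integral_eq_integral) (auto intro: ennreal_leI)
  qed
  also have "\<dots> = ennreal K" by (simp add: Liminf_const)
  finally have N: "(\<integral>\<^sup>+x. ennreal ((m x * U x) powr q) \<partial>lborel) \<le> ennreal K" .
  show I: "integrable lborel (\<lambda>x. (m x * pot f x) powr hq TYPE('a))"
    using N unfolding q_def U_def by (intro integrableI_bounded) (auto intro: le_less_trans)
  define X where "X = (\<integral>x. (m x * U x) powr q \<partial>lborel)"
  have X0: "X \<ge> 0" unfolding X_def by (intro integral_nonneg_AE) auto
  have "ennreal X \<le> ennreal K"
    using N I unfolding X_def q_def U_def by (subst (asm) nn_integral_eq_integral) auto
  then have "X \<le> K" using K0 by simp
  then have "X powr (2 / q) \<le> K powr (2 / q)" using X0 pq by (intro powr_mono2) auto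
  also have "\<dots> = M * T / c" unfolding K_def using pq M T0 c by (simp add: powr_powr)
  finally have "c * X powr (2 / q) \<le> M * T" using c by (simp add: pos_le_divide_eq mult.commute)
  then show "newt_c TYPE('a) * (\<integral>x. (m x * pot f x) powr hq TYPE('a) \<partial>lborel) powr (2 / hq TYPE('a))
      \<le> hls_M TYPE('a) * (newt_c TYPE('a) * (\<integral>x. f x * (m x)\<^sup>2 * pot f x \<partial>lborel) + (\<integral>x. (pot f x)\<^sup>2 * grad2 m1 x \<partial>lborel))"
    unfolding c_def q_def M_def X_def T_def U_def .
qed

text \<open>The multiplier 1 has no gradient, which leaves the plain Sobolev inequality dual to the
  definition of \<open>hls_M\<close>.\<close>

lemma pot_Lhq:
  fixes f :: "'a::euclidean_space \<Rightarrow> real"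
  assumes d: "DIM('a) \<ge> 3" and f: "f \<in> Lhp" and f0: "\<And>x. 0 \<le> f x"
  shows "integrable lborel (\<lambda>x. pot f x powr hq TYPE('a))"
    "(\<integral>x. pot f x powr hq TYPE('a) \<partial>lborel) powr (2 / hq TYPE('a)) \<le> hls_M TYPE('a) * hls f f"
proof -
  have J: "integrable lborel (\<lambda>x. (pot f x)\<^sup>2 * grad2 (\<lambda>_ _. 0 :: real) x)" by (simp add: grad2_def)
  note S = localized_Sobolev[OF d multiplier_one f f0 J]
  show "integrable lborel (\<lambda>x. pot f x powr hq TYPE('a))" using S(1) by simp
  have "newt_c TYPE('a) * (\<integral>x. pot f x powr hq TYPE('a) \<partial>lborel) powr (2 / hq TYPE('a)) \<le> newt_c TYPE('a) * (hls_M TYPE('a) * hls f f)"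
    using S(2) unfolding hls_pot(2)[OF d f f] by (simp add: grad2_def mult_ac)
  then show "(\<integral>x. pot f x powr hq TYPE('a) \<partial>lborel) powr (2 / hq TYPE('a)) \<le> hls_M TYPE('a) * hls f f"
    using newt_c_pos[OF d] by simp
qed

section \<open>The second variation\<close>


text \<open>Lagrange's remainder: the third derivative is at most 6 times 5 times 4 times 4, and
  division by 3! leaves 80. The last factor 4 bounds (1 + \<xi>)^(q-3), whose exponent changes sign
  at q = 3.\<close>

lemma powr_taylor_lower:
  fixes q t :: real
  assumes q: "2 < q" "q \<le> 6" and t: "\<bar>t\<bar> \<le> 1 / 2"
  shows "1 + q * t + q * (q - 1) / 2 * t\<^sup>2 - 80 * \<bar>t\<bar> ^ 3 \<le> (1 + t) powr q"
proof (cases "t = 0")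
  case False
  define diff where "diff = (\<lambda>m t::real. (\<Prod>j<m. q - real j) * (1 + t) powr (q - real m))"
  have "\<exists>\<xi>. (if t < 0 then t < \<xi> \<and> \<xi> < 0 else 0 < \<xi> \<and> \<xi> < t) \<and>
     (1 + t) powr q = (\<Sum>m<3. diff m 0 / fact m * (t - 0) ^ m) + diff 3 \<xi> / fact 3 * (t - 0) ^ 3"
  proof (rule Taylor[where a = "- 1 / 2" and b = "1 / 2"])
    show "diff 0 = (\<lambda>t. (1 + t) powr q)" by (simp add: diff_def)
    show "\<forall>m t. m < 3 \<and> - 1 / 2 \<le> t \<and> t \<le> 1 / 2 \<longrightarrow> DERIV (diff m) t :> diff (Suc m) t"
      unfolding diff_def by (auto intro!: derivative_eq_intros simp: algebra_simps)
  qed (use t False in auto)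
  then obtain \<xi> where c: "if t < 0 then t < \<xi> \<and> \<xi> < 0 else 0 < \<xi> \<and> \<xi> < t"
    and T0: "(1 + t) powr q = (\<Sum>m<3. diff m 0 / fact m * (t - 0) ^ m) + diff 3 \<xi> / fact 3 * (t - 0) ^ 3"
    by blast
  have \<xi>: "\<bar>\<xi>\<bar> \<le> 1 / 2" using c t by (cases "t < 0") auto
  have T: "(1 + t) powr q = (\<Sum>m<3. diff m 0 / fact m * t ^ m) + diff 3 \<xi> / fact 3 * t ^ 3"
    using T0 by simp
  have S: "(\<Sum>m<3. diff m 0 / fact m * t ^ m) = 1 + q * t + q * (q - 1) / 2 * t\<^sup>2"
    by (simp add: diff_def numeral_3_eq_3 lessThan_Suc power2_eq_square algebra_simps)
  have D3: "diff 3 \<xi> = q * (q - 1) * (q - 2) * (1 + \<xi>) powr (q - 3)"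
    by (simp add: diff_def numeral_3_eq_3 lessThan_Suc algebra_simps)
  have X: "0 \<le> (1 + \<xi>) powr (q - 3)" "(1 + \<xi>) powr (q - 3) \<le> 4"
  proof -
    show "(1 + \<xi>) powr (q - 3) \<le> 4"
    proof (cases "q \<ge> 3")
      case True
      have "(1 + \<xi>) powr (q - 3) \<le> (3 / 2) powr (q - 3)" using \<xi> True by (intro powr_mono2) auto
      also have "\<dots> \<le> (3 / 2) powr 3" using q by (intro powr_mono) auto
      also have "\<dots> \<le> 4" by (simp add: power3_eq_cube)
      finally show ?thesis .
    next
      case False
      have "(1 + \<xi>) powr (q - 3) \<le> (1 / 2) powr (q - 3)" using \<xi> False by (intro powr_mono2') auto
      also have "\<dots> \<le> (1 / 2) powr (- 1)" using q by (intro powr_mono') auto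
      also have "\<dots> \<le> 4" by (simp add: powr_minus)
      finally show ?thesis .
    qed
  qed simp
  have "q * (q - 1) * (q - 2) * (1 + \<xi>) powr (q - 3) \<le> 6 * 5 * 4 * 4"
    using q X by (intro mult_mono mult_nonneg_nonneg) auto
  then have d: "0 \<le> diff 3 \<xi> / fact 3" "diff 3 \<xi> / fact 3 \<le> 80"
    unfolding D3 using q X by (auto simp: fact_numeral)
  have "\<bar>diff 3 \<xi> / fact 3 * t ^ 3\<bar> \<le> 80 * \<bar>t\<bar> ^ 3"
    unfolding abs_mult power_abs[symmetric] using d by (intro mult_mono) auto
  then show ?thesis unfolding T S by linarith
qed simp

text \<open>From ln (1 + z) \<ge> z - 2 z^2 and exp t \<ge> 1 + t.\<close>

lemma one_plus_powr_lower:
  fixes r z :: real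
  assumes "0 \<le> r" "r \<le> 1" "\<bar>z\<bar> \<le> 1 / 2"
  shows "1 + r * z - 2 * z\<^sup>2 \<le> (1 + z) powr r"
proof -
  have "\<bar>ln (1 + z) - z\<bar> \<le> 2 * z\<^sup>2" by (rule abs_ln_one_plus_x_minus_x_bound[OF assms(3)])
  then have "z - 2 * z\<^sup>2 \<le> ln (1 + z)" by linarith
  then have "r * (z - 2 * z\<^sup>2) \<le> r * ln (1 + z)" using assms by (intro mult_left_mono) auto
  moreover have "r * (2 * z\<^sup>2) \<le> 1 * (2 * z\<^sup>2)" using assms by (intro mult_right_mono) auto
  ultimately have "1 + r * z - 2 * z\<^sup>2 \<le> 1 + r * ln (1 + z)" by (simp add: right_diff_distrib)
  also have "\<dots> \<le> exp (r * ln (1 + z))" by (rule exp_ge_add_one_self)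
  also have "\<dots> = (1 + z) powr r" using assms by (simp add: powr_def)
  finally show ?thesis .
qed

section \<open>Stereographic coordinates\<close>

text \<open>The conformal factor of the inverse stereographic projection; its d-th power is the
  Jacobian.\<close>

definition h2 :: "'a::euclidean_space \<Rightarrow> real" where
  "h2 x = 2 / (1 + (norm x)\<^sup>2)"

text \<open>The coordinate of the inverse stereographic projection of \<open>x\<close> in the direction \<open>(\<alpha>, e)\<close>, where \<open>\<alpha>\<close> is
  the vertical component, and its partial derivatives.\<close>

definition om :: "real \<Rightarrow> 'a::euclidean_space \<Rightarrow> 'a \<Rightarrow> real" where
  "om \<alpha> e x = \<alpha> * (h2 x - 1) + (x \<bullet> e) * h2 x"

definition om1 :: "real \<Rightarrow> 'a::euclidean_space \<Rightarrow> 'a \<Rightarrow> 'a \<Rightarrow> real" where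
  "om1 \<alpha> e i x = (i \<bullet> e) * h2 x - (\<alpha> + x \<bullet> e) * (x \<bullet> i) * (h2 x)\<^sup>2"

lemma h2_pos [simp]: "h2 x > 0" by (simp add: h2_def add_pos_nonneg)
lemma h2_nonneg [simp]: "h2 x \<ge> 0" by (simp add: less_imp_le)
lemma h2_neq_0 [simp]: "h2 x \<noteq> 0" using h2_pos[of x] by linarith
lemma h2_le: "h2 x \<le> 2" by (simp add: h2_def divide_le_eq add_pos_nonneg)
lemma h2_norm: "(norm x)\<^sup>2 * h2 x = 2 - h2 x"
proof -
  have "1 + (norm x)\<^sup>2 \<noteq> 0" by (metis add_pos_nonneg less_irrefl zero_le_power2 zero_less_one)
  then show ?thesis by (simp add: h2_def field_simps)
qed
lemma h2_measurable [measurable]: "h2 \<in> borel_measurable borel" unfolding h2_def[abs_def] by measurable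
lemma om_measurable [measurable]: "om \<alpha> e \<in> borel_measurable borel" "om1 \<alpha> e i \<in> borel_measurable borel"
  unfolding om_def[abs_def] om1_def[abs_def] by measurable

text \<open>Cauchy-Schwarz for the unit vector (\<alpha>, e) and the point over x, which lies on the
  unit sphere by \<open>h2_norm\<close>.\<close>

lemma om_abs_le:
  assumes "\<alpha>\<^sup>2 + (norm e)\<^sup>2 = 1"
  shows "\<bar>om \<alpha> e x\<bar> \<le> 1"
proof -
  have "(om \<alpha> e x)\<^sup>2 = ((\<alpha>, e) \<bullet> (h2 x - 1, h2 x *\<^sub>R x))\<^sup>2"
    by (simp add: om_def inner_commute mult.commute)
  also have "\<dots> \<le> ((\<alpha>, e) \<bullet> (\<alpha>, e)) * ((h2 x - 1, h2 x *\<^sub>R x) \<bullet> (h2 x - 1, h2 x *\<^sub>R x))"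
    by (rule Cauchy_Schwarz_ineq)
  also have "(\<alpha>, e) \<bullet> (\<alpha>, e) = 1" using assms unfolding power2_norm_eq_inner by (simp add: power2_eq_square)
  also have "(h2 x - 1, h2 x *\<^sub>R x) \<bullet> (h2 x - 1, h2 x *\<^sub>R x) = (h2 x - 1)\<^sup>2 + h2 x * ((norm x)\<^sup>2 * h2 x)"
    unfolding power2_norm_eq_inner by (simp add: power2_eq_square)
  also have "\<dots> = 1" unfolding h2_norm by (simp add: power2_eq_square algebra_simps)
  finally show ?thesis by (simp add: abs_square_le_1)
qed

text \<open>The squared chordal distance of the points over x and y is h2 x times h2 y times |x -
  y|^2, and \<open>h2\<close> is at most 2.\<close>

lemma om_lipschitz:
  assumes "\<alpha>\<^sup>2 + (norm e)\<^sup>2 = 1"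
  shows "\<bar>om \<alpha> e x - om \<alpha> e y\<bar> \<le> 2 * norm (x - y)"
proof -
  define v where "v = (h2 x - h2 y, h2 x *\<^sub>R x - h2 y *\<^sub>R y)"
  have vv: "v \<bullet> v = h2 x * h2 y * (norm (x - y))\<^sup>2"
  proof -
    define X Y Z where "X = x \<bullet> x" and "Y = y \<bullet> y" and "Z = x \<bullet> y"
    have n: "X * h2 x = 2 - h2 x" "Y * h2 y = 2 - h2 y"
      using h2_norm[of x] h2_norm[of y] by (simp_all add: X_def Y_def power2_norm_eq_inner)
    have "v \<bullet> v = (h2 x - h2 y)\<^sup>2 + h2 x * (X * h2 x) + h2 y * (Y * h2 y) - 2 * h2 x * h2 y * Z"
      unfolding v_def X_def Y_def Z_def by (simp add: inner_simps inner_commute power2_eq_square algebra_simps)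
    also have "\<dots> = (X * h2 x) * h2 y + (Y * h2 y) * h2 x - 2 * h2 x * h2 y * Z"
      unfolding n by (simp add: power2_eq_square algebra_simps)
    also have "\<dots> = h2 x * h2 y * (norm (x - y))\<^sup>2"
      unfolding X_def Y_def Z_def power2_norm_eq_inner by (simp add: inner_simps inner_commute algebra_simps)
    finally show ?thesis .
  qed
  have "(om \<alpha> e x - om \<alpha> e y)\<^sup>2 = ((\<alpha>, e) \<bullet> v)\<^sup>2"
    by (simp add: om_def v_def inner_simps inner_commute algebra_simps)
  also have "\<dots> \<le> ((\<alpha>, e) \<bullet> (\<alpha>, e)) * (v \<bullet> v)" by (rule Cauchy_Schwarz_ineq)
  also have "(\<alpha>, e) \<bullet> (\<alpha>, e) = 1" using assms unfolding power2_norm_eq_inner by (simp add: power2_eq_square)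
  also have "1 * (v \<bullet> v) \<le> 2 * 2 * (norm (x - y))\<^sup>2"
    unfolding vv mult_1 by (intro mult_right_mono mult_mono h2_le) auto
  finally have "(om \<alpha> e x - om \<alpha> e y)\<^sup>2 \<le> (2 * norm (x - y))\<^sup>2" by (simp add: power_mult_distrib)
  then have "\<bar>om \<alpha> e x - om \<alpha> e y\<bar> \<le> \<bar>2 * norm (x - y)\<bar>" unfolding abs_le_square_iff .
  then show ?thesis by simp
qed

lemma sb_h2:
  fixes i :: "'a::euclidean_space"
  assumes "norm i = 1"
  shows "sb i 2 h2 (\<lambda>x. - (x \<bullet> i) * (h2 x)\<^sup>2)"
proof -
  have A: "sb i 2 (\<lambda>x. 2 * (1\<^sup>2 + (norm (x - 0))\<^sup>2) powr (- 2 / 2))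
    (\<lambda>x. 2 * (- 2 * ((x - 0) \<bullet> i) * (1\<^sup>2 + (norm (x - 0))\<^sup>2) powr (- (2 + 2) / 2)))"
    by (intro sb_scale sb_bubble assms) auto
  have B: "2 * (1\<^sup>2 + (norm (x - 0))\<^sup>2) powr (- 2 / 2) = h2 x"
    "2 * (- 2 * ((x - 0) \<bullet> i) * (1\<^sup>2 + (norm (x - 0))\<^sup>2) powr (- (2 + 2) / 2)) = - (x \<bullet> i) * (h2 x)\<^sup>2" for x
  proof -
    have p: "1 + (norm x)\<^sup>2 > 0" by (simp add: add_pos_nonneg)
    show "2 * (1\<^sup>2 + (norm (x - 0))\<^sup>2) powr (- 2 / 2) = h2 x"
      using p by (simp add: h2_def powr_minus_divide)
    show "2 * (- 2 * ((x - 0) \<bullet> i) * (1\<^sup>2 + (norm (x - 0))\<^sup>2) powr (- (2 + 2) / 2)) = - (x \<bullet> i) * (h2 x)\<^sup>2"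
      using p by (simp add: h2_def powr_minus_divide power_divide)
  qed
  show ?thesis using A unfolding B .
qed

text \<open>The coordinate is the constant -\<alpha> plus the product of \<alpha> + x \<bullet> e,
  which grows linearly, with \<open>h2\<close>, which decays quadratically; hence a constant plus a
  symbol of rate 1. The restriction on \<epsilon> keeps the multiplier nonnegative.\<close>

lemma multiplier_om:
  fixes e :: "'a::euclidean_space"
  assumes ae: "\<alpha>\<^sup>2 + (norm e)\<^sup>2 = 1" and \<epsilon>: "\<bar>\<epsilon>\<bar> \<le> 1"
  shows "\<exists>m2. multiplier (\<lambda>x. 1 + \<epsilon> * om \<alpha> e x) (\<lambda>i x. \<epsilon> * om1 \<alpha> e i x) m2"
proof -
  have ex: "\<exists>m2. sb i 0 (\<lambda>x. 1 + \<epsilon> * om \<alpha> e x) (\<lambda>x. \<epsilon> * om1 \<alpha> e i x) \<and> sb i 1 (\<lambda>x. \<epsilon> * om1 \<alpha> e i x) m2"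
    if i: "i \<in> Basis" for i :: 'a
  proof -
    have ni: "norm i = 1" using i by simp
    have L: "sb i (- 1) (\<lambda>x. \<alpha> + x \<bullet> e) (\<lambda>x. i \<bullet> e)"
      using sb_add[OF sb_mono[OF sb_const[of i \<alpha>], of "- 1"] sb_coord[OF ni, of 0 e]] by simp
    note H = sb_h2[OF ni]
    have P: "sb i 1 (\<lambda>x. (\<alpha> + x \<bullet> e) * h2 x) (\<lambda>x. (i \<bullet> e) * h2 x + (\<alpha> + x \<bullet> e) * (- (x \<bullet> i) * (h2 x)\<^sup>2))"
      using sb_mult[OF L H] by simp
    have Q: "sb i 0 (\<lambda>x. (1 - \<epsilon> * \<alpha>) + \<epsilon> * ((\<alpha> + x \<bullet> e) * h2 x)) (\<lambda>x. 0 + \<epsilon> * ((i \<bullet> e) * h2 x + (\<alpha> + x \<bullet> e) * (- (x \<bullet> i) * (h2 x)\<^sup>2)))"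
      by (intro sb_add sb_const sb_mono[OF sb_scale[OF P]]) simp
    have e1: "(\<lambda>x. (1 - \<epsilon> * \<alpha>) + \<epsilon> * ((\<alpha> + x \<bullet> e) * h2 x)) = (\<lambda>x. 1 + \<epsilon> * om \<alpha> e x)"
      by (simp add: om_def algebra_simps)
    have e2: "(\<lambda>x. 0 + \<epsilon> * ((i \<bullet> e) * h2 x + (\<alpha> + x \<bullet> e) * (- (x \<bullet> i) * (h2 x)\<^sup>2))) = (\<lambda>x. \<epsilon> * om1 \<alpha> e i x)"
      by (simp add: om1_def algebra_simps)
    have C: "sb i (- 1) (\<lambda>x. x \<bullet> i) (\<lambda>x. i \<bullet> i)" using sb_coord[OF ni, of 0 i] by simp
    obtain k' where K: "sb i 2 (\<lambda>x. (\<alpha> + x \<bullet> e) * ((x \<bullet> i) * (h2 x * h2 x))) k'"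
    proof -
      have "sb i (- 1 + (- 1 + (2 + 2))) (\<lambda>x. (\<alpha> + x \<bullet> e) * ((x \<bullet> i) * (h2 x * h2 x))) k'" if "k' = (\<lambda>x. (i \<bullet> e) * ((x \<bullet> i) * (h2 x * h2 x)) + (\<alpha> + x \<bullet> e) * ((i \<bullet> i) * (h2 x * h2 x) + (x \<bullet> i) * ((- (x \<bullet> i) * (h2 x)\<^sup>2) * h2 x + h2 x * (- (x \<bullet> i) * (h2 x)\<^sup>2))))" for k'
        unfolding that by (rule sb_mult[OF L sb_mult[OF C sb_mult[OF H H]]])
      then show thesis using that by simp
    qed
    obtain l' where R: "sb i 2 (\<lambda>x. \<epsilon> * ((i \<bullet> e) * h2 x + (- 1) * ((\<alpha> + x \<bullet> e) * ((x \<bullet> i) * (h2 x * h2 x))))) l'"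
      using sb_scale[OF sb_add[OF sb_scale[OF H] sb_scale[OF K]]] by blast
    have e3: "(\<lambda>x. \<epsilon> * ((i \<bullet> e) * h2 x + (- 1) * ((\<alpha> + x \<bullet> e) * ((x \<bullet> i) * (h2 x * h2 x))))) = (\<lambda>x. \<epsilon> * om1 \<alpha> e i x)"
      by (simp add: om1_def algebra_simps power2_eq_square)
    show ?thesis using Q[unfolded e1 e2] sb_mono[OF R[unfolded e3], of 1] by auto
  qed
  then obtain m2 where m2: "\<And>i. i \<in> Basis \<Longrightarrow> sb i 0 (\<lambda>x. 1 + \<epsilon> * om \<alpha> e x) (\<lambda>x. \<epsilon> * om1 \<alpha> e i x) \<and> sb i 1 (\<lambda>x. \<epsilon> * om1 \<alpha> e i x) (m2 i)"
    by metis
  have pos: "0 \<le> 1 + \<epsilon> * om \<alpha> e x" for x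
  proof -
    have "\<bar>\<epsilon> * om \<alpha> e x\<bar> \<le> 1 * 1" unfolding abs_mult using om_abs_le[OF ae, of x] \<epsilon> by (intro mult_mono) auto
    then show ?thesis by linarith
  qed
  have "\<bar>(1 + \<epsilon> * om \<alpha> e x) - (1 + \<epsilon> * om \<alpha> e y)\<bar> \<le> 2 * norm (x - y)" for x y
  proof -
    have "\<bar>\<epsilon> * (om \<alpha> e x - om \<alpha> e y)\<bar> \<le> 1 * (2 * norm (x - y))"
      unfolding abs_mult using om_lipschitz[OF ae, of x y] \<epsilon> by (intro mult_mono) auto
    then show ?thesis by (simp add: algebra_simps)
  qed
  then show ?thesis using m2 pos unfolding multiplier_def by blast
qed

lemma sum_Basis_inner_sq: "(\<Sum>b\<in>Basis. (x \<bullet> b)\<^sup>2) = (norm (x::'a::euclidean_space))\<^sup>2"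
  unfolding power2_norm_eq_inner by (subst (2) euclidean_inner) (simp add: power2_eq_square)

lemma om_sum_squares: "(om 1 0 x)\<^sup>2 + (\<Sum>b\<in>Basis. (om 0 b x)\<^sup>2) = 1"
  for x :: "'a::euclidean_space"
proof -
  have "(\<Sum>b\<in>Basis. (om 0 b x)\<^sup>2) = (norm x)\<^sup>2 * (h2 x)\<^sup>2"
    by (simp add: om_def power_mult_distrib sum_distrib_right[symmetric] sum_Basis_inner_sq)
  also have "\<dots> = ((norm x)\<^sup>2 * h2 x) * h2 x" by (simp add: power2_eq_square)
  finally show ?thesis unfolding h2_norm by (simp add: om_def power2_eq_square algebra_simps)
qed

lemma grad2_om:
  fixes x :: "'a::euclidean_space"
  shows "grad2 (om1 \<alpha> e) x = (norm e)\<^sup>2 * (h2 x)\<^sup>2 - 2 * (\<alpha> + x \<bullet> e) * (x \<bullet> e) * (h2 x) ^ 3 + (\<alpha> + x \<bullet> e)\<^sup>2 * (norm x)\<^sup>2 * (h2 x) ^ 4"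
proof -
  define k where "k = (\<alpha> + x \<bullet> e) * (h2 x)\<^sup>2"
  have "grad2 (om1 \<alpha> e) x = (\<Sum>i\<in>Basis. (h2 x)\<^sup>2 * (e \<bullet> i)\<^sup>2 - 2 * h2 x * k * ((x \<bullet> i) * (e \<bullet> i)) + k\<^sup>2 * (x \<bullet> i)\<^sup>2)"
    unfolding grad2_def om1_def k_def
    by (intro sum.cong refl) (simp add: power2_eq_square algebra_simps inner_commute)
  also have "\<dots> = (h2 x)\<^sup>2 * (\<Sum>i\<in>Basis. (e \<bullet> i)\<^sup>2) - 2 * h2 x * k * (\<Sum>i\<in>Basis. (x \<bullet> i) * (e \<bullet> i)) + k\<^sup>2 * (\<Sum>i\<in>Basis. (x \<bullet> i)\<^sup>2)"
    by (simp add: sum.distrib sum_subtractf sum_distrib_left)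
  also have "(\<Sum>i\<in>Basis. (x \<bullet> i) * (e \<bullet> i)) = x \<bullet> e" by (rule euclidean_inner[symmetric])
  finally show ?thesis unfolding sum_Basis_inner_sq k_def
    by (simp add: power2_eq_square power3_eq_cube power4_eq_xxxx algebra_simps)
qed

text \<open>On the unit sphere the gradients of the coordinates are the tangential projections of
  the basis vectors, whose squared lengths sum to the dimension d. The conformal map contributes the
  factor h2^2.\<close>

lemma grad2_om_sum:
  fixes x :: "'a::euclidean_space"
  shows "grad2 (om1 1 0) x + (\<Sum>b\<in>Basis. grad2 (om1 0 b) x) = real DIM('a) * (h2 x)\<^sup>2"
proof -
  define N where "N = (norm x)\<^sup>2"
  have n: "N * h2 x = 2 - h2 x" unfolding N_def by (rule h2_norm)
  have "(\<Sum>b\<in>Basis. grad2 (om1 0 b) x) = (\<Sum>b\<in>Basis. (h2 x)\<^sup>2 + (N * (h2 x) ^ 4 - 2 * (h2 x) ^ 3) * (x \<bullet> b)\<^sup>2)"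
    unfolding N_def by (intro sum.cong refl) (simp add: grad2_om power2_eq_square algebra_simps)
  also have "\<dots> = real DIM('a) * (h2 x)\<^sup>2 + (N * (h2 x) ^ 4 - 2 * (h2 x) ^ 3) * N"
    by (simp add: sum.distrib sum_distrib_left[symmetric] sum_Basis_inner_sq N_def)
  also have "(N * (h2 x) ^ 4 - 2 * (h2 x) ^ 3) * N = (N * h2 x) * (N * h2 x) * (h2 x)\<^sup>2 - 2 * (N * h2 x) * (h2 x)\<^sup>2"
    by (simp add: power2_eq_square power3_eq_cube power4_eq_xxxx algebra_simps)
  finally have "(\<Sum>b\<in>Basis. grad2 (om1 0 b) x) = real DIM('a) * (h2 x)\<^sup>2 + ((N * h2 x) * (N * h2 x) * (h2 x)\<^sup>2 - 2 * (N * h2 x) * (h2 x)\<^sup>2)" .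
  moreover have "grad2 (om1 1 0) x = (N * h2 x) * (h2 x) ^ 3"
    by (simp add: grad2_om N_def power3_eq_cube power4_eq_xxxx)
  ultimately show ?thesis unfolding n by (simp add: power2_eq_square power3_eq_cube algebra_simps)
qed

lemma grad2_om_le:
  fixes x :: "'a::euclidean_space"
  assumes "(\<alpha>, e) = (1, 0) \<or> (\<alpha> = 0 \<and> e \<in> Basis)"
  shows "grad2 (om1 \<alpha> e) x \<le> real DIM('a) * (h2 x)\<^sup>2"
proof (cases "(\<alpha>, e) = (1, 0)")
  case True
  then show ?thesis using grad2_om_sum[of x] sum_nonneg[of Basis "\<lambda>b. grad2 (om1 0 b) x"] by simp
next
  case False
  then have e: "e \<in> Basis" "\<alpha> = 0" using assms by auto
  have "grad2 (om1 0 e) x \<le> (\<Sum>b\<in>Basis. grad2 (om1 0 b) x)" using e by (intro member_le_sum) auto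
  then show ?thesis unfolding e(2) using grad2_om_sum[of x] grad2_nonneg[of "om1 1 0" x] by linarith
qed

section \<open>Translations and dilations\<close>

text \<open>The exponent (d + 2)/2 is d divided by \<open>hp\<close>; with it the action preserves
  both the norm and the energy.\<close>

definition sc :: "real \<Rightarrow> 'a::euclidean_space \<Rightarrow> ('a \<Rightarrow> real) \<Rightarrow> 'a \<Rightarrow> real" where
  "sc s a f x = s powr ((real DIM('a) + 2) / 2) * f (a + s *\<^sub>R x)"

lemma sc_facts:
  fixes f :: "'a::euclidean_space \<Rightarrow> real"
  assumes d: "DIM('a) \<ge> 3" and f: "f \<in> Lhp" and s: "s > 0"
  shows "sc s a f \<in> Lhp"
    "(\<integral>x. \<bar>sc s a f x\<bar> powr hp TYPE('a) \<partial>lborel) = (\<integral>x. \<bar>f x\<bar> powr hp TYPE('a) \<partial>lborel)"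
    "pot (sc s a f) x = s powr ((real DIM('a) - 2) / 2) * pot f (a + s *\<^sub>R x)"
    "hls (sc s a f) (sc s a f) = hls f f"
proof -
  define D where "D = real DIM('a)"
  define p where "p = hp TYPE('a)"
  have D: "D \<ge> 3" using d by (simp add: D_def)
  have fm [measurable]: "f \<in> borel_measurable borel" using f by (rule LhpD)
  have m [measurable]: "sc s a f \<in> borel_measurable borel" unfolding sc_def[abs_def] by measurable
  have sD: "s ^ DIM('a) = s powr D" using s by (simp add: D_def powr_realpow)
  have pp: "\<bar>sc s a f x\<bar> powr p = s powr D * \<bar>f (a + s *\<^sub>R x)\<bar> powr p" for x
  proof -
    have "(D + 2) / 2 * p = D" using D by (simp add: p_def hp_def D_def field_simps)
    then show ?thesis unfolding sc_def D_def[symmetric] by (simp add: abs_mult powr_mult powr_powr)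
  qed
  have fI: "integrable lborel (\<lambda>x. \<bar>f x\<bar> powr p)" using LhpD(2)[OF f] by (simp add: p_def)
  have "integrable lborel (\<lambda>x. \<bar>f (a + s *\<^sub>R x)\<bar> powr p)"
    using fI s integrable_affine_iff[of "\<lambda>x. \<bar>f x\<bar> powr p" s a] by simp
  then show L: "sc s a f \<in> Lhp" by (simp add: Lhp_def p_def[symmetric] pp)
  show "(\<integral>x. \<bar>sc s a f x\<bar> powr hp TYPE('a) \<partial>lborel) = (\<integral>x. \<bar>f x\<bar> powr hp TYPE('a) \<partial>lborel)"
    unfolding p_def[symmetric] pp using s integral_affine[of "\<lambda>x. \<bar>f x\<bar> powr p" s a] sD by simp
  show pot: "pot (sc s a f) x = s powr ((real DIM('a) - 2) / 2) * pot f (a + s *\<^sub>R x)" for x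
  proof -
    have nw: "newton (x - y) = s powr (D - 2) * newton ((a + s *\<^sub>R x) - (a + s *\<^sub>R y))" for y
    proof -
      have "(a + s *\<^sub>R x) - (a + s *\<^sub>R y) = s *\<^sub>R (x - y)" by (simp add: algebra_simps)
      then have "newton ((a + s *\<^sub>R x) - (a + s *\<^sub>R y)) = s powr (2 - D) * newton (x - y)"
        using s by (simp add: newton_def D_def powr_mult)
      moreover have "s powr (D - 2) * s powr (2 - D) = 1" using s unfolding powr_add[symmetric] by simp
      ultimately show ?thesis by (simp add: mult.assoc[symmetric])
    qed
    have "pot (sc s a f) x = (\<integral>y. (s powr (D - 2) * s powr ((D + 2) / 2)) * (newton ((a + s *\<^sub>R x) - (a + s *\<^sub>R y)) * f (a + s *\<^sub>R y)) \<partial>lborel)"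
      unfolding pot_def by (subst nw) (simp add: sc_def D_def mult_ac)
    also have "\<dots> = (s powr (D - 2) * s powr ((D + 2) / 2)) * (\<integral>y. newton ((a + s *\<^sub>R x) - (a + s *\<^sub>R y)) * f (a + s *\<^sub>R y) \<partial>lborel)"
      by (rule integral_mult_right_zero)
    also have "(\<integral>y. newton ((a + s *\<^sub>R x) - (a + s *\<^sub>R y)) * f (a + s *\<^sub>R y) \<partial>lborel) = s powr (- D) * pot f (a + s *\<^sub>R x)"
      unfolding pot_def using s integral_affine[of "\<lambda>z. newton ((a + s *\<^sub>R x) - z) * f z" s a] sD
      by (simp add: powr_minus_divide)
    also have "(s powr (D - 2) * s powr ((D + 2) / 2)) * (s powr (- D) * pot f (a + s *\<^sub>R x)) = (s powr (D - 2) * s powr ((D + 2) / 2) * s powr (- D)) * pot f (a + s *\<^sub>R x)"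
      by simp
    also have "s powr (D - 2) * s powr ((D + 2) / 2) * s powr (- D) = s powr ((D - 2) / 2)"
      unfolding powr_add[symmetric] by (simp add: field_simps)
    finally show ?thesis by (simp add: D_def)
  qed
  have e: "sc s a f x * pot (sc s a f) x = s powr D * (f (a + s *\<^sub>R x) * pot f (a + s *\<^sub>R x))" for x
  proof -
    have "s powr ((D + 2) / 2) * s powr ((D - 2) / 2) = s powr D" unfolding powr_add[symmetric] by (simp add: field_simps)
    then show ?thesis unfolding pot sc_def D_def[symmetric] by (simp add: mult_ac)
  qed
  show "hls (sc s a f) (sc s a f) = hls f f"
    unfolding hls_pot(2)[OF d L L] hls_pot(2)[OF d f f] e
    using s sD integral_affine[of "\<lambda>x. f x * pot f x" s a] by simp
qed


lemma powr_mult_le_add: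
  fixes A B :: real
  assumes "0 \<le> A" "0 \<le> B" "0 \<le> \<theta>" "\<theta> \<le> 1"
  shows "A powr \<theta> * B powr (1 - \<theta>) \<le> A + B"
proof -
  have "A powr \<theta> * B powr (1 - \<theta>) \<le> (A + B) powr \<theta> * (A + B) powr (1 - \<theta>)"
    using assms by (intro mult_mono powr_mono2) auto
  also have "\<dots> = A + B" using assms by (simp add: powr_add[symmetric])
  finally show ?thesis .
qed

lemma pot_scale: "pot (\<lambda>x. k * f x) y = k * pot f y"
  unfolding pot_def by (simp add: mult.left_commute)

text \<open>The area of the unit sphere in dimension d + 1, the target of the inverse stereographic
  projection.\<close>

definition sph :: "'a::euclidean_space itself \<Rightarrow> real" where
  "sph _ = (real DIM('a) + 1) * unit_ball_vol (real DIM('a) + 1)"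

lemma sph_pos: "sph TYPE('a::euclidean_space) > 0"
  by (simp add: sph_def add_pos_nonneg)

lemma h2_integral:
  assumes d: "DIM('a::euclidean_space) \<ge> 3"
  shows "integrable lborel (\<lambda>x::'a. h2 x powr real DIM('a))"
    "(\<integral>x. h2 (x::'a) powr real DIM('a) \<partial>lborel) = sph TYPE('a)"
proof -
  have e: "h2 x powr real DIM('a) = (2 / (1 + (norm x)\<^sup>2)) ^ DIM('a)" for x :: 'a
    using powr_realpow[OF h2_pos[of x], of "DIM('a)"] by (simp add: h2_def)
  have I: "(\<integral>\<^sup>+x. ennreal (h2 (x::'a) powr real DIM('a)) \<partial>lborel) = ennreal (sph TYPE('a))"
    unfolding e sph_def by (rule nn_integral_sphere)
  show "integrable lborel (\<lambda>x::'a. h2 x powr real DIM('a))"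
    by (rule integrableI_nonneg) (auto simp: I)
  show "(\<integral>x. h2 (x::'a) powr real DIM('a) \<partial>lborel) = sph TYPE('a)"
    by (subst integral_eq_nn_integral) (use sph_pos[where 'a='a] in \<open>auto simp: I\<close>)
qed

section \<open>The standard bubble\<close>

text \<open>\<open>WW\<close> is the optimizer and \<open>VV\<close> its potential, both up to
  constants. The power \<open>hp\<close> of the former and the power \<open>hq\<close> of the latter
  are both the Jacobian, so the two are extremal for each other in Hoelder's inequality.\<close>

definition WW :: "'a::euclidean_space \<Rightarrow> real" where "WW x = h2 x powr ((real DIM('a) + 2) / 2)"
definition VV :: "'a::euclidean_space \<Rightarrow> real" where "VV x = h2 x powr ((real DIM('a) - 2) / 2)"

lemma VW_measurable [measurable]: "VV \<in> borel_measurable borel" "WW \<in> borel_measurable borel"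
  unfolding VV_def[abs_def] WW_def[abs_def] by measurable
lemma VW_pos [simp]: "VV x > 0" "WW x > 0" "VV x \<ge> 0" "WW x \<ge> 0" "VV x \<noteq> 0" "WW x \<noteq> 0"
  by (auto simp: VV_def WW_def)

lemma h2_powr: "h2 x powr k = 2 powr k * (1 + (norm x)\<^sup>2) powr (- k)"
  unfolding h2_def by (subst powr_divide) (simp_all add: powr_minus_divide add_nonneg_nonneg)

lemma WW_rho:
  assumes d: "DIM('a::euclidean_space) \<ge> 3"
  shows "WW (x::'a) = 2 powr ((real DIM('a) + 2) / 2) / (real DIM('a) * (real DIM('a) - 2)) * rho 1 (x - 0)"
proof -
  define k where "k = real DIM('a) * (real DIM('a) - 2)"
  have k: "k \<noteq> 0" using d by (simp add: k_def)
  have cancel: "A * Z = A / k * (k * Z)" for A Z :: real using k by simp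
  show ?thesis
    unfolding rho_def power_one diff_0_right mult_1_right k_def[symmetric] WW_def h2_powr minus_divide_left
    by (rule cancel)
qed

lemma VV_bub: "bub 1 (x - 0) = 2 powr (- ((real DIM('a) - 2) / 2)) * VV (x::'a::euclidean_space)"
proof -
  have cancel: "Z = (2::real) powr (- k) * (2 powr k * Z)" for k Z by (simp add: powr_minus)
  show ?thesis
    unfolding bub_def power_one diff_0_right VV_def h2_powr minus_divide_left[symmetric] by (rule cancel)
qed

lemma WW_Lhp:
  assumes d: "DIM('a::euclidean_space) \<ge> 3"
  shows "WW \<in> (Lhp :: ('a \<Rightarrow> real) set)"
proof -
  have "(\<lambda>x::'a. rho 1 (x - 0)) \<in> Lhp" using rho_integrable(4)[OF d, of 1 0] by simp
  from Lhp_scale[OF this] show ?thesis unfolding WW_rho[OF d, abs_def] .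
qed

text \<open>\<open>WW\<close> and \<open>VV\<close> are multiples of \<open>rho 1\<close> and
  \<open>bub 1\<close>, so \<open>pot_rho\<close> applies; the 4 collects their powers of 2.\<close>

lemma pot_WW:
  assumes d: "DIM('a::euclidean_space) \<ge> 3"
  shows "pot WW (y::'a) = newt_c TYPE('a) * 4 / (real DIM('a) * (real DIM('a) - 2)) * VV y"
proof -
  define D where "D = real DIM('a)"
  have D: "D \<ge> 3" using d by (simp add: D_def)
  have "2 powr ((D + 2) / 2) * 2 powr (- ((D - 2) / 2)) = (2::real) powr 2"
    unfolding powr_add[symmetric] by (rule arg_cong[of _ _ "(powr) 2"]) (simp add: field_simps)
  then have e: "2 powr ((D + 2) / 2) * 2 powr (- ((D - 2) / 2)) = (4::real)" by simp
  have "pot WW y = 2 powr ((D + 2) / 2) / (D * (D - 2)) * (newt_c TYPE('a) * bub 1 (y - 0))"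
    unfolding WW_rho[OF d, abs_def] pot_scale by (subst pot_rho[OF d]) (simp_all add: D_def)
  also have "\<dots> = 2 powr ((D + 2) / 2) / (D * (D - 2)) * (newt_c TYPE('a) * (2 powr (- ((D - 2) / 2)) * VV y))"
    unfolding VV_bub D_def ..
  also have "\<dots> = newt_c TYPE('a) * (2 powr ((D + 2) / 2) * 2 powr (- ((D - 2) / 2))) / (D * (D - 2)) * VV y"
    by simp
  finally show ?thesis unfolding e unfolding D_def .
qed

lemma VW_powr:
  assumes d: "DIM('a::euclidean_space) \<ge> 3"
  shows "VV (x::'a) powr hq TYPE('a) = h2 x powr real DIM('a)" "WW (x::'a) powr hp TYPE('a) = h2 x powr real DIM('a)"
    "WW x = VV x * (h2 x)\<^sup>2"
proof -
  have "(real DIM('a) - 2) / 2 * hq TYPE('a) = real DIM('a)" "(real DIM('a) + 2) / 2 * hp TYPE('a) = real DIM('a)"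
    using d by (simp_all add: hq_def hp_def field_simps)
  then show "VV (x::'a) powr hq TYPE('a) = h2 x powr real DIM('a)" "WW (x::'a) powr hp TYPE('a) = h2 x powr real DIM('a)"
    by (simp_all add: VV_def WW_def powr_powr)
  have "(h2 x)\<^sup>2 = h2 x powr 2" by simp
  moreover have "(real DIM('a) + 2) / 2 = (real DIM('a) - 2) / 2 + 2" by (simp add: field_simps)
  ultimately show "WW x = VV x * (h2 x)\<^sup>2" unfolding VV_def WW_def by (simp only: powr_add[symmetric])
qed

text \<open>Interpolation: the \<open>hp\<close>-th power is a geometric mean of u^q and h2^d with
  weights (d - 2)/(d + 2) and 4/(d + 2), hence at most their sum.\<close>

lemma mult_h2_Lhp:
  fixes u :: "'a::euclidean_space \<Rightarrow> real"
  assumes d: "DIM('a) \<ge> 3" and [measurable]: "u \<in> borel_measurable borel" and u0: "\<And>x. 0 \<le> u x"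
    and I: "integrable lborel (\<lambda>x. u x powr hq TYPE('a))"
  shows "(\<lambda>x. u x * (h2 x)\<^sup>2) \<in> Lhp"
proof -
  define D where "D = real DIM('a)"
  define p q where "p = hp TYPE('a)" and "q = hq TYPE('a)"
  define \<theta> where "\<theta> = (D - 2) / (D + 2)"
  have D: "D \<ge> 3" using d by (simp add: D_def)
  have \<theta>': "1 - \<theta> = 4 / (D + 2)" using D by (simp add: \<theta>_def field_simps)
  have e: "q * \<theta> = p" "D * (1 - \<theta>) = 2 * p" "0 \<le> \<theta>" "\<theta> \<le> 1"
    using D unfolding \<theta>' unfolding p_def q_def \<theta>_def hp_def hq_def D_def[symmetric] by simp_all
  have E: "\<bar>u x * (h2 x)\<^sup>2\<bar> powr p = (u x powr q) powr \<theta> * (h2 x powr D) powr (1 - \<theta>)" for x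
  proof -
    have "\<bar>u x * (h2 x)\<^sup>2\<bar> powr p = u x powr p * ((h2 x)\<^sup>2) powr p" using u0[of x] by (simp add: powr_mult)
    also have "((h2 x)\<^sup>2) powr p = h2 x powr (2 * p)"
      using powr_powr[of "h2 x" 2 p] by simp
    finally show ?thesis unfolding powr_powr e .
  qed
  have le: "\<bar>u x * (h2 x)\<^sup>2\<bar> powr p \<le> u x powr q + h2 x powr D" for x
    unfolding E by (rule powr_mult_le_add) (use e in auto)
  have S: "integrable lborel (\<lambda>x. u x powr q + h2 x powr D)"
    unfolding q_def D_def by (intro Bochner_Integration.integrable_add I h2_integral(1)[OF d])
  have "integrable lborel (\<lambda>x. \<bar>u x * (h2 x)\<^sup>2\<bar> powr p)"
    by (rule Bochner_Integration.integrable_bound[OF S _ AE_norm_mono(1)[OF _ le]]) simp_all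
  then show ?thesis by (simp add: Lhp_def p_def)
qed

text \<open>This is the image of f under the conformally weighted operator. Since its energy pairing
  with f is the weighted integral of the squared potential, Cauchy-Schwarz can relate the second
  variation to the spectrum.\<close>

lemma pot_h2_integrable:
  fixes f :: "'a::euclidean_space \<Rightarrow> real"
  assumes d: "DIM('a) \<ge> 3" and f: "f \<in> Lhp" and f0: "\<And>x. 0 \<le> f x"
  shows "(\<lambda>x. pot f x * (h2 x)\<^sup>2) \<in> Lhp" "integrable lborel (\<lambda>x. (pot f x)\<^sup>2 * (h2 x)\<^sup>2)"
    "hls (\<lambda>x. pot f x * (h2 x)\<^sup>2) f = (\<integral>x. (pot f x)\<^sup>2 * (h2 x)\<^sup>2 \<partial>lborel)"
proof -
  have [measurable]: "f \<in> borel_measurable borel" using f by (rule LhpD)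
  show L: "(\<lambda>x. pot f x * (h2 x)\<^sup>2) \<in> Lhp"
    by (rule mult_h2_Lhp[OF d _ pot_nonneg[OF f0] pot_Lhq(1)[OF d f f0]]) measurable
  have e: "pot f x * (h2 x)\<^sup>2 * pot f x = (pot f x)\<^sup>2 * (h2 x)\<^sup>2" for x by (simp add: power2_eq_square)
  show "integrable lborel (\<lambda>x. (pot f x)\<^sup>2 * (h2 x)\<^sup>2)" 
    using hls_pot(1)[OF d L f] unfolding e .
  show "hls (\<lambda>x. pot f x * (h2 x)\<^sup>2) f = (\<integral>x. (pot f x)\<^sup>2 * (h2 x)\<^sup>2 \<partial>lborel)"
    using hls_pot(2)[OF d L f] unfolding e .
qed


lemma integrable_mult_bounded:
  fixes g k :: "'a::euclidean_space \<Rightarrow> real"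
  assumes g: "integrable lborel g" and k [measurable]: "k \<in> borel_measurable borel" and k1: "\<And>x. \<bar>k x\<bar> \<le> 1"
  shows "integrable lborel (\<lambda>x. g x * k x)"
proof -
  have [measurable]: "g \<in> borel_measurable borel" using borel_measurable_integrable[OF g] by simp
  have "norm (g x * k x) \<le> norm (g x)" for x
    using mult_left_mono[OF k1[of x], of "\<bar>g x\<bar>"] by (simp add: abs_mult)
  then show ?thesis by (intro Bochner_Integration.integrable_bound[OF g] AE_I2) simp_all
qed

lemma pot_grad2_integrable:
  fixes f :: "'a::euclidean_space \<Rightarrow> real"
  assumes d: "DIM('a) \<ge> 3" and f: "f \<in> Lhp" and f0: "\<And>x. 0 \<le> f x"
    and ae: "(\<alpha>, e) = (1, 0) \<or> (\<alpha> = 0 \<and> e \<in> Basis)"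
  shows "integrable lborel (\<lambda>x. (pot f x)\<^sup>2 * grad2 (om1 \<alpha> e) x)"
proof -
  have ae2: "\<alpha>\<^sup>2 + (norm e)\<^sup>2 = 1" using ae by auto
  have [measurable]: "f \<in> borel_measurable borel" using f by (rule LhpD)
  have S: "integrable lborel (\<lambda>x. real DIM('a) * ((pot f x)\<^sup>2 * (h2 x)\<^sup>2))"
    using pot_h2_integrable(2)[OF d f f0] by simp
  obtain m2 where "multiplier (\<lambda>x. 1 + 1 * om \<alpha> e x) (\<lambda>i x. 1 * om1 \<alpha> e i x) m2"
    using multiplier_om[OF ae2, of 1] by auto
  from multiplierD(5)[OF this] have [measurable]: "grad2 (om1 \<alpha> e) \<in> borel_measurable borel"
    by (simp add: grad2_def[abs_def])
  have le: "(pot f x)\<^sup>2 * grad2 (om1 \<alpha> e) x \<le> real DIM('a) * ((pot f x)\<^sup>2 * (h2 x)\<^sup>2)" for x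
    using mult_left_mono[OF grad2_om_le[OF ae, of x], of "(pot f x)\<^sup>2"] by (simp add: mult_ac)
  show ?thesis
    by (rule Bochner_Integration.integrable_bound[OF S _ AE_norm_mono(1)[OF _ le]]) simp_all
qed

section \<open>Testing with the coordinates of the sphere\<close>

text \<open>The localized Sobolev inequality is taken at 1 + \<eta> \<omega> for \<eta> = \<epsilon>
  and \<eta> = -\<epsilon>. On the left the linear term vanishes by the centering. On the right its
  coefficient \<open>B\<close> has no reason to vanish, since f satisfies no Euler-Lagrange
  equation; averaging the two signs removes it.\<close>

lemma variation_inequality:
  fixes f :: "'a::euclidean_space \<Rightarrow> real" and e :: 'a
  assumes d: "DIM('a) \<ge> 3" and f: "f \<in> Lhp" and f0: "\<And>x. 0 \<le> f x" and Q: "hls f f = 1"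
    and ae: "(\<alpha>, e) = (1, 0) \<or> (\<alpha> = 0 \<and> e \<in> Basis)"
    and N: "(\<integral>x. pot f x powr hq TYPE('a) \<partial>lborel) > 0"
    and cent: "(\<integral>x. pot f x powr hq TYPE('a) * om \<alpha> e x \<partial>lborel) = 0"
    and \<epsilon>: "0 < \<epsilon>" "\<epsilon> \<le> 1 / 10"
  shows "(\<integral>x. pot f x powr hq TYPE('a) \<partial>lborel) powr (2 / hq TYPE('a)) *
     (1 + \<epsilon>\<^sup>2 * ((hq TYPE('a) - 1) * (\<integral>x. pot f x powr hq TYPE('a) * (om \<alpha> e x)\<^sup>2 \<partial>lborel) / (\<integral>x. pot f x powr hq TYPE('a) \<partial>lborel)) - 200 * \<epsilon> ^ 3)
    \<le> hls_M TYPE('a) * (1 + \<epsilon>\<^sup>2 * ((\<integral>x. f x * (om \<alpha> e x)\<^sup>2 * pot f x \<partial>lborel)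
        + (\<integral>x. (pot f x)\<^sup>2 * grad2 (om1 \<alpha> e) x \<partial>lborel) / newt_c TYPE('a)))"
proof -
  define q where "q = hq TYPE('a)"
  define c where "c = newt_c TYPE('a)"
  define M where "M = hls_M TYPE('a)"
  define u where "u = pot f"
  define w where "w = om \<alpha> e"
  define N where "N = (\<integral>x. u x powr q \<partial>lborel)"
  define T where "T = (\<integral>x. u x powr q * (w x)\<^sup>2 \<partial>lborel)"
  define B C E where "B = (\<integral>x. f x * w x * u x \<partial>lborel)" and "C = (\<integral>x. f x * (w x)\<^sup>2 * u x \<partial>lborel)"
    and "E = (\<integral>x. (u x)\<^sup>2 * grad2 (om1 \<alpha> e) x \<partial>lborel)"
  note pq = hp_hq[OF d, folded q_def]
  have q: "2 < q" "q \<le> 6" using pq by auto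
  have c: "c > 0" unfolding c_def by (rule newt_c_pos[OF d])
  have Npos: "N > 0" using N by (simp add: N_def u_def q_def)
  have ae2: "\<alpha>\<^sup>2 + (norm e)\<^sup>2 = 1" using ae by auto
  have w1: "\<bar>w x\<bar> \<le> 1" for x unfolding w_def by (rule om_abs_le[OF ae2])
  have w2: "(w x)\<^sup>2 \<le> 1" for x using w1[of x] by (simp add: abs_square_le_1)
  have w3: "\<bar>w x\<bar> ^ 3 \<le> 1" for x by (rule power_le_one) (use w1[of x] in auto)
  have [measurable]: "f \<in> borel_measurable borel" using f by (rule LhpD)
  have [measurable]: "u \<in> borel_measurable borel" "w \<in> borel_measurable borel" unfolding u_def w_def by measurable
  have u0: "u x \<ge> 0" for x unfolding u_def by (rule pot_nonneg[OF f0])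
  have uI: "integrable lborel (\<lambda>x. u x powr q)" unfolding u_def q_def by (rule pot_Lhq(1)[OF d f f0])
  have fuI: "integrable lborel (\<lambda>x. f x * u x)" and fu1: "(\<integral>x. f x * u x \<partial>lborel) = 1"
    using hls_pot[OF d f f] Q by (simp_all add: u_def)
  note dom = integrable_mult_bounded
  have uwI: "integrable lborel (\<lambda>x. u x powr q * w x)" "integrable lborel (\<lambda>x. u x powr q * (w x)\<^sup>2)"
    by (rule dom[OF uI]; use w1 w2 in simp)+
  have fuwI: "integrable lborel (\<lambda>x. f x * w x * u x)" "integrable lborel (\<lambda>x. f x * (w x)\<^sup>2 * u x)"
  proof -
    have "integrable lborel (\<lambda>x. f x * u x * w x)" "integrable lborel (\<lambda>x. f x * u x * (w x)\<^sup>2)"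
      by (rule dom[OF fuI]; use w1 w2 in simp)+
    then show "integrable lborel (\<lambda>x. f x * w x * u x)" "integrable lborel (\<lambda>x. f x * (w x)\<^sup>2 * u x)"
      by (simp_all add: mult_ac)
  qed
  have T: "0 \<le> T" "T \<le> N"
    unfolding T_def N_def
    by (auto intro!: integral_nonneg_AE) (rule integral_mono[OF uwI(2) uI], use w2 in \<open>auto intro: mult_left_le\<close>)
  have cent0: "(\<integral>x. u x powr q * w x \<partial>lborel) = 0" using cent by (simp add: u_def w_def q_def)
  have EI0: "integrable lborel (\<lambda>x. (u x)\<^sup>2 * grad2 (om1 \<alpha> e) x)"
    unfolding u_def by (rule pot_grad2_integrable[OF d f f0 ae])
  have dir: "N powr (2 / q) * (1 + \<epsilon>\<^sup>2 * ((q - 1) * T / N) - 200 * \<epsilon> ^ 3) \<le> M * (1 + 2 * \<eta> * B + \<epsilon>\<^sup>2 * (C + E / c))"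
    if \<eta>: "\<bar>\<eta>\<bar> = \<epsilon>" for \<eta>
  proof -
    have \<eta>1: "\<bar>\<eta>\<bar> \<le> 1" "\<bar>\<eta>\<bar> \<le> 1 / 10" using \<eta> \<epsilon> by auto
    have \<eta>2: "\<eta>\<^sup>2 = \<epsilon>\<^sup>2" using \<eta> by (metis power2_abs)
    obtain m2 where m: "multiplier (\<lambda>x. 1 + \<eta> * w x) (\<lambda>i x. \<eta> * om1 \<alpha> e i x) m2"
      using multiplier_om[OF ae2 \<eta>1(1)] unfolding w_def by auto
    have g2: "grad2 (\<lambda>i x. \<eta> * om1 \<alpha> e i x) x = \<epsilon>\<^sup>2 * grad2 (om1 \<alpha> e) x" for x
      unfolding grad2_def by (simp add: power_mult_distrib \<eta>2 sum_distrib_left)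
    have ge: "(u x)\<^sup>2 * grad2 (\<lambda>i x. \<eta> * om1 \<alpha> e i x) x = \<epsilon>\<^sup>2 * ((u x)\<^sup>2 * grad2 (om1 \<alpha> e) x)" for x
      unfolding g2 by simp
    have J: "integrable lborel (\<lambda>x. (pot f x)\<^sup>2 * grad2 (\<lambda>i x. \<eta> * om1 \<alpha> e i x) x)"
      unfolding u_def[symmetric] ge using EI0 by simp
    note L = localized_Sobolev[OF d m f f0 J, folded u_def c_def M_def q_def]
    have fe: "f x * (1 + \<eta> * w x)\<^sup>2 * u x = f x * u x + 2 * \<eta> * (f x * w x * u x) + \<epsilon>\<^sup>2 * (f x * (w x)\<^sup>2 * u x)" for x
      unfolding \<eta>2[symmetric] by (simp add: power2_eq_square algebra_simps)
    have up1: "(\<integral>x. f x * (1 + \<eta> * w x)\<^sup>2 * u x \<partial>lborel) = 1 + 2 * \<eta> * B + \<epsilon>\<^sup>2 * C"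
      unfolding fe B_def C_def using fuI fuwI fu1 by simp
    have up2: "(\<integral>x. (u x)\<^sup>2 * grad2 (\<lambda>i x. \<eta> * om1 \<alpha> e i x) x \<partial>lborel) = \<epsilon>\<^sup>2 * E"
      unfolding ge E_def by simp
    define Z where "Z = (\<integral>x. ((1 + \<eta> * w x) * u x) powr q \<partial>lborel)"
    have "c * Z powr (2 / q) \<le> M * (c * (1 + 2 * \<eta> * B + \<epsilon>\<^sup>2 * C) + \<epsilon>\<^sup>2 * E)"
      using L(2) unfolding up1 up2 Z_def .
    also have "\<dots> = c * (M * (1 + 2 * \<eta> * B + \<epsilon>\<^sup>2 * (C + E / c)))" using c by (simp add: field_simps)
    finally have upper: "Z powr (2 / q) \<le> M * (1 + 2 * \<eta> * B + \<epsilon>\<^sup>2 * (C + E / c))" using c by simp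
    \<comment> \<open>The relative gain in the integral of the q-th power that the Taylor bound
      guarantees; the root of order q/2 is expanded afterwards by
      \<open>one_plus_powr_lower\<close>.\<close>
    define z where "z = q * (q - 1) / 2 * \<epsilon>\<^sup>2 * (T / N) - 80 * \<epsilon> ^ 3"
    have "u x powr q + (q * \<eta>) * (u x powr q * w x) + (q * (q - 1) / 2 * \<epsilon>\<^sup>2) * (u x powr q * (w x)\<^sup>2) - (80 * \<epsilon> ^ 3) * u x powr q
        \<le> ((1 + \<eta> * w x) * u x) powr q" for x
    proof -
      have a: "\<bar>\<eta> * w x\<bar> \<le> \<epsilon>" using w1[of x] \<eta> \<epsilon> by (simp add: abs_mult mult_left_le)
      have a3: "\<bar>\<eta> * w x\<bar> ^ 3 \<le> \<epsilon> ^ 3" by (rule power_mono[OF a]) simp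
      have "1 + q * (\<eta> * w x) + q * (q - 1) / 2 * (\<eta> * w x)\<^sup>2 - 80 * \<epsilon> ^ 3 \<le> (1 + \<eta> * w x) powr q"
        using powr_taylor_lower[OF q, of "\<eta> * w x"] a a3 \<epsilon> by linarith
      from mult_right_mono[OF this, of "u x powr q"]
      have "(1 + q * (\<eta> * w x) + q * (q - 1) / 2 * (\<eta> * w x)\<^sup>2 - 80 * \<epsilon> ^ 3) * u x powr q \<le> ((1 + \<eta> * w x) * u x) powr q"
        using u0[of x] a \<epsilon> by (simp add: powr_mult)
      then show ?thesis unfolding power_mult_distrib \<eta>2 by (simp add: algebra_simps)
    qed
    moreover have "integrable lborel (\<lambda>x. u x powr q + (q * \<eta>) * (u x powr q * w x) + (q * (q - 1) / 2 * \<epsilon>\<^sup>2) * (u x powr q * (w x)\<^sup>2) - (80 * \<epsilon> ^ 3) * u x powr q)"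
      using uI uwI by simp
    ultimately have "(\<integral>x. u x powr q + (q * \<eta>) * (u x powr q * w x) + (q * (q - 1) / 2 * \<epsilon>\<^sup>2) * (u x powr q * (w x)\<^sup>2) - (80 * \<epsilon> ^ 3) * u x powr q \<partial>lborel) \<le> Z"
      unfolding Z_def by (intro integral_mono L(1)) auto
    also have "(\<integral>x. u x powr q + (q * \<eta>) * (u x powr q * w x) + (q * (q - 1) / 2 * \<epsilon>\<^sup>2) * (u x powr q * (w x)\<^sup>2) - (80 * \<epsilon> ^ 3) * u x powr q \<partial>lborel)
      = N + (q * \<eta>) * (\<integral>x. u x powr q * w x \<partial>lborel) + (q * (q - 1) / 2 * \<epsilon>\<^sup>2) * T - (80 * \<epsilon> ^ 3) * N"
      unfolding N_def T_def using uI uwI by simp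
    also have "\<dots> = N * (1 + z)" unfolding cent0 z_def using Npos by (simp add: field_simps)
    finally have NZ: "N * (1 + z) \<le> Z" .
    have tn: "0 \<le> T / N" "T / N \<le> 1" using T Npos by simp_all
    have qq: "0 \<le> q * (q - 1) / 2" "q * (q - 1) / 2 \<le> 15"
      using mult_mono[of q 6 "q - 1" 5] q by auto
    have z1: "0 \<le> q * (q - 1) / 2 * \<epsilon>\<^sup>2 * (T / N)" "q * (q - 1) / 2 * \<epsilon>\<^sup>2 * (T / N) \<le> 15 * \<epsilon>\<^sup>2 * 1"
      subgoal using qq(1) tn(1) by (intro mult_nonneg_nonneg) auto
      subgoal using qq tn by (intro mult_mono) auto
      done
    have e3: "0 \<le> \<epsilon> ^ 3" "10 * \<epsilon> ^ 3 \<le> \<epsilon>\<^sup>2" "\<epsilon>\<^sup>2 \<le> 1 / 100" "10 * (\<epsilon>\<^sup>2)\<^sup>2 \<le> \<epsilon> ^ 3"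
    proof -
      show "0 \<le> \<epsilon> ^ 3" using \<epsilon> by simp
      have "\<epsilon> ^ 3 = \<epsilon> * \<epsilon>\<^sup>2" "(\<epsilon>\<^sup>2)\<^sup>2 = \<epsilon> * \<epsilon> ^ 3" by (simp_all add: power2_eq_square power3_eq_cube)
      moreover have "\<epsilon> * \<epsilon>\<^sup>2 \<le> 1 / 10 * \<epsilon>\<^sup>2" "\<epsilon> * \<epsilon> ^ 3 \<le> 1 / 10 * \<epsilon> ^ 3" using \<epsilon> by (auto intro!: mult_right_mono)
      ultimately show "10 * \<epsilon> ^ 3 \<le> \<epsilon>\<^sup>2" "10 * (\<epsilon>\<^sup>2)\<^sup>2 \<le> \<epsilon> ^ 3" by linarith+
      show "\<epsilon>\<^sup>2 \<le> 1 / 100" using power_mono[of \<epsilon> "1/10" 2] \<epsilon> by (simp add: power2_eq_square)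
    qed
    have z2: "\<bar>z\<bar> \<le> 15 * \<epsilon>\<^sup>2" unfolding z_def using z1 e3 by linarith
    have z3: "z\<^sup>2 \<le> 225 * (\<epsilon>\<^sup>2)\<^sup>2" using power_mono[OF z2, of 2] by (simp add: power_mult_distrib)
    have r: "0 \<le> 2 / q" "2 / q \<le> 1" using q by auto
    have "1 + 2 / q * z - 2 * z\<^sup>2 \<le> (1 + z) powr (2 / q)"
      by (rule one_plus_powr_lower[OF r]) (use z2 e3 in linarith)
    moreover have "2 / q * z = \<epsilon>\<^sup>2 * ((q - 1) * T / N) - 2 / q * (80 * \<epsilon> ^ 3)"
      unfolding z_def using q Npos by (simp add: field_simps)
    moreover have "2 / q * (80 * \<epsilon> ^ 3) \<le> 1 * (80 * \<epsilon> ^ 3)" using r e3 by (intro mult_right_mono) auto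
    \<comment> \<open>The cubic errors are at most 80 \<epsilon>^3 from the Taylor remainder and,
      through 2 z^2 \<le> 450 \<epsilon>^4, another 45 \<epsilon>^3; 200 leaves room.\<close>
    ultimately have "1 + \<epsilon>\<^sup>2 * ((q - 1) * T / N) - 200 * \<epsilon> ^ 3 \<le> (1 + z) powr (2 / q)"
      using z3 e3 by linarith
    then have "N powr (2 / q) * (1 + \<epsilon>\<^sup>2 * ((q - 1) * T / N) - 200 * \<epsilon> ^ 3) \<le> N powr (2 / q) * (1 + z) powr (2 / q)"
      by (intro mult_left_mono) auto
    also have "\<dots> = (N * (1 + z)) powr (2 / q)" using Npos z2 e3 by (simp add: powr_mult)
    also have "\<dots> \<le> Z powr (2 / q)" using NZ Npos z2 e3 r by (intro powr_mono2) auto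
    also note upper
    finally show ?thesis .
  qed
  have "N powr (2 / q) * (1 + \<epsilon>\<^sup>2 * ((q - 1) * T / N) - 200 * \<epsilon> ^ 3) \<le> M * (1 + \<epsilon>\<^sup>2 * (C + E / c))"
  proof -
    have "M * (1 + 2 * \<epsilon> * B + \<epsilon>\<^sup>2 * (C + E / c)) + M * (1 + 2 * (- \<epsilon>) * B + \<epsilon>\<^sup>2 * (C + E / c)) = 2 * (M * (1 + \<epsilon>\<^sup>2 * (C + E / c)))"
      by (simp add: algebra_simps)
    moreover have "\<bar>\<epsilon>\<bar> = \<epsilon>" "\<bar>- \<epsilon>\<bar> = \<epsilon>" using \<epsilon> by auto
    moreover have "x \<le> y" if "x \<le> a" "x \<le> b" "a + b = 2 * y" for x y a b :: real using that by simp
    ultimately show ?thesis using dir[of \<epsilon>] dir[of "- \<epsilon>"] by blast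
  qed
  then show ?thesis unfolding N_def T_def C_def E_def q_def M_def c_def u_def w_def .
qed

text \<open>Summed over the d + 1 coordinates, \<open>om_sum_squares\<close> removes the coordinates
  from the terms \<open>T\<close> and \<open>C\<close>, and \<open>grad2_om_sum\<close> turns the
  gradient terms into d S. Division by \<epsilon>^2 leaves q - 2 = 4 / (d - 2) against (d / c) S,
  turns the cubic error into \<epsilon> and the deficit \<delta> into \<delta> /
  \<epsilon>^2.\<close>

lemma second_variation:
  fixes f :: "'a::euclidean_space \<Rightarrow> real"
  assumes d: "DIM('a) \<ge> 3" and f: "f \<in> Lhp" and f0: "\<And>x. 0 \<le> f x" and Q: "hls f f = 1"
    and N: "(\<integral>x. pot f x powr hq TYPE('a) \<partial>lborel) > 0"
    and cent: "(\<integral>x. pot f x powr hq TYPE('a) * om 1 0 x \<partial>lborel) = 0"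
      "\<And>b. b \<in> Basis \<Longrightarrow> (\<integral>x. pot f x powr hq TYPE('a) * om 0 b x \<partial>lborel) = 0"
    and M: "hls_M TYPE('a) > 0" and \<delta>: "0 \<le> \<delta>"
    and near: "hls_M TYPE('a) * (1 - \<delta>) \<le> (\<integral>x. pot f x powr hq TYPE('a) \<partial>lborel) powr (2 / hq TYPE('a))"
    and \<epsilon>: "0 < \<epsilon>" "\<epsilon> \<le> 1 / 10"
  shows "1 \<le> real DIM('a) * (real DIM('a) - 2) / (4 * newt_c TYPE('a)) * (\<integral>x. (pot f x)\<^sup>2 * (h2 x)\<^sup>2 \<partial>lborel)
    + 50 * (real DIM('a) - 2) * (real DIM('a) + 7) * (\<epsilon> + \<delta> / \<epsilon>\<^sup>2)"
proof -
  define D where "D = real DIM('a)"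
  define q where "q = hq TYPE('a)"
  define c where "c = newt_c TYPE('a)"
  define M where "M = hls_M TYPE('a)"
  define u where "u = pot f"
  define N where "N = (\<integral>x. u x powr q \<partial>lborel)"
  define S where "S = (\<integral>x. (u x)\<^sup>2 * (h2 x)\<^sup>2 \<partial>lborel)"
  define T where "T \<alpha> e = (\<integral>x. u x powr q * (om \<alpha> e x)\<^sup>2 \<partial>lborel)" for \<alpha> and e :: 'a
  define C where "C \<alpha> e = (\<integral>x. f x * (om \<alpha> e x)\<^sup>2 * u x \<partial>lborel)" for \<alpha> and e :: 'a
  define E where "E \<alpha> e = (\<integral>x. (u x)\<^sup>2 * grad2 (om1 \<alpha> e) x \<partial>lborel)" for \<alpha> and e :: 'a
  have D: "D \<ge> 3" using d by (simp add: D_def)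
  have c: "c > 0" unfolding c_def by (rule newt_c_pos[OF d])
  have Mpos: "M > 0" using M by (simp add: M_def)
  have Npos: "N > 0" using N by (simp add: N_def u_def q_def)
  note pq = hp_hq[OF d, folded q_def]
  have uI: "integrable lborel (\<lambda>x. u x powr q)" unfolding u_def q_def by (rule pot_Lhq(1)[OF d f f0])
  have fuI: "integrable lborel (\<lambda>x. f x * u x)" and fu1: "(\<integral>x. f x * u x \<partial>lborel) = 1"
    using hls_pot[OF d f f] Q by (simp_all add: u_def)
  have I: "integrable lborel (\<lambda>x. u x powr q * (om \<alpha> e x)\<^sup>2)" "integrable lborel (\<lambda>x. f x * (om \<alpha> e x)\<^sup>2 * u x)"
    "integrable lborel (\<lambda>x. (u x)\<^sup>2 * grad2 (om1 \<alpha> e) x)"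
    if ae: "(\<alpha>, e) = (1, 0) \<or> (\<alpha> = 0 \<and> e \<in> Basis)" for \<alpha> and e :: 'a
  proof -
    have w2: "\<bar>(om \<alpha> e x)\<^sup>2\<bar> \<le> 1" for x using om_abs_le[of \<alpha> e x] ae by (auto simp: abs_square_le_1)
    show "integrable lborel (\<lambda>x. u x powr q * (om \<alpha> e x)\<^sup>2)"
      by (rule integrable_mult_bounded[OF uI _ w2]) measurable
    have "integrable lborel (\<lambda>x. f x * u x * (om \<alpha> e x)\<^sup>2)"
      by (rule integrable_mult_bounded[OF fuI _ w2]) measurable
    then show "integrable lborel (\<lambda>x. f x * (om \<alpha> e x)\<^sup>2 * u x)" by (simp add: mult_ac)
    show "integrable lborel (\<lambda>x. (u x)\<^sup>2 * grad2 (om1 \<alpha> e) x)"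
      unfolding u_def by (rule pot_grad2_integrable[OF d f f0 ae])
  qed
  have sum: "(\<integral>x. g 1 0 x \<partial>lborel) + (\<Sum>b\<in>Basis. (\<integral>x. g 0 b x \<partial>lborel)) = (\<integral>x. g 1 0 x + (\<Sum>b\<in>Basis. g 0 b x) \<partial>lborel)"
    if "\<And>\<alpha> e. (\<alpha>, e) = (1, 0) \<or> (\<alpha> = 0 \<and> e \<in> Basis) \<Longrightarrow> integrable lborel (g \<alpha> e)" for g :: "real \<Rightarrow> 'a \<Rightarrow> 'a \<Rightarrow> real"
    using that[of 1 0] that[of 0] by (subst Bochner_Integration.integral_add) (auto simp: Bochner_Integration.integral_sum)
  have sT: "T 1 0 + (\<Sum>b\<in>Basis. T 0 b) = N"
  proof -
    have "u x powr q * (om 1 0 x)\<^sup>2 + (\<Sum>b\<in>Basis. u x powr q * (om 0 b x)\<^sup>2) = u x powr q" for x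
      unfolding sum_distrib_left[symmetric] distrib_left[symmetric] om_sum_squares by simp
    then show ?thesis unfolding T_def N_def using sum[of "\<lambda>\<alpha> e x. u x powr q * (om \<alpha> e x)\<^sup>2", OF I(1)] by simp
  qed
  have sC: "C 1 0 + (\<Sum>b\<in>Basis. C 0 b) = 1"
  proof -
    have "f x * (om 1 0 x)\<^sup>2 * u x + (\<Sum>b\<in>Basis. f x * (om 0 b x)\<^sup>2 * u x) = f x * ((om 1 0 x)\<^sup>2 + (\<Sum>b\<in>Basis. (om 0 b x)\<^sup>2)) * u x" for x
      by (simp add: distrib_left distrib_right sum_distrib_left sum_distrib_right)
    then show ?thesis unfolding C_def using sum[of "\<lambda>\<alpha> e x. f x * (om \<alpha> e x)\<^sup>2 * u x", OF I(2)] fu1 by (simp add: om_sum_squares)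
  qed
  have sE: "E 1 0 + (\<Sum>b\<in>Basis. E 0 b) = D * S"
  proof -
    have "(u x)\<^sup>2 * grad2 (om1 1 0) x + (\<Sum>b\<in>Basis. (u x)\<^sup>2 * grad2 (om1 0 b) x) = D * ((u x)\<^sup>2 * (h2 x)\<^sup>2)" for x
      unfolding sum_distrib_left[symmetric] distrib_left[symmetric] grad2_om_sum D_def by simp
    then show ?thesis unfolding E_def S_def using sum[of "\<lambda>\<alpha> e x. (u x)\<^sup>2 * grad2 (om1 \<alpha> e) x", OF I(3)] by simp
  qed
  define L where "L \<alpha> e = N powr (2 / q) * (1 + \<epsilon>\<^sup>2 * ((q - 1) * T \<alpha> e / N) - 200 * \<epsilon> ^ 3)" for \<alpha> e
  define R where "R \<alpha> e = M * (1 + \<epsilon>\<^sup>2 * (C \<alpha> e + E \<alpha> e / c))" for \<alpha> e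
  have LR: "L 1 0 \<le> R 1 0" "b \<in> Basis \<Longrightarrow> L 0 b \<le> R 0 b" for b
    using variation_inequality[OF d f f0 Q _ N _ \<epsilon>, of 1 0] variation_inequality[OF d f f0 Q _ N _ \<epsilon>, of 0 b] cent
    unfolding L_def R_def N_def T_def C_def E_def q_def M_def c_def u_def by auto
  have "L 1 0 + (\<Sum>b\<in>Basis. L 0 b) \<le> R 1 0 + (\<Sum>b\<in>Basis. R 0 b)"
    by (intro add_mono sum_mono LR)
  also have "R 1 0 + (\<Sum>b\<in>Basis. R 0 b) = M * ((D + 1) + \<epsilon>\<^sup>2 * ((C 1 0 + (\<Sum>b\<in>Basis. C 0 b)) + (E 1 0 + (\<Sum>b\<in>Basis. E 0 b)) / c))"
    unfolding R_def sum_distrib_left[symmetric] sum.distrib sum_divide_distrib[symmetric] D_def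
    by (simp add: algebra_simps add_divide_distrib)
  also have "L 1 0 + (\<Sum>b\<in>Basis. L 0 b) = N powr (2 / q) * ((D + 1) + \<epsilon>\<^sup>2 * ((q - 1) * (T 1 0 + (\<Sum>b\<in>Basis. T 0 b)) / N) - (D + 1) * (200 * \<epsilon> ^ 3))"
    unfolding L_def sum_distrib_left[symmetric] sum.distrib sum_subtractf sum_divide_distrib[symmetric] D_def
    by (simp add: algebra_simps add_divide_distrib diff_divide_distrib)
  finally have main: "N powr (2 / q) * ((D + 1) + \<epsilon>\<^sup>2 * (q - 1) - (D + 1) * (200 * \<epsilon> ^ 3)) \<le> M * ((D + 1) + \<epsilon>\<^sup>2 * (1 + D * S / c))"
    unfolding sT sC sE using Npos by simp
  have e3: "\<epsilon> ^ 3 \<le> 1 / 1000" using power_mono[of \<epsilon> "1/10" 3] \<epsilon> by (simp add: power3_eq_cube)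
  have e2: "\<epsilon>\<^sup>2 \<le> 1" using power_mono[of \<epsilon> 1 2] \<epsilon> by simp
  have e2p: "\<epsilon>\<^sup>2 > 0" using \<epsilon> by simp
  define X where "X = (D + 1) + \<epsilon>\<^sup>2 * (q - 1) - (D + 1) * (200 * \<epsilon> ^ 3)"
  \<comment> \<open>\<open>X\<close> has to be nonnegative to be multiplied with the
    near-maximality, and its bound D + 7 controls the term \<delta> X.\<close>
  define P Y where "P = (D + 1) * (200 * \<epsilon> ^ 3)" and "Y = \<epsilon>\<^sup>2 * (q - 1)"
  have "P \<le> (D + 1) * 1" unfolding P_def using e3 D by (intro mult_left_mono) auto
  moreover have "0 \<le> Y" using pq(2) by (simp add: Y_def)
  moreover have "Y \<le> 1 * 5" unfolding Y_def using e2 pq(2,9) by (intro mult_mono) auto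
  moreover have "0 \<le> P" using \<epsilon> D by (simp add: P_def)
  moreover have "X = D + 1 + Y - P" by (simp add: X_def P_def Y_def)
  ultimately have X: "0 \<le> X" "X \<le> D + 7" by simp_all
  have "M * (1 - \<delta>) * X \<le> N powr (2 / q) * X"
    using near X(1) unfolding M_def N_def q_def u_def by (rule mult_right_mono)
  with main have "M * ((1 - \<delta>) * X) \<le> M * ((D + 1) + \<epsilon>\<^sup>2 * (1 + D * S / c))" unfolding X_def by (simp add: mult.assoc)
  then have "(1 - \<delta>) * X \<le> (D + 1) + \<epsilon>\<^sup>2 * (1 + D * S / c)" using Mpos by simp
  moreover have "\<delta> * X \<le> \<delta> * (D + 7)" using X \<delta> by (intro mult_left_mono) auto
  ultimately have "\<epsilon>\<^sup>2 * (q - 2) \<le> \<epsilon>\<^sup>2 * (D * S / c) + (D + 1) * (200 * \<epsilon> ^ 3) + \<delta> * (D + 7)"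
    unfolding X_def by (simp add: algebra_simps)
  also have "\<dots> = \<epsilon>\<^sup>2 * (D * S / c + 200 * (D + 1) * \<epsilon> + (D + 7) * (\<delta> / \<epsilon>\<^sup>2))"
    using \<epsilon> by (simp add: field_simps power2_eq_square power3_eq_cube)
  finally have "q - 2 \<le> D * S / c + 200 * (D + 1) * \<epsilon> + (D + 7) * (\<delta> / \<epsilon>\<^sup>2)"
    using e2p by (simp only: mult_le_cancel_left_pos)
  moreover have "q - 2 = 4 / (D - 2)" using pq(8) by (simp add: D_def)
  ultimately have le: "(D - 2) / 4 * (4 / (D - 2)) \<le> (D - 2) / 4 * (D * S / c + 200 * (D + 1) * \<epsilon> + (D + 7) * (\<delta> / \<epsilon>\<^sup>2))"
    using D by (intro mult_left_mono) auto
  have one: "(D - 2) / 4 * (4 / (D - 2)) = 1" using D by simp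
  have eq: "(D - 2) / 4 * (D * S / c + 200 * (D + 1) * \<epsilon> + (D + 7) * t)
      = D * (D - 2) / (4 * c) * S + (50 * (D - 2) * (D + 1) * \<epsilon> + (D - 2) * (D + 7) / 4 * t)" for t
    using c by (simp add: field_simps)
  have "1 \<le> D * (D - 2) / (4 * c) * S + (50 * (D - 2) * (D + 1) * \<epsilon> + (D - 2) * (D + 7) / 4 * (\<delta> / \<epsilon>\<^sup>2))"
    using le unfolding one eq .
  also have "50 * (D - 2) * (D + 1) * \<epsilon> \<le> 50 * (D - 2) * (D + 7) * \<epsilon>" using D \<epsilon> by (intro mult_mono) auto
  also have "(D - 2) * (D + 7) / 4 * (\<delta> / \<epsilon>\<^sup>2) \<le> 50 * (D - 2) * (D + 7) * (\<delta> / \<epsilon>\<^sup>2)"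
  proof (intro mult_right_mono)
    have "0 \<le> (D - 2) * (D + 7)" using D by simp
    then show "(D - 2) * (D + 7) / 4 \<le> 50 * (D - 2) * (D + 7)" by linarith
  qed (use \<delta> in auto)
  finally have "1 \<le> D * (D - 2) / (4 * c) * S + 50 * (D - 2) * (D + 7) * (\<epsilon> + \<delta> / \<epsilon>\<^sup>2)"
    by (simp only: distrib_left) 
  then show ?thesis unfolding D_def c_def S_def u_def .
qed

section \<open>The spectral gap\<close>


lemma integrable_pair_mult:
  fixes f g :: "'a::euclidean_space \<Rightarrow> real"
  assumes f: "integrable lborel f" and g: "integrable lborel g"
  shows "integrable (lborel \<Otimes>\<^sub>M lborel) (\<lambda>z. f (fst z) * g (snd z))"
    "(\<integral>z. f (fst z) * g (snd z) \<partial>(lborel \<Otimes>\<^sub>M lborel)) = (\<integral>x. f x \<partial>lborel) * (\<integral>x. g x \<partial>lborel)"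
proof -
  have [measurable]: "f \<in> borel_measurable borel" "g \<in> borel_measurable borel"
    using borel_measurable_integrable[OF f] borel_measurable_integrable[OF g] by simp_all
  show I: "integrable (lborel \<Otimes>\<^sub>M lborel) (\<lambda>z. f (fst z) * g (snd z))"
    by (rule lborel_pair.Fubini_integrable) (use f g in \<open>auto simp: abs_mult\<close>)
  show "(\<integral>z. f (fst z) * g (snd z) \<partial>(lborel \<Otimes>\<^sub>M lborel)) = (\<integral>x. f x \<partial>lborel) * (\<integral>x. g x \<partial>lborel)"
    using lborel_pair.integral_fst'[OF I] by simp
qed

text \<open>Two points of the unit sphere are at distance at most 2, and in stereographic
  coordinates this distance is |x - y| times the square root of h2 x times h2 y.\<close>

lemma newton_lower:
  fixes x y :: "'a::euclidean_space"
  assumes d: "DIM('a) \<ge> 3" and ne: "x \<noteq> y"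
  shows "2 powr (2 - real DIM('a)) * (VV x * VV y) \<le> newton (x - y)"
proof -
  define D where "D = real DIM('a)"
  define n where "n = norm (x - y)"
  have D: "D \<ge> 3" using d by (simp add: D_def)
  have n: "n > 0" using ne by (simp add: n_def)
  have "n\<^sup>2 \<le> (norm x + norm y)\<^sup>2" unfolding n_def by (intro power_mono norm_triangle_ineq4) auto
  also have "\<dots> \<le> (1 + (norm x)\<^sup>2) * (1 + (norm y)\<^sup>2)"
    using zero_le_power2[of "1 - norm x * norm y"] by (simp add: power2_eq_square algebra_simps)
  finally have "n\<^sup>2 * (h2 x * h2 y) \<le> (1 + (norm x)\<^sup>2) * (1 + (norm y)\<^sup>2) * (h2 x * h2 y)"
    by (intro mult_right_mono) auto
  also have "(1 + (norm x)\<^sup>2) * (1 + (norm y)\<^sup>2) * (h2 x * h2 y) = (h2 x + (norm x)\<^sup>2 * h2 x) * (h2 y + (norm y)\<^sup>2 * h2 y)"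
    by (simp add: algebra_simps)
  finally have "n\<^sup>2 * (h2 x * h2 y) \<le> 4" unfolding h2_norm by simp
  then have "h2 x * h2 y \<le> 4 / n\<^sup>2" using n by (simp add: field_simps)
  then have "(h2 x * h2 y) powr ((D - 2) / 2) \<le> (4 / n\<^sup>2) powr ((D - 2) / 2)"
    using D by (intro powr_mono2) auto
  also have "4 / n\<^sup>2 = (2 / n) powr 2" using n by (simp add: power_divide)
  also have "((2 / n) powr 2) powr ((D - 2) / 2) = (2 / n) powr (D - 2)"
    unfolding powr_powr by (rule arg_cong[of _ _ "(powr) (2 / n)"]) simp
  also have "\<dots> = 2 powr (D - 2) * n powr (2 - D)"
    using n powr_minus[of n "D - 2"] by (simp add: powr_divide field_simps)
  finally have "2 powr (2 - D) * (h2 x * h2 y) powr ((D - 2) / 2) \<le> 2 powr (2 - D) * (2 powr (D - 2) * n powr (2 - D))"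
    by (intro mult_left_mono) auto
  also have "\<dots> = n powr (2 - D)" by (simp add: mult.assoc[symmetric] powr_add[symmetric])
  finally show ?thesis by (simp add: VV_def powr_mult newton_def n_def D_def)
qed

text \<open>With r = u / \<open>VV\<close> the right side is half the double integral of (r x - r
  y)^2 against the Newton kernel with weights \<open>WW\<close>. Replacing the kernel by its lower
  bound from \<open>newton_lower\<close> separates the variables and leaves a variance.\<close>

lemma hls_gap:
  fixes f :: "'a::euclidean_space \<Rightarrow> real"
  assumes d: "DIM('a) \<ge> 3" and f: "f \<in> Lhp" and f0: "\<And>x. 0 \<le> f x"
    and k: "k = newt_c TYPE('a) * 4 / (real DIM('a) * (real DIM('a) - 2))"
    and S: "S = (\<integral>x. (pot f x)\<^sup>2 * (h2 x)\<^sup>2 \<partial>lborel)"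
  shows "2 powr (2 - real DIM('a)) * (sph TYPE('a) * S - (\<integral>x. pot f x * WW x \<partial>lborel)\<^sup>2)
    \<le> k * S - hls (\<lambda>x. pot f x * (h2 x)\<^sup>2) (\<lambda>x. pot f x * (h2 x)\<^sup>2)"
proof -
  define u where "u = pot f"
  define r where "r x = u x / VV x" for x
  define K where "K = 2 powr (2 - real DIM('a))"
  note PP = pot_h2_integrable[OF d f f0]
  have [measurable]: "f \<in> borel_measurable borel" using f by (rule LhpD)
  have [measurable]: "u \<in> borel_measurable borel" unfolding u_def by measurable
  have [measurable]: "r \<in> borel_measurable borel" unfolding r_def[abs_def] by measurable
  have rW: "r x * WW x = u x * (h2 x)\<^sup>2" "(r x)\<^sup>2 * WW x * VV x = (u x)\<^sup>2 * (h2 x)\<^sup>2"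
    "r x * (WW x * VV x) = u x * WW x" "WW x * VV x = h2 x powr real DIM('a)" for x
  proof -
    have "VV x * (h2 x)\<^sup>2 * VV x = (VV x)\<^sup>2 * (h2 x)\<^sup>2" by (simp add: power2_eq_square)
    show "r x * WW x = u x * (h2 x)\<^sup>2" "(r x)\<^sup>2 * WW x * VV x = (u x)\<^sup>2 * (h2 x)\<^sup>2" "r x * (WW x * VV x) = u x * WW x"
      unfolding r_def VW_powr(3)[OF d] by (simp_all add: power2_eq_square)
    have "(real DIM('a) + 2) / 2 + (real DIM('a) - 2) / 2 = real DIM('a)" by (simp add: field_simps)
    then show "WW x * VV x = h2 x powr real DIM('a)" unfolding WW_def VV_def powr_add[symmetric] by simp
  qed
  have potW: "pot WW x = k * VV x" for x :: 'a unfolding k by (rule pot_WW[OF d])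
  have SI: "integrable lborel (\<lambda>x. (u x)\<^sup>2 * (h2 x)\<^sup>2)" using PP(2) by (simp add: u_def)
  \<comment> \<open>The terms of the expanded square (r x - r y)^2: \<open>A1\<close> to
    \<open>A3\<close> with the Newton kernel, \<open>B1\<close> to \<open>B3\<close> with the
    product kernel. In \<open>A1\<close> the inner integral is the potential of \<open>WW\<close>,
    which is k times \<open>VV\<close>.\<close>
  define A1 where "A1 z = (r (fst z))\<^sup>2 * WW (fst z) * newton (fst z - snd z) * WW (snd z)" for z :: "'a \<times> 'a"
  define A2 where "A2 z = WW (fst z) * newton (fst z - snd z) * ((r (snd z))\<^sup>2 * WW (snd z))" for z :: "'a \<times> 'a"
  define A3 where "A3 z = (u (fst z) * (h2 (fst z))\<^sup>2) * newton (fst z - snd z) * (u (snd z) * (h2 (snd z))\<^sup>2)" for z :: "'a \<times> 'a"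
  define B1 where "B1 z = ((u (fst z))\<^sup>2 * (h2 (fst z))\<^sup>2) * h2 (snd z) powr real DIM('a)" for z :: "'a \<times> 'a"
  define B2 where "B2 z = h2 (fst z) powr real DIM('a) * ((u (snd z))\<^sup>2 * (h2 (snd z))\<^sup>2)" for z :: "'a \<times> 'a"
  define B3 where "B3 z = (u (fst z) * WW (fst z)) * (u (snd z) * WW (snd z))" for z :: "'a \<times> 'a"
  have [measurable]: "A1 \<in> borel_measurable (lborel \<Otimes>\<^sub>M lborel)" unfolding A1_def[abs_def] by measurable
  have A1y: "(\<integral>y. A1 (x, y) \<partial>lborel) = k * ((u x)\<^sup>2 * (h2 x)\<^sup>2)" for x
  proof -
    have "(\<integral>y. A1 (x, y) \<partial>lborel) = (\<integral>y. ((r x)\<^sup>2 * WW x) * (newton (x - y) * WW y) \<partial>lborel)"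
      unfolding A1_def by (simp add: mult.assoc)
    also have "\<dots> = (r x)\<^sup>2 * WW x * pot WW x" unfolding pot_def by simp
    also have "\<dots> = k * ((r x)\<^sup>2 * WW x * VV x)" unfolding potW by simp
    finally show ?thesis unfolding rW .
  qed
  have A1n: "norm (A1 z) = A1 z" for z unfolding A1_def by simp
  have A1: "integrable (lborel \<Otimes>\<^sub>M lborel) A1"
  proof (rule lborel_pair.Fubini_integrable)
    show "integrable lborel (\<lambda>x. \<integral>y. norm (A1 (x, y)) \<partial>lborel)" unfolding A1n A1y using SI by simp
    show "AE x in lborel. integrable lborel (\<lambda>y. A1 (x, y))"
      using AE_integrable_newton[OF d WW_Lhp[OF d]]
    proof eventually_elim
      case (elim x)
      then have "integrable lborel (\<lambda>y. ((r x)\<^sup>2 * WW x) * (newton (x - y) * WW y))" by simp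
      then show ?case unfolding A1_def by (simp add: mult.assoc)
    qed
  qed measurable
  have iA1: "(\<integral>z. A1 z \<partial>(lborel \<Otimes>\<^sub>M lborel)) = k * S"
    using lborel_pair.integral_fst'[OF A1] unfolding A1y S u_def[symmetric] by simp
  have sw: "A2 = (\<lambda>(x, y). A1 (y, x))" unfolding A1_def A2_def by (auto simp: fun_eq_iff newton_commute)
  have A2: "integrable (lborel \<Otimes>\<^sub>M lborel) A2" "(\<integral>z. A2 z \<partial>(lborel \<Otimes>\<^sub>M lborel)) = k * S"
    unfolding sw using lborel_pair.integrable_product_swap[OF A1] lborel_pair.integral_product_swap[of A1] iA1 by simp_all
  have A3: "integrable (lborel \<Otimes>\<^sub>M lborel) A3" unfolding A3_def u_def by (rule hls_integrable[OF d PP(1) PP(1)])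
  have iA3: "(\<integral>z. A3 z \<partial>(lborel \<Otimes>\<^sub>M lborel)) = hls (\<lambda>x. u x * (h2 x)\<^sup>2) (\<lambda>x. u x * (h2 x)\<^sup>2)"
    unfolding A3_def hls_def ..
  have uWI: "integrable lborel (\<lambda>x. u x * WW x)"
    using hls_pot(1)[OF d WW_Lhp[OF d] f] by (simp add: u_def mult.commute)
  note h2I = h2_integral[OF d]
  have B1: "integrable (lborel \<Otimes>\<^sub>M lborel) B1" "(\<integral>z. B1 z \<partial>(lborel \<Otimes>\<^sub>M lborel)) = S * sph TYPE('a)"
    unfolding B1_def using integrable_pair_mult[OF SI h2I(1)] h2I(2) by (simp_all add: S u_def)
  have B2: "integrable (lborel \<Otimes>\<^sub>M lborel) B2" "(\<integral>z. B2 z \<partial>(lborel \<Otimes>\<^sub>M lborel)) = S * sph TYPE('a)"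
    unfolding B2_def using integrable_pair_mult[OF h2I(1) SI] h2I(2) by (simp_all add: S u_def)
  have B3: "integrable (lborel \<Otimes>\<^sub>M lborel) B3" "(\<integral>z. B3 z \<partial>(lborel \<Otimes>\<^sub>M lborel)) = (\<integral>x. u x * WW x \<partial>lborel)\<^sup>2"
    unfolding B3_def using integrable_pair_mult[OF uWI uWI] by (simp_all add: power2_eq_square)
  have le: "K * (B1 z + B2 z - 2 * B3 z) \<le> A1 z + A2 z - 2 * A3 z" for z
  proof -
    obtain x y where z: "z = (x, y)" by (cases z)
    define w where "w = (r x - r y)\<^sup>2 * (WW x * WW y)"
    have a: "A1 z + A2 z - 2 * A3 z = w * newton (x - y)"
      unfolding A1_def A2_def A3_def z fst_conv snd_conv rW(1)[symmetric] w_def by (simp add: power2_eq_square algebra_simps)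
    have b: "B1 z + B2 z - 2 * B3 z = w * (VV x * VV y)"
      unfolding B1_def B2_def B3_def z fst_conv snd_conv rW(2-4)[symmetric] w_def by (simp add: power2_eq_square algebra_simps)
    show ?thesis
    proof (cases "x = y")
      case True
      then show ?thesis unfolding a b w_def by simp
    next
      case False
      have "w * (K * (VV x * VV y)) \<le> w * newton (x - y)"
        unfolding K_def by (rule mult_left_mono[OF newton_lower[OF d False]]) (simp add: w_def)
      then show ?thesis unfolding a b by (simp add: mult.left_commute)
    qed
  qed
  have "(\<integral>z. K * (B1 z + B2 z - 2 * B3 z) \<partial>(lborel \<Otimes>\<^sub>M lborel)) \<le> (\<integral>z. A1 z + A2 z - 2 * A3 z \<partial>(lborel \<Otimes>\<^sub>M lborel))"
    by (rule integral_mono[OF _ _ le]) (use A1 A2(1) A3 B1(1) B2(1) B3(1) in auto)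
  then have "K * (2 * (S * sph TYPE('a)) - 2 * (\<integral>x. u x * WW x \<partial>lborel)\<^sup>2)
      \<le> 2 * (k * S) - 2 * hls (\<lambda>x. u x * (h2 x)\<^sup>2) (\<lambda>x. u x * (h2 x)\<^sup>2)"
    using A1 A2 A3 B1 B2 B3 iA1 iA3 by (simp add: mult.commute)
  then show ?thesis unfolding K_def u_def by (simp add: algebra_simps)
qed

text \<open>Put a = S / k. Cauchy-Schwarz bounds the energy in \<open>hls_gap\<close> from below by
  S^2, so the variance is at most a multiple of a - a^2 \<le> 1 - a \<le> R. Hence, if a is close to
  1, almost all of f lies in the direction of the top eigenfunction and its pairing with
  \<open>VV\<close> is nearly extremal.\<close>

lemma almost_sharp:
  fixes f :: "'a::euclidean_space \<Rightarrow> real"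
  assumes d: "DIM('a) \<ge> 3" and f: "f \<in> Lhp" and f0: "\<And>x. 0 \<le> f x" and Q: "hls f f = 1"
    and k: "k = newt_c TYPE('a) * 4 / (real DIM('a) * (real DIM('a) - 2))"
    and R: "1 \<le> 1 / k * (\<integral>x. (pot f x)\<^sup>2 * (h2 x)\<^sup>2 \<partial>lborel) + R"
  shows "1 \<le> k * (\<integral>x. f x * VV x \<partial>lborel)\<^sup>2 / sph TYPE('a) + (1 + k / (2 powr (2 - real DIM('a)) * sph TYPE('a))) * R"
proof -
  define S where "S = (\<integral>x. (pot f x)\<^sup>2 * (h2 x)\<^sup>2 \<partial>lborel)"
  define F where "F = (\<integral>x. f x * VV x \<partial>lborel)"
  define K where "K = 2 powr (2 - real DIM('a))"
  define s where "s = sph TYPE('a)"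
  define a where "a = S / k"
  have [measurable]: "f \<in> borel_measurable borel" using f by (rule LhpD)
  have kp: "k > 0" unfolding k using newt_c_pos[OF d] d by simp
  have sp: "s > 0" unfolding s_def by (rule sph_pos)
  have Kp: "K > 0" by (simp add: K_def)
  note PP = pot_h2_integrable[OF d f f0]
  have "(\<integral>x. pot f x * WW x \<partial>lborel) = hls WW f" using hls_pot(2)[OF d WW_Lhp[OF d] f] by (simp add: mult.commute)
  also have "\<dots> = hls f WW" by (rule hls_commute) simp_all
  also have "\<dots> = k * F"
    unfolding hls_pot(2)[OF d f WW_Lhp[OF d]] pot_WW[OF d] k[symmetric] F_def mult.left_commute[of _ k] by simp
  finally have uW: "(\<integral>x. pot f x * WW x \<partial>lborel) = k * F" .
  have "(hls (\<lambda>x. pot f x * (h2 x)\<^sup>2) f)\<^sup>2 \<le> hls (\<lambda>x. pot f x * (h2 x)\<^sup>2) (\<lambda>x. pot f x * (h2 x)\<^sup>2)"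
    using hls_Cauchy_Schwarz[OF d PP(1) f] Q by simp
  then have "S\<^sup>2 \<le> hls (\<lambda>x. pot f x * (h2 x)\<^sup>2) (\<lambda>x. pot f x * (h2 x)\<^sup>2)" unfolding PP(3) S_def .
  with hls_gap[OF d f f0 k S_def] have "K * (s * S - (k * F)\<^sup>2) \<le> k * S - S\<^sup>2" unfolding K_def s_def uW by simp
  moreover have Sa: "S = k * a" using kp by (simp add: a_def)
  ultimately have "k * (K * (s * a - k * F\<^sup>2)) \<le> k * (k * (a - a\<^sup>2))" by (simp add: power2_eq_square algebra_simps)
  then have "K * (s * a - k * F\<^sup>2) \<le> k * (a - a\<^sup>2)" using kp by simp
  also have "\<dots> \<le> k * (1 - a)" using kp zero_le_power2[of "1 - a"] by (intro mult_left_mono) (auto simp: power2_eq_square algebra_simps)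
  also have "\<dots> \<le> k * R" using R kp unfolding S_def[symmetric] a_def by (intro mult_left_mono) (auto)
  finally have "a \<le> k * F\<^sup>2 / s + k / (K * s) * R" using Kp sp by (simp add: field_simps)
  moreover have "1 \<le> a + R" using R unfolding S_def[symmetric] a_def by simp
  ultimately show ?thesis unfolding F_def K_def s_def by (simp add: algebra_simps)
qed

section \<open>The sharp inequality\<close>


lemma AE_lborel_affine:
  fixes g h :: "'a::euclidean_space \<Rightarrow> real"
  assumes c: "c \<noteq> 0" and [measurable]: "g \<in> borel_measurable borel" "h \<in> borel_measurable borel"
    and A: "AE x in lborel. g (t + c *\<^sub>R x) = h (t + c *\<^sub>R x)"
  shows "AE y in lborel. g y = h y"
  by (subst lborel_affine[OF c, of t]) (use A in \<open>simp add: AE_density AE_distr_iff\<close>)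

text \<open>The centre is found for the probability density u^q / N. The potential is covariant
  under \<open>sc\<close>, so a change of variables expresses the coordinate integrals of the
  rescaled function through the coordinates at (y - a) / s, which are multiples of the integrands in
  \<open>conformal_centering\<close>.\<close>

lemma centered_scaling:
  fixes f :: "'a::euclidean_space \<Rightarrow> real"
  assumes d: "DIM('a) \<ge> 3" and f: "f \<in> Lhp" and f0: "\<And>x. 0 \<le> f x"
    and N: "(\<integral>x. pot f x powr hq TYPE('a) \<partial>lborel) > 0"
  obtains a s where "s > 0" "(\<integral>x. pot (sc s a f) x powr hq TYPE('a) \<partial>lborel) = (\<integral>x. pot f x powr hq TYPE('a) \<partial>lborel)"
    "(\<integral>x. pot (sc s a f) x powr hq TYPE('a) * om 1 0 x \<partial>lborel) = 0"
    "\<And>b. b \<in> Basis \<Longrightarrow> (\<integral>x. pot (sc s a f) x powr hq TYPE('a) * om 0 b x \<partial>lborel) = 0"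
proof -
  define q where "q = hq TYPE('a)"
  define u where "u = pot f"
  define N where "N = (\<integral>x. u x powr q \<partial>lborel)"
  have Npos: "N > 0" using N by (simp add: N_def u_def q_def)
  have [measurable]: "f \<in> borel_measurable borel" using f by (rule LhpD)
  have [measurable]: "u \<in> borel_measurable borel" unfolding u_def by measurable
  have u0: "u x \<ge> 0" for x unfolding u_def by (rule pot_nonneg[OF f0])
  have uI: "integrable lborel (\<lambda>x. u x powr q)" unfolding u_def q_def by (rule pot_Lhq(1)[OF d f f0])
  obtain a s where s: "s > 0"
    and c1: "\<And>e. norm e = 1 \<Longrightarrow> (\<integral>y. (u y powr q / N) * (((y - a) \<bullet> e) / (s\<^sup>2 + (norm (y - a))\<^sup>2)) \<partial>lborel) = 0"
    and c2: "(\<integral>y. (u y powr q / N) * ((s\<^sup>2 - (norm (y - a))\<^sup>2) / (s\<^sup>2 + (norm (y - a))\<^sup>2)) \<partial>lborel) = 0"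
  proof (rule conformal_centering[of "\<lambda>y. u y powr q / N"])
    show "(\<integral>x. u x powr q / N \<partial>lborel) = 1" using Npos by (simp add: N_def[symmetric])
  qed (use uI Npos in auto)
  have pw: "pot (sc s a f) x powr q = s ^ DIM('a) * u (a + s *\<^sub>R x) powr q" for x
  proof -
    have "(real DIM('a) - 2) / 2 * q = real DIM('a)" using d by (simp add: q_def hq_def field_simps)
    then show ?thesis
      unfolding sc_facts(3)[OF d f s] u_def[symmetric] using s u0 by (simp add: powr_mult powr_powr powr_realpow)
  qed
  have tr: "(\<integral>x. pot (sc s a f) x powr q * g x \<partial>lborel) = (\<integral>y. u y powr q * g ((y - a) /\<^sub>R s) \<partial>lborel)"
    if [measurable]: "g \<in> borel_measurable borel" for g
  proof -
    have "(\<integral>y. u y powr q * g ((y - a) /\<^sub>R s) \<partial>lborel)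
        = s ^ DIM('a) * (\<integral>x. u (a + s *\<^sub>R x) powr q * g x \<partial>lborel)"
      using s by (subst integral_affine[of _ s a]) simp_all
    then show ?thesis unfolding pw by (simp add: mult.assoc)
  qed
  have pos: "s\<^sup>2 + (norm (y - a))\<^sup>2 > 0" for y using s by (simp add: add_pos_nonneg)
  have h: "h2 ((y - a) /\<^sub>R s) = 2 * s\<^sup>2 / (s\<^sup>2 + (norm (y - a))\<^sup>2)" for y
  proof -
    have "1 + (norm ((y - a) /\<^sub>R s))\<^sup>2 = (s\<^sup>2 + (norm (y - a))\<^sup>2) / s\<^sup>2"
    proof -
      have "(norm ((y - a) /\<^sub>R s))\<^sup>2 = inverse (s\<^sup>2) * (norm (y - a))\<^sup>2"
        using s by (simp add: power_mult_distrib power_inverse)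
      then show ?thesis using s by (simp add: divide_inverse distrib_right)
    qed
    then show ?thesis unfolding h2_def using s by simp
  qed
  have o1: "u y powr q * om 1 0 ((y - a) /\<^sub>R s) = N * ((u y powr q / N) * ((s\<^sup>2 - (norm (y - a))\<^sup>2) / (s\<^sup>2 + (norm (y - a))\<^sup>2)))" for y
  proof -
    have "om 1 0 ((y - a) /\<^sub>R s) = (s\<^sup>2 - (norm (y - a))\<^sup>2) / (s\<^sup>2 + (norm (y - a))\<^sup>2)"
    proof -
      have "1 * (2 * P / (P + R) - 1) = (P - R) / (P + R)" if "P + R > 0" for P R :: real
        using that by (simp add: field_simps)
      from this[OF pos[of y]] show ?thesis unfolding om_def h by simp
    qed
    then show ?thesis using Npos by simp
  qed
  have o2: "u y powr q * om 0 b ((y - a) /\<^sub>R s) = N * 2 * s * ((u y powr q / N) * (((y - a) \<bullet> b) / (s\<^sup>2 + (norm (y - a))\<^sup>2)))" for y b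
  proof -
    have "om 0 b ((y - a) /\<^sub>R s) = 2 * s * (((y - a) \<bullet> b) / (s\<^sup>2 + (norm (y - a))\<^sup>2))"
      unfolding om_def h using s by (simp add: power2_eq_square divide_inverse)
    then show ?thesis using Npos by simp
  qed
  show ?thesis
  proof (rule that[OF s])
    show "(\<integral>x. pot (sc s a f) x powr hq TYPE('a) \<partial>lborel) = (\<integral>x. pot f x powr hq TYPE('a) \<partial>lborel)"
      using tr[of "\<lambda>_. 1"] by (simp add: q_def u_def)
    show "(\<integral>x. pot (sc s a f) x powr hq TYPE('a) * om 1 0 x \<partial>lborel) = 0"
      unfolding q_def[symmetric] by (subst tr, measurable) (simp only: o1 integral_mult_right_zero c2 mult_zero_right)
    show "(\<integral>x. pot (sc s a f) x powr hq TYPE('a) * om 0 b x \<partial>lborel) = 0" if "b \<in> Basis" for b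
      unfolding q_def[symmetric] by (subst tr, measurable) (simp only: o2 integral_mult_right_zero c1[OF norm_Basis[OF that]] mult_zero_right)
  qed
qed

definition hls_k :: "'a::euclidean_space itself \<Rightarrow> real" where
  "hls_k _ = newt_c TYPE('a) * 4 / (real DIM('a) * (real DIM('a) - 2))"

lemma pot_WW_hls_k:
  assumes d: "DIM('a::euclidean_space) \<ge> 3"
  shows "pot WW (y::'a) = hls_k TYPE('a) * VV y"
  using pot_WW[OF d, of y] by (simp only: hls_k_def)

lemma hls_k_pos: "DIM('a::euclidean_space) \<ge> 3 \<Longrightarrow> hls_k TYPE('a) > 0"
  using newt_c_pos[where 'a='a] by (simp add: hls_k_def)

text \<open>The quotient of energy and squared norm at the standard bubble, as verified in
  \<open>hls_WW\<close>.\<close>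

definition hls_sharp :: "'a::euclidean_space itself \<Rightarrow> real" where
  "hls_sharp _ = hls_k TYPE('a) * sph TYPE('a) powr (- 2 / real DIM('a))"

lemma hls_sharp_pos: "DIM('a::euclidean_space) \<ge> 3 \<Longrightarrow> hls_sharp TYPE('a) > 0"
  using hls_k_pos[where 'a='a] sph_pos[where 'a='a] by (simp add: hls_sharp_def)

lemma hls_WW:
  assumes d: "DIM('a::euclidean_space) \<ge> 3"
  shows "(\<integral>(x::'a). \<bar>WW x\<bar> powr hp TYPE('a) \<partial>lborel) = sph TYPE('a)"
    "hls WW (WW :: 'a \<Rightarrow> real) = hls_k TYPE('a) * sph TYPE('a)"
    "hls WW (WW :: 'a \<Rightarrow> real) = hls_sharp TYPE('a) * (\<integral>(x::'a). \<bar>WW x\<bar> powr hp TYPE('a) \<partial>lborel) powr (2 / hp TYPE('a))"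
proof -
  show I: "(\<integral>(x::'a). \<bar>WW x\<bar> powr hp TYPE('a) \<partial>lborel) = sph TYPE('a)"
    using h2_integral(2)[OF d] by (simp add: VW_powr(2)[OF d])
  have "(real DIM('a) + 2) / 2 + (real DIM('a) - 2) / 2 = real DIM('a)" by (simp add: field_simps)
  then have "WW x * VV x = h2 x powr real DIM('a)" for x :: 'a unfolding WW_def VV_def powr_add[symmetric] by simp
  then show H: "hls WW (WW :: 'a \<Rightarrow> real) = hls_k TYPE('a) * sph TYPE('a)"
    unfolding hls_pot(2)[OF d WW_Lhp[OF d] WW_Lhp[OF d]] pot_WW_hls_k[OF d]
      mult.left_commute[of _ "hls_k TYPE('a)"] using h2_integral(2)[OF d] by simp
  have "- 2 / real DIM('a) + 2 / hp TYPE('a) = 1" using d by (simp add: hp_def field_simps)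
  then have "sph TYPE('a) powr (- 2 / real DIM('a)) * sph TYPE('a) powr (2 / hp TYPE('a)) = sph TYPE('a)"
    unfolding powr_add[symmetric] using sph_pos[where 'a='a] by simp
  then show "hls WW (WW :: 'a \<Rightarrow> real) = hls_sharp TYPE('a) * (\<integral>(x::'a). \<bar>WW x\<bar> powr hp TYPE('a) \<partial>lborel) powr (2 / hp TYPE('a))"
    unfolding I H hls_sharp_def mult.assoc by simp
qed

lemma powr_root_square:
  fixes a b :: real
  shows "(a powr (1 / p) * b powr (1 / q))\<^sup>2 = a powr (2 / p) * b powr (2 / q)"
proof -
  have "(x powr (1 / r))\<^sup>2 = x powr (2 / r)" for x r :: real
    unfolding power2_eq_square powr_add[symmetric] by simp
  then show ?thesis by (simp add: power_mult_distrib)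
qed

text \<open>Hoelder's inequality against \<open>VV\<close>, whose q-th power has the integral
  \<open>sph\<close>. In the squared form the exponents of \<open>sph\<close> combine to 2/q - 1 =
  -2/d, which produces \<open>hls_sharp\<close>. In the equality case f^p is proportional to the
  q-th power of \<open>VV\<close>, that is to the p-th power of \<open>WW\<close>.\<close>

lemma Holder_VV:
  fixes f :: "'a::euclidean_space \<Rightarrow> real"
  assumes d: "DIM('a) \<ge> 3" and f: "f \<in> Lhp" and f0: "\<And>x. 0 \<le> f x"
  shows "0 \<le> (\<integral>x. f x * VV x \<partial>lborel)"
    "(\<integral>x. f x * VV x \<partial>lborel) \<le> (\<integral>x. f x powr hp TYPE('a) \<partial>lborel) powr (1 / hp TYPE('a)) * sph TYPE('a) powr (1 / hq TYPE('a))"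
    "(\<integral>x. f x * VV x \<partial>lborel) = (\<integral>x. f x powr hp TYPE('a) \<partial>lborel) powr (1 / hp TYPE('a)) * sph TYPE('a) powr (1 / hq TYPE('a)) \<Longrightarrow>
      (\<integral>x. f x powr hp TYPE('a) \<partial>lborel) > 0 \<Longrightarrow>
      AE x in lborel. f x = ((\<integral>x. f x powr hp TYPE('a) \<partial>lborel) / sph TYPE('a)) powr (1 / hp TYPE('a)) * WW x"
    "hls_k TYPE('a) * (\<integral>x. f x * VV x \<partial>lborel)\<^sup>2 / sph TYPE('a) \<le> hls_sharp TYPE('a) * (\<integral>x. f x powr hp TYPE('a) \<partial>lborel) powr (2 / hp TYPE('a))"
proof -
  define p q where "p = hp TYPE('a)" and "q = hq TYPE('a)"
  define A where "A = (\<integral>x. f x powr p \<partial>lborel)"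
  define F where "F = (\<integral>x. f x * VV x \<partial>lborel)"
  define s where "s = sph TYPE('a)"
  have s: "s > 0" unfolding s_def by (rule sph_pos)
  note pq = hp_hq[OF d, folded p_def q_def]
  have fm [measurable]: "f \<in> borel_measurable borel" using f by (rule LhpD)
  have fI: "integrable lborel (\<lambda>x. \<bar>f x\<bar> powr p)" using LhpD(2)[OF f] by (simp add: p_def)
  have Vq: "\<bar>VV x\<bar> powr q = h2 x powr real DIM('a)" for x :: 'a using VW_powr(1)[OF d, of x] by (simp add: q_def)
  have VI: "integrable lborel (\<lambda>x::'a. \<bar>VV x\<bar> powr q)" "(\<integral>(x::'a). \<bar>VV x\<bar> powr q \<partial>lborel) = s"
    unfolding Vq s_def by (rule h2_integral[OF d])+
  have fa: "\<bar>f x\<bar> = f x" for x using f0[of x] by simp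
  have A0: "A \<ge> 0" unfolding A_def by (auto intro: integral_nonneg_AE)
  have m: "f \<in> borel_measurable lborel" "(VV :: 'a \<Rightarrow> real) \<in> borel_measurable lborel" by simp_all
  note H = Holder_integral[OF pq(1) _ pq(3) m fI VI(1), unfolded VI(2) fa A_def[symmetric] F_def[symmetric]]
  have q1: "q > 1" using pq(10) .
  show F0: "0 \<le> (\<integral>x. f x * VV x \<partial>lborel)" using f0 by (auto intro!: integral_nonneg_AE)
  have F: "F \<le> A powr (1 / p) * s powr (1 / q)" by (rule H(2)[OF q1])
  then show "(\<integral>x. f x * VV x \<partial>lborel) \<le> (\<integral>x. f x powr hp TYPE('a) \<partial>lborel) powr (1 / hp TYPE('a)) * sph TYPE('a) powr (1 / hq TYPE('a))"
    unfolding F_def A_def p_def q_def s_def .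
  have e: "2 / q - 1 = - 2 / real DIM('a)" using d by (simp add: q_def hq_def field_simps)
  have "F\<^sup>2 \<le> (A powr (1 / p) * s powr (1 / q))\<^sup>2" using F F0 unfolding F_def by (intro power_mono)
  also have "\<dots> = A powr (2 / p) * s powr (2 / q)"
    by (rule powr_root_square)
  finally have "F\<^sup>2 \<le> A powr (2 / p) * s powr (2 / q)" .
  then have "hls_k TYPE('a) * F\<^sup>2 / s \<le> hls_k TYPE('a) * (A powr (2 / p) * s powr (2 / q)) / s"
    using s hls_k_pos[OF d] by (intro divide_right_mono mult_left_mono) auto
  also have "\<dots> = hls_k TYPE('a) * (s powr (2 / q) / s powr 1) * A powr (2 / p)" using s by simp
  also have "\<dots> = hls_sharp TYPE('a) * A powr (2 / p)" unfolding powr_diff[symmetric] e hls_sharp_def s_def ..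
  finally show "hls_k TYPE('a) * (\<integral>x. f x * VV x \<partial>lborel)\<^sup>2 / sph TYPE('a) \<le> hls_sharp TYPE('a) * (\<integral>x. f x powr hp TYPE('a) \<partial>lborel) powr (2 / hp TYPE('a))"
    unfolding F_def A_def p_def s_def .
  show "AE x in lborel. f x = ((\<integral>x. f x powr hp TYPE('a) \<partial>lborel) / sph TYPE('a)) powr (1 / hp TYPE('a)) * WW x"
    if eq: "(\<integral>x. f x * VV x \<partial>lborel) = (\<integral>x. f x powr hp TYPE('a) \<partial>lborel) powr (1 / hp TYPE('a)) * sph TYPE('a) powr (1 / hq TYPE('a))"
      and Ap: "(\<integral>x. f x powr hp TYPE('a) \<partial>lborel) > 0"
  proof -
    have Ap': "A > 0" using Ap by (simp add: A_def p_def)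
    have "AE x in lborel. f x powr p / A = \<bar>VV x\<bar> powr q / s"
      using H(3)[OF q1] eq Ap' s unfolding F_def A_def p_def q_def s_def by blast
    then have "AE x in lborel. f x = (A / s) powr (1 / p) * WW x"
    proof eventually_elim
      case (elim x)
      have "f x powr p = (A / s) * WW x powr p"
        using elim Ap' s unfolding Vq p_def VW_powr(2)[OF d] by (simp add: field_simps)
      then have "(f x powr p) powr (1 / p) = ((A / s) * WW x powr p) powr (1 / p)" by simp
      also have "\<dots> = (A / s) powr (1 / p) * (WW x powr p) powr (1 / p)"
        using Ap' s by (subst powr_mult) auto
      finally show ?case using pq(1) f0[of x] by (simp add: powr_powr)
    qed
    then show ?thesis unfolding A_def p_def s_def .
  qed
qed



lemma sc_nonneg: "(\<And>x. 0 \<le> f x) \<Longrightarrow> 0 \<le> sc s a f x"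
  by (simp add: sc_def)

text \<open>The factor of \<open>almost_sharp\<close> times the factor of
  \<open>second_variation\<close>.\<close>

definition gap_K :: "'a::euclidean_space itself \<Rightarrow> real" where
  "gap_K _ = (1 + hls_k TYPE('a) / (2 powr (2 - real DIM('a)) * sph TYPE('a)))
    * (50 * (real DIM('a) - 2) * (real DIM('a) + 7))"

text \<open>The translation and dilation are fixed before \<epsilon>, since the centering depends on
  f alone. The equality case relies on this order of quantifiers: there \<epsilon> tends to 0 for a
  fixed centered function.\<close>

lemma near_maximizer:
  fixes f :: "'a::euclidean_space \<Rightarrow> real"
  assumes d: "DIM('a) \<ge> 3" and f: "f \<in> Lhp" and f0: "\<And>x. 0 \<le> f x" and Q: "hls f f = 1"
    and M: "hls_M TYPE('a) > 0" and \<delta>: "0 \<le> \<delta>" "\<delta> < 1"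
    and near: "hls_M TYPE('a) * (1 - \<delta>) \<le> (\<integral>x. pot f x powr hq TYPE('a) \<partial>lborel) powr (2 / hq TYPE('a))"
  obtains a s where "s > 0"
    "\<And>\<epsilon>. 0 < \<epsilon> \<Longrightarrow> \<epsilon> \<le> 1 / 10 \<Longrightarrow>
      1 \<le> hls_k TYPE('a) * (\<integral>x. sc s a f x * VV x \<partial>lborel)\<^sup>2 / sph TYPE('a) + gap_K TYPE('a) * (\<epsilon> + \<delta> / \<epsilon>\<^sup>2)"
proof -
  define N where "N = (\<integral>x. pot f x powr hq TYPE('a) \<partial>lborel)"
  have "0 < N powr (2 / hq TYPE('a))"
    using near M \<delta> unfolding N_def by (intro less_le_trans[OF _ near]) simp
  then have "N \<noteq> 0" by auto
  moreover have "N \<ge> 0" unfolding N_def by (auto intro!: integral_nonneg_AE)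
  ultimately have "N > 0" by linarith
  then have N: "(\<integral>x. pot f x powr hq TYPE('a) \<partial>lborel) > 0" by (simp add: N_def)
  obtain a s where s: "s > 0" and c: "(\<integral>x. pot (sc s a f) x powr hq TYPE('a) \<partial>lborel) = (\<integral>x. pot f x powr hq TYPE('a) \<partial>lborel)"
    "(\<integral>x. pot (sc s a f) x powr hq TYPE('a) * om 1 0 x \<partial>lborel) = 0"
    "\<And>b. b \<in> Basis \<Longrightarrow> (\<integral>x. pot (sc s a f) x powr hq TYPE('a) * om 0 b x \<partial>lborel) = 0"
    by (rule centered_scaling[OF d f f0 N]) (rule that, assumption+)
  define g where "g = sc s a f"
  note sf = sc_facts[OF d f s, of a, folded g_def]
  have g0: "0 \<le> g x" for x unfolding g_def by (rule sc_nonneg[OF f0])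
  show ?thesis
  proof (rule that[OF s])
    fix \<epsilon> :: real
    assume \<epsilon>: "0 < \<epsilon>" "\<epsilon> \<le> 1 / 10"
    have sv: "1 \<le> 1 / hls_k TYPE('a) * (\<integral>x. (pot g x)\<^sup>2 * (h2 x)\<^sup>2 \<partial>lborel)
        + 50 * (real DIM('a) - 2) * (real DIM('a) + 7) * (\<epsilon> + \<delta> / \<epsilon>\<^sup>2)"
      using second_variation[OF d sf(1) g0 _ _ _ _ M \<delta>(1) _ \<epsilon>] c N near sf(4) Q unfolding g_def[symmetric]
      by (simp add: hls_k_def mult.commute)
    show "1 \<le> hls_k TYPE('a) * (\<integral>x. sc s a f x * VV x \<partial>lborel)\<^sup>2 / sph TYPE('a) + gap_K TYPE('a) * (\<epsilon> + \<delta> / \<epsilon>\<^sup>2)"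
      using almost_sharp[OF d sf(1) g0 _ hls_k_def sv] sf(4) Q
      unfolding g_def[symmetric] gap_K_def mult.assoc by simp
  qed
qed

lemma hls_scale_both:
  fixes f :: "'a::euclidean_space \<Rightarrow> real"
  assumes [measurable]: "f \<in> borel_measurable borel"
  shows "hls (\<lambda>x. c * f x) (\<lambda>x. c * f x) = c\<^sup>2 * hls f f"
proof -
  have "hls f (\<lambda>x. c * f x) = c * hls f f"
    by (subst hls_commute) (simp_all add: hls_scale_left)
  then show ?thesis by (simp add: hls_scale_left power2_eq_square)
qed

text \<open>For the last part: at energy 1 Hoelder's inequality bounds 1 by the product of the
  \<open>hp\<close>-norm of g and the \<open>hq\<close>-norm of its potential. A large quotient for
  f thus forces a large potential, as \<open>near_maximizer\<close> demands.\<close>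

lemma normalized_maximizer:
  fixes f :: "'a::euclidean_space \<Rightarrow> real"
  assumes d: "DIM('a) \<ge> 3" and f: "f \<in> Lhp" and f0: "\<And>x. 0 \<le> f x"
    and Q: "hls f f > 0" and A: "(\<integral>x. f x powr hp TYPE('a) \<partial>lborel) > 0"
    and g: "g = (\<lambda>x. 1 / sqrt (hls f f) * f x)"
  shows "g \<in> Lhp" "0 \<le> g x" "hls g g = 1"
    "(\<integral>x. g x powr hp TYPE('a) \<partial>lborel) powr (2 / hp TYPE('a)) = (\<integral>x. f x powr hp TYPE('a) \<partial>lborel) powr (2 / hp TYPE('a)) / hls f f"
    "(\<integral>x. g x powr hp TYPE('a) \<partial>lborel) > 0"
    "hls f f / (\<integral>x. f x powr hp TYPE('a) \<partial>lborel) powr (2 / hp TYPE('a)) \<le> (\<integral>x. pot g x powr hq TYPE('a) \<partial>lborel) powr (2 / hq TYPE('a))"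
proof -
  define p q where "p = hp TYPE('a)" and "q = hq TYPE('a)"
  note pq = hp_hq[OF d, folded p_def q_def]
  define Q' where "Q' = hls f f"
  define A where "A = (\<integral>x. f x powr p \<partial>lborel)"
  define B where "B = (\<integral>x. g x powr p \<partial>lborel)"
  define N where "N = (\<integral>x. pot g x powr q \<partial>lborel)"
  have Qp: "Q' > 0" using Q by (simp add: Q'_def)
  have Ap: "A > 0" using A by (simp add: A_def p_def)
  have [measurable]: "f \<in> borel_measurable borel" using f by (rule LhpD)
  show gL: "g \<in> Lhp" unfolding g by (rule Lhp_scale[OF f])
  then have [measurable]: "g \<in> borel_measurable borel" by (rule LhpD)
  show g0: "0 \<le> g x" for x unfolding g using f0[of x] Q by simp
  show g1: "hls g g = 1" unfolding g using Q by (subst hls_scale_both) (simp_all add: power_divide)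
  have "g x powr p = (1 / sqrt Q') powr p * f x powr p" for x unfolding g Q'_def using f0[of x] Q by (subst powr_mult) auto
  then have B: "B = (1 / sqrt Q') powr p * A" unfolding B_def A_def by simp
  show "(\<integral>x. g x powr hp TYPE('a) \<partial>lborel) > 0" using B Ap Qp by (simp add: B_def p_def)
  have "B powr (2 / p) = ((1 / sqrt Q') powr p) powr (2 / p) * A powr (2 / p)" unfolding B using Ap by (simp add: powr_mult)
  also have "((1 / sqrt Q') powr p) powr (2 / p) = (1 / sqrt Q') powr 2" unfolding powr_powr using pq(1) by simp
  also have "\<dots> = 1 / Q'" using Qp by (simp add: power_divide)
  finally have B2: "B powr (2 / p) = A powr (2 / p) / Q'" by simp
  then show "(\<integral>x. g x powr hp TYPE('a) \<partial>lborel) powr (2 / hp TYPE('a)) = (\<integral>x. f x powr hp TYPE('a) \<partial>lborel) powr (2 / hp TYPE('a)) / hls f f"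
    unfolding A_def B_def Q'_def p_def .
  have u0: "pot g x \<ge> 0" for x by (rule pot_nonneg[OF g0])
  have abs: "\<bar>g x\<bar> = g x" "\<bar>pot g x\<bar> = pot g x" for x using g0[of x] u0[of x] by auto
  have "integrable lborel (\<lambda>x. \<bar>g x\<bar> powr p)" "integrable lborel (\<lambda>x. \<bar>pot g x\<bar> powr q)"
    using LhpD(2)[OF gL] pot_Lhq(1)[OF d gL g0] unfolding abs by (simp_all add: p_def q_def abs)
  then have "(\<integral>x. g x * pot g x \<partial>lborel) \<le> B powr (1 / p) * N powr (1 / q)"
    using Holder_integral(2)[OF pq(1,10,3), of g lborel "pot g"] unfolding abs B_def N_def by simp
  then have "1 \<le> B powr (1 / p) * N powr (1 / q)" using hls_pot(2)[OF d gL gL] g1 by simp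
  then have "1\<^sup>2 \<le> (B powr (1 / p) * N powr (1 / q))\<^sup>2" by (intro power_mono) auto
  then have "1 \<le> B powr (2 / p) * N powr (2 / q)" by (simp add: powr_root_square)
  then have "Q' / A powr (2 / p) \<le> N powr (2 / q)" unfolding B2 using Qp Ap by (simp add: field_simps)
  then show "hls f f / (\<integral>x. f x powr hp TYPE('a) \<partial>lborel) powr (2 / hp TYPE('a)) \<le> (\<integral>x. pot g x powr hq TYPE('a) \<partial>lborel) powr (2 / hq TYPE('a))"
    unfolding A_def N_def Q'_def p_def q_def .
qed

section \<open>The sharp constant and the optimizers\<close>

lemma hls_M_pos:
  assumes d: "DIM('a::euclidean_space) \<ge> 3"
  shows "hls_M TYPE('a) > 0"
proof (rule ccontr)
  assume "\<not> hls_M TYPE('a) > 0"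
  then have "hls_M TYPE('a) * (\<integral>x. WW (x::'a) powr hp TYPE('a) \<partial>lborel) powr (2 / hp TYPE('a)) \<le> 0"
    by (intro mult_nonpos_nonneg) auto
  then have "hls WW (WW :: 'a \<Rightarrow> real) \<le> 0" using hls_le_M[OF d WW_Lhp[OF d]] by simp
  moreover have "hls_k TYPE('a) * sph TYPE('a) > 0" using hls_k_pos[OF d] sph_pos[where 'a='a] by simp
  ultimately show False unfolding hls_WW(2)[OF d] by simp
qed

text \<open>Applied to a function within the factor 1 - \<epsilon>^3 of the supremum,
  \<open>near_maximizer\<close> has the error \<epsilon> + \<epsilon>^3 / \<epsilon>^2 = 2
  \<epsilon>. The limit \<epsilon> to 0 leaves 1 \<le> C / M.\<close>

lemma hls_M_le_sharp:
  assumes d: "DIM('a::euclidean_space) \<ge> 3"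
  shows "hls_M TYPE('a) \<le> hls_sharp TYPE('a)"
proof -
  define p where "p = hp TYPE('a)"
  define M where "M = hls_M TYPE('a)"
  define C where "C = hls_sharp TYPE('a)"
  note pq = hp_hq[OF d, folded p_def]
  have M: "M > 0" unfolding M_def by (rule hls_M_pos[OF d])
  have C: "C > 0" unfolding C_def by (rule hls_sharp_pos[OF d])
  define Y where "Y = {hls f f | f :: 'a \<Rightarrow> real. f \<in> Lhp \<and> (\<forall>x. 0 \<le> f x) \<and> (\<integral>x. f x powr p \<partial>lborel) = 1}"
  \<comment> \<open>The normalized bubble belongs to the set, so that near-maximizers can be picked
    from the supremum.\<close>
  have ne: "Y \<noteq> {}"
  proof -
    define w where "w x = sph TYPE('a) powr (- 1 / p) * WW x" for x :: 'a
    have "w x powr p = sph TYPE('a) powr (- 1) * h2 x powr real DIM('a)" for x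
      unfolding w_def using pq(1) VW_powr(2)[OF d, of x] by (simp add: powr_mult powr_powr p_def)
    then have "(\<integral>x. w x powr p \<partial>lborel) = 1"
      using h2_integral(2)[OF d] sph_pos[where 'a='a] by (simp add: powr_minus)
    moreover have "w \<in> Lhp" unfolding w_def[abs_def] by (rule Lhp_scale[OF WW_Lhp[OF d]])
    moreover have "\<forall>x. 0 \<le> w x" by (simp add: w_def)
    ultimately show ?thesis unfolding Y_def by blast
  qed
  have M_Sup: "M = Sup Y" unfolding M_def hls_M_def Y_def p_def ..
  have bound: "1 \<le> C / (M * (1 - \<epsilon> ^ 3)) + gap_K TYPE('a) * (2 * \<epsilon>)" if \<epsilon>: "0 < \<epsilon>" "\<epsilon> \<le> 1 / 10" for \<epsilon>
  proof -
    have e3: "0 < \<epsilon> ^ 3" "\<epsilon> ^ 3 < 1" using \<epsilon> by (simp_all add: power_less_one_iff)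
    have "M * (1 - \<epsilon> ^ 3) < Sup Y" using M e3 unfolding M_Sup[symmetric] by simp
    from less_cSupD[OF ne this] obtain f :: "'a \<Rightarrow> real" where f: "f \<in> Lhp" "\<And>x. 0 \<le> f x"
      "(\<integral>x. f x powr p \<partial>lborel) = 1" "M * (1 - \<epsilon> ^ 3) < hls f f"
      unfolding Y_def by auto
    have Mp: "0 < M * (1 - \<epsilon> ^ 3)" using M e3 by simp
    then have Q: "hls f f > 0" using f(4) by simp
    have A: "(\<integral>x. f x powr hp TYPE('a) \<partial>lborel) > 0" using f(3) by (simp add: p_def)
    define g where "g = (\<lambda>x. 1 / sqrt (hls f f) * f x)"
    note G = normalized_maximizer[OF d f(1,2) Q A g_def, folded p_def, unfolded f(3)]
    have near: "hls_M TYPE('a) * (1 - \<epsilon> ^ 3) \<le> (\<integral>x. pot g x powr hq TYPE('a) \<partial>lborel) powr (2 / hq TYPE('a))"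
      using G(6) f(4) by (simp add: M_def)
    obtain a s where s: "s > 0" and le: "\<And>e. 0 < e \<Longrightarrow> e \<le> 1 / 10 \<Longrightarrow>
      1 \<le> hls_k TYPE('a) * (\<integral>x. sc s a g x * VV x \<partial>lborel)\<^sup>2 / sph TYPE('a) + gap_K TYPE('a) * (e + \<epsilon> ^ 3 / e\<^sup>2)"
      by (rule near_maximizer[OF d G(1-3) hls_M_pos[OF d] less_imp_le[OF e3(1)] e3(2) near]) (rule that, assumption+)
    define k where "k = sc s a g"
    note sf = sc_facts[OF d G(1) s, of a, folded k_def]
    have k0: "0 \<le> k x" for x unfolding k_def by (rule sc_nonneg[OF G(2)])
    have kg: "(\<integral>x. k x powr p \<partial>lborel) = (\<integral>x. g x powr p \<partial>lborel)"
      using sf(2) k0 G(2) by (simp add: p_def)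
    have "1 \<le> hls_k TYPE('a) * (\<integral>x. k x * VV x \<partial>lborel)\<^sup>2 / sph TYPE('a) + gap_K TYPE('a) * (\<epsilon> + \<epsilon> ^ 3 / \<epsilon>\<^sup>2)"
      unfolding k_def by (rule le[OF \<epsilon>])
    also have "\<epsilon> + \<epsilon> ^ 3 / \<epsilon>\<^sup>2 = 2 * \<epsilon>" using \<epsilon> by (simp add: power3_eq_cube power2_eq_square)
    also have "hls_k TYPE('a) * (\<integral>x. k x * VV x \<partial>lborel)\<^sup>2 / sph TYPE('a) \<le> C * (1 / hls f f)"
      using Holder_VV(4)[OF d sf(1) k0] G(4) unfolding p_def[symmetric] kg C_def by simp
    also have "C * (1 / hls f f) \<le> C * (1 / (M * (1 - \<epsilon> ^ 3)))"
      by (rule mult_left_mono[OF divide_left_mono[OF less_imp_le[OF f(4)] zero_le_one mult_pos_pos[OF Q Mp]] less_imp_le[OF C]])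
    finally show ?thesis by simp
  qed
  have "((\<lambda>\<epsilon>. C / (M * (1 - \<epsilon> ^ 3)) + gap_K TYPE('a) * (2 * \<epsilon>)) \<longlongrightarrow> C / (M * (1 - 0 ^ 3)) + gap_K TYPE('a) * (2 * 0)) (at_right 0)"
    using M by (intro tendsto_intros) auto
  moreover have "\<forall>\<^sub>F \<epsilon> in at_right 0. 1 \<le> C / (M * (1 - \<epsilon> ^ 3)) + gap_K TYPE('a) * (2 * \<epsilon>)"
    using eventually_at_right_real[of 0 "1 / 10"] by (auto elim!: eventually_mono intro!: bound)
  ultimately have "1 \<le> C / (M * (1 - 0 ^ 3)) + gap_K TYPE('a) * (2 * 0)"
    by (intro tendsto_lowerbound) auto
  then show ?thesis using M by (simp add: C_def M_def field_simps)
qed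

lemma hls_le_sharp:
  fixes f :: "'a::euclidean_space \<Rightarrow> real"
  assumes d: "DIM('a) \<ge> 3" and f: "f \<in> Lhp" and f0: "\<And>x. 0 \<le> f x"
  shows "hls f f \<le> hls_sharp TYPE('a) * (\<integral>x. f x powr hp TYPE('a) \<partial>lborel) powr (2 / hp TYPE('a))"
  using hls_le_M[OF d f f0] mult_right_mono[OF hls_M_le_sharp[OF d], of "(\<integral>x. f x powr hp TYPE('a) \<partial>lborel) powr (2 / hp TYPE('a))"]
  by simp

text \<open>A function attaining the sharp constant is an exact maximizer, so \<delta> = 0 is
  allowed. Letting \<epsilon> tend to 0 shows that the pairing of the centered function with
  \<open>VV\<close> attains Hoelder's bound, and the equality case identifies that function with a
  multiple of \<open>WW\<close>.\<close>

lemma hls_eq_sharp: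
  fixes f :: "'a::euclidean_space \<Rightarrow> real"
  assumes d: "DIM('a) \<ge> 3" and f: "f \<in> Lhp" and f0: "\<And>x. 0 \<le> f x"
    and eq: "hls f f = hls_sharp TYPE('a) * (\<integral>x. f x powr hp TYPE('a) \<partial>lborel) powr (2 / hp TYPE('a))"
    and A: "(\<integral>x. f x powr hp TYPE('a) \<partial>lborel) > 0"
  obtains c s a where "s > 0" "AE y in lborel. f y = c * WW ((y - a) /\<^sub>R s)"
proof -
  define p q where "p = hp TYPE('a)" and "q = hq TYPE('a)"
  define C where "C = hls_sharp TYPE('a)"
  define D where "D = real DIM('a)"
  note pq = hp_hq[OF d, folded p_def q_def]
  have C: "C > 0" unfolding C_def by (rule hls_sharp_pos[OF d])
  define A' where "A' = (\<integral>x. f x powr p \<partial>lborel)"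
  have Ap: "A' > 0" using A by (simp add: A'_def p_def)
  have eq': "hls f f = C * A' powr (2 / p)" using eq by (simp add: C_def A'_def p_def)
  have Q: "hls f f > 0" unfolding eq' using C Ap by simp
  have [measurable]: "f \<in> borel_measurable borel" using f by (rule LhpD)
  define g where "g = (\<lambda>x. 1 / sqrt (hls f f) * f x)"
  note G = normalized_maximizer[OF d f f0 Q A g_def, folded p_def q_def, folded A'_def]
  define B where "B = (\<integral>x. g x powr p \<partial>lborel)"
  have Bp: "B > 0" using G(5) by (simp add: B_def)
  have CB: "C * B powr (2 / p) = 1" using G(4) C Ap unfolding B_def[symmetric] eq' by simp
  have near: "hls_M TYPE('a) * (1 - 0) \<le> (\<integral>x. pot g x powr hq TYPE('a) \<partial>lborel) powr (2 / hq TYPE('a))"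
    using G(6) hls_M_le_sharp[OF d] Ap unfolding eq' C_def q_def by simp
  obtain a s where s: "s > 0" and le: "\<And>e. 0 < e \<Longrightarrow> e \<le> 1 / 10 \<Longrightarrow>
    1 \<le> hls_k TYPE('a) * (\<integral>x. sc s a g x * VV x \<partial>lborel)\<^sup>2 / sph TYPE('a) + gap_K TYPE('a) * (e + 0 / e\<^sup>2)"
    by (rule near_maximizer[OF d G(1-3) hls_M_pos[OF d] order_refl zero_less_one near]) (rule that, assumption+)
  define k where "k = sc s a g"
  define F where "F = (\<integral>x. k x * VV x \<partial>lborel)"
  note sf = sc_facts[OF d G(1) s, of a, folded k_def]
  have k0: "0 \<le> k x" for x unfolding k_def by (rule sc_nonneg[OF G(2)])
  have kg: "(\<integral>x. k x powr p \<partial>lborel) = B"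
    using sf(2) k0 G(2) by (simp add: p_def B_def)
  note H = Holder_VV[OF d sf(1) k0, folded p_def q_def F_def, unfolded kg]
  have lim: "((\<lambda>e. hls_k TYPE('a) * F\<^sup>2 / sph TYPE('a) + gap_K TYPE('a) * e) \<longlongrightarrow> hls_k TYPE('a) * F\<^sup>2 / sph TYPE('a) + gap_K TYPE('a) * 0) (at_right 0)"
    by (intro tendsto_intros)
  have "\<forall>\<^sub>F e in at_right 0. 1 \<le> hls_k TYPE('a) * F\<^sup>2 / sph TYPE('a) + gap_K TYPE('a) * e"
    using eventually_at_right_real[of 0 "1 / 10"] le unfolding F_def k_def by (auto elim!: eventually_mono)
  from tendsto_lowerbound[OF lim this] have one: "1 \<le> hls_k TYPE('a) * F\<^sup>2 / sph TYPE('a)" by simp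
  have "F = B powr (1 / p) * sph TYPE('a) powr (1 / q)"
  proof (rule ccontr)
    assume "F \<noteq> B powr (1 / p) * sph TYPE('a) powr (1 / q)"
    then have "F < B powr (1 / p) * sph TYPE('a) powr (1 / q)" using H(2) by simp
    then have "F\<^sup>2 < (B powr (1 / p) * sph TYPE('a) powr (1 / q))\<^sup>2" using H(1) by (intro power_strict_mono) auto
    also have "\<dots> = B powr (2 / p) * sph TYPE('a) powr (2 / q)"
      by (rule powr_root_square)
    finally have "hls_k TYPE('a) * F\<^sup>2 / sph TYPE('a) < hls_k TYPE('a) * (B powr (2 / p) * sph TYPE('a) powr (2 / q)) / sph TYPE('a)"
      using hls_k_pos[OF d] sph_pos[where 'a='a] by (simp add: divide_strict_right_mono)
    also have "\<dots> = hls_k TYPE('a) * (sph TYPE('a) powr (2 / q) / sph TYPE('a) powr 1) * B powr (2 / p)"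
      using sph_pos[where 'a='a] by simp
    also have "\<dots> = C * B powr (2 / p)"
    proof -
      have "2 / q - 1 = - 2 / real DIM('a)" using d by (simp add: q_def hq_def field_simps)
      then show ?thesis unfolding powr_diff[symmetric] C_def hls_sharp_def by simp
    qed
    finally show False using one unfolding CB by simp
  qed
  from H(3)[OF this Bp] have k: "AE x in lborel. k x = (B / sph TYPE('a)) powr (1 / p) * WW x" .
  \<comment> \<open>Undoes the normalization to energy 1 and the power of s in
    \<open>sc\<close>.\<close>
  define c where "c = sqrt (hls f f) * (B / sph TYPE('a)) powr (1 / p) * s powr (- ((D + 2) / 2))"
  have "AE x in lborel. f (a + s *\<^sub>R x) = c * WW ((a + s *\<^sub>R x - a) /\<^sub>R s)"
    using k
  proof eventually_elim
    case (elim x)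
    have "f (a + s *\<^sub>R x) = sqrt (hls f f) * g (a + s *\<^sub>R x)" using Q by (simp add: g_def)
    also have "g (a + s *\<^sub>R x) = s powr (- ((D + 2) / 2)) * k x"
      using s unfolding k_def sc_def D_def[symmetric] by (simp add: powr_minus)
    finally show ?case using s unfolding elim c_def by simp
  qed
  then have "AE y in lborel. f y = c * WW ((y - a) /\<^sub>R s)"
    using s by (intro AE_lborel_affine[of s f "\<lambda>y. c * WW ((y - a) /\<^sub>R s)" a]) simp_all
  with s show ?thesis by (rule that)
qed

text \<open>The function is a multiple of the image of \<open>WW\<close> under \<open>sc\<close>;
  both sides are invariant under \<open>sc\<close> and homogeneous of degree 2. The factor c may be
  negative, whence the absolute value.\<close>

lemma hls_optimizer:
  fixes b :: "'a::euclidean_space"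
  assumes d: "DIM('a) \<ge> 3" and t: "t > 0" and f: "f = (\<lambda>x. c * WW (b + t *\<^sub>R x))"
  shows "f \<in> Lhp" "hls f f = hls_sharp TYPE('a) * (\<integral>x. \<bar>f x\<bar> powr hp TYPE('a) \<partial>lborel) powr (2 / hp TYPE('a))"
proof -
  define p where "p = hp TYPE('a)"
  define g where "g = (sc t b WW :: 'a \<Rightarrow> real)"
  define c' where "c' = c * t powr (- ((real DIM('a) + 2) / 2))"
  note pq = hp_hq[OF d, folded p_def]
  note sf = sc_facts[OF d WW_Lhp[OF d] t, of b, folded g_def p_def]
  have [measurable]: "g \<in> borel_measurable borel" using sf(1) by (rule LhpD)
  have fg: "f = (\<lambda>x. c' * g x)"
    unfolding f g_def sc_def c'_def using t by (simp add: powr_minus fun_eq_iff)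
  show "f \<in> Lhp" unfolding fg by (rule Lhp_scale[OF sf(1)])
  have "(\<integral>x. \<bar>f x\<bar> powr p \<partial>lborel) = \<bar>c'\<bar> powr p * sph TYPE('a)"
    unfolding fg using sf(2) hls_WW(1)[OF d] by (simp add: abs_mult powr_mult p_def)
  then have "(\<integral>x. \<bar>f x\<bar> powr p \<partial>lborel) powr (2 / p) = (\<bar>c'\<bar> powr p) powr (2 / p) * sph TYPE('a) powr (2 / p)"
    using sph_pos[where 'a='a] by (simp add: powr_mult)
  also have "(\<bar>c'\<bar> powr p) powr (2 / p) = \<bar>c'\<bar> powr 2" unfolding powr_powr using pq(1) by simp
  also have "\<dots> = c'\<^sup>2" by simp
  finally have A: "(\<integral>x. \<bar>f x\<bar> powr p \<partial>lborel) powr (2 / p) = c'\<^sup>2 * sph TYPE('a) powr (2 / p)" .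
  have "hls f f = c'\<^sup>2 * (hls_sharp TYPE('a) * sph TYPE('a) powr (2 / p))"
    unfolding fg using sf(4) hls_WW(3)[OF d] hls_WW(1)[OF d] by (subst hls_scale_both) (simp_all add: p_def)
  then show "hls f f = hls_sharp TYPE('a) * (\<integral>x. \<bar>f x\<bar> powr hp TYPE('a) \<partial>lborel) powr (2 / hp TYPE('a))"
    unfolding p_def[symmetric] A by simp
qed

section \<open>Passage to Lebesgue measure\<close>

lemma newton_eq_power:
  assumes d: "DIM('a::euclidean_space) \<ge> 3"
  shows "newton (z::'a) = 1 / norm z ^ (DIM('a) - 2)"
proof (cases "z = 0")
  \<comment> \<open>At the origin both sides are 0: on the left by the value of \<open>powr\<close>,
    on the right because the denominator is a positive power of 0.\<close>
  case True
  then show ?thesis using d by (simp add: newton_def)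
next
  case False
  have "2 - real DIM('a) = - real (DIM('a) - 2)" using d by (simp add: of_nat_diff)
  then have "newton z = norm z powr (- real (DIM('a) - 2))" by (simp only: newton_def)
  then show ?thesis using False by (simp add: powr_minus_divide powr_realpow)
qed

text \<open>Lebesgue measure completes \<open>lborel\<close>, so an integrand that is measurable
  only for the completion may be traded for a Borel one that agrees with it almost
  everywhere.\<close>

lemma lebesgue_integral_cong_lborel:
  fixes F G :: "'a::euclidean_space \<Rightarrow> real"
  assumes F: "F \<in> borel_measurable lebesgue" and G: "G \<in> borel_measurable borel"
    and eq: "AE x in lborel. F x = G x"
  shows "integral\<^sup>L lebesgue F = integral\<^sup>L lborel G" "integrable lebesgue F \<longleftrightarrow> integrable lborel G"
proof -
  have G': "G \<in> borel_measurable lborel" using G by simp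
  have G2: "G \<in> borel_measurable lebesgue" by (rule measurable_completion[OF G'])
  note eq' = AE_completion[OF eq]
  show "integral\<^sup>L lebesgue F = integral\<^sup>L lborel G"
    using integral_cong_AE[OF F G2 eq'] integral_completion[OF G'] by simp
  show "integrable lebesgue F \<longleftrightarrow> integrable lborel G"
    using integrable_cong_AE[OF F G2 eq'] integrable_completion[OF G'] by simp
qed

text \<open>The positive part of a Borel version makes the sign condition hold everywhere instead of
  almost everywhere.\<close>

lemma lebesgue_representative:
  fixes f :: "'a::euclidean_space \<Rightarrow> real"
  assumes f: "f \<in> borel_measurable lebesgue" and f0: "AE x in lebesgue. 0 \<le> f x"
  obtains h where "h \<in> borel_measurable borel" "\<And>x. 0 \<le> h x" "AE x in lborel. f x = h x"
proof -
  obtain g where g: "g \<in> borel_measurable lborel" "AE x in lborel. f x = g x"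
    using completion_ex_borel_measurable_real[OF f] by blast
  have g': "(\<lambda>x. max 0 (g x)) \<in> borel_measurable borel" using g(1) by simp
  have "AE x in lborel. f x = max 0 (g x)"
    using g(2) f0[unfolded AE_completion_iff] by eventually_elim simp
  with g' show ?thesis by (intro that[of "\<lambda>x. max 0 (g x)"]) auto
qed

text \<open>The product of two completed measures is a measure of its own, so the integrals are
  transferred one variable at a time, each inner one becoming a multiple of \<open>pot h\<close>.
  Fubini for the product of the completions then yields the integrability.\<close>

lemma HLS_double_integral:
  fixes f h :: "'a::euclidean_space \<Rightarrow> real"
  assumes d: "DIM('a) \<ge> 3" and f: "f \<in> borel_measurable lebesgue"
    and h: "h \<in> Lhp" and h0: "\<And>x. 0 \<le> h x" and fh: "AE x in lborel. f x = h x"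
  shows "integrable (lebesgue \<Otimes>\<^sub>M lebesgue) (\<lambda>(x, y). f x * f y * newton (x - y))"
    "(LINT y|lebesgue. (LINT x|lebesgue. f x * f y * newton (x - y))) = hls h h"
proof -
  have hm [measurable]: "h \<in> borel_measurable borel" using h by (rule LhpD)
  have id: "(\<lambda>x::'a. x) \<in> borel_measurable lebesgue" by (rule measurable_completion) simp
  have nm: "(\<lambda>y. newton (x - y)) \<in> borel_measurable lebesgue" for x :: 'a
    by (rule measurable_completion) simp
  have pm: "pot h \<in> borel_measurable lebesgue" by (rule measurable_completion) simp
  have tr: "(LINT y|lebesgue. a * f y * newton (x - y)) = (\<integral>y. a * (newton (x - y) * h y) \<partial>lborel)"
    "integrable lebesgue (\<lambda>y. a * f y * newton (x - y)) \<longleftrightarrow> integrable lborel (\<lambda>y. a * (newton (x - y) * h y))" for a x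
  proof -
    have m1: "(\<lambda>y. a * f y * newton (x - y)) \<in> borel_measurable lebesgue"
      by (intro borel_measurable_times borel_measurable_const f nm)
    have m2: "(\<lambda>y. a * (newton (x - y) * h y)) \<in> borel_measurable borel" by simp
    have e: "AE y in lborel. a * f y * newton (x - y) = a * (newton (x - y) * h y)"
      using fh by eventually_elim (simp only: mult_ac)
    show "(LINT y|lebesgue. a * f y * newton (x - y)) = (\<integral>y. a * (newton (x - y) * h y) \<partial>lborel)"
      "integrable lebesgue (\<lambda>y. a * f y * newton (x - y)) \<longleftrightarrow> integrable lborel (\<lambda>y. a * (newton (x - y) * h y))"
      by (rule lebesgue_integral_cong_lborel[OF m1 m2 e])+
  qed
  have in1: "(LINT y|lebesgue. a * f y * newton (x - y)) = a * pot h x" for a x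
    unfolding tr(1) pot_def by simp
  have in2: "integrable lebesgue (\<lambda>y. a * f y * newton (x - y))" if "integrable lborel (\<lambda>y. newton (x - y) * h y)" for a x
    unfolding tr(2) using that by simp
  \<comment> \<open>A countable cover by Borel sets of finite measure serves the completion as
    well.\<close>
  have sf: "sigma_finite_measure (lebesgue :: 'a measure)"
  proof -
    obtain S :: "'a set set" where S: "countable S" "S \<subseteq> sets lborel" "\<Union>S = space lborel" "\<forall>a\<in>S. emeasure lborel a \<noteq> \<infinity>"
      using lborel.sigma_finite_countable by blast
    have "emeasure lebesgue a \<noteq> \<infinity>" if "a \<in> S" for a
    proof -
      have a: "a \<in> sets lborel" using S(2) that by blast
      have "emeasure lebesgue a = emeasure lborel a"
        using a by (simp add: emeasure_completion)
      then show ?thesis using S(4) that by simp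
    qed
    moreover have "S \<subseteq> sets lebesgue" using S(2) sets_completionI_sets by blast
    moreover have "\<Union>S = space lebesgue" using S(3) by simp
    ultimately show ?thesis unfolding sigma_finite_measure_def using S(1) by blast
  qed
  interpret L: pair_sigma_finite "lebesgue :: 'a measure" "lebesgue :: 'a measure"
    using sf by (simp add: pair_sigma_finite_def)
  have c1: "fst \<in> borel_measurable ((lebesgue :: 'a measure) \<Otimes>\<^sub>M (lebesgue :: 'a measure))"
    by (rule measurable_compose[OF measurable_fst id])
  have c2: "snd \<in> borel_measurable ((lebesgue :: 'a measure) \<Otimes>\<^sub>M (lebesgue :: 'a measure))"
    by (rule measurable_compose[OF measurable_snd id])
  have newt: "(newton :: 'a \<Rightarrow> real) \<in> borel_measurable borel" by simp
  have m: "(\<lambda>z. f (fst z) * f (snd z) * newton (fst z - snd z)) \<in> borel_measurable (lebesgue \<Otimes>\<^sub>M lebesgue)"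
    by (intro borel_measurable_times measurable_compose[OF measurable_fst f] measurable_compose[OF measurable_snd f]
        measurable_compose[OF borel_measurable_diff[OF c1 c2] newt])
  have H: "integrable lborel (\<lambda>x. h x * pot h x)" "hls h h = (\<integral>x. h x * pot h x \<partial>lborel)" by (rule hls_pot[OF d h h])+
  have "integrable (lebesgue \<Otimes>\<^sub>M lebesgue) (\<lambda>z. f (fst z) * f (snd z) * newton (fst z - snd z))"
  proof (rule L.Fubini_integrable[OF m])
    have "(LINT y|lebesgue. norm (f (fst (x, y)) * f (snd (x, y)) * newton (fst (x, y) - snd (x, y)))) = \<bar>f x\<bar> * pot h x" for x
    proof -
      have "(LINT y|lebesgue. norm (f (fst (x, y)) * f (snd (x, y)) * newton (fst (x, y) - snd (x, y))))
          = (\<integral>y. \<bar>f x\<bar> * (newton (x - y) * h y) \<partial>lborel)"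
      proof (rule lebesgue_integral_cong_lborel(1))
        show "(\<lambda>y. norm (f (fst (x, y)) * f (snd (x, y)) * newton (fst (x, y) - snd (x, y)))) \<in> borel_measurable lebesgue"
          unfolding fst_conv snd_conv real_norm_def by (intro borel_measurable_abs borel_measurable_times borel_measurable_const f nm)
        show "AE y in lborel. norm (f (fst (x, y)) * f (snd (x, y)) * newton (fst (x, y) - snd (x, y))) = \<bar>f x\<bar> * (newton (x - y) * h y)"
          using fh by eventually_elim (simp add: abs_mult h0)
      qed simp
      then show ?thesis by (simp add: pot_def)
    qed
    moreover have "integrable lebesgue (\<lambda>x. \<bar>f x\<bar> * pot h x)"
    proof -
      have m1: "(\<lambda>x. \<bar>f x\<bar> * pot h x) \<in> borel_measurable lebesgue" by (intro borel_measurable_times borel_measurable_abs f pm)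
      have m2: "(\<lambda>x. h x * pot h x) \<in> borel_measurable borel" by simp
      have "AE x in lborel. \<bar>f x\<bar> * pot h x = h x * pot h x" using fh by eventually_elim (simp add: h0)
      from lebesgue_integral_cong_lborel(2)[OF m1 m2 this] show ?thesis using H(1) by simp
    qed
    ultimately show "integrable lebesgue (\<lambda>x. LINT y|lebesgue. norm (f (fst (x, y)) * f (snd (x, y)) * newton (fst (x, y) - snd (x, y))))"
      by simp
    show "AE x in lebesgue. integrable lebesgue (\<lambda>y. f (fst (x, y)) * f (snd (x, y)) * newton (fst (x, y) - snd (x, y)))"
      using AE_completion[OF AE_integrable_newton[OF d h]] by eventually_elim (simp add: in2)
  qed
  then show "integrable (lebesgue \<Otimes>\<^sub>M lebesgue) (\<lambda>(x, y). f x * f y * newton (x - y))"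
    by (simp add: case_prod_beta')
  have "(LINT x|lebesgue. f x * f y * newton (x - y)) = f y * pot h y" for y
    using in1[of "f y" y] by (simp add: newton_commute[of y] mult.commute)
  then have "(LINT y|lebesgue. (LINT x|lebesgue. f x * f y * newton (x - y))) = (LINT y|lebesgue. f y * pot h y)" by simp
  also have "\<dots> = (\<integral>y. h y * pot h y \<partial>lborel)"
  proof (rule lebesgue_integral_cong_lborel(1))
    show "(\<lambda>y. f y * pot h y) \<in> borel_measurable lebesgue" by (intro borel_measurable_times f pm)
    show "AE y in lborel. f y * pot h y = h y * pot h y" using fh by eventually_elim simp
  qed simp
  finally show "(LINT y|lebesgue. (LINT x|lebesgue. f x * f y * newton (x - y))) = hls h h" unfolding H(2) .
qed

lemma HLS_optimizer_WW: "WW (x :: real^'n) = 2 powr ((real CARD('n) + 2) / 2) * HLS_optimizer x"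
  unfolding WW_def HLS_optimizer_def h2_def by (simp add: powr_divide add_nonneg_nonneg)

theorem theorem2p3:
  fixes f :: "real^'n \<Rightarrow> real"
  assumes "CARD('n) \<ge> 3"
    and "f \<in> Lp_space (2 * real CARD('n) / (real CARD('n) + 2))"
    and "AE x in lebesgue. 0 \<le> f x"
  shows "integrable (lebesgue \<Otimes>\<^sub>M lebesgue) (\<lambda>(x, y). HLS_integrand f x y)
    \<and> HLS_functional f \<ge> 0
    \<and> (HLS_functional f = 0 \<longleftrightarrow>
        (\<exists>c s. \<exists>x0 :: real^'n. s > 0 \<and>
           (AE x in lebesgue. f x = c * HLS_optimizer (x /\<^sub>R s - x0))))"
proof -
  define D where "D = real CARD('n)"
  define p where "p = hp TYPE(real^'n)"
  define W where "W = (2::real) powr ((D + 2) / 2)"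
  have d: "DIM(real^'n) \<ge> 3" using assms(1) by simp
  have D: "D \<ge> 3" using assms(1) by (simp add: D_def)
  have W: "W > 0" by (simp add: W_def)
  note pq = hp_hq[OF d, folded p_def]
  have p: "2 * real CARD('n) / (real CARD('n) + 2) = p" by (simp add: p_def hp_def)
  have fm: "f \<in> borel_measurable lebesgue" and fI: "integrable lebesgue (\<lambda>x. \<bar>f x\<bar> powr p)"
    using assms(2) unfolding p Lp_space_def by auto
  have fpm: "(\<lambda>x. \<bar>f x\<bar> powr p) \<in> borel_measurable lebesgue" using fI by (rule borel_measurable_integrable)
  obtain h where hm [measurable]: "h \<in> borel_measurable borel" and h0: "\<And>x. 0 \<le> h x" and fh: "AE x in lborel. f x = h x"
    by (rule lebesgue_representative[OF fm assms(3)]) (rule that, assumption+)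
  have pm: "(\<lambda>x. \<bar>h x\<bar> powr p) \<in> borel_measurable borel" by simp
  have fhp: "AE x in lborel. \<bar>f x\<bar> powr p = \<bar>h x\<bar> powr p" using fh by eventually_elim simp
  note tr = lebesgue_integral_cong_lborel[OF fpm pm fhp]
  have h: "h \<in> Lhp" using fI tr(2) by (simp add: Lhp_def p_def)
  define A where "A = (\<integral>x. h x powr p \<partial>lborel)"
  have habs: "\<bar>h x\<bar> = h x" for x using h0[of x] by simp
  have A0: "A \<ge> 0" unfolding A_def by (auto intro!: integral_nonneg_AE)
  have norm: "(Lp_norm p f)\<^sup>2 = A powr (2 / p)"
    unfolding Lp_norm_def tr(1) habs A_def[symmetric] power2_eq_square powr_add[symmetric] by simp
  have integrand: "HLS_integrand f x y = f x * f y * newton (x - y)" for x y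
    unfolding HLS_integrand_def newton_eq_power[OF d] by simp
  note HD = HLS_double_integral[OF d fm h h0 fh]
  define c where "c = newt_c TYPE(real^'n)"
  define C where "C = hls_sharp TYPE(real^'n)"
  have c: "c > 0" unfolding c_def by (rule newt_c_pos[OF d])
  \<comment> \<open>The normalization of the inverse Laplacian, d - 2 times the area of the unit
    sphere, is \<open>newt_c\<close>.\<close>
  have energy: "HLS_energy f = hls h h / c"
    unfolding HLS_energy_def integrand HD(2) surface_area_unit_sphere c_def newt_c_def by (simp add: mult.commute)
  \<comment> \<open>The factor \<open>newt_c\<close> contained in \<open>hls_k\<close> cancels and
    leaves 4 / (d (d - 2)); the product type has dimension d + 1, so its unit sphere has the area
    \<open>sph\<close>.\<close>
  have const: "HLS_const TYPE('n) = C / c"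
    unfolding HLS_const_def C_def hls_sharp_def hls_k_def sph_def surface_area_unit_sphere c_def[symmetric]
    using c by (simp add: add.commute)
  have F: "HLS_functional f = (C * A powr (2 / p) - hls h h) / c"
    unfolding HLS_functional_def p norm energy const by (simp add: diff_divide_distrib)
  have F0: "HLS_functional f = 0 \<longleftrightarrow> hls h h = C * A powr (2 / p)" unfolding F using c by auto
  have "hls h h \<le> C * A powr (2 / p)" unfolding C_def A_def p_def by (rule hls_le_sharp[OF d h h0])
  then have ge: "HLS_functional f \<ge> 0" unfolding F using c by simp
  have opt: "WW x = W * HLS_optimizer x" for x :: "real^'n" unfolding W_def D_def by (rule HLS_optimizer_WW)
  have "\<exists>c s. \<exists>x0 :: real^'n. s > 0 \<and> (AE x in lebesgue. f x = c * HLS_optimizer (x /\<^sub>R s - x0))"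
    if eq: "hls h h = C * A powr (2 / p)"
  proof (cases "A > 0")
    case True
    obtain c' s a where s: "s > 0" and e: "AE y in lborel. h y = c' * WW ((y - a) /\<^sub>R s)"
      by (rule hls_eq_sharp[OF d h h0 eq[unfolded C_def A_def p_def] True[unfolded A_def p_def]]) (rule that, assumption+)
    have "AE y in lborel. f y = (c' * W) * HLS_optimizer (y /\<^sub>R s - a /\<^sub>R s)"
      using e fh by eventually_elim (simp add: opt scaleR_diff_right)
    from AE_completion[OF this] s show ?thesis by blast
  next
    \<comment> \<open>Norm zero: f is the multiple 0 of the optimizer, with arbitrary scale and
      centre.\<close>
    case False
    then have "A = 0" using A0 by simp
    moreover have "integrable lborel (\<lambda>x. h x powr p)" using LhpD(2)[OF h] unfolding p_def[symmetric] habs .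
    ultimately have "AE x in lborel. h x powr p = 0"
      unfolding A_def by (subst (asm) integral_nonneg_eq_0_iff_AE) auto
    with fh have "AE x in lborel. f x = 0 * HLS_optimizer (x /\<^sub>R 1 - 0)"
      by eventually_elim simp
    from AE_completion[OF this] show ?thesis using zero_less_one by blast
  qed
  moreover have "hls h h = C * A powr (2 / p)"
    if s: "s > 0" and e: "AE x in lebesgue. f x = c' * HLS_optimizer (x /\<^sub>R s - x0)" for c' s and x0 :: "real^'n"
  proof -
    \<comment> \<open>The optimizer at x / s - x0 brought into the form of
      \<open>hls_optimizer\<close>, with shift -x0 and factor 1 / s; \<open>W\<close> accounts for
      the constant between the optimizer and \<open>WW\<close>.\<close>
    define g where "g = (\<lambda>x. (c' / W) * WW (- x0 + (1 / s) *\<^sub>R x))"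
    have s': "1 / s > 0" using s by simp
    note G = hls_optimizer[OF d s' g_def]
    have [measurable]: "g \<in> borel_measurable borel" using G(1) by (rule LhpD)
    have hg: "AE x in lborel. h x = g x"
      using e[unfolded AE_completion_iff] fh
    proof eventually_elim
      case (elim x)
      have eqv: "- x0 + (1 / s) *\<^sub>R x = x /\<^sub>R s - x0" by (simp add: inverse_eq_divide)
      show ?case using elim W unfolding g_def opt eqv by simp
    qed
    have "A = (\<integral>x. \<bar>g x\<bar> powr p \<partial>lborel)"
      unfolding A_def
    proof (rule integral_cong_AE)
      show "AE x in lborel. h x powr p = \<bar>g x\<bar> powr p"
        using hg
      proof eventually_elim
        case (elim x)
        then show ?case using h0[of x] by simp
      qed
    qed simp_all
    then show ?thesis using hls_cong_AE[OF d h G(1) hg] G(2) unfolding C_def p_def by simp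
  qed
  ultimately have "HLS_functional f = 0 \<longleftrightarrow>
      (\<exists>c s. \<exists>x0 :: real^'n. s > 0 \<and> (AE x in lebesgue. f x = c * HLS_optimizer (x /\<^sub>R s - x0)))"
    unfolding F0 by blast
  then show ?thesis using HD(1) ge unfolding integrand by blast
qed

end
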